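(* Let $d\ge2$, $e\in(0,\infty)$ and $T>0$. For each $(\boldsymbol\pi,\boldsymbol Q)\in\mathscr S_{e,T}$ $$H_e(\pi_0|M_e)+J_{e,T}(\boldsymbol\pi,\boldsymbol Q)=H_e(\pi_T|M_e)+J_{e,T}(\boldsymbol\pi,\boldsymbol Q\circ\Upsilon),\qquad( * )$$ in the sense that if either side is finite, then so is the other and equality holds. Moreover, if either side of $( * )$ is finite, then for all $t\in[0,T]$ the measure $\pi_t$ admits a density $f_t$, and $$\boldsymbol Q\Big(\Big|\log\frac{f'f_*'}{ff_*}\Big|\Big)<\infty.$$ Finally, in this case, for any $[r,s]\subset[0,T]$ the entropy satisfies the chain rule $$H_e(f_s\,dv|M_e)-H_e(f_r\,dv|M_e)=\boldsymbol Q\Big(1_{[r,s]}\log\frac{f'f_*'}{ff_*}\Big).$$ In particular, $t\mapsto H_e(\pi_t|M_e)$ is finite and continuous on $[0,T]$. Here $f,f_*,f',f_*'$ denote $f_t$ evaluated at $v,v_*,v',v_*'$.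
   Context: Fix an integer $d\ge2$ and $e\in(0,\infty)$. $d\omega$ is the Haar (rotation invariant) measure on the unit sphere $\mathbb S_{d-1}\subset\mathbb R^d$. The collision kernel is $B(v-v_*,\omega)=\frac12|(v-v_* )\cdot\omega|$. Given $v,v_*\in\mathbb R^d$, $\omega\in\mathbb S_{d-1}$, the post-collisional velocities are $v'=v+(\omega\cdot(v_*-v))\omega$, $v_*'=v_*-(\omega\cdot(v_*-v))\omega$. Write $\zeta_0(v)=|v|^2/2$, $\zeta(v)=v$. $\mathscr P_e$ is the set of probability measures $\pi$ on $\mathbb R^d$ with $\pi(\zeta_0)\le e$ and $\pi(\zeta)=0$, with the weak topology. $M_e$ is the Maxwellian (centred isotropic Gaussian) on $\mathbb R^d$ with $M_e(\zeta_0)=e$. For $\pi\in\mathscr P_e$ with density $f$, $H_e(\pi|M_e)=\int f\log f\,dv+\frac d2\big(\log\frac{4\pi e}{d}+1\big)$ (where the $\pi$ inside the logarithm is the number $3.14\ldots$), and $H_e(\pi|M_e)=+\infty$ if $\pi$ has no density; equivalently $H_e(\pi|M_e)=\mathrm{Ent}(\pi|M_e)+\frac d{2e}[e-\pi(\zeta_0)]$, with $\mathrm{Ent}$ the relative entropy. For $T>0$: $D([0,T];\mathscr P_e)$ is the Skorokhod space of càdlàg paths; $\mathscr M_T$ is the set of finite measures $\boldsymbol Q$ on $[0,T]\times\mathbb R^{2d}\times\mathbb R^{2d}$ with $\boldsymbol Q(dt;dv,dv_*,dv',dv_*')=\boldsymbol Q(dt;dv_*,dv,dv',dv_*')=\boldsymbol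 Q(dt;dv,dv_*,dv_*',dv')$. $\mathscr S_{e,T}$ is the set of pairs $(\boldsymbol\pi,\boldsymbol Q)\in D([0,T];\mathscr P_e)\times\mathscr M_T$ satisfying, for every $\phi\in C^1_b([0,T]\times\mathbb R^d)$, the balance equation $$\pi_T(\phi_T)-\pi_0(\phi_0)-\int_0^T dt\,\pi_t(\partial_t\phi_t)-\int\boldsymbol Q(dt;dv,dv_*,dv',dv_*')\,\bar\nabla\phi_t(v,v_*,v',v_*')=0,$$ where $\bar\nabla\phi(v,v_*,v',v_*')=\phi(v')+\phi(v_*')-\phi(v)-\phi(v_* )$. Let $r(v,v_*;\cdot)$ be the measure on $\mathbb R^{2d}$ which is the image of $B(v-v_*,\omega)\,d\omega$ under $\omega\mapsto(v',v_*')$, and set $\boldsymbol Q^{\boldsymbol\pi}(dt;dv,dv_*,dv',dv_*')=\frac12dt\,\pi_t(dv)\pi_t(dv_* )\,r(v,v_*;dv',dv_*')$. For $\boldsymbol\pi\in D([0,T];\mathscr P_e)$ and $\boldsymbol R\in\mathscr M_T$, $$J_{e,T}(\boldsymbol\pi,\boldsymbol R)=\int d\boldsymbol Q^{\boldsymbol\pi}\Big[\frac{d\boldsymbol R}{d\boldsymbol Q^{\boldsymbol\pi}}\log\frac{d\boldsymbol R}{d\boldsymbol Q^{\boldsymbol\pi}}-\Big(\frac{d\boldsymbol R}{d\boldsymbol Q^{\boldsymbol\pi}}-1\Big)\Big]$$ if $\boldsymbol\pi\in C([0,T];\mathscr P_e)$ and $\boldsymbol R\ll\boldsymbol Q^{\boldsymbol\pi}$,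 and $J_{e,T}(\boldsymbol\pi,\boldsymbol R)=+\infty$ otherwise; it is used both for $\boldsymbol R=\boldsymbol Q$ and $\boldsymbol R=\boldsymbol Q\circ\Upsilon$. $\Upsilon(v,v_*,v',v_*')=(v',v_*',v,v_* )$ is the involution exchanging incoming and outgoing velocities, and $\boldsymbol Q\circ\Upsilon$ is the image of $\boldsymbol Q$ under $\Upsilon$ acting on the velocity variables (time unchanged). For a function $G$, $\boldsymbol Q(G)$ denotes the integral of $G$ with respect to $\boldsymbol Q$. *)

theory Defs
  imports "HOL-Probability.Probability"
begin

text \<open>The rotation invariant measures on the unit sphere are unique up to a positive factor; no
  normalisation is imposed. They are regarded as Borel measures on the whole space that are
  carried by the sphere.\<close>

definition haar_sphere :: "(real^'n) measure \<Rightarrow> bool" where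
  "haar_sphere \<sigma> \<longleftrightarrow>
     sets \<sigma> = sets borel \<and> finite_measure \<sigma> \<and>
     emeasure \<sigma> (- sphere 0 1) = 0 \<and> emeasure \<sigma> (sphere 0 1) > 0 \<and>
     (\<forall>A. rotation_matrix A \<longrightarrow> distr \<sigma> borel ((*v) A) = \<sigma>)"

definition collision_kernel :: "real^'n \<Rightarrow> real^'n \<Rightarrow> real" where
  "collision_kernel u \<omega> = 1/2 * \<bar>u \<bullet> \<omega>\<bar>"

definition post_collision :: "real^'n \<Rightarrow> real^'n \<Rightarrow> real^'n \<Rightarrow> (real^'n) \<times> (real^'n)" where
  "post_collision v w \<omega> = (v + (\<omega> \<bullet> (w - v)) *\<^sub>R \<omega>, w - (\<omega> \<bullet> (w - v)) *\<^sub>R \<omega>)"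

definition scattering :: "(real^'n) measure \<Rightarrow> real^'n \<Rightarrow> real^'n \<Rightarrow> ((real^'n) \<times> (real^'n)) measure" where
  "scattering \<sigma> v w =
     distr (density \<sigma> (\<lambda>\<omega>. ennreal (collision_kernel (v - w) \<omega>))) borel (post_collision v w)"

text \<open>The second moment bound makes \<open>v\<close> integrable, so the barycentre condition is not met by
  default.\<close>

definition velocity_laws :: "real \<Rightarrow> (real^'n) measure set" where
  "velocity_laws e = {\<mu>. sets \<mu> = sets borel \<and> prob_space \<mu> \<and>
     (\<integral>\<^sup>+v. ennreal ((norm v)\<^sup>2 / 2) \<partial>\<mu>) \<le> ennreal e \<and> (\<integral>v. v \<partial>\<mu>) = 0}"

text \<open>The topology of weak convergence: the coarsest one on \<open>velocity_laws e\<close> for which all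
  integrals of bounded continuous functions are continuous.\<close>

definition weak_topology :: "real \<Rightarrow> (real^'n) measure topology" where
  "weak_topology e = topology_generated_by
     {{\<mu> \<in> velocity_laws e. (\<integral>v. \<phi> v \<partial>\<mu>) \<in> U} | (\<phi> :: real^'n \<Rightarrow> real) (U :: real set).
        continuous_on UNIV \<phi> \<and> bounded (range \<phi>) \<and> open U}"

text \<open>Only the values of a path on \<open>{0..T}\<close> are constrained.\<close>

definition cadlag_paths :: "real \<Rightarrow> real \<Rightarrow> (real \<Rightarrow> (real^'n) measure) set" where
  "cadlag_paths e T = {\<pi>.
     (\<forall>t\<in>{0..T}. \<pi> t \<in> velocity_laws e) \<and>
     (\<forall>t\<in>{0..<T}. limitin (weak_topology e) \<pi> (\<pi> t) (at_right t)) \<and>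
     (\<forall>t\<in>{0<..T}. \<exists>\<mu>. limitin (weak_topology e) \<pi> \<mu> (at_left t))}"

definition continuous_paths :: "real \<Rightarrow> real \<Rightarrow> (real \<Rightarrow> (real^'n) measure) set" where
  "continuous_paths e T = {\<pi>. continuous_map (top_of_set {0..T}) (weak_topology e) \<pi>}"

text \<open>A point \<open>(t, (v, w), (v', w'))\<close> records the collision time, the incoming and the outgoing
  velocities; \<open>w\<close> stands for the starred velocity.\<close>

type_synonym 'n collision =
  "real \<times> ((real^'n) \<times> (real^'n)) \<times> ((real^'n) \<times> (real^'n))"

definition collision_space :: "real \<Rightarrow> 'n::finite collision measure" where
  "collision_space T = restrict_space borel ({0..T} \<times> UNIV)"

definition flux_measures :: "real \<Rightarrow> 'n::finite collision measure set" where
  "flux_measures T = {Q. sets Q = sets (collision_space T) \<and> finite_measure Q \<and>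
     distr Q Q (\<lambda>(t, (v, w), z). (t, (w, v), z)) = Q \<and>
     distr Q Q (\<lambda>(t, x, (v', w')). (t, x, (w', v'))) = Q}"

text \<open>\<open>\<phi>\<close> is of class \<open>C\<^sup>1\<^sub>b\<close> on \<open>[0,T] \<times> \<real>\<^sup>d\<close> with space-time differential \<open>D\<close>.\<close>

definition C1b_with_derivative ::
  "real \<Rightarrow> (real \<times> (real^'n) \<Rightarrow> real) \<Rightarrow> (real \<times> (real^'n) \<Rightarrow> (real \<times> (real^'n)) \<Rightarrow>\<^sub>L real) \<Rightarrow> bool" where
  "C1b_with_derivative T \<phi> D \<longleftrightarrow>
     (\<forall>z\<in>{0..T} \<times> UNIV. (\<phi> has_derivative blinfun_apply (D z)) (at z within {0..T} \<times> UNIV)) \<and>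
     continuous_on ({0..T} \<times> UNIV) D \<and>
     bounded (\<phi> ` ({0..T} \<times> UNIV)) \<and> bounded (D ` ({0..T} \<times> UNIV))"

definition collision_gradient :: "(real^'n \<Rightarrow> real) \<Rightarrow> ((real^'n) \<times> (real^'n)) \<times> ((real^'n) \<times> (real^'n)) \<Rightarrow> real" where
  "collision_gradient \<phi> = (\<lambda>((v, w), (v', w')). \<phi> v' + \<phi> w' - \<phi> v - \<phi> w)"

text \<open>\<open>D (t, v) (1, 0)\<close> is the time derivative of \<open>\<phi>\<close>.\<close>

definition balance_pairs :: "real \<Rightarrow> real \<Rightarrow> ((real \<Rightarrow> (real^'n) measure) \<times> 'n collision measure) set" where
  "balance_pairs e T = {(\<pi>, Q). \<pi> \<in> cadlag_paths e T \<and> Q \<in> flux_measures T \<and>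
     (\<forall>\<phi> D. C1b_with_derivative T \<phi> D \<longrightarrow>
        (\<integral>v. \<phi> (T, v) \<partial>\<pi> T) - (\<integral>v. \<phi> (0, v) \<partial>\<pi> 0)
        - (LINT t:{0..T}|lborel. (\<integral>v. D (t, v) (1, 0) \<partial>\<pi> t))
        - (\<integral>(t, z). collision_gradient (\<lambda>v. \<phi> (t, v)) z \<partial>Q) = 0)}"

definition typical_flux ::
  "real \<Rightarrow> (real^'n) measure \<Rightarrow> (real \<Rightarrow> (real^'n) measure) \<Rightarrow> 'n collision measure" where
  "typical_flux T \<sigma> \<pi> = measure_of ({0..T} \<times> UNIV) (sets (collision_space T))
     (\<lambda>A. \<integral>\<^sup>+t\<in>{0..T}. (\<integral>\<^sup>+v. (\<integral>\<^sup>+w.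
        1/2 * emeasure (scattering \<sigma> v w) {z. (t, (v, w), z) \<in> A} \<partial>\<pi> t) \<partial>\<pi> t) \<partial>lborel)"

text \<open>\<open>measure_of\<close> would return a null measure if the set function above were not countably
  additive; for cadlag paths it is.\<close>

lemma right_continuous_measurable:
  fixes g :: "real \<Rightarrow> real"
  assumes lim: "\<And>t. t \<in> {0..<T} \<Longrightarrow> (g \<longlongrightarrow> g t) (at_right t)"
  shows "g \<in> borel_measurable (restrict_space borel {0..T})"
proof -
  define s where "s n t = min T ((of_int \<lfloor>real (Suc n) * t\<rfloor> + 1) / real (Suc n))" for n t
  have s_gt: "t < (of_int \<lfloor>real (Suc n) * t\<rfloor> + 1) / real (Suc n)" for n t
    using floor_correct[of "real (Suc n) * t"] by (simp add: pos_less_divide_eq mult.commute del: of_nat_Suc)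
  have s_le: "s n t \<le> t + 1 / real (Suc n)" for n t
  proof -
    have "(of_int \<lfloor>real (Suc n) * t\<rfloor> + 1) / real (Suc n) \<le> (real (Suc n) * t + 1) / real (Suc n)"
      by (intro divide_right_mono) auto
    also have "\<dots> = t + 1 / real (Suc n)" by (simp add: field_simps del: of_nat_Suc)
    finally show ?thesis unfolding s_def by linarith
  qed
  show ?thesis
  proof (rule borel_measurable_LIMSEQ_real[where u = "\<lambda>n t. g (s n t)"])
    fix t assume "t \<in> space (restrict_space borel {0..T})"
    then have t: "0 \<le> t" "t \<le> T" by (auto simp: space_restrict_space)
    show "(\<lambda>n. g (s n t)) \<longlonglongrightarrow> g t"
    proof (cases "t = T")
      case True
      have "s n t = T" for n using s_gt[of t n] True by (simp add: s_def)
      then show ?thesis using True by simp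
    next
      case False
      then have tT: "t < T" using t by simp
      have "s n t > t" for n using s_gt[of t n] tT by (simp add: s_def)
      moreover have "(\<lambda>n. s n t) \<longlonglongrightarrow> t"
      proof (rule tendsto_sandwich[where f = "\<lambda>_. t" and h = "\<lambda>n. t + 1 / real (Suc n)"])
        show "(\<lambda>n. t + 1 / real (Suc n)) \<longlonglongrightarrow> t"
          using tendsto_add[OF tendsto_const LIMSEQ_inverse_real_of_nat, of t]
          by (simp add: inverse_eq_divide)
      qed (use calculation s_le in \<open>auto intro!: always_eventually less_imp_le simp del: of_nat_Suc\<close>)
      ultimately have "filterlim (\<lambda>n. s n t) (at_right t) sequentially"
        by (auto simp: filterlim_at intro!: always_eventually dest: less_imp_neq[THEN not_sym])
      then show ?thesis using filterlim_compose[OF lim] t tT by auto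
    qed
  next
    fix n
    have "(\<lambda>t. g (min T ((of_int \<lfloor>real (Suc n) * t\<rfloor> + 1) / real (Suc n)))) \<in> borel_measurable borel"
      by (rule measurable_compose[where f = "\<lambda>t. \<lfloor>real (Suc n) * t\<rfloor>" and N = "count_space UNIV"
           and g = "\<lambda>k. g (min T ((of_int k + 1) / real (Suc n)))"]) auto
    then show "(\<lambda>t. g (s n t)) \<in> borel_measurable (restrict_space borel {0..T})"
      unfolding s_def by (rule measurable_restrict_space1)
  qed
qed

lemma limitin_weak:
  fixes \<phi> :: "real^'n \<Rightarrow> real"
  assumes "limitin (weak_topology e) p m F" "continuous_on UNIV \<phi>" "bounded (range \<phi>)"
  shows "((\<lambda>t. \<integral>v. \<phi> v \<partial>p t) \<longlongrightarrow> (\<integral>v. \<phi> v \<partial>m)) F"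
proof (rule topological_tendstoI)
  fix U :: "real set" assume U: "open U" "(\<integral>v. \<phi> v \<partial>m) \<in> U"
  have top: "topspace (weak_topology e :: (real^'n) measure topology) \<subseteq> velocity_laws e"
    unfolding weak_topology_def topology_generated_by_topspace by auto
  let ?V = "{\<mu> \<in> velocity_laws e. (\<integral>v. \<phi> v \<partial>\<mu>) \<in> U}"
  have "openin (weak_topology e) ?V"
    unfolding weak_topology_def using assms(2,3) U(1) by (intro topology_generated_by_Basis) blast
  moreover have "m \<in> ?V" using limitin_topspace[OF assms(1)] top U by auto
  ultimately have "eventually (\<lambda>t. p t \<in> ?V) F"
    using limitinD[OF assms(1)] by blast
  then show "eventually (\<lambda>t. (\<integral>v. \<phi> v \<partial>p t) \<in> U) F" by (rule eventually_mono) simp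
qed

lemma path_measurable:
  fixes p :: "real \<Rightarrow> (real^'n) measure"
  assumes p: "p \<in> cadlag_paths e T"
  shows "p \<in> restrict_space borel {0..T} \<rightarrow>\<^sub>M prob_algebra borel"
proof (rule measurable_prob_algebra_generated[where \<Omega> = UNIV and G = "Collect closed"])
  show "sets borel = sigma_sets UNIV (Collect closed :: (real^'n) set set)"
    by (simp add: borel_eq_closed)
  show "Int_stable (Collect closed :: (real^'n) set set)"
    by (auto simp: Int_stable_def)
next
  fix a assume "a \<in> space (restrict_space borel {0..T})"
  then have "p a \<in> velocity_laws e" using p by (auto simp: cadlag_paths_def space_restrict_space)
  then show "prob_space (p a)" "sets (p a) = sets borel" by (auto simp: velocity_laws_def)
next
  fix C :: "(real^'n) set" assume "C \<in> Collect closed"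
  then have C: "closed C" by simp
  show "(\<lambda>a. emeasure (p a) C) \<in> borel_measurable (restrict_space borel {0..T})"
  proof (cases "C = {}")
    case False
    define \<phi> where "\<phi> k v = max 0 (1 - real k * infdist v C)" for k v
    have cont: "continuous_on UNIV (\<phi> k)" for k
      unfolding \<phi>_def by (intro continuous_intros)
    have bd: "\<bar>\<phi> k v\<bar> \<le> 1" for k v
      unfolding \<phi>_def by (auto simp: infdist_nonneg)
    have bdd: "bounded (range (\<phi> k))" for k
      using bd by (auto simp: bounded_iff)
    have m: "(\<lambda>t. \<integral>v. \<phi> k v \<partial>p t) \<in> borel_measurable (restrict_space borel {0..T})" for k
      by (rule right_continuous_measurable)
         (use p cont bdd in \<open>auto simp: cadlag_paths_def intro!: limitin_weak\<close>)
    have lim: "(\<lambda>k. \<phi> k v) \<longlonglongrightarrow> indicator C v" for v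
    proof (cases "v \<in> C")
      case True then show ?thesis by (simp add: \<phi>_def)
    next
      case vC: False
      then have pos: "infdist v C > 0"
        using C False by (metis in_closed_iff_infdist_zero infdist_nonneg less_eq_real_def)
      obtain N where N: "real N * infdist v C > 1"
        using reals_Archimedean3[OF pos] by auto
      have "eventually (\<lambda>k. \<phi> k v = 0) sequentially"
      proof (rule eventually_sequentiallyI[of N])
        fix k assume "N \<le> k"
        then have "real N * infdist v C \<le> real k * infdist v C" using pos by (intro mult_right_mono) auto
        then show "\<phi> k v = 0" using N by (simp add: \<phi>_def)
      qed
      then show ?thesis using vC by (simp add: tendsto_eventually)
    qed
    have "(\<lambda>t. measure (p t) C) \<in> borel_measurable (restrict_space borel {0..T})"
    proof (rule borel_measurable_LIMSEQ_real[OF _ m])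
      fix t assume "t \<in> space (restrict_space borel {0..T})"
      then have pt: "sets (p t) = sets borel" "prob_space (p t)"
        using p by (auto simp: cadlag_paths_def space_restrict_space velocity_laws_def)
      interpret prob_space "p t" by fact
      have meas: "\<phi> k \<in> borel_measurable (p t)" for k
        using borel_measurable_continuous_onI[OF cont] by (simp add: measurable_cong_sets[OF pt(1) refl])
      have "(\<lambda>k. \<integral>v. \<phi> k v \<partial>p t) \<longlonglongrightarrow> (\<integral>v. indicator C v \<partial>p t)"
        by (rule integral_dominated_convergence[where w = "\<lambda>_. 1"])
           (use C pt(1) meas lim bd in \<open>auto intro!: borel_measurable_indicator\<close>)
      then show "(\<lambda>k. \<integral>v. \<phi> k v \<partial>p t) \<longlonglongrightarrow> measure (p t) C"
        using C pt(1) sets.sets_into_space[of C "p t"] by (simp add: Int_absorb2 sets_eq_imp_space_eq)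
    qed
    then have "(\<lambda>t. ennreal (measure (p t) C)) \<in> borel_measurable (restrict_space borel {0..T})"
      by simp
    moreover have "emeasure (p t) C = ennreal (measure (p t) C)"
      if "t \<in> space (restrict_space borel {0..T})" for t
    proof -
      interpret prob_space "p t"
        using that p by (auto simp: cadlag_paths_def space_restrict_space velocity_laws_def)
      show ?thesis by (rule emeasure_eq_measure)
    qed
    ultimately show ?thesis by (subst measurable_cong) 
  qed simp
qed auto

lemma emeasure_typical_flux:
  fixes \<pi> :: "real \<Rightarrow> (real^'n) measure"
  assumes \<sigma>: "haar_sphere \<sigma>" and p: "\<pi> \<in> cadlag_paths e T" and A: "A \<in> sets (collision_space T)"
  shows "emeasure (typical_flux T \<sigma> \<pi>) A = (\<integral>\<^sup>+t\<in>{0..T}. (\<integral>\<^sup>+v. (\<integral>\<^sup>+w.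
        1/2 * emeasure (scattering \<sigma> v w) {z. (t, (v, w), z) \<in> A} \<partial>\<pi> t) \<partial>\<pi> t) \<partial>lborel)"
    (is "_ = ?F A")
proof -
  have s\<sigma>[measurable_cong]: "sets \<sigma> = sets borel" using \<sigma> by (simp add: haar_sphere_def)
  interpret \<sigma>: finite_measure \<sigma> using \<sigma> by (simp add: haar_sphere_def)
  have Abor: "A \<in> sets borel" if "A \<in> sets (collision_space T :: 'n collision measure)" for A
  proof -
    have "({0..T} \<times> UNIV :: 'n collision set) \<in> sets borel"
      by (intro borel_closed closed_Times) auto
    then show ?thesis using that by (simp add: collision_space_def sets_restrict_space_iff)
  qed
  have post2: "(\<lambda>(x, \<omega>). post_collision (fst x) (snd x) \<omega>) \<in> borel_measurable borel"
    unfolding post_collision_def split_beta by (intro borel_measurable_continuous_onI continuous_intros)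
  have post[measurable]: "post_collision v w \<in> borel_measurable borel" for v w :: "real^'n"
    unfolding post_collision_def by (intro borel_measurable_continuous_onI continuous_intros)
  have ck[measurable]: "(\<lambda>\<omega>. ennreal (collision_kernel u \<omega>)) \<in> borel_measurable borel" for u :: "real^'n"
    unfolding collision_kernel_def by measurable
  define g :: "'n collision set \<Rightarrow> real \<Rightarrow> real^'n \<Rightarrow> real^'n \<Rightarrow> ennreal" where "g A t v w = (\<integral>\<^sup>+\<omega>. ennreal (collision_kernel (v - w) \<omega>)
      * indicator A (t, (v, w), post_collision v w \<omega>) \<partial>\<sigma>)" for A t v w
  have slice: "{z. (t, (v, w), z) \<in> A} \<in> sets borel" if "A \<in> sets borel"
    for A :: "'n collision set" and t v w
  proof -
    have "(\<lambda>z. (t, (v, w), z)) \<in> borel_measurable borel"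
      by (intro borel_measurable_continuous_onI continuous_intros)
    from measurable_sets[OF this that] show ?thesis by (simp add: vimage_def)
  qed
  have g: "emeasure (scattering \<sigma> v w) {z. (t, (v, w), z) \<in> A} = g A t v w"
    if "A \<in> sets borel" for A t v w
    using slice[OF that, of t v w] measurable_sets[OF post slice[OF that, of t v w], of v w]
    unfolding scattering_def g_def
    by (subst emeasure_distr)
       (auto simp: emeasure_density sets_eq_imp_space_eq[OF s\<sigma>] measurable_cong_sets[OF s\<sigma> refl] s\<sigma>
             intro!: nn_integral_cong split: split_indicator)
  have gm: "(\<lambda>((t, v), w). g A t v w) \<in> borel_measurable ((borel \<Otimes>\<^sub>M borel) \<Otimes>\<^sub>M borel)"
    if A[measurable]: "A \<in> sets borel" for A
  proof -
    have c1: "(\<lambda>(((t, v), w), \<omega>). (t, (v, w), post_collision v w \<omega>)) \<in> 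
       borel_measurable (borel :: (((real \<times> (real^'n)) \<times> (real^'n)) \<times> (real^'n)) measure)"
      unfolding post_collision_def split_beta by (intro borel_measurable_continuous_onI continuous_intros)
    have c2: "(\<lambda>(((t, v), w), \<omega>). collision_kernel (v - w) \<omega>) \<in> 
       borel_measurable (borel :: (((real \<times> (real^'n)) \<times> (real^'n)) \<times> (real^'n)) measure)"
      unfolding collision_kernel_def split_beta by (intro borel_measurable_continuous_onI continuous_intros)
    have "(\<lambda>x. case x of (((t, v), w), \<omega>) \<Rightarrow> ennreal (collision_kernel (v - w) \<omega>)
        * indicator A (t, (v, w), post_collision v w \<omega>)) \<in>
       borel_measurable (borel :: (((real \<times> (real^'n)) \<times> (real^'n)) \<times> (real^'n)) measure)"
      using c2 measurable_compose[OF c1 borel_measurable_indicator[OF A]]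
      unfolding split_beta by (intro borel_measurable_times_ennreal measurable_compose[OF _ measurable_ennreal]) auto
    then have "(\<lambda>(x, \<omega>). case x of ((t, v), w) \<Rightarrow> ennreal (collision_kernel (v - w) \<omega>)
        * indicator A (t, (v, w), post_collision v w \<omega>)) \<in>
       borel_measurable (((borel \<Otimes>\<^sub>M borel) \<Otimes>\<^sub>M borel) \<Otimes>\<^sub>M \<sigma>)"
      by (simp add: borel_prod split_beta measurable_cong_sets[OF sets_pair_measure_cong[OF refl s\<sigma>] refl])
    from \<sigma>.borel_measurable_nn_integral_fst[OF this] show ?thesis
      unfolding g_def by (simp add: split_beta')
  qed
  note pm = measurable_prob_algebraD[OF path_measurable[OF p]]
  have G1: "(\<lambda>(t, v). \<integral>\<^sup>+w. 1/2 * g A t v w \<partial>\<pi> t) \<in>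
      borel_measurable (restrict_space borel {0..T} \<Otimes>\<^sub>M borel)" if A: "A \<in> sets borel" for A
  proof -
    have id: "(\<lambda>x. x) \<in> restrict_space borel {0..T} \<rightarrow>\<^sub>M (borel :: real measure)"
      by (intro measurable_restrict_space1) simp
    have 1: "(\<lambda>(x, w). 1/2 * g A (fst x) (snd x) w) \<in>
      borel_measurable ((restrict_space borel {0..T} \<Otimes>\<^sub>M borel) \<Otimes>\<^sub>M borel)"
    proof -
      have "(\<lambda>y. ((fst (fst y), snd (fst y)), snd y)) \<in>
        (restrict_space borel {0..T} \<Otimes>\<^sub>M borel) \<Otimes>\<^sub>M borel \<rightarrow>\<^sub>M
          ((borel :: real measure) \<Otimes>\<^sub>M (borel :: (real^'n) measure)) \<Otimes>\<^sub>M (borel :: (real^'n) measure)"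
        by (intro measurable_Pair measurable_compose[OF measurable_compose[OF measurable_fst measurable_fst] id])
           measurable
      from measurable_compose[OF this gm[OF A]] show ?thesis
        by (simp add: split_beta)
    qed
    have 2: "(\<lambda>x. \<pi> (fst x)) \<in> restrict_space borel {0..T} \<Otimes>\<^sub>M (borel :: (real^'n) measure)
        \<rightarrow>\<^sub>M subprob_algebra borel"
      by (rule measurable_compose[OF measurable_fst pm])
    from nn_integral_measurable_subprob_algebra2[OF 1 2] show ?thesis by (simp add: split_beta)
  qed
  have G2: "(\<lambda>t. \<integral>\<^sup>+v. (\<integral>\<^sup>+w. 1/2 * g A t v w \<partial>\<pi> t) \<partial>\<pi> t) \<in>
      borel_measurable (restrict_space borel {0..T})" if A: "A \<in> sets borel" for A
    by (rule nn_integral_measurable_subprob_algebra2[OF G1[OF A] pm])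
  have G3: "(\<lambda>t. (\<integral>\<^sup>+v. (\<integral>\<^sup>+w. 1/2 * g A t v w \<partial>\<pi> t) \<partial>\<pi> t) * indicator {0..T} t) \<in>
      borel_measurable lborel" if A: "A \<in> sets borel" for A
    using G2[OF A] by (subst (asm) borel_measurable_restrict_space_iff_ennreal) auto
  let ?G = "\<lambda>A. \<integral>\<^sup>+t\<in>{0..T}. (\<integral>\<^sup>+v. (\<integral>\<^sup>+w. 1/2 * g A t v w \<partial>\<pi> t) \<partial>\<pi> t) \<partial>lborel"
  have FG: "?F A = ?G A" if "A \<in> sets (collision_space T)" for A
    using g[OF Abor[OF that]] by simp
  have space: "space (collision_space T :: 'n collision measure) = {0..T} \<times> UNIV"
    by (simp add: collision_space_def space_restrict_space)
  have sal: "sigma_algebra ({0..T} \<times> UNIV) (sets (collision_space T :: 'n collision measure))"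
    using sets.sigma_algebra_axioms[of "collision_space T :: 'n collision measure"] by (simp add: space)
  have pos: "positive (sets (collision_space T :: 'n collision measure)) ?F"
    by (simp add: positive_def)
  have ca: "countably_additive (sets (collision_space T :: 'n collision measure)) ?F"
  proof (rule countably_additiveI)
    fix B :: "nat \<Rightarrow> 'n collision set"
    assume B: "range B \<subseteq> sets (collision_space T)" and dj: "disjoint_family B"
      and UB: "(\<Union>i. B i) \<in> sets (collision_space T)"
    have Bi: "B i \<in> sets (collision_space T)" for i using B by auto
    note Bb = Abor[OF Bi]
    have gs: "(\<Sum>i. g (B i) t v w) = g (\<Union>i. B i) t v w" for t v w
    proof -
      have "range (\<lambda>i. {z. (t, (v, w), z) \<in> B i}) \<subseteq> sets (scattering \<sigma> v w)"
        using slice[OF Bb] by (auto simp: scattering_def)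
      moreover have "disjoint_family (\<lambda>i. {z. (t, (v, w), z) \<in> B i})"
        using dj by (auto simp: disjoint_family_on_def)
      ultimately have "(\<Sum>i. emeasure (scattering \<sigma> v w) {z. (t, (v, w), z) \<in> B i})
          = emeasure (scattering \<sigma> v w) (\<Union>i. {z. (t, (v, w), z) \<in> B i})"
        by (rule suminf_emeasure)
      also have "(\<Union>i. {z. (t, (v, w), z) \<in> B i}) = {z. (t, (v, w), z) \<in> (\<Union>i. B i)}" by auto
      finally show ?thesis using g[OF Bb] g[OF Abor[OF UB]] by simp
    qed
    have "(\<Sum>i. ?G (B i)) = (\<integral>\<^sup>+t. (\<Sum>i. (\<integral>\<^sup>+v. (\<integral>\<^sup>+w. 1/2 * g (B i) t v w \<partial>\<pi> t) \<partial>\<pi> t)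
        * indicator {0..T} t) \<partial>lborel)"
      by (rule nn_integral_suminf[symmetric, OF G3[OF Bb]])
    also have "\<dots> = ?G (\<Union>i. B i)"
    proof (rule nn_integral_cong)
      fix t :: real
      show "(\<Sum>i. (\<integral>\<^sup>+v. (\<integral>\<^sup>+w. 1/2 * g (B i) t v w \<partial>\<pi> t) \<partial>\<pi> t) * indicator {0..T} t)
        = (\<integral>\<^sup>+v. (\<integral>\<^sup>+w. 1/2 * g (\<Union>i. B i) t v w \<partial>\<pi> t) \<partial>\<pi> t) * indicator {0..T} t"
      proof (cases "t \<in> {0..T}")
        case True
        then have pt[measurable_cong]: "sets (\<pi> t) = sets borel"
          using p by (auto simp: cadlag_paths_def velocity_laws_def)
        have m1: "(\<lambda>w. 1/2 * g (B i) t v w) \<in> borel_measurable (\<pi> t)" for i v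
        proof -
          have "(\<lambda>w. ((t, v), w)) \<in> \<pi> t \<rightarrow>\<^sub>M (borel \<Otimes>\<^sub>M borel) \<Otimes>\<^sub>M borel" by measurable
          from measurable_compose[OF this gm[OF Bb[of i]]] show ?thesis by simp
        qed
        have m2: "(\<lambda>v. \<integral>\<^sup>+w. 1/2 * g (B i) t v w \<partial>\<pi> t) \<in> borel_measurable (\<pi> t)" for i
        proof -
          have "(\<lambda>v. (t, v)) \<in> \<pi> t \<rightarrow>\<^sub>M restrict_space borel {0..T} \<Otimes>\<^sub>M borel"
            using True by (auto simp: space_restrict_space intro!: measurable_Pair)
          from measurable_compose[OF this G1[OF Bb[of i]]] show ?thesis by simp
        qed
        have "(\<Sum>i. \<integral>\<^sup>+v. (\<integral>\<^sup>+w. 1/2 * g (B i) t v w \<partial>\<pi> t) \<partial>\<pi> t)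
            = (\<integral>\<^sup>+v. (\<integral>\<^sup>+w. (\<Sum>i. 1/2 * g (B i) t v w) \<partial>\<pi> t) \<partial>\<pi> t)"
          using m1 m2 by (simp add: nn_integral_suminf[symmetric])
        then show ?thesis using True by (simp only: ennreal_suminf_cmult gs) simp
      qed simp
    qed
    finally show "(\<Sum>i. ?F (B i)) = ?F (\<Union>i. B i)"
      using FG[OF Bi] FG[OF UB] by simp
  qed
  show ?thesis
    unfolding typical_flux_def by (rule emeasure_measure_of_sigma[OF sal pos ca A])
qed

text \<open>The integrand is non-negative and, as \<open>ln 0 = 0\<close>, has the value \<open>1\<close> where the density
  vanishes.\<close>

definition action ::
  "real \<Rightarrow> real \<Rightarrow> (real^'n) measure \<Rightarrow> (real \<Rightarrow> (real^'n) measure) \<Rightarrow> 'n collision measure \<Rightarrow> ereal" where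
  "action e T \<sigma> \<pi> R =
     (if \<pi> \<in> continuous_paths e T \<and> absolutely_continuous (typical_flux T \<sigma> \<pi>) R
      then enn2ereal (\<integral>\<^sup>+z. (let h = enn2real (RN_deriv (typical_flux T \<sigma> \<pi>) R z)
                        in ennreal (h * ln h - (h - 1))) \<partial>typical_flux T \<sigma> \<pi>)
      else \<infinity>)"

text \<open>For laws of finite second moment the negative part of \<open>f ln f\<close> is integrable, so the
  difference below is not of the form \<open>\<infinity> - \<infinity>\<close>.\<close>

definition entropy_rel :: "real \<Rightarrow> (real^'n) measure \<Rightarrow> ereal" where
  "entropy_rel e \<mu> =
     (if \<exists>g\<in>borel_measurable lborel. density lborel g = \<mu>
      then let f = (\<lambda>v. enn2real (RN_deriv lborel \<mu> v)); d = real CARD('n)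
           in enn2ereal (\<integral>\<^sup>+v. ennreal (f v * ln (f v)) \<partial>lborel)
              - enn2ereal (\<integral>\<^sup>+v. ennreal (- (f v * ln (f v))) \<partial>lborel)
              + ereal (d / 2 * (ln (4 * pi * e / d) + 1))
      else \<infinity>)"

definition time_reversal :: "'n::finite collision measure \<Rightarrow> 'n collision measure" where
  "time_reversal Q = distr Q Q (\<lambda>(t, x, y). (t, y, x))"

text \<open>The densities are chosen jointly measurable in time and velocity, so that they can be
  integrated against measures on \<open>collision_space T\<close>.\<close>

definition densities_of_path ::
  "real \<Rightarrow> (real \<Rightarrow> (real^'n) measure) \<Rightarrow> (real \<Rightarrow> real^'n \<Rightarrow> real) \<Rightarrow> bool" where
  "densities_of_path T \<pi> f \<longleftrightarrow>
     (\<lambda>(t, v). f t v) \<in> borel_measurable (restrict_space borel ({0..T} \<times> UNIV)) \<and>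
     (\<forall>t\<in>{0..T}. (\<forall>v. 0 \<le> f t v) \<and> \<pi> t = density lborel (\<lambda>v. ennreal (f t v)))"

text \<open>The value of \<open>ln (f' f'\<^sub>* / (f f\<^sub>*))\<close> is \<open>ln 0 = 0\<close> instead of infinite where one of the
  products vanishes. Finiteness of the integral of its modulus, with the extended logarithm, thus
  means that both products are almost everywhere positive and the function below is integrable.\<close>

definition log_ratio :: "(real \<Rightarrow> real^'n \<Rightarrow> real) \<Rightarrow> 'n collision \<Rightarrow> real" where
  "log_ratio f = (\<lambda>(t, (v, w), (v', w')). ln (f t v' * f t w' / (f t v * f t w)))"

definition log_ratio_integrable :: "(real \<Rightarrow> real^'n \<Rightarrow> real) \<Rightarrow> 'n collision measure \<Rightarrow> bool" where
  "log_ratio_integrable f Q \<longleftrightarrow>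
     (AE (t, (v, w), (v', w')) in Q. 0 < f t v * f t w \<and> 0 < f t v' * f t w') \<and>
     integrable Q (log_ratio f)"

end

theory Submission
  imports Defs "HOL-Real_Asymp.Real_Asymp"
begin

text \<open>Mollify \<open>\<pi>\<^sub>t\<close> by a Gaussian and mix it with a fixed weight. For the resulting positive densities \<open>\<kappa>\<close>,
  convexity of \<open>x ln x\<close> bounds the increment of the entropy by the integral of the flux against the
  mollified collision gradient of \<open>ln \<kappa>\<close>. For a fixed direction \<open>\<omega>\<close> a collision is an isometric
  involution of the pairs of velocities, so it commutes with Gaussian convolution, and the mollified
  flux \<open>q\<close> may be paired with \<open>ln (\<kappa>' \<kappa>'\<^sub>* / (\<kappa> \<kappa>\<^sub>*))\<close>. By Legendre duality, the sum of this pairing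
  with the negative sign, of a convex functional of \<open>q\<close> and of the gain \<open>\<kappa>' \<kappa>'\<^sub>*\<close> is the integral of a
  nonnegative function. Fatou's lemma then shows that \<open>ln (f' f'\<^sub>* / (f f\<^sub>*))\<close> is integrable for the flux
  and that its integral is at least the increment of the entropy.

  The path run backwards in time has as flux the image of the given flux under the exchange of
  incoming and outgoing velocities; the same inequality for it gives the chain rule. The density of the
  exchanged flux is \<open>h(v', v'\<^sub>*, v, v\<^sub>*) f' f'\<^sub>* / (f f\<^sub>*)\<close>, so the two actions differ by the
  integral of \<open>ln (f' f'\<^sub>* / (f f\<^sub>*))\<close>.\<close>

section \<open>Gaussian kernels and mollification\<close>

text \<open>The flux is known only through the finite entropic cost of its density \<open>h\<close>,
  so by Young's inequality it can be paired only with functions whose exponential is integrable for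
  the typical flux. With second moments at hand these are logarithms of functions of moderate
  growth. Hence the mixing weight decays polynomially: a Gaussian weight would make the logarithm
  quadratic. The unbounded collision rate is the second obstacle. Comparing \<open>h\<close> with 1
  / (1 + rate) instead of 1 leaves a gain term without the rate, and its mass is known exactly,
  uniformly in the mollification. The entropy is measured relative to the weight, so that its
  integrand is nonnegative as well; Fatou's lemma then acts on the final entropy and on the Legendre
  integrand together, and the constants in the limit cancel. The limit needs densities at all times,
  so absolute continuity is derived beforehand from a cruder entropy bound that is uniform in the
  mollification. The limit also has to cover points where the incoming pair density vanishes; there
  the Legendre inequality is used at half the logarithm.\<close>

lemma nn_integral_lborel_shift:
  fixes f :: "'a::euclidean_space \<Rightarrow> ennreal"
  assumes [measurable]: "f \<in> borel_measurable borel"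
  shows "(\<integral>\<^sup>+x. f (a + x) \<partial>lborel) = (\<integral>\<^sup>+x. f x \<partial>lborel)"
  by (subst (2) lborel_distr_plus[of a, symmetric]) (simp add: nn_integral_distr)

lemma nn_integral_lborel_reflect:
  fixes f :: "'a::euclidean_space \<Rightarrow> ennreal"
  assumes [measurable]: "f \<in> borel_measurable borel"
  shows "(\<integral>\<^sup>+x. f (a - x) \<partial>lborel) = (\<integral>\<^sup>+x. f x \<partial>lborel)"
  by (subst (2) lborel_affine[of "-1" a]) (simp_all add: nn_integral_density nn_integral_distr)

text \<open>Translation invariance and Fubini suffice. The unit ball is invariant under
  \<open>T\<close>; multiplying by its volume \<open>c\<close> and smearing with its indicator
  \<open>b\<close> moves the map \<open>T\<close> from \<open>f\<close> to \<open>b\<close>, which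
  does not see it.\<close>

lemma nn_integral_lborel_isometric_involution:
  fixes T :: "'a::euclidean_space \<Rightarrow> 'a"
  assumes lin: "linear T" and iso: "\<And>x. norm (T x) = norm x" and inv: "\<And>x. T (T x) = x"
    and f [measurable]: "f \<in> borel_measurable borel"
  shows "(\<integral>\<^sup>+x. f (T x) \<partial>lborel) = (\<integral>\<^sup>+x. f x \<partial>lborel)"
proof -
  have T[measurable]: "T \<in> borel_measurable borel"
    using lin by (intro borel_measurable_continuous_onI linear_continuous_on linear_conv_bounded_linear[THEN iffD1])
  define b where "b = (indicator (ball 0 1) :: 'a \<Rightarrow> ennreal)"
  define c where "c = emeasure lborel (ball (0::'a) 1)"
  have b[measurable]: "b \<in> borel_measurable borel" unfolding b_def by (intro borel_measurable_indicator) auto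
  have bT: "b (T x) = b x" for x using iso by (simp add: b_def indicator_def)
  have c: "c \<noteq> 0" "c \<noteq> \<infinity>"
    using emeasure_lborel_ball_finite[of "0::'a" 1] content_ball_pos[of 1 "0::'a"]
    by (auto simp: c_def measure_def)
  have cb: "(\<integral>\<^sup>+x. b x \<partial>lborel) = c" by (simp add: b_def c_def)
  have "c * (\<integral>\<^sup>+x. f (T x) \<partial>lborel) = (\<integral>\<^sup>+y. b y * (\<integral>\<^sup>+x. f (T x) \<partial>lborel) \<partial>lborel)"
    by (simp add: cb nn_integral_multc)
  also have "\<dots> = (\<integral>\<^sup>+y. b y * (\<integral>\<^sup>+x. f (T x + y) \<partial>lborel) \<partial>lborel)"
  proof (rule nn_integral_cong)
    fix y
    have "(\<integral>\<^sup>+x. f (T x) \<partial>lborel) = (\<integral>\<^sup>+x. f (T (T y + x)) \<partial>lborel)"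
      by (rule nn_integral_lborel_shift[symmetric]) measurable
    also have "\<dots> = (\<integral>\<^sup>+x. f (T x + y) \<partial>lborel)"
      by (simp add: linear_add[OF lin] inv add.commute)
    finally show "b y * (\<integral>\<^sup>+x. f (T x) \<partial>lborel) = b y * (\<integral>\<^sup>+x. f (T x + y) \<partial>lborel)" by simp
  qed
  also have "\<dots> = (\<integral>\<^sup>+y. (\<integral>\<^sup>+x. b y * f (T x + y) \<partial>lborel) \<partial>lborel)"
    by (simp add: nn_integral_cmult)
  also have "\<dots> = (\<integral>\<^sup>+x. (\<integral>\<^sup>+y. b y * f (T x + y) \<partial>lborel) \<partial>lborel)"
    by (rule lborel_pair.Fubini') measurable
  also have "\<dots> = (\<integral>\<^sup>+x. (\<integral>\<^sup>+y. b (y - T x) * f y \<partial>lborel) \<partial>lborel)"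
  proof (rule nn_integral_cong)
    fix x
    have "(\<integral>\<^sup>+y. b y * f (T x + y) \<partial>lborel) = (\<integral>\<^sup>+y. b ((T x + y) - T x) * f (T x + y) \<partial>lborel)" by simp
    also have "\<dots> = (\<integral>\<^sup>+y. b (y - T x) * f y \<partial>lborel)"
      by (rule nn_integral_lborel_shift) measurable
    finally show "(\<integral>\<^sup>+y. b y * f (T x + y) \<partial>lborel) = (\<integral>\<^sup>+y. b (y - T x) * f y \<partial>lborel)" .
  qed
  also have "\<dots> = (\<integral>\<^sup>+y. (\<integral>\<^sup>+x. b (y - T x) * f y \<partial>lborel) \<partial>lborel)"
    by (rule lborel_pair.Fubini') measurable
  also have "\<dots> = (\<integral>\<^sup>+y. c * f y \<partial>lborel)"
  \<comment> \<open>As \<open>b\<close> is invariant and \<open>T\<close> is a linear involution,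
    b(y - T x) = b(T y - x), which a reflection integrates to \<open>c\<close> for every y.\<close>
  proof (rule nn_integral_cong)
    fix y
    have "(\<integral>\<^sup>+x. b (y - T x) * f y \<partial>lborel) = (\<integral>\<^sup>+x. b (T y - x) \<partial>lborel) * f y"
      by (subst nn_integral_multc[symmetric])
         (auto intro!: nn_integral_cong simp: bT[of "y - T _", symmetric] linear_diff[OF lin] inv)
    also have "(\<integral>\<^sup>+x. b (T y - x) \<partial>lborel) = c"
      by (simp add: nn_integral_lborel_reflect cb)
    finally show "(\<integral>\<^sup>+x. b (y - T x) * f y \<partial>lborel) = c * f y" .
  qed
  also have "\<dots> = c * (\<integral>\<^sup>+y. f y \<partial>lborel)" by (simp add: nn_integral_cmult)
  finally show ?thesis using c ennreal_mult_cancel_left by auto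
qed

section \<open>Gaussian densities and their first moment\<close>

definition gauss :: "real \<Rightarrow> 'a::euclidean_space \<Rightarrow> real" where
  "gauss s x = (1 / sqrt (2 * pi * s\<^sup>2)) ^ DIM('a) * exp (- (norm x)\<^sup>2 / (2 * s\<^sup>2))"

lemma gauss_measurable [measurable]: "gauss s \<in> borel_measurable borel"
  unfolding gauss_def by measurable

lemma gauss_continuous: "s > 0 \<Longrightarrow> continuous_on A (gauss s)"
  unfolding gauss_def by (intro continuous_intros) (auto simp: power2_eq_square)

lemma gauss_pos: "s > 0 \<Longrightarrow> gauss s x > 0"
  by (simp add: gauss_def)

lemma gauss_nonneg: "gauss s x \<ge> 0"
  by (simp add: gauss_def)

lemma gauss_commute: "gauss s (x - y) = gauss s (y - x)"
  by (simp add: gauss_def norm_minus_commute)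

lemma gauss_le: "gauss s (x::'a::euclidean_space) \<le> gauss s (0::'a)"
  by (auto simp: gauss_def intro!: mult_left_le)

text \<open>On pairs of velocities the kernel factors, so mollifying a product law gives the product
  of the mollified laws.\<close>

lemma gauss_Pair: "gauss s (x, y) = gauss s x * gauss s y"
proof -
  have "exp (- ((norm x)\<^sup>2 + (norm y)\<^sup>2) / c) = exp (- (norm x)\<^sup>2 / c) * exp (- (norm y)\<^sup>2 / c)" for c
    by (simp add: exp_add[symmetric] diff_divide_distrib)
  then show ?thesis by (simp add: gauss_def norm_prod_def power_add)
qed

lemma gauss_cong_norm: "norm (x::'a::euclidean_space) = norm (y::'a) \<Longrightarrow> gauss s x = gauss s y"
  by (simp add: gauss_def)

lemma nn_integral_gauss:
  assumes "s > 0" shows "(\<integral>\<^sup>+(x::'a::euclidean_space). gauss s x \<partial>lborel) = 1"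
proof -
  have "(\<integral>\<^sup>+(x::'a). gauss s x \<partial>lborel) = (\<integral>\<^sup>+(x::'a). (\<Prod>b\<in>Basis. ennreal (normal_density 0 s (x \<bullet> b))) \<partial>lborel)"
  proof (rule nn_integral_cong)
    fix x :: 'a
    have "(norm x)\<^sup>2 = (\<Sum>b\<in>Basis. (x \<bullet> b)\<^sup>2)"
      by (simp add: norm_eq_sqrt_inner euclidean_inner[of x x] power2_eq_square[symmetric] sum_nonneg)
    then have "gauss s x = (\<Prod>b\<in>Basis. normal_density 0 s (x \<bullet> b))"
      by (simp add: gauss_def normal_density_def prod_dividef exp_sum[OF finite_Basis, symmetric] sum_negf
          sum_divide_distrib power_divide)
    then show "ennreal (gauss s x) = (\<Prod>b\<in>Basis. ennreal (normal_density 0 s (x \<bullet> b)))"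
      by (simp add: prod_ennreal)
  qed
  also have "\<dots> = (\<Prod>b\<in>(Basis::'a set). (\<integral>\<^sup>+x. normal_density 0 s x \<partial>lborel))"
    by (rule nn_integral_lborel_prod) auto
  also have "\<dots> = 1"
    using assms by (simp add: nn_integral_eq_integral)
  finally show ?thesis .
qed

lemma gauss_shift:
  assumes "s > 0"
  shows "(\<integral>\<^sup>+x. gauss s (x - a) \<partial>lborel) = 1" "(\<integral>\<^sup>+x. gauss s (a - x) \<partial>lborel) = 1"
proof -
  show "(\<integral>\<^sup>+x. gauss s (a - x) \<partial>lborel) = 1"
    using assms by (subst nn_integral_lborel_reflect) (auto simp: nn_integral_gauss)
  then show "(\<integral>\<^sup>+x. gauss s (x - a) \<partial>lborel) = 1" by (simp add: gauss_commute)
qed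

lemma integral_gauss:
  assumes "s > 0"
  shows "integrable lborel (\<lambda>x. gauss s (x - a))" "(\<integral>x. gauss s (x - a) \<partial>lborel) = 1"
    "integrable lborel (\<lambda>x. gauss s (a - x))" "(\<integral>x. gauss s (a - x) \<partial>lborel) = 1"
proof -
  show "integrable lborel (\<lambda>x. gauss s (x - a))"
    using gauss_shift[OF assms, of a] by (intro integrableI_nonneg) (auto simp: gauss_nonneg)
  then show "integrable lborel (\<lambda>x. gauss s (a - x))" by (simp add: gauss_commute)
  show "(\<integral>x. gauss s (x - a) \<partial>lborel) = 1"
    using gauss_shift[OF assms, of a] by (subst integral_eq_nn_integral) (auto simp: gauss_nonneg)
  then show "(\<integral>x. gauss s (a - x) \<partial>lborel) = 1" by (simp add: gauss_commute)
qed

text \<open>The constant of \<open>norm_mult_gauss_le\<close>: 8/3 comes from r \<le> 8/3 exp (3 r^2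
  / 8), and the power of 2 is the ratio of the normalising factors for the widths \<open>s\<close>
  and \<open>2 * s\<close>.\<close>

definition gauss_moment :: "'a::euclidean_space itself \<Rightarrow> real" where
  "gauss_moment _ = 8/3 * 2 ^ DIM('a)"

text \<open>Part of the Gaussian decay is traded for the factor |x|, at the price of doubling the
  width. Integration gives the first moment, and the pointwise bound later controls the gradient of
  the Gaussian.\<close>

lemma norm_mult_gauss_le:
  fixes x :: "'a::euclidean_space"
  assumes "s > 0" shows "norm x * gauss s x \<le> s * gauss_moment TYPE('a) * gauss (2 * s) x"
proof -
  define r where "r = norm x / s"
  have "r \<le> 1 + r\<^sup>2" using sum_power2_ge_zero[of r "r - 1"] by (simp add: power2_eq_square algebra_simps)
  also have "\<dots> \<le> 8/3 * (1 + 3 * r\<^sup>2 / 8)" by simp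
  also have "\<dots> \<le> 8/3 * exp (3 * r\<^sup>2 / 8)" by (intro mult_left_mono exp_ge_add_one_self) auto
  finally have "r * exp (- r\<^sup>2/2) \<le> 8/3 * exp (3 * r\<^sup>2 / 8) * exp (- r\<^sup>2 / 2)" by (intro mult_right_mono) auto
  also have "\<dots> = 8/3 * exp (- r\<^sup>2 / 8)" by (simp add: exp_add[symmetric] field_simps)
  finally have *: "r * exp (- r\<^sup>2/2) \<le> 8/3 * exp (- r\<^sup>2 / 8)" .
  have r1: "norm x = r * s" using assms by (simp add: r_def)
  have r2: "(norm x)\<^sup>2 = r\<^sup>2 * s\<^sup>2" unfolding r1 by (simp add: power_mult_distrib)
  have e1: "exp (- (norm x)\<^sup>2 / (2 * s\<^sup>2)) = exp (- r\<^sup>2/2)"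
    unfolding r2 using assms by simp
  have e2: "exp (- (norm x)\<^sup>2 / (2 * (2 * s)\<^sup>2)) = exp (- r\<^sup>2/8)"
    unfolding r2 using assms by (simp add: power_mult_distrib)
  have sq: "sqrt (2 * pi * (2 * s)\<^sup>2) = 2 * sqrt (2 * pi * s\<^sup>2)" using assms
    real_sqrt_mult[of 4 "2 * pi * s\<^sup>2"] by (simp add: power_mult_distrib algebra_simps)
  define c where "c = (1 / sqrt (2 * pi * s\<^sup>2)) ^ DIM('a)"
  have c: "(1 / sqrt (2 * pi * s\<^sup>2)) ^ DIM('a) = 2 ^ DIM('a) * (1 / sqrt (2 * pi * (2 * s)\<^sup>2)) ^ DIM('a)"
    unfolding sq power_mult_distrib[symmetric] by simp
  have "norm x * gauss s x = s * c * (r * exp (- r\<^sup>2/2))"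
    unfolding gauss_def e1 c_def by (simp add: r1)
  also have "\<dots> \<le> s * c * (8/3 * exp (- r\<^sup>2 / 8))"
    using assms * by (intro mult_left_mono) (auto simp: c_def)
  also have "\<dots> = s * gauss_moment TYPE('a) * gauss (2 * s) x"
    unfolding c_def c gauss_def e2 gauss_moment_def by simp
  finally show ?thesis .
qed

lemma gauss_first_moment:
  assumes "s > 0"
  shows "(\<integral>\<^sup>+(x::'a::euclidean_space). norm x * gauss s x \<partial>lborel) \<le> ennreal (s * gauss_moment TYPE('a))"
proof -
  have "(\<integral>\<^sup>+(x::'a). norm x * gauss s x \<partial>lborel) \<le> (\<integral>\<^sup>+(x::'a). ennreal (s * gauss_moment TYPE('a)) * ennreal (gauss (2 * s) x) \<partial>lborel)"
    using norm_mult_gauss_le[OF assms, where ?'a='a] assms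
    by (intro nn_integral_mono) (auto simp: ennreal_mult[symmetric] gauss_nonneg gauss_moment_def intro!: ennreal_leI)
  also have "\<dots> = ennreal (s * gauss_moment TYPE('a))"
    using assms by (subst nn_integral_cmult) (auto simp: nn_integral_gauss)
  finally show ?thesis .
qed

text \<open>The decay is fast enough for a first moment and slow enough for \<open>ln weight\<close> to be Lipschitz.\<close>

definition weight0 :: "'a::euclidean_space \<Rightarrow> real" where
  "weight0 x = (1 / (1 + norm x)) ^ (3 * DIM('a))"

definition weight :: "'a::euclidean_space \<Rightarrow> real" where
  "weight x = weight0 x / (\<integral>(y::'a). weight0 y \<partial>lborel)"

lemma weight0_measurable [measurable]: "weight0 \<in> borel_measurable borel"
  unfolding weight0_def by measurable

lemma weight_measurable [measurable]: "weight \<in> borel_measurable borel"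
  unfolding weight_def by measurable

lemma weight0_pos: "weight0 x > 0"
  unfolding weight0_def by (intro zero_less_power) (auto simp: add_pos_nonneg)

text \<open>Each of the d coordinates absorbs two of the 2 d powers, which leaves a product of
  one-dimensional functions 1 / (1 + y^2).\<close>

lemma inverse_norm_integrable: "integrable lborel (\<lambda>x::'a::euclidean_space. (1 / (1 + norm x)) ^ (2 * DIM('a)))"
proof (rule integrableI_bounded)
  have "(\<integral>\<^sup>+(x::'a). ennreal (norm ((1 / (1 + norm x)) ^ (2 * DIM('a)))) \<partial>lborel) \<le> (\<integral>\<^sup>+(x::'a). (\<Prod>b\<in>Basis. ennreal (inverse (1 + (x \<bullet> b)\<^sup>2))) \<partial>lborel)"
  proof (rule nn_integral_mono)
    fix x :: 'a
    have "(1 / (1 + norm x)) ^ (2 * DIM('a)) = (\<Prod>b\<in>(Basis::'a set). (1 / (1 + norm x))\<^sup>2)"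
      by (simp add: power_mult)
    also have "\<dots> \<le> (\<Prod>b\<in>Basis. inverse (1 + (x \<bullet> b)\<^sup>2))"
    proof (intro prod_mono conjI)
      fix b :: 'a assume b: "b \<in> Basis"
      have "(x \<bullet> b)\<^sup>2 \<le> (norm x)\<^sup>2" using Basis_le_norm[OF b, of x] by (simp add: abs_le_square_iff[symmetric])
      then have "1 + (x \<bullet> b)\<^sup>2 \<le> (1 + norm x)\<^sup>2" by (simp add: power2_sum) (use norm_ge_zero[of x] in linarith)
      then show "(1 / (1 + norm x))\<^sup>2 \<le> inverse (1 + (x \<bullet> b)\<^sup>2)"
        using le_imp_inverse_le[of "1 + (x \<bullet> b)\<^sup>2" "(1 + norm x)\<^sup>2"]
        by (simp add: power_divide inverse_eq_divide add_pos_nonneg)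
    qed simp
    finally show "ennreal (norm ((1 / (1 + norm x)) ^ (2 * DIM('a)))) \<le> (\<Prod>b\<in>Basis. ennreal (inverse (1 + (x \<bullet> b)\<^sup>2)))"
      by (simp add: prod_ennreal ennreal_leI)
  qed
  also have "\<dots> = (\<Prod>b\<in>(Basis::'a set). (\<integral>\<^sup>+(x::real). inverse (1 + x\<^sup>2) \<partial>lborel))"
    by (rule nn_integral_lborel_prod) auto
  also have "\<dots> < \<infinity>"
  proof -
    have "integrable lborel (\<lambda>x::real. inverse (1 + x\<^sup>2))"
      using integrable_inverse_1_plus_square by (simp add: set_integrable_def)
    then have "(\<integral>\<^sup>+(x::real). inverse (1 + x\<^sup>2) \<partial>lborel) < \<infinity>"
      by (simp add: nn_integral_eq_integral)
    then show ?thesis by (simp add: power_less_top_ennreal)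
  qed
  finally show "(\<integral>\<^sup>+(x::'a). ennreal (norm ((1 / (1 + norm x)) ^ (2 * DIM('a)))) \<partial>lborel) < \<infinity>" .
qed simp

text \<open>One of the 3 d powers pays for the factor 1 + |x|; the remaining 3 d - 1 are at least 2
  d since d is positive.\<close>

lemma weight0_norm_le: "weight0 x * (1 + norm x) \<le> (1 / (1 + norm x)) ^ (2 * DIM('a))" "weight0 x \<le> (1 / (1 + norm x)) ^ (2 * DIM('a))"
  for x :: "'a::euclidean_space"
proof -
  define y where "y = 1 / (1 + norm x)"
  have y: "0 < y" "y \<le> 1" "y * (1 + norm x) = 1" by (auto simp: y_def add_pos_nonneg divide_le_eq add_nonneg_eq_0_iff)
  have d: "3 * DIM('a) = Suc (3 * DIM('a) - 1)" using DIM_positive[where 'a='a] by simp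
  have "weight0 x * (1 + norm x) = y ^ (3 * DIM('a) - 1) * (y * (1 + norm x))"
  proof -
    have "y ^ (3 * DIM('a)) = y ^ (3 * DIM('a) - 1) * y" by (metis d power_Suc2)
    then show ?thesis by (simp add: weight0_def y_def[symmetric] mult.assoc)
  qed
  also have "\<dots> \<le> y ^ (2 * DIM('a))" unfolding y(3) using y DIM_positive[where 'a='a] by (simp add: power_decreasing)
  finally show "weight0 x * (1 + norm x) \<le> (1 / (1 + norm x)) ^ (2 * DIM('a))" by (simp add: y_def)
  show "weight0 x \<le> (1 / (1 + norm x)) ^ (2 * DIM('a))"
    unfolding weight0_def y_def[symmetric] using y by (intro power_decreasing) auto
qed

lemma weight0_integrable: "integrable lborel (weight0 :: 'a::euclidean_space \<Rightarrow> real)"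
  by (rule Bochner_Integration.integrable_bound[OF inverse_norm_integrable])
     (use weight0_norm_le(2)[where 'a='a] in \<open>auto simp: abs_of_pos[OF weight0_pos]\<close>)

lemma weight0_norm_integrable: "integrable lborel (\<lambda>x::'a::euclidean_space. weight0 x * (1 + norm x))"
  by (rule Bochner_Integration.integrable_bound[OF inverse_norm_integrable])
     (use weight0_norm_le(1)[where 'a='a] in \<open>auto simp: abs_mult abs_of_pos[OF weight0_pos]\<close>)

lemma weight0_integral_pos: "(\<integral>(y::'a::euclidean_space). weight0 y \<partial>lborel) > 0"
proof -
  have "(\<integral>(y::'a::euclidean_space). weight0 y \<partial>lborel) \<noteq> 0"
    using weight0_pos[where ?'a='a] by (subst integral_nonneg_eq_0_iff_AE[OF weight0_integrable]) (auto simp: less_imp_le less_imp_neq[THEN not_sym] trivial_limit_def[symmetric] ae_filter_eq_bot_iff)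
  moreover have "(\<integral>(y::'a::euclidean_space). weight0 y \<partial>lborel) \<ge> 0"
    using weight0_pos[where ?'a='a] by (auto intro!: integral_nonneg simp: less_imp_le)
  ultimately show ?thesis by simp
qed

lemma weight_pos: "weight x > 0"
  unfolding weight_def using weight0_pos weight0_integral_pos by (intro divide_pos_pos)

lemma weight_integrable: "integrable lborel weight"
  unfolding weight_def by (intro integrable_divide_zero weight0_integrable)

lemma weight_integral: "(\<integral>(x::'a::euclidean_space). weight x \<partial>lborel) = 1"
  unfolding weight_def using weight0_integral_pos[where ?'a='a] by simp

lemma weight_nn_integral: "(\<integral>\<^sup>+(x::'a::euclidean_space). weight x \<partial>lborel) = 1"
  using weight_pos[where ?'a='a] by (simp add: nn_integral_eq_integral[OF weight_integrable] weight_integral less_imp_le)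

lemma weight_norm_integrable: "integrable lborel (\<lambda>x::'a::euclidean_space. weight x * (1 + norm x))"
  unfolding weight_def using integrable_divide_zero[OF weight0_norm_integrable] by simp

text \<open>The potential of the weight: for a probability density f, the relative entropy with
  respect to \<open>weight\<close> is the integral of f ln f plus that of f times
  \<open>lw\<close>.\<close>

definition lw :: "'a::euclidean_space \<Rightarrow> real" where "lw x = - ln (weight x)"

lemma lw_measurable [measurable]: "lw \<in> borel_measurable borel"
  unfolding lw_def by measurable

lemma lw_eq: "lw (x::'a::euclidean_space) = 3 * DIM('a) * ln (1 + norm x) + ln (\<integral>(y::'a). weight0 y \<partial>lborel)"
proof -
  have "1 + norm x > 0" by (simp add: add_pos_nonneg)
  then show ?thesis using weight0_integral_pos[where ?'a='a] weight0_pos[of x]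
    by (simp add: lw_def weight_def ln_div) (simp add: weight0_def ln_realpow ln_div)
qed

lemma ln_norm_lipschitz: "\<bar>ln (1 + norm (x::'a::real_normed_vector)) - ln (1 + norm y)\<bar> \<le> norm (x - y)"
proof -
  have *: "ln (1 + norm a) - ln (1 + norm b) \<le> norm (a - b)" for a b :: 'a
  proof -
    have pos: "1 + norm a > 0" "1 + norm b > 0" by (auto simp: add_pos_nonneg)
    have "ln (1 + norm a) - ln (1 + norm b) = ln ((1 + norm a) / (1 + norm b))"
      using pos by (simp add: ln_div)
    also have "\<dots> \<le> (1 + norm a) / (1 + norm b) - 1" using pos by (intro ln_le_minus_one) auto
    also have "\<dots> = (norm a - norm b) / (1 + norm b)" using pos by (simp add: field_simps)
    also have "\<dots> \<le> norm (a - b) / (1 + norm b)" using pos by (intro divide_right_mono norm_triangle_ineq2) auto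
    also have "\<dots> \<le> norm (a - b)" using pos by (simp add: divide_le_eq mult_le_cancel_left1)
    finally show ?thesis .
  qed
  from *[of x y] *[of y x] show ?thesis by (simp add: norm_minus_commute abs_le_iff)
qed

text \<open>The exponent of \<open>weight0\<close> becomes the Lipschitz constant. Mollification
  with width \<open>s\<close> therefore changes integrals of \<open>lw\<close> by at most a multiple
  of \<open>s\<close>.\<close>

lemma lw_lipschitz: "\<bar>lw (x::'a::euclidean_space) - lw y\<bar> \<le> 3 * DIM('a) * norm (x - y)"
proof -
  have "\<bar>lw x - lw y\<bar> = 3 * DIM('a) * \<bar>ln (1 + norm x) - ln (1 + norm y)\<bar>"
    by (simp add: lw_eq abs_mult right_diff_distrib[symmetric])
  also have "\<dots> \<le> 3 * DIM('a) * norm (x - y)" by (intro mult_left_mono ln_norm_lipschitz) auto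
  finally show ?thesis .
qed

text \<open>Squeeze \<open>A\<close> between a compact \<open>K\<close> and an open \<open>U\<close>
  whose complement has positive distance from \<open>K\<close>. A shorter shift keeps
  \<open>K\<close> inside \<open>U\<close>, so the indicator changes only on \<open>A - K\<close>,
  on \<open>U - A\<close> or on their translates.\<close>

lemma lborel_translation_indicator:
  fixes A :: "'a::euclidean_space set"
  assumes A: "A \<in> sets borel" "emeasure lborel A < \<infinity>" and e: "e > (0::real)"
  shows "\<exists>\<rho>>0. \<forall>h. norm h < \<rho> \<longrightarrow>
    (\<integral>\<^sup>+x. ennreal \<bar>indicator A (x + h) - indicator A x\<bar> \<partial>lborel) \<le> ennreal e"
proof -
  \<comment> \<open>Two small sets and their two translates contribute.\<close>
  define d where "d = e / 4"
  have d: "d > 0" "4 * d = e" using e by (auto simp: d_def)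
  obtain U where U: "open U" "A \<subseteq> U" "emeasure lborel (U - A) < d"
    using outer_regular_lborel[OF A(1) d(1)] by blast
  \<comment> \<open>Inner regularity is applied to a finite measure, the restriction of Lebesgue
    measure to \<open>A\<close>.\<close>
  define M where "M = density lborel (indicator A)"
  have M: "sets M = sets borel" "emeasure M (space M) \<noteq> \<infinity>"
    using A by (auto simp: M_def emeasure_density)
  have "emeasure M A = (SUP K \<in> {K. K \<subseteq> A \<and> compact K}. emeasure M K)"
    by (rule inner_regular[OF M A(1)])
  moreover have MB: "emeasure M B = emeasure lborel B" if "B \<subseteq> A" "B \<in> sets borel" for B
    using that A by (auto simp: M_def emeasure_density indicator_inter_arith[symmetric] Int_absorb1)
  ultimately have sup: "emeasure lborel A = (SUP K \<in> {K. K \<subseteq> A \<and> compact K}. emeasure M K)"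
    using A by simp
  have "\<exists>K \<in> {K. K \<subseteq> A \<and> compact K}. emeasure lborel A \<le> emeasure M K + ennreal d"
  proof -
    have ne: "{K. K \<subseteq> A \<and> compact K} \<noteq> {}" by (rule ex_in_conv[THEN iffD1]) (rule exI[of _ "{}"], simp)
    have fin: "emeasure lborel A \<noteq> \<infinity>" using A(2) by auto
    from SUP_approx_ennreal[OF d(1) ne sup fin] show ?thesis by (meson less_imp_le)
  qed
  then obtain K where K: "K \<subseteq> A" "compact K" "emeasure lborel A \<le> emeasure M K + ennreal d" by blast
  have Kb: "K \<in> sets borel" using K(2) by (simp add: compact_imp_closed borel_closed)
  have Kf: "emeasure lborel K < \<infinity>" using K(2) by (rule emeasure_compact_finite)
  have AK: "emeasure lborel (A - K) \<le> ennreal d"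
  proof -
    have "emeasure lborel (A - K) = emeasure lborel A - emeasure lborel K"
      using A(1) Kb K(1) Kf by (intro emeasure_Diff) auto
    then show ?thesis using K(3) MB[OF K(1) Kb] Kf by (simp add: ennreal_minus_le_iff add.commute less_top)
  qed
  obtain \<rho> where r: "\<rho> > 0" "\<And>x y. x \<in> K \<Longrightarrow> y \<in> - U \<Longrightarrow> \<rho> \<le> dist x y"
  proof -
    have "K \<inter> - U = {}" using K U by blast
    then have "\<exists>\<rho>>0. \<forall>x\<in>K. \<forall>y\<in>- U. \<rho> \<le> dist x y"
      using separate_compact_closed[of K "- U"] K U by (auto simp: closed_Compl)
    then show ?thesis using that by blast
  qed
  have main: "(\<integral>\<^sup>+x. ennreal \<bar>indicator A (x + h) - indicator A x\<bar> \<partial>lborel) \<le> ennreal e" if h: "norm h < \<rho>" for h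
  proof -
    have iK: "x + h \<in> U \<and> x - h \<in> U" if "x \<in> K" for x
      using r(2)[OF that, of "x + h"] r(2)[OF that, of "x - h"] h by (auto simp: dist_norm)
    have U': "U - A \<in> sets borel" "A - K \<in> sets borel" using U A Kb by auto
    have "(\<integral>\<^sup>+x. ennreal \<bar>indicator A (x + h) - indicator A x\<bar> \<partial>lborel) \<le>
      (\<integral>\<^sup>+x. indicator (A - K) x + indicator (U - A) x + indicator (A - K) (h + x) + indicator (U - A) (h + x) \<partial>lborel)"
    proof (rule nn_integral_mono)
      fix x
      consider "x \<in> A \<longleftrightarrow> x + h \<in> A" | "x \<in> A" "x + h \<notin> A" | "x \<notin> A" "x + h \<in> A" by blast
      then show "ennreal \<bar>indicator A (x + h) - indicator A x\<bar> \<le> 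
        indicator (A - K) x + indicator (U - A) x + indicator (A - K) (h + x) + indicator (U - A) (h + x)"
      proof cases
        case 1 then have "\<bar>indicator A (x + h) - indicator A x :: real\<bar> = 0" by (auto simp: indicator_def)
        then show ?thesis by simp
      next
        case 2 
        then have "x \<in> A - K \<or> h + x \<in> U - A" using iK[of x] by (auto simp: add.commute)
        then show ?thesis using 2 by (auto simp: indicator_def)
      next
        case 3
        then have "h + x \<in> A - K \<or> x \<in> U - A" using iK[of "x + h"] by (auto simp: add.commute)
        then show ?thesis using 3 by (auto simp: indicator_def)
      qed
    qed
    also have "\<dots> = 2 * emeasure lborel (A - K) + 2 * emeasure lborel (U - A)"
      using U' nn_integral_lborel_shift[of "indicator (A - K)" h] nn_integral_lborel_shift[of "indicator (U - A)" h]
      by (simp add: nn_integral_add mult_2 ac_simps)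
    also have "\<dots> \<le> 2 * ennreal d + 2 * ennreal d"
      using AK U(3) by (intro add_mono mult_left_mono) auto
    also have "\<dots> = ennreal e" by (simp add: d(2)[symmetric] ennreal_mult' distrib_right[symmetric])
    finally show ?thesis .
  qed
  then show ?thesis using r(1) by blast
qed

text \<open>The property passes from indicators to sums and to L1 limits. In the limit step
  translation invariance makes the shifted approximation error equal to the unshifted one.\<close>

lemma lborel_translation_continuous:
  fixes A :: "'a::euclidean_space \<Rightarrow> real"
  assumes A: "integrable lborel A" and e: "e > (0::real)"
  shows "\<exists>\<rho>>0. \<forall>h. norm h < \<rho> \<longrightarrow> (\<integral>\<^sup>+x. ennreal \<bar>A (x + h) - A x\<bar> \<partial>lborel) \<le> ennreal e"
  using A e
proof (induction arbitrary: e rule: integrable_induct)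
  case (base A c)
  have "e / (1 + \<bar>c\<bar>) > 0" using base by simp
  from lborel_translation_indicator[OF _ _ this, of A] base obtain \<rho> where \<rho>: "\<rho> > 0"
    "\<And>h. norm h < \<rho> \<Longrightarrow> (\<integral>\<^sup>+x. ennreal \<bar>indicator A (x + h) - indicator A x\<bar> \<partial>lborel) \<le> ennreal (e / (1 + \<bar>c\<bar>))"
    by auto
  have "(\<integral>\<^sup>+x. ennreal \<bar>indicator A (x + h) *\<^sub>R c - indicator A x *\<^sub>R c\<bar> \<partial>lborel) \<le> ennreal e" if "norm h < \<rho>" for h
  proof -
    have [measurable]: "A \<in> sets borel" using base by simp
    have "(\<integral>\<^sup>+x. ennreal \<bar>indicator A (x + h) *\<^sub>R c - indicator A x *\<^sub>R c\<bar> \<partial>lborel) =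
      (\<integral>\<^sup>+x. ennreal \<bar>c\<bar> * ennreal \<bar>indicator A (x + h) - indicator A x\<bar> \<partial>lborel)"
      by (intro nn_integral_cong) (auto simp: ennreal_mult[symmetric] abs_mult[symmetric] algebra_simps)
    also have "\<dots> \<le> ennreal \<bar>c\<bar> * ennreal (e / (1 + \<bar>c\<bar>))"
      by (subst nn_integral_cmult) (auto intro!: mult_left_mono \<rho>(2) that)
    also have "\<dots> \<le> ennreal e"
      using base(3) by (auto simp: ennreal_mult[symmetric] field_simps intro!: ennreal_leI)
    finally show ?thesis .
  qed
  then show ?case using \<rho>(1) by blast
next
  case (add f g)
  note [measurable] = borel_measurable_integrable[OF add(1)] borel_measurable_integrable[OF add(2)]
  obtain \<rho>1 where \<rho>1: "\<rho>1 > 0" "\<And>h. norm h < \<rho>1 \<Longrightarrow> (\<integral>\<^sup>+x. ennreal \<bar>f (x + h) - f x\<bar> \<partial>lborel) \<le> ennreal (e/2)"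
    using add(3)[of "e/2"] add(5) by auto
  obtain \<rho>2 where \<rho>2: "\<rho>2 > 0" "\<And>h. norm h < \<rho>2 \<Longrightarrow> (\<integral>\<^sup>+x. ennreal \<bar>g (x + h) - g x\<bar> \<partial>lborel) \<le> ennreal (e/2)"
    using add(4)[of "e/2"] add(5) by auto
  have "(\<integral>\<^sup>+x. ennreal \<bar>f (x + h) + g (x + h) - (f x + g x)\<bar> \<partial>lborel) \<le> ennreal e" if "norm h < min \<rho>1 \<rho>2" for h
  proof -
    have "(\<integral>\<^sup>+x. ennreal \<bar>f (x + h) + g (x + h) - (f x + g x)\<bar> \<partial>lborel) \<le>
      (\<integral>\<^sup>+x. ennreal \<bar>f (x + h) - f x\<bar> + ennreal \<bar>g (x + h) - g x\<bar> \<partial>lborel)"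
      by (intro nn_integral_mono) (auto simp: ennreal_plus[symmetric] simp del: ennreal_plus intro!: ennreal_leI)
    also have "\<dots> = (\<integral>\<^sup>+x. ennreal \<bar>f (x + h) - f x\<bar> \<partial>lborel) + (\<integral>\<^sup>+x. ennreal \<bar>g (x + h) - g x\<bar> \<partial>lborel)"
      by (intro nn_integral_add) measurable
    also have "\<dots> \<le> ennreal (e/2) + ennreal (e/2)" using that \<rho>1 \<rho>2 by (intro add_mono) auto
    also have "\<dots> = ennreal e" using add(5) by (simp add: ennreal_plus[symmetric] del: ennreal_plus)
    finally show ?thesis .
  qed
  then show ?case using \<rho>1(1) \<rho>2(1) by (intro exI[of _ "min \<rho>1 \<rho>2"]) auto
next
  case (lim f s)
  note [measurable] = borel_measurable_integrable[OF lim(1)] borel_measurable_integrable[OF lim(4)]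
  have "(\<lambda>i. \<integral>\<^sup>+x. ennreal (norm (s i x - f x)) \<partial>lborel) \<longlonglongrightarrow> 0"
  proof -
    have "(\<integral>\<^sup>+x. ennreal (2 * norm (f x)) \<partial>lborel) < \<infinity>"
      using lim(4) by (simp add: integrable_iff_bounded ennreal_mult nn_integral_cmult ennreal_mult_less_top)
    from nn_integral_dominated_convergence_norm[OF _ _ _ _ this, of s f] show ?thesis
      using lim(2,3) by (simp add: abs_minus_commute)
  qed
  then have "\<forall>\<^sub>F i in sequentially. (\<integral>\<^sup>+x. ennreal \<bar>s i x - f x\<bar> \<partial>lborel) < ennreal (e/3)"
    using lim(6) by (intro order_tendstoD) auto
  then obtain i where i: "(\<integral>\<^sup>+x. ennreal \<bar>s i x - f x\<bar> \<partial>lborel) < ennreal (e/3)"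
    by (auto simp: eventually_sequentially)
  obtain \<rho> where \<rho>: "\<rho> > 0" "\<And>h. norm h < \<rho> \<Longrightarrow> (\<integral>\<^sup>+x. ennreal \<bar>s i (x + h) - s i x\<bar> \<partial>lborel) \<le> ennreal (e/3)"
    using lim(5)[of "e/3"] lim(6) by auto
  have "(\<integral>\<^sup>+x. ennreal \<bar>f (x + h) - f x\<bar> \<partial>lborel) \<le> ennreal e" if "norm h < \<rho>" for h
  proof -
    have sh: "(\<integral>\<^sup>+x. ennreal \<bar>s i (x + h) - f (x + h)\<bar> \<partial>lborel) = (\<integral>\<^sup>+x. ennreal \<bar>s i x - f x\<bar> \<partial>lborel)"
      using nn_integral_lborel_shift[of "\<lambda>x. ennreal \<bar>s i x - f x\<bar>" h] by (simp add: add.commute)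
    have "(\<integral>\<^sup>+x. ennreal \<bar>f (x + h) - f x\<bar> \<partial>lborel) \<le>
      (\<integral>\<^sup>+x. ennreal \<bar>s i (x + h) - f (x + h)\<bar> + (ennreal \<bar>s i (x + h) - s i x\<bar> + ennreal \<bar>s i x - f x\<bar>) \<partial>lborel)"
      by (intro nn_integral_mono) (auto simp: ennreal_plus[symmetric] simp del: ennreal_plus intro!: ennreal_leI)
    also have "\<dots> = (\<integral>\<^sup>+x. ennreal \<bar>s i (x + h) - f (x + h)\<bar> \<partial>lborel) + ((\<integral>\<^sup>+x. ennreal \<bar>s i (x + h) - s i x\<bar> \<partial>lborel)
        + (\<integral>\<^sup>+x. ennreal \<bar>s i x - f x\<bar> \<partial>lborel))"
      by (simp add: nn_integral_add)
    also have "\<dots> \<le> ennreal (e/3) + (ennreal (e/3) + ennreal (e/3))"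
      using i \<rho>(2)[OF that] unfolding sh by (intro add_mono) auto
    also have "\<dots> = ennreal e" using lim(6) by (simp add: ennreal_plus[symmetric] del: ennreal_plus)
    finally show ?thesis .
  qed
  then show ?case using \<rho>(1) by blast
qed

definition mollify :: "real \<Rightarrow> ('a::euclidean_space \<Rightarrow> real) \<Rightarrow> 'a \<Rightarrow> real" where
  "mollify s A x = (\<integral>u. gauss s (x - u) * A u \<partial>lborel)"

lemma mollify_integrable:
  assumes "integrable lborel A" "s > 0"
  shows "integrable lborel (\<lambda>u. gauss s (x - u) * A u)"
proof (rule Bochner_Integration.integrable_bound[OF integrable_mult_right[OF assms(1), of "gauss s (0::'a)"]])
  show "AE u in lborel. norm (gauss s (x - u) * A u) \<le> norm (gauss s (0::'a) * A u)"
    using gauss_le[of s "x - _"] by (auto simp: abs_mult gauss_nonneg intro!: mult_right_mono)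
qed (use assms in measurable)

lemma mollify_nonneg: "(\<And>u. A u \<ge> 0) \<Longrightarrow> mollify s A x \<ge> 0"
  unfolding mollify_def by (intro Bochner_Integration.integral_nonneg) (simp add: gauss_nonneg)

lemma mollify_measurable [measurable]:
  assumes [measurable]: "A \<in> borel_measurable borel"
  shows "mollify s A \<in> borel_measurable borel"
  unfolding mollify_def by measurable

lemma mollify_measurable_param:
  fixes A :: "'p \<Rightarrow> 'a::euclidean_space \<Rightarrow> real"
  assumes [measurable]: "(\<lambda>(p, u). A p u) \<in> borel_measurable (M \<Otimes>\<^sub>M lborel)"
  shows "(\<lambda>(p, x). mollify s (A p) x) \<in> borel_measurable (M \<Otimes>\<^sub>M lborel)"
  unfolding mollify_def by measurable

text \<open>The kernel has mass one, so the error is a Gaussian average of differences of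
  translates; Fubini puts the shift outside.\<close>

lemma mollify_minus_le:
  fixes A :: "'a::euclidean_space \<Rightarrow> real"
  assumes A: "integrable lborel A" and s: "s > 0"
  shows "(\<integral>\<^sup>+x. ennreal \<bar>mollify s A x - A x\<bar> \<partial>lborel)
    \<le> (\<integral>\<^sup>+z. gauss s z * (\<integral>\<^sup>+x. ennreal \<bar>A (x + z) - A x\<bar> \<partial>lborel) \<partial>lborel)"
proof -
  note [measurable] = borel_measurable_integrable[OF A]
  have "(\<integral>\<^sup>+x. ennreal \<bar>mollify s A x - A x\<bar> \<partial>lborel) \<le> (\<integral>\<^sup>+x. (\<integral>\<^sup>+z. ennreal (gauss s z) * ennreal \<bar>A (x + z) - A x\<bar> \<partial>lborel) \<partial>lborel)"
  proof (rule nn_integral_mono)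
    fix x
    have i: "integrable lborel (\<lambda>u. gauss s (x - u) * A u - gauss s (x - u) * A x)"
      using mollify_integrable[OF A s] integral_gauss(3)[OF s, of x] by auto
    have "mollify s A x - A x = (\<integral>u. gauss s (x - u) * A u - gauss s (x - u) * A x \<partial>lborel)"
      using mollify_integrable[OF A s] integral_gauss(3,4)[OF s, of x]
      by (simp add: mollify_def)
    then have "\<bar>mollify s A x - A x\<bar> \<le> (\<integral>u. \<bar>gauss s (x - u) * A u - gauss s (x - u) * A x\<bar> \<partial>lborel)"
      by simp
    then have "ennreal \<bar>mollify s A x - A x\<bar> \<le> ennreal (\<integral>u. \<bar>gauss s (x - u) * A u - gauss s (x - u) * A x\<bar> \<partial>lborel)"
      by (rule ennreal_leI)
    also have "\<dots> = (\<integral>\<^sup>+u. ennreal \<bar>gauss s (x - u) * A u - gauss s (x - u) * A x\<bar> \<partial>lborel)"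
      using i by (intro nn_integral_eq_integral[symmetric]) auto
    also have "\<dots> = (\<integral>\<^sup>+u. ennreal (gauss s (u - x)) * ennreal \<bar>A (x + (u - x)) - A x\<bar> \<partial>lborel)"
      by (intro nn_integral_cong)
         (auto simp: gauss_commute[of s x] ennreal_mult[symmetric] gauss_nonneg right_diff_distrib[symmetric] abs_mult)
    also have "\<dots> = (\<integral>\<^sup>+z. ennreal (gauss s z) * ennreal \<bar>A (x + z) - A x\<bar> \<partial>lborel)"
      using nn_integral_lborel_shift[of "\<lambda>z. ennreal (gauss s z) * ennreal \<bar>A (x + z) - A x\<bar>" "- x"] by simp
    finally show "ennreal \<bar>mollify s A x - A x\<bar> \<le> (\<integral>\<^sup>+z. ennreal (gauss s z) * ennreal \<bar>A (x + z) - A x\<bar> \<partial>lborel)" .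
  qed
  also have "\<dots> = (\<integral>\<^sup>+z. (\<integral>\<^sup>+x. ennreal (gauss s z) * ennreal \<bar>A (x + z) - A x\<bar> \<partial>lborel) \<partial>lborel)"
    by (rule lborel_pair.Fubini') measurable
  also have "\<dots> = (\<integral>\<^sup>+z. gauss s z * (\<integral>\<^sup>+x. ennreal \<bar>A (x + z) - A x\<bar> \<partial>lborel) \<partial>lborel)"
    by (intro nn_integral_cong nn_integral_cmult) measurable
  finally show ?thesis .
qed

lemma translation_le:
  fixes A :: "'a::euclidean_space \<Rightarrow> real"
  assumes A: "integrable lborel A"
  shows "(\<integral>\<^sup>+x. ennreal \<bar>A (x + z) - A x\<bar> \<partial>lborel) \<le> 2 * (\<integral>\<^sup>+x. ennreal \<bar>A x\<bar> \<partial>lborel)"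
proof -
  note [measurable] = borel_measurable_integrable[OF A]
  have "(\<integral>\<^sup>+x. ennreal \<bar>A (x + z) - A x\<bar> \<partial>lborel) \<le> (\<integral>\<^sup>+x. ennreal \<bar>A (z + x)\<bar> + ennreal \<bar>A x\<bar> \<partial>lborel)"
    by (intro nn_integral_mono) (auto simp: ennreal_plus[symmetric] add.commute[of z] simp del: ennreal_plus intro!: ennreal_leI)
  also have "\<dots> = 2 * (\<integral>\<^sup>+x. ennreal \<bar>A x\<bar> \<partial>lborel)"
    using nn_integral_lborel_shift[of "\<lambda>x. ennreal \<bar>A x\<bar>" z] by (simp add: nn_integral_add mult_2)
  finally show ?thesis .
qed

text \<open>The bound is independent of \<open>s\<close> and serves as the dominating function when
  a parameter is integrated out.\<close>

lemma mollify_minus_bound: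
  fixes A :: "'a::euclidean_space \<Rightarrow> real"
  assumes A: "integrable lborel A" and s: "s > 0"
  shows "(\<integral>\<^sup>+x. ennreal \<bar>mollify s A x - A x\<bar> \<partial>lborel) \<le> 2 * (\<integral>\<^sup>+x. ennreal \<bar>A x\<bar> \<partial>lborel)"
proof -
  note [measurable] = borel_measurable_integrable[OF A]
  have "(\<integral>\<^sup>+x. ennreal \<bar>mollify s A x - A x\<bar> \<partial>lborel)
      \<le> (\<integral>\<^sup>+(z::'a). gauss s z * (2 * (\<integral>\<^sup>+x. ennreal \<bar>A x\<bar> \<partial>lborel)) \<partial>lborel)"
    by (rule order_trans[OF mollify_minus_le[OF A s]]) (intro nn_integral_mono mult_left_mono translation_le A, simp)
  also have "\<dots> = 2 * (\<integral>\<^sup>+x. ennreal \<bar>A x\<bar> \<partial>lborel)"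
    by (subst nn_integral_multc) (auto simp: nn_integral_gauss s)
  finally show ?thesis .
qed

text \<open>Shifts shorter than \<rho> are handled by the continuity of translations. Longer ones
  satisfy 1 \<le> |z| / \<rho> and are handled by the first moment of the Gaussian, which is of
  order \<open>s\<close>.\<close>

lemma mollify_L1:
  fixes A :: "'a::euclidean_space \<Rightarrow> real"
  assumes A: "integrable lborel A" and s: "\<And>n. s n > 0" "s \<longlonglongrightarrow> 0"
  shows "(\<lambda>n. \<integral>\<^sup>+x. ennreal \<bar>mollify (s n) A x - A x\<bar> \<partial>lborel) \<longlonglongrightarrow> 0"
proof -
  note [measurable] = borel_measurable_integrable[OF A]
  define I where "I = (\<integral>x. \<bar>A x\<bar> \<partial>lborel)"
  have I: "(\<integral>\<^sup>+x. ennreal \<bar>A x\<bar> \<partial>lborel) = ennreal I" "I \<ge> 0"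
    using A by (auto simp: I_def nn_integral_eq_integral)
  show ?thesis
  proof (rule tendsto_zero_ennreal)
    fix r :: real assume r: "0 < r"
    obtain \<rho> where \<rho>: "\<rho> > 0" "\<And>h. norm h < \<rho> \<Longrightarrow> (\<integral>\<^sup>+x. ennreal \<bar>A (x + h) - A x\<bar> \<partial>lborel) \<le> ennreal (r/2)"
      using lborel_translation_continuous[OF A, of "r/2"] r by auto
    define C where "C = 2 * I / \<rho> * gauss_moment TYPE('a)"
    have C: "C \<ge> 0" using I \<rho> by (simp add: C_def gauss_moment_def)
    have bnd: "(\<integral>\<^sup>+x. ennreal \<bar>mollify t A x - A x\<bar> \<partial>lborel) \<le> ennreal (r/2 + C * t)" if t: "t > 0" for t
    proof -
      have "(\<integral>\<^sup>+x. ennreal \<bar>mollify t A x - A x\<bar> \<partial>lborel)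
        \<le> (\<integral>\<^sup>+z. gauss t z * (\<integral>\<^sup>+x. ennreal \<bar>A (x + z) - A x\<bar> \<partial>lborel) \<partial>lborel)"
        by (rule mollify_minus_le[OF A t])
      also have "\<dots> \<le> (\<integral>\<^sup>+(z::'a). ennreal (r/2) * gauss t z + ennreal (2 * I / \<rho>) * ennreal (norm z * gauss t z) \<partial>lborel)"
      proof (rule nn_integral_mono)
        fix z :: 'a
        have "(\<integral>\<^sup>+x. ennreal \<bar>A (x + z) - A x\<bar> \<partial>lborel) \<le> ennreal (r/2 + 2 * I / \<rho> * norm z)"
        proof (cases "norm z < \<rho>")
          case True
          have "ennreal (r/2) \<le> ennreal (r/2 + 2 * I / \<rho> * norm z)" using I \<rho> by (intro ennreal_leI) auto
          then show ?thesis using \<rho>(2)[OF True] by (rule order_trans[rotated])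
        next
          case False
          have "(\<integral>\<^sup>+x. ennreal \<bar>A (x + z) - A x\<bar> \<partial>lborel) \<le> ennreal (2 * I)"
            using translation_le[OF A, of z] I by (simp add: ennreal_mult')
          also have "2 * I * 1 \<le> 2 * I * (norm z / \<rho>)" using False \<rho> I by (intro mult_left_mono) auto
          then have "ennreal (2 * I) \<le> ennreal (r/2 + 2 * I / \<rho> * norm z)"
            using r by (intro ennreal_leI) simp
          finally show ?thesis .
        qed
        then have "gauss t z * (\<integral>\<^sup>+x. ennreal \<bar>A (x + z) - A x\<bar> \<partial>lborel) \<le> ennreal (gauss t z) * ennreal (r/2 + 2 * I / \<rho> * norm z)"
          by (intro mult_left_mono) auto
        also have "\<dots> = ennreal (r/2) * gauss t z + ennreal (2 * I / \<rho>) * ennreal (norm z * gauss t z)"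
          using r I \<rho> gauss_nonneg[of t z]
          by (simp add: ennreal_mult[symmetric] ennreal_plus[symmetric] del: ennreal_plus) (simp add: algebra_simps)
        finally show "gauss t z * (\<integral>\<^sup>+x. ennreal \<bar>A (x + z) - A x\<bar> \<partial>lborel)
          \<le> ennreal (r/2) * gauss t z + ennreal (2 * I / \<rho>) * ennreal (norm z * gauss t z)" .
      qed
      also have "\<dots> = ennreal (r/2) + ennreal (2 * I / \<rho>) * (\<integral>\<^sup>+(z::'a). norm z * gauss t z \<partial>lborel)"
        using t by (simp add: nn_integral_add nn_integral_cmult nn_integral_gauss)
      also have "\<dots> \<le> ennreal (r/2) + ennreal (2 * I / \<rho>) * ennreal (t * gauss_moment TYPE('a))"
        by (intro add_left_mono mult_left_mono gauss_first_moment t) auto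
      also have "\<dots> = ennreal (r/2 + C * t)"
        using r C t I \<rho> by (simp add: C_def ennreal_mult[symmetric] ennreal_plus[symmetric] gauss_moment_def mult_ac del: ennreal_plus)
      finally show ?thesis .
    qed
    have "(\<lambda>n. r/2 + C * s n) \<longlonglongrightarrow> r/2 + C * 0" by (intro tendsto_intros s)
    from order_tendstoD(2)[OF this, of r] have "\<forall>\<^sub>F n in sequentially. r/2 + C * s n < r" using r by simp
    then show "\<forall>\<^sub>F n in sequentially. (\<integral>\<^sup>+x. ennreal \<bar>mollify (s n) A x - A x\<bar> \<partial>lborel) < ennreal r"
      by (rule eventually_mono) (use bnd[OF s(1)] r in \<open>auto intro: le_less_trans ennreal_lessI\<close>)
  qed
qed

text \<open>The mollification acts on each slice. The slice errors tend to 0 and are dominated by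
  twice the slice norm, so the joint L1 error tends to 0 and a subsequence converges almost
  everywhere.\<close>

lemma mollify_AE_subseq:
  fixes A :: "'p \<times> 'a::euclidean_space \<Rightarrow> real"
  assumes M: "sigma_finite_measure M"
    and A: "integrable (M \<Otimes>\<^sub>M lborel) A" and s: "\<And>n. s n > 0" "s \<longlonglongrightarrow> 0"
  shows "\<exists>r::nat\<Rightarrow>nat. strict_mono r \<and>
    (AE z in M \<Otimes>\<^sub>M lborel. (\<lambda>n. mollify (s (r n)) (\<lambda>u. A (fst z, u)) (snd z)) \<longlonglongrightarrow> A z)"
proof -
  interpret M: sigma_finite_measure M by fact
  interpret P: pair_sigma_finite M "lborel :: 'a measure" ..
  note Am[measurable] = borel_measurable_integrable[OF A]
  have Am': "(\<lambda>(p, u). A (p, u)) \<in> borel_measurable (M \<Otimes>\<^sub>M lborel)" by simp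
  have mm: "(\<lambda>z. mollify t (\<lambda>u. A (fst z, u)) (snd z)) \<in> borel_measurable (M \<Otimes>\<^sub>M lborel)" for t
    using mollify_measurable_param[OF Am'] by (simp add: split_beta')
  have AEi: "AE p in M. integrable lborel (\<lambda>u. A (p, u))" using P.AE_integrable_fst'[OF A] .
  define N where "N p = (\<integral>\<^sup>+u. ennreal \<bar>A (p, u)\<bar> \<partial>lborel)" for p
  have Nm[measurable]: "N \<in> borel_measurable M" unfolding N_def by measurable
  have Nf: "(\<integral>\<^sup>+p. 2 * N p \<partial>M) < \<infinity>"
    using A lborel.nn_integral_fst[of "\<lambda>z. ennreal \<bar>A z\<bar>" M]
    by (simp add: N_def nn_integral_cmult integrable_iff_bounded ennreal_mult_less_top)
  define d where "d n p = (\<integral>\<^sup>+x. ennreal \<bar>mollify (s n) (\<lambda>u. A (p, u)) x - A (p, x)\<bar> \<partial>lborel)" for n p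
  have mm2[measurable]: "(\<lambda>(p, x). ennreal \<bar>mollify t (\<lambda>u. A (p, u)) x - A (p, x)\<bar>) \<in> borel_measurable (M \<Otimes>\<^sub>M lborel)" for t
    using mm[of t] Am by (simp add: split_beta')
  have "(\<lambda>n. \<integral>\<^sup>+p. d n p \<partial>M) \<longlonglongrightarrow> (\<integral>\<^sup>+p. 0 \<partial>M)"
  proof (rule nn_integral_dominated_convergence[where w = "\<lambda>p. 2 * N p"])
    show "d n \<in> borel_measurable M" for n unfolding d_def by measurable
    show "AE p in M. d n p \<le> 2 * N p" for n
      using AEi by eventually_elim (use mollify_minus_bound s in \<open>auto simp: d_def N_def\<close>)
    show "AE p in M. (\<lambda>n. d n p) \<longlonglongrightarrow> 0"
      using AEi by eventually_elim (use mollify_L1 s in \<open>auto simp: d_def\<close>)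
  qed (use Nf in auto)
  then have lim: "(\<lambda>n. \<integral>\<^sup>+z. ennreal (norm (mollify (s n) (\<lambda>u. A (fst z, u)) (snd z) - A z)) \<partial>(M \<Otimes>\<^sub>M lborel)) \<longlonglongrightarrow> 0"
    unfolding d_def using lborel.nn_integral_fst[OF mm2] by (simp add: split_beta')
  define u where "u n z = mollify (s n) (\<lambda>u. A (fst z, u)) (snd z) - A z" for n z
  have u: "integrable (M \<Otimes>\<^sub>M lborel) (u n)" for n
  proof (rule integrableI_bounded)
    show "u n \<in> borel_measurable (M \<Otimes>\<^sub>M lborel)" unfolding u_def using mm[of "s n"] Am by simp
    have "(\<integral>\<^sup>+z. ennreal (norm (u n z)) \<partial>(M \<Otimes>\<^sub>M lborel)) = (\<integral>\<^sup>+p. d n p \<partial>M)"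
      unfolding d_def using lborel.nn_integral_fst[OF mm2] by (simp add: split_beta' u_def)
    also have "\<dots> \<le> (\<integral>\<^sup>+p. 2 * N p \<partial>M)"
    proof (rule nn_integral_mono_AE)
      show "AE p in M. d n p \<le> 2 * N p"
        using AEi by eventually_elim (use mollify_minus_bound s in \<open>auto simp: d_def N_def\<close>)
    qed
    finally show "(\<integral>\<^sup>+z. ennreal (norm (u n z)) \<partial>(M \<Otimes>\<^sub>M lborel)) < \<infinity>" using Nf by (rule le_less_trans)
  qed
  have "(\<lambda>n. \<integral>z. norm (u n z) \<partial>(M \<Otimes>\<^sub>M lborel)) \<longlonglongrightarrow> 0"
  proof -
    have "(\<lambda>n. ennreal (\<integral>z. norm (u n z) \<partial>(M \<Otimes>\<^sub>M lborel))) \<longlonglongrightarrow> ennreal 0"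
      using lim u by (simp add: u_def[symmetric] nn_integral_eq_integral)
    then show ?thesis by (rule tendsto_ennrealD) auto
  qed
  from tendsto_L1_AE_subseq[OF u this] obtain r where r: "strict_mono r" "AE z in M \<Otimes>\<^sub>M lborel. (\<lambda>n. u (r n) z) \<longlonglongrightarrow> 0"
    by auto
  have "AE z in M \<Otimes>\<^sub>M lborel. (\<lambda>n. mollify (s (r n)) (\<lambda>u. A (fst z, u)) (snd z)) \<longlonglongrightarrow> A z"
    using r(2) by eventually_elim (auto simp: u_def dest: LIM_zero_cancel)
  with r(1) show ?thesis by blast
qed

section \<open>Collisions and the reference flux\<close>

definition scatter :: "real^'n \<Rightarrow> (real^'n) \<times> (real^'n) \<Rightarrow> (real^'n) \<times> (real^'n)" where
  "scatter \<omega> u = post_collision (fst u) (snd u) \<omega>"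

definition rate :: "real^'n \<Rightarrow> (real^'n) \<times> (real^'n) \<Rightarrow> real" where
  "rate \<omega> u = \<bar>(fst u - snd u) \<bullet> \<omega>\<bar> / 2"

lemma scatter_simps:
  "fst (scatter \<omega> u) = fst u + (\<omega> \<bullet> (snd u - fst u)) *\<^sub>R \<omega>"
  "snd (scatter \<omega> u) = snd u - (\<omega> \<bullet> (snd u - fst u)) *\<^sub>R \<omega>"
  by (simp_all add: scatter_def post_collision_def)

lemma rate_nonneg: "rate \<omega> u \<ge> 0" by (simp add: rate_def)

lemma collision_kernel_rate: "collision_kernel (fst u - snd u) \<omega> = rate \<omega> u"
  by (simp add: rate_def collision_kernel_def)

lemma scatter_linear: "linear (scatter \<omega>)"
  by (rule linearI) (auto simp: prod_eq_iff scatter_simps algebra_simps inner_simps)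

lemma scatter_measurable [measurable (raw)]:
  assumes [measurable]: "f \<in> borel_measurable M" "g \<in> borel_measurable M"
  shows "(\<lambda>x. scatter (f x) (g x)) \<in> borel_measurable M"
proof -
  have "(\<lambda>(x::(real^'n) \<times> ((real^'n) \<times> (real^'n))). scatter (fst x) (snd x)) \<in> borel_measurable borel"
    unfolding scatter_def post_collision_def by (intro borel_measurable_continuous_onI continuous_intros)
  from measurable_compose[OF _ this, of "\<lambda>x. (f x, g x)" M] show ?thesis by simp
qed

lemma rate_measurable [measurable (raw)]:
  assumes [measurable]: "f \<in> borel_measurable M" "g \<in> borel_measurable M"
  shows "(\<lambda>x. rate (f x) (g x)) \<in> borel_measurable M"
proof -
  have "(\<lambda>(x::(real^'n) \<times> ((real^'n) \<times> (real^'n))). rate (fst x) (snd x)) \<in> borel_measurable borel"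
    unfolding rate_def by (intro borel_measurable_continuous_onI continuous_intros) auto
  from measurable_compose[OF _ this, of "\<lambda>x. (f x, g x)" M] show ?thesis by simp
qed

context
  fixes \<omega> :: "real^'n" assumes \<omega>: "norm \<omega> = 1"
begin

lemma inner_unit: "\<omega> \<bullet> \<omega> = 1" using \<omega> by (simp add: norm_eq_1)

lemma inner_scatter: "\<omega> \<bullet> (snd (scatter \<omega> u) - fst (scatter \<omega> u)) = - (\<omega> \<bullet> (snd u - fst u))"
  unfolding scatter_simps inner_diff_right inner_add_right inner_scaleR_right inner_unit by simp

text \<open>Scattering reverses the component of the relative velocity along \<omega>, so the second
  transfer undoes the first.\<close>

lemma scatter_involution: "scatter \<omega> (scatter \<omega> u) = u"
  unfolding prod_eq_iff scatter_simps(1)[of _ "scatter \<omega> u"] scatter_simps(2)[of _ "scatter \<omega> u"] inner_scatter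
  by (simp add: scatter_simps)

text \<open>Conservation of energy: the cross terms amount to 2 c times the difference of the two
  components along \<omega>, which is -2 c^2, and cancel the two squares c^2.\<close>

lemma scatter_norm: "norm (scatter \<omega> u) = norm u"
proof -
  define c where "c = \<omega> \<bullet> (snd u - fst u)"
  have c: "c = \<omega> \<bullet> snd u - \<omega> \<bullet> fst u" by (simp add: c_def inner_diff_right)
  have 1: "(fst u + c *\<^sub>R \<omega>) \<bullet> (fst u + c *\<^sub>R \<omega>) = fst u \<bullet> fst u + 2 * (c * (\<omega> \<bullet> fst u)) + c * c"
    by (simp add: inner_add_left inner_add_right inner_unit inner_commute[of "fst u" \<omega>] algebra_simps)
  have 2: "(snd u - c *\<^sub>R \<omega>) \<bullet> (snd u - c *\<^sub>R \<omega>) = snd u \<bullet> snd u - 2 * (c * (\<omega> \<bullet> snd u)) + c * c"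
    by (simp add: inner_diff_left inner_diff_right inner_unit inner_commute[of "snd u" \<omega>] algebra_simps)
  have "(norm (scatter \<omega> u))\<^sup>2 = (norm u)\<^sup>2"
    unfolding power2_norm_eq_inner inner_prod_def scatter_simps c_def[symmetric] 1 2
    unfolding c by (simp add: algebra_simps)
  then show ?thesis by simp
qed

lemma rate_scatter: "rate \<omega> (scatter \<omega> u) = rate \<omega> u"
proof -
  have "rate \<omega> u = \<bar>\<omega> \<bullet> (snd u - fst u)\<bar> / 2" for u
    by (simp add: rate_def inner_commute[of \<omega>] inner_diff_left abs_minus_commute)
  then show ?thesis by (simp only: inner_scatter abs_minus_cancel)
qed

text \<open>A point of the collision space does not record \<omega>; the rate is recovered from the
  length of the velocity transfer.\<close>

lemma rate_eq_norm: "rate \<omega> u = norm (fst (scatter \<omega> u) - fst u) / 2"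
  using \<omega> by (simp add: scatter_simps rate_def inner_commute[of \<omega>] abs_minus_commute inner_simps)

lemma rate_le: "rate \<omega> u \<le> 1 + norm (fst u) + norm (snd u)"
proof -
  have "\<bar>(fst u - snd u) \<bullet> \<omega>\<bar> \<le> norm (fst u - snd u)"
    using Cauchy_Schwarz_ineq2[of "fst u - snd u" \<omega>] \<omega> by simp
  also have "\<dots> \<le> norm (fst u) + norm (snd u)" by (rule norm_triangle_ineq4)
  finally show ?thesis by (simp add: rate_def)
qed

lemma norm_scatter_le:
  "norm (fst (scatter \<omega> u)) \<le> 2 * (1 + norm (fst u) + norm (snd u))"
  "norm (snd (scatter \<omega> u)) \<le> 2 * (1 + norm (fst u) + norm (snd u))"
proof -
  have *: "norm ((\<omega> \<bullet> (snd u - fst u)) *\<^sub>R \<omega>) \<le> norm (fst u) + norm (snd u)"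
    using Cauchy_Schwarz_ineq2[of \<omega> "snd u - fst u"] \<omega> norm_triangle_ineq4[of "snd u" "fst u"] by simp
  show "norm (fst (scatter \<omega> u)) \<le> 2 * (1 + norm (fst u) + norm (snd u))"
    unfolding scatter_simps by (rule order_trans[OF norm_triangle_ineq order_trans[OF add_left_mono[OF *]]]) simp
  show "norm (snd (scatter \<omega> u)) \<le> 2 * (1 + norm (fst u) + norm (snd u))"
    unfolding scatter_simps by (rule order_trans[OF norm_triangle_ineq4 order_trans[OF add_left_mono[OF *]]]) simp
qed

lemma nn_integral_scatter:
  assumes [measurable]: "f \<in> borel_measurable borel"
  shows "(\<integral>\<^sup>+u. f (scatter \<omega> u) \<partial>lborel) = (\<integral>\<^sup>+u. f u \<partial>lborel)"
  by (rule nn_integral_lborel_isometric_involution[OF scatter_linear scatter_norm scatter_involution]) simp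

lemma gauss_scatter: "gauss s (scatter \<omega> x - scatter \<omega> y) = gauss s (x - y)"
  by (rule gauss_cong_norm) (simp add: linear_diff[OF scatter_linear, symmetric] scatter_norm)

lemma distr_scatter: "distr lborel lborel (scatter \<omega>) = lborel"
proof (rule measure_eqI)
  fix A assume "A \<in> sets (distr lborel lborel (scatter \<omega>))"
  then have [measurable]: "A \<in> sets borel" by simp
  have "emeasure (distr lborel lborel (scatter \<omega>)) A = (\<integral>\<^sup>+u. indicator A u \<partial>distr lborel lborel (scatter \<omega>))"
    by simp
  also have "\<dots> = (\<integral>\<^sup>+u. indicator A (scatter \<omega> u) \<partial>lborel)"
    by (rule nn_integral_distr) measurable
  also have "\<dots> = (\<integral>\<^sup>+u. indicator A u \<partial>lborel)" by (rule nn_integral_scatter) measurable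
  finally show "emeasure (distr lborel lborel (scatter \<omega>)) A = emeasure lborel A" by simp
qed simp

end

section \<open>Weakly continuous paths and their typical flux\<close>

locale vpath =
  fixes e T :: real and \<sigma> :: "(real^'n) measure" and \<pi> :: "real \<Rightarrow> (real^'n) measure"
  assumes T: "T > 0" and haar: "haar_sphere \<sigma>" and cont: "\<pi> \<in> continuous_paths e T"
begin

lemma sets_\<sigma> [measurable_cong, simp]: "sets \<sigma> = sets borel"
  using haar by (simp add: haar_sphere_def)

lemma space_\<sigma> [simp]: "space \<sigma> = UNIV"
  using sets_eq_imp_space_eq[OF sets_\<sigma>] by simp

lemma finite_\<sigma>: "finite_measure \<sigma>"
  using haar by (simp add: haar_sphere_def)

lemma AE_unit: "AE \<omega> in \<sigma>. norm \<omega> = 1"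
proof (rule AE_I[where N = "- sphere 0 1"])
  show "emeasure \<sigma> (- sphere 0 1) = 0" using haar by (simp add: haar_sphere_def)
qed (auto simp: sphere_def dist_norm)

lemma topspace_weak: "topspace (weak_topology e :: (real^'n) measure topology) \<subseteq> velocity_laws e"
  unfolding weak_topology_def topology_generated_by_topspace by auto

lemma laws: "t \<in> {0..T} \<Longrightarrow> \<pi> t \<in> velocity_laws e"
  using cont topspace_weak by (auto simp: continuous_paths_def continuous_map_def)

lemma limitin_at_within:
  assumes "t \<in> {0..T}" shows "limitin (weak_topology e) \<pi> (\<pi> t) (at t within {0..T})"
  unfolding limitin_def
proof (intro conjI allI impI)
  have c: "continuous_map (top_of_set {0..T}) (weak_topology e) \<pi>" using cont by (simp add: continuous_paths_def)
  show "\<pi> t \<in> topspace (weak_topology e)" using c assms by (auto simp: continuous_map_def)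
  fix U assume U: "openin (weak_topology e) U \<and> \<pi> t \<in> U"
  then have "openin (top_of_set {0..T}) {x \<in> {0..T}. \<pi> x \<in> U}" using c by (auto simp: continuous_map_def)
  then obtain W where W: "open W" "{x \<in> {0..T}. \<pi> x \<in> U} = {0..T} \<inter> W" by (auto simp: openin_open)
  then show "\<forall>\<^sub>F x in at t within {0..T}. \<pi> x \<in> U"
    unfolding eventually_at_topological using U assms by blast
qed

text \<open>Both one-sided filters are finer than the filter within the interval; the left limit is
  the value itself. This makes the facts about cadlag paths available.\<close>

lemma cadlag: "\<pi> \<in> cadlag_paths e T"
proof -
  have 1: "limitin (weak_topology e) \<pi> (\<pi> t) (at_right t)" if "t \<in> {0..<T}" for t
  proof -
    have "at t within {t..T} \<le> at t within {0..T}" using that by (intro at_le) auto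
    then have "at_right t \<le> at t within {0..T}" using that by (simp add: at_within_Icc_at_right)
    then show ?thesis using limitin_at_within[of t] that unfolding limitin_def
      by (auto simp: le_filter_def)
  qed
  have 2: "limitin (weak_topology e) \<pi> (\<pi> t) (at_left t)" if "t \<in> {0<..T}" for t
  proof -
    have "at t within {0..t} \<le> at t within {0..T}" using that by (intro at_le) auto
    then have "at_left t \<le> at t within {0..T}" using that by (simp add: at_within_Icc_at_left)
    then show ?thesis using limitin_at_within[of t] that unfolding limitin_def
      by (auto simp: le_filter_def)
  qed
  show ?thesis unfolding cadlag_paths_def using laws 1 2 by fastforce
qed

lemma prob: "t \<in> {0..T} \<Longrightarrow> prob_space (\<pi> t)"
  and sets_\<pi>: "t \<in> {0..T} \<Longrightarrow> sets (\<pi> t) = sets borel"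
  using laws by (auto simp: velocity_laws_def)

lemma space_\<pi>: "t \<in> {0..T} \<Longrightarrow> space (\<pi> t) = UNIV"
  using sets_eq_imp_space_eq[OF sets_\<pi>] by simp

lemma continuous_integral:
  fixes \<phi> :: "real^'n \<Rightarrow> real"
  assumes "continuous_on UNIV \<phi>" "bounded (range \<phi>)"
  shows "continuous_on {0..T} (\<lambda>t. \<integral>v. \<phi> v \<partial>\<pi> t)"
  unfolding continuous_on_def using limitin_weak[OF limitin_at_within assms] by blast

text \<open>A version of the path with all its values probability measures.\<close>

definition ker :: "real \<Rightarrow> (real^'n) measure" where
  "ker t = (if t \<in> {0..T} then \<pi> t else return borel 0)"

lemma ker_measurable: "ker \<in> borel \<rightarrow>\<^sub>M prob_algebra borel"
  unfolding ker_def
proof (rule measurable_If_restrict_space_iff[THEN iffD2])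
  show "{x \<in> space borel. x \<in> {0..T}} \<in> sets borel" by simp
  have "\<pi> \<in> restrict_space borel {x. x \<in> {0..T}} \<rightarrow>\<^sub>M prob_algebra borel"
    unfolding Collect_mem_eq by (rule path_measurable[OF cadlag])
  moreover have "(\<lambda>t. return borel 0) \<in> restrict_space borel {x. x \<notin> {0..T}} \<rightarrow>\<^sub>M prob_algebra borel"
    by (rule measurable_const) (simp add: space_prob_algebra prob_space_return)
  ultimately show "\<pi> \<in> restrict_space borel {x. x \<in> {0..T}} \<rightarrow>\<^sub>M prob_algebra borel \<and>
    (\<lambda>t. return borel 0) \<in> restrict_space borel {x. x \<notin> {0..T}} \<rightarrow>\<^sub>M prob_algebra borel" ..
qed

lemmas ker_sub [measurable] = measurable_prob_algebraD[OF ker_measurable]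

lemma sets_ker [measurable_cong, simp]: "sets (ker t) = sets borel"
  using sets_\<pi> by (simp add: ker_def)

lemma space_ker [simp]: "space (ker t) = UNIV"
  using sets_eq_imp_space_eq[OF sets_ker] by simp

lemma prob_ker: "prob_space (ker t)"
  using prob by (auto simp: ker_def prob_space_return)

definition ker2 :: "real \<Rightarrow> ((real^'n) \<times> (real^'n)) measure" where
  "ker2 t = ker t \<Otimes>\<^sub>M ker t"

lemma ker2_sub [measurable]: "ker2 \<in> borel \<rightarrow>\<^sub>M subprob_algebra borel"
  unfolding ker2_def[abs_def] borel_prod[symmetric] by (intro measurable_pair_measure ker_sub)

lemma sets_ker2 [measurable_cong, simp]: "sets (ker2 t) = sets borel"
  unfolding ker2_def by (rule trans[OF sets_pair_measure_cong[OF sets_ker sets_ker]]) (simp only: borel_prod)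

lemma space_ker2 [simp]: "space (ker2 t) = UNIV"
  using sets_eq_imp_space_eq[OF sets_ker2] by simp

lemma prob_ker2: "prob_space (ker2 t)"
proof -
  interpret prob_space "ker t" by (rule prob_ker)
  interpret P: pair_prob_space "ker t" "ker t" ..
  show ?thesis unfolding ker2_def by (rule P.prob_space_axioms)
qed

lemma nn_integral_ker2:
  assumes [measurable]: "f \<in> borel_measurable borel"
  shows "(\<integral>\<^sup>+u. f u \<partial>ker2 t) = (\<integral>\<^sup>+v. \<integral>\<^sup>+w. f (v, w) \<partial>ker t \<partial>ker t)"
proof -
  interpret prob_space "ker t" by (rule prob_ker)
  have "f \<in> borel_measurable (ker t \<Otimes>\<^sub>M ker t)"
    using assms unfolding measurable_cong_sets[OF sets_ker2[unfolded ker2_def] refl] .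
  from nn_integral_fst[OF this] show ?thesis by (simp add: ker2_def)
qed

abbreviation K :: "'n collision measure" where "K \<equiv> typical_flux T \<sigma> \<pi>"

lemma sets_collision_space: "sets (collision_space T :: 'n collision measure) = sets (restrict_space borel ({0..T} \<times> UNIV))"
  by (simp add: collision_space_def)

lemma slab_borel: "{0..T} \<times> (UNIV :: (((real^'n) \<times> (real^'n)) \<times> ((real^'n) \<times> (real^'n))) set) \<in> sets borel"
  by (intro borel_closed closed_Times) auto

lemma space_collision_space: "space (collision_space T :: 'n collision measure) = {0..T} \<times> UNIV"
  by (simp add: collision_space_def space_restrict_space)

lemma sets_K [measurable_cong, simp]: "sets K = sets (restrict_space borel ({0..T} \<times> UNIV))"
proof -
  have "sets K = sigma_sets ({0..T} \<times> UNIV) (sets (collision_space T :: 'n collision measure))"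
    unfolding typical_flux_def using sets.sets_into_space[of _ "collision_space T :: 'n collision measure"]
    by (intro sets_measure_of) (auto simp: space_collision_space)
  then show ?thesis using sets.sigma_sets_eq[of "collision_space T :: 'n collision measure"]
    by (simp add: space_collision_space sets_collision_space)
qed

lemma space_K [simp]: "space K = {0..T} \<times> UNIV"
  using sets_eq_imp_space_eq[OF sets_K] by (simp add: space_restrict_space)

lemma measurable_K: "f \<in> borel_measurable borel \<Longrightarrow> f \<in> borel_measurable K"
  by (simp add: measurable_cong_sets[OF sets_K refl] measurable_restrict_space1)

text \<open>The typical flux with the direction \<omega> as an integration variable. Keeping
  \<omega> makes the scattering map for fixed \<omega> available, which the image measure on
  outgoing pairs hides.\<close>

definition flux_int :: "('n collision \<Rightarrow> ennreal) \<Rightarrow> ennreal" where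
  "flux_int F = (\<integral>\<^sup>+t. indicator {0..T} t * (\<integral>\<^sup>+u. \<integral>\<^sup>+\<omega>. ennreal (rate \<omega> u / 2) * F (t, u, scatter \<omega> u) \<partial>\<sigma> \<partial>ker2 t) \<partial>lborel)"

lemma nn_integral_\<sigma>_measurable [measurable (raw)]:
  assumes "case_prod f \<in> borel_measurable (M \<Otimes>\<^sub>M borel)"
  shows "(\<lambda>x. \<integral>\<^sup>+\<omega>. f x \<omega> \<partial>\<sigma>) \<in> borel_measurable M"
proof -
  interpret finite_measure \<sigma> by (rule finite_\<sigma>)
  have "case_prod f \<in> borel_measurable (M \<Otimes>\<^sub>M \<sigma>)" using assms by (simp add: measurable_cong_sets[OF sets_pair_measure_cong[OF refl sets_\<sigma>] refl])
  then show ?thesis by (rule borel_measurable_nn_integral)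
qed

lemma nn_integral_ker2_measurable [measurable (raw)]:
  assumes "case_prod f \<in> borel_measurable (M \<Otimes>\<^sub>M borel)" "g \<in> borel_measurable M"
  shows "(\<lambda>x. \<integral>\<^sup>+u. f x u \<partial>ker2 (g x)) \<in> borel_measurable M"
  by (rule nn_integral_measurable_subprob_algebra2[OF assms(1) measurable_compose[OF assms(2) ker2_sub]])

lemma flux_int_measurable [measurable]:
  assumes [measurable]: "F \<in> borel_measurable (borel :: 'n collision measure)"
  shows "(\<lambda>t. \<integral>\<^sup>+u. \<integral>\<^sup>+\<omega>. ennreal (rate \<omega> u / 2) * F (t, u, scatter \<omega> u) \<partial>\<sigma> \<partial>ker2 t) \<in> borel_measurable borel"
    "(\<lambda>(t, u). \<integral>\<^sup>+\<omega>. ennreal (rate \<omega> u / 2) * F (t, u, scatter \<omega> u) \<partial>\<sigma>) \<in> borel_measurable (borel \<Otimes>\<^sub>M borel)"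
  by measurable

lemma nn_integral_K:
  assumes "F \<in> borel_measurable (borel :: 'n collision measure)"
  shows "(\<integral>\<^sup>+z. F z \<partial>K) = flux_int F"
  using assms
proof (induction rule: borel_measurable_induct)
  case (cong f g)
  then have "f = g" by auto
  then show ?case using cong by simp
next
  case (set A)
  then have A[measurable]: "A \<in> sets borel" by simp
  \<comment> \<open>The integrand is Borel on the whole space, whereas the measure lives on the
    slab; other times are cut off before the formula for the measure of sets is applied.\<close>
  let ?A = "A \<inter> ({0..T} \<times> UNIV)"
  have A': "?A \<in> sets (collision_space T)"
    using slab_borel A unfolding sets_collision_space by (subst sets_restrict_space_iff) auto
  have "(\<integral>\<^sup>+z. indicator A z \<partial>K) = emeasure K ?A"
  proof -
    have "(\<integral>\<^sup>+z. indicator A z \<partial>K) = (\<integral>\<^sup>+z. indicator ?A z \<partial>K)"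
      by (intro nn_integral_cong) (auto simp: indicator_def)
    also have "\<dots> = emeasure K ?A" using A' by (intro nn_integral_indicator) (simp add: sets_collision_space)
    finally show ?thesis .
  qed
  also have "\<dots> = (\<integral>\<^sup>+t\<in>{0..T}. (\<integral>\<^sup>+v. (\<integral>\<^sup>+w. 1/2 * emeasure (scattering \<sigma> v w) {z. (t, (v, w), z) \<in> ?A} \<partial>\<pi> t) \<partial>\<pi> t) \<partial>lborel)"
    by (rule emeasure_typical_flux[OF haar cadlag A'])
  also have "\<dots> = flux_int (indicator A)"
    unfolding flux_int_def
  proof (rule nn_integral_cong)
    fix t
    have "(\<integral>\<^sup>+v. (\<integral>\<^sup>+w. 1/2 * emeasure (scattering \<sigma> v w) {z. (t, (v, w), z) \<in> ?A} \<partial>\<pi> t) \<partial>\<pi> t)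
      = (\<integral>\<^sup>+u. \<integral>\<^sup>+\<omega>. ennreal (rate \<omega> u / 2) * indicator A (t, u, scatter \<omega> u) \<partial>\<sigma> \<partial>ker2 t)" if t: "t \<in> {0..T}"
    proof -
      have k: "ker t = \<pi> t" using t by (simp add: ker_def)
      have "1/2 * emeasure (scattering \<sigma> v w) {z. (t, (v, w), z) \<in> ?A} =
          (\<integral>\<^sup>+\<omega>. ennreal (rate \<omega> (v, w) / 2) * indicator A (t, (v, w), scatter \<omega> (v, w)) \<partial>\<sigma>)" for v w
      proof -
        have [measurable]: "post_collision v w \<in> borel_measurable borel" "collision_kernel (v - w) \<in> borel_measurable borel"
          unfolding post_collision_def collision_kernel_def by (intro borel_measurable_continuous_onI continuous_intros)+
        have [measurable]: "{z. (t, (v, w), z) \<in> A} \<in> sets borel" by measurable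
        have "emeasure (scattering \<sigma> v w) {z. (t, (v, w), z) \<in> ?A} = emeasure (scattering \<sigma> v w) {z. (t, (v, w), z) \<in> A}"
          using t by simp
        also have "\<dots> = (\<integral>\<^sup>+\<omega>. ennreal (rate \<omega> (v, w)) * indicator A (t, (v, w), scatter \<omega> (v, w)) \<partial>\<sigma>)"
          unfolding scattering_def
          by (subst emeasure_distr)
             (auto simp: emeasure_density collision_kernel_rate[of "(v, w)", simplified] scatter_def intro!: nn_integral_cong split: split_indicator)
        finally show ?thesis
          by (simp add: nn_integral_cmult[symmetric] divide_ennreal_def ennreal_divide_numeral[symmetric] rate_nonneg mult_ac)
      qed
      then show ?thesis by (subst nn_integral_ker2) (simp_all add: k)
    qed
    then show "(\<integral>\<^sup>+v. (\<integral>\<^sup>+w. 1/2 * emeasure (scattering \<sigma> v w) {z. (t, (v, w), z) \<in> ?A} \<partial>\<pi> t) \<partial>\<pi> t) * indicator {0..T} t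
      = indicator {0..T} t * (\<integral>\<^sup>+u. \<integral>\<^sup>+\<omega>. ennreal (rate \<omega> u / 2) * indicator A (t, u, scatter \<omega> u) \<partial>\<sigma> \<partial>ker2 t)"
      by (simp split: split_indicator)
  qed
  finally show ?case .
next
  case (mult f c)
  note [measurable] = mult(2)
  show ?case using mult
    by (simp add: nn_integral_cmult measurable_K flux_int_def mult.left_commute[of _ c])
next
  case (add f g)
  note [measurable] = add(1,4)
  show ?case using add
    by (simp add: nn_integral_add measurable_K flux_int_def distrib_left)
next
  case (seq U)
  note [measurable] = seq(1)
  note inc = seq(3)
  have 0: "Sup (range U) = (\<lambda>z. SUP i. U i z)" by (rule ext) (simp add: image_comp)
  have "(\<integral>\<^sup>+z. Sup (range U) z \<partial>K) = (SUP i. \<integral>\<^sup>+z. U i z \<partial>K)"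
    unfolding 0 by (rule nn_integral_monotone_convergence_SUP[OF inc measurable_K]) simp
  also have "\<dots> = (SUP i. flux_int (U i))" using seq by simp
  also have "\<dots> = flux_int (\<lambda>z. SUP i. U i z)"
  proof -
    have Ui: "m \<le> n \<Longrightarrow> U m z \<le> U n z" for m n z using inc by (simp only: incseq_def le_fun_def)
    have i1: "incseq (\<lambda>i \<omega>. ennreal (rate \<omega> u / 2) * U i (t, u, scatter \<omega> u))" for t u
      by (intro monoI le_funI mult_left_mono Ui) auto
    have i2: "incseq (\<lambda>i u. \<integral>\<^sup>+\<omega>. ennreal (rate \<omega> u / 2) * U i (t, u, scatter \<omega> u) \<partial>\<sigma>)" for t
      by (intro monoI le_funI mult_left_mono nn_integral_mono Ui) auto
    have i3: "incseq (\<lambda>i t. indicator {0..T} t * (\<integral>\<^sup>+u. \<integral>\<^sup>+\<omega>. ennreal (rate \<omega> u / 2) * U i (t, u, scatter \<omega> u) \<partial>\<sigma> \<partial>ker2 t))"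
      by (intro monoI le_funI mult_left_mono nn_integral_mono Ui) auto
    show ?thesis
      unfolding flux_int_def
      by (simp add: SUP_mult_left_ennreal nn_integral_monotone_convergence_SUP[OF i1] nn_integral_monotone_convergence_SUP[OF i2]
          nn_integral_monotone_convergence_SUP[OF i3])
  qed
  finally show ?case by (simp add: 0)
qed

end

section \<open>Mollified laws\<close>

lemma integrable_nonneg_le:
  fixes f g :: "'a \<Rightarrow> real"
  assumes "integrable M g" "f \<in> borel_measurable M" "\<And>x. 0 \<le> f x" "\<And>x. f x \<le> g x"
  shows "integrable M f"
  by (rule Bochner_Integration.integrable_bound[OF assms(1,2)], rule AE_I2, unfold real_norm_def)
     (rule order_trans[OF _ abs_ge_self], simp add: assms(3,4))

section \<open>Functions of logarithmic growth and Young's inequality\<close>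

definition lg :: "'a::real_normed_vector \<Rightarrow> real" where "lg x = ln (1 + norm x)"

lemma lg_measurable [measurable]: "lg \<in> borel_measurable borel"
  unfolding lg_def by measurable

lemma lg_nonneg: "lg x \<ge> 0" by (simp add: lg_def)

lemma lg_le: "lg x \<le> lg y + norm (x - y)"
  using ln_norm_lipschitz[of x y] by (simp add: lg_def)

lemma lg_le_norm: "lg x \<le> norm x"
  using lg_le[of x 0] by (simp add: lg_def)

lemma weight_le: "weight (x::'a::euclidean_space) \<le> weight (0::'a)"
  unfolding weight_def weight0_def using weight0_integral_pos[where ?'a='a]
  by (intro divide_right_mono power_mono) (auto simp: weight0_def divide_le_eq add_pos_nonneg)

lemma lw_bound: "\<exists>C\<ge>0. \<forall>x::'a::euclidean_space. \<bar>lw x\<bar> \<le> C * (1 + lg x)"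
proof (intro exI conjI allI)
  define c where "c = \<bar>ln (\<integral>(y::'a). weight0 y \<partial>lborel)\<bar>"
  fix x :: 'a
  have "\<bar>lw x\<bar> \<le> 3 * DIM('a) * lg x + c"
    using lg_nonneg[of x] by (simp add: lw_eq c_def lg_def[symmetric] abs_if)
  also have "\<dots> \<le> (3 * DIM('a) + c) * (1 + lg x)"
    using lg_nonneg[of x] by (simp add: c_def algebra_simps)
  finally show "\<bar>lw x\<bar> \<le> (3 * DIM('a) + \<bar>ln (\<integral>(y::'a). weight0 y \<partial>lborel)\<bar>) * (1 + lg x)" by (simp add: c_def)
qed simp

text \<open>\<open>lg\<close> is 1-Lipschitz, so its average around \<open>v\<close> exceeds its
  value at \<open>v\<close> by at most the first moment of the Gaussian.\<close>

lemma nn_integral_gauss_lg: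
  fixes v :: "'a::euclidean_space"
  assumes s: "s > 0"
  shows "(\<integral>\<^sup>+x. ennreal (gauss s (x - v) * (1 + lg x)) \<partial>lborel) \<le> ennreal ((1 + s * gauss_moment TYPE('a)) * (1 + lg v))"
proof -
  have g: "gauss_moment TYPE('a) \<ge> 0" by (simp add: gauss_moment_def)
  have "(\<integral>\<^sup>+x. ennreal (gauss s (x - v) * (1 + lg x)) \<partial>lborel)
      \<le> (\<integral>\<^sup>+x. ennreal (1 + lg v) * ennreal (gauss s (x - v)) + ennreal (norm (x - v) * gauss s (x - v)) \<partial>lborel)"
  proof (rule nn_integral_mono)
    fix x
    have "gauss s (x - v) * (1 + lg x) \<le> gauss s (x - v) * (1 + lg v + norm (x - v))"
      using lg_le[of x v] by (intro mult_left_mono) (auto simp: gauss_nonneg)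
    then have "ennreal (gauss s (x - v) * (1 + lg x)) \<le> ennreal ((1 + lg v) * gauss s (x - v) + norm (x - v) * gauss s (x - v))"
      by (intro ennreal_leI) (simp add: algebra_simps)
    then show "ennreal (gauss s (x - v) * (1 + lg x)) \<le> ennreal (1 + lg v) * ennreal (gauss s (x - v)) + ennreal (norm (x - v) * gauss s (x - v))"
      using lg_nonneg[of v] gauss_nonneg[of s "x - v"] by (simp add: ennreal_plus[symmetric] ennreal_mult[symmetric] del: ennreal_plus)
  qed
  also have "\<dots> = ennreal (1 + lg v) + (\<integral>\<^sup>+x. ennreal (norm (x - v) * gauss s (x - v)) \<partial>lborel)"
    using gauss_shift(1)[OF s, of v] by (simp add: nn_integral_add nn_integral_cmult del: ennreal_plus)
  also have "(\<integral>\<^sup>+x. ennreal (norm (x - v) * gauss s (x - v)) \<partial>lborel) = (\<integral>\<^sup>+(x::'a). ennreal (norm x * gauss s x) \<partial>lborel)"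
    using nn_integral_lborel_shift[of "\<lambda>x. ennreal (norm x * gauss s x)" "- v"] by simp
  also have "ennreal (1 + lg v) + \<dots> \<le> ennreal (1 + lg v) + ennreal (s * gauss_moment TYPE('a))"
    by (intro add_left_mono gauss_first_moment s)
  also have "\<dots> = ennreal (1 + lg v + s * gauss_moment TYPE('a))"
    using lg_nonneg[of v] s g by (simp add: ennreal_plus[symmetric] del: ennreal_plus)
  also have "\<dots> \<le> ennreal ((1 + s * gauss_moment TYPE('a)) * (1 + lg v))"
    using lg_nonneg[of v] s g by (intro ennreal_leI) (simp add: algebra_simps)
  finally show ?thesis .
qed

text \<open>Logarithmic growth is stable under Gaussian averaging, with a constant that does not
  depend on the centre \<open>v\<close>.\<close>

lemma gauss_lg_integrable:
  fixes L :: "'a::euclidean_space \<Rightarrow> real"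
  assumes s: "s > 0" and [measurable]: "L \<in> borel_measurable borel" and L: "\<And>x. \<bar>L x\<bar> \<le> C * (1 + lg x)"
  shows "integrable lborel (\<lambda>x. gauss s (x - v) * L x)"
    "\<bar>\<integral>x. gauss s (x - v) * L x \<partial>lborel\<bar> \<le> C * (1 + s * gauss_moment TYPE('a)) * (1 + lg v)"
proof -
  have C: "C \<ge> 0" using L[of 0] by (simp add: lg_def)
  have le: "ennreal (norm (gauss s (x - v) * L x)) \<le> ennreal C * ennreal (gauss s (x - v) * (1 + lg x))" for x
    using mult_left_mono[OF L[of x] gauss_nonneg[of s "x - v"]] gauss_nonneg[of s "x - v"] C lg_nonneg[of x]
    by (auto simp: ennreal_mult[symmetric] abs_mult mult_ac intro!: ennreal_leI)
  have b: "(\<integral>\<^sup>+x. ennreal (norm (gauss s (x - v) * L x)) \<partial>lborel) \<le> ennreal C * ennreal ((1 + s * gauss_moment TYPE('a)) * (1 + lg v))"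
  proof -
    have "(\<integral>\<^sup>+x. ennreal (norm (gauss s (x - v) * L x)) \<partial>lborel) \<le> (\<integral>\<^sup>+x. ennreal C * ennreal (gauss s (x - v) * (1 + lg x)) \<partial>lborel)"
      by (intro nn_integral_mono le)
    also have "\<dots> = ennreal C * (\<integral>\<^sup>+x. ennreal (gauss s (x - v) * (1 + lg x)) \<partial>lborel)"
      by (rule nn_integral_cmult) measurable
    also have "\<dots> \<le> ennreal C * ennreal ((1 + s * gauss_moment TYPE('a)) * (1 + lg v))"
      by (intro mult_left_mono nn_integral_gauss_lg s) simp
    finally show ?thesis .
  qed
  show i: "integrable lborel (\<lambda>x. gauss s (x - v) * L x)"
    by (rule integrableI_bounded) (use b in \<open>auto intro: le_less_trans simp: ennreal_mult_less_top\<close>)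
  have g: "gauss_moment TYPE('a) \<ge> 0" by (simp add: gauss_moment_def)
  have "ennreal (norm (\<integral>x. gauss s (x - v) * L x \<partial>lborel)) \<le> ennreal (C * ((1 + s * gauss_moment TYPE('a)) * (1 + lg v)))"
    using integral_norm_bound_ennreal[OF i] b C s g lg_nonneg[of v] by (simp add: ennreal_mult)
  then show "\<bar>\<integral>x. gauss s (x - v) * L x \<partial>lborel\<bar> \<le> C * (1 + s * gauss_moment TYPE('a)) * (1 + lg v)"
    using C s g lg_nonneg[of v] by (subst (asm) ennreal_le_iff) (auto simp: mult.assoc)
qed

text \<open>Young's inequality for the conjugate functions q ln q - q and exp, obtained from 1 + y
  \<le> exp y at y = a - ln q.\<close>

lemma legendre_exp:
  fixes q a :: real assumes "q \<ge> 0" shows "q * a \<le> q * ln q - q + exp a"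
proof (cases "q = 0")
  case False
  then have q: "q > 0" using assms by simp
  have "1 + (a - ln q) \<le> exp (a - ln q)" by (rule exp_ge_add_one_self)
  then have "q * (1 + (a - ln q)) \<le> q * exp (a - ln q)" using q by (intro mult_left_mono) auto
  also have "\<dots> = exp a" using q by (simp add: exp_diff)
  finally show ?thesis by (simp add: algebra_simps)
qed simp

text \<open>For positive q equality holds at a = ln (q / c), so \<open>c\<close> is the reference
  value with which \<open>q\<close> is compared.\<close>

lemma legendre:
  fixes q c a :: real assumes "q \<ge> 0" "c > 0" shows "q * a \<le> q * ln q - q * ln c - q + c * exp a"
  using legendre_exp[OF assms(1), of "a + ln c"] assms(2) by (simp add: exp_add algebra_simps)

definition comp1 :: "'n::finite collision \<Rightarrow> real^'n" where "comp1 z = fst (fst (snd z))"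
definition comp2 :: "'n::finite collision \<Rightarrow> real^'n" where "comp2 z = snd (fst (snd z))"
definition comp3 :: "'n::finite collision \<Rightarrow> real^'n" where "comp3 z = fst (snd (snd z))"
definition comp4 :: "'n::finite collision \<Rightarrow> real^'n" where "comp4 z = snd (snd (snd z))"

lemmas comp_defs = comp1_def comp2_def comp3_def comp4_def

lemma comp_measurable [measurable]:
  "comp1 \<in> borel_measurable borel" "comp2 \<in> borel_measurable borel"
  "comp3 \<in> borel_measurable borel" "comp4 \<in> borel_measurable borel"
  unfolding comp_defs[abs_def] by (intro borel_measurable_continuous_onI continuous_intros)+

lemma collision_gradient_comp: "collision_gradient \<phi> (snd z) = \<phi> (comp3 z) + \<phi> (comp4 z) - \<phi> (comp1 z) - \<phi> (comp2 z)"
  by (simp add: collision_gradient_def comp_defs split_beta)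

text \<open>By \<open>speed_scatter\<close> this is the collision rate, read off from the endpoints
  so that it is a function on the collision space.\<close>

definition speed :: "'n::finite collision \<Rightarrow> real" where "speed z = norm (comp3 z - comp1 z) / 2"

definition spread :: "'n::finite collision \<Rightarrow> real" where "spread z = 1 + norm (comp1 z) + norm (comp2 z)"

lemma speed_measurable [measurable]: "speed \<in> borel_measurable borel" unfolding speed_def by measurable
lemma spread_measurable [measurable]: "spread \<in> borel_measurable borel" unfolding spread_def by measurable
lemma speed_nonneg: "speed z \<ge> 0" by (simp add: speed_def)
lemma spread_ge_1: "spread z \<ge> 1" by (simp add: spread_def)

lemma speed_scatter: "norm \<omega> = 1 \<Longrightarrow> speed (t, u, scatter \<omega> u) = rate \<omega> u"
  by (simp add: speed_def comp_defs rate_eq_norm)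

text \<open>The four lengths and the rate are at most 2 Z, and 1 + 2 Z \<le> 3 Z; the factor 3 on
  the right absorbs ln 3, which is at most 2.\<close>

lemma lg_comp_scatter:
  assumes "norm \<omega> = 1"
  shows "1 + lg (comp1 (t, u, scatter \<omega> u)) \<le> 3 * (1 + ln (spread (t, u, scatter \<omega> u)))"
    "1 + lg (comp2 (t, u, scatter \<omega> u)) \<le> 3 * (1 + ln (spread (t, u, scatter \<omega> u)))"
    "1 + lg (comp3 (t, u, scatter \<omega> u)) \<le> 3 * (1 + ln (spread (t, u, scatter \<omega> u)))"
    "1 + lg (comp4 (t, u, scatter \<omega> u)) \<le> 3 * (1 + ln (spread (t, u, scatter \<omega> u)))"
    "ln (1 + speed (t, u, scatter \<omega> u)) \<le> 3 * (1 + ln (spread (t, u, scatter \<omega> u)))"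
proof -
  define Z where "Z = 1 + norm (fst u) + norm (snd u)"
  have Z1: "Z \<ge> 1" by (simp add: Z_def)
  have *: "1 + ln (1 + r) \<le> 3 * (1 + ln Z)" if "0 \<le> r" "r \<le> 2 * Z" for r
  proof -
    have "ln (1 + r) \<le> ln (3 * Z)" using that Z1 by (intro ln_mono) auto
    also have "\<dots> = ln 3 + ln Z" using Z1 by (simp add: ln_mult)
    finally show ?thesis using ln_ge_zero[OF Z1] ln_le_minus_one[of "3::real"] by simp
  qed
  have z: "spread (t, u, scatter \<omega> u) = Z" by (simp add: spread_def comp_defs Z_def)
  note n = norm_scatter_le[OF assms, of u, folded Z_def]
  have n1: "norm (fst u) \<le> 2 * Z" "norm (snd u) \<le> 2 * Z" using norm_ge_zero[of "fst u"] norm_ge_zero[of "snd u"] by (simp_all add: Z_def algebra_simps)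
  have n2: "rate \<omega> u \<le> 2 * Z" using rate_le[OF assms, of u] Z1 unfolding Z_def[symmetric] by linarith
  show "1 + lg (comp1 (t, u, scatter \<omega> u)) \<le> 3 * (1 + ln (spread (t, u, scatter \<omega> u)))"
    "1 + lg (comp2 (t, u, scatter \<omega> u)) \<le> 3 * (1 + ln (spread (t, u, scatter \<omega> u)))"
    "1 + lg (comp3 (t, u, scatter \<omega> u)) \<le> 3 * (1 + ln (spread (t, u, scatter \<omega> u)))"
    "1 + lg (comp4 (t, u, scatter \<omega> u)) \<le> 3 * (1 + ln (spread (t, u, scatter \<omega> u)))"
    unfolding z lg_def comp_defs fst_conv snd_conv by (intro * n n1 norm_ge_zero)+
  show "ln (1 + speed (t, u, scatter \<omega> u)) \<le> 3 * (1 + ln (spread (t, u, scatter \<omega> u)))"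
    using *[of "rate \<omega> u"] n2 rate_nonneg[of \<omega> u] unfolding z speed_scatter[OF assms] by linarith
qed

context vpath begin

text \<open>The direction measure is carried by the unit sphere, so only scattered pairs at times in
  {0..T} are charged.\<close>

lemma AE_K:
  assumes [measurable]: "Measurable.pred borel P"
    and P: "\<And>t u \<omega>. t \<in> {0..T} \<Longrightarrow> norm \<omega> = 1 \<Longrightarrow> P (t, u, scatter \<omega> u)"
  shows "AE z in K. P z"
proof -
  have "(\<integral>\<^sup>+z. indicator {z. \<not> P z} z \<partial>K) = flux_int (indicator {z. \<not> P z})"
    by (rule nn_integral_K) measurable
  also have "\<dots> = (\<integral>\<^sup>+t. 0 \<partial>(lborel::real measure))"
    unfolding flux_int_def
  proof (rule nn_integral_cong)
    fix t
    show "indicator {0..T} t * (\<integral>\<^sup>+u. \<integral>\<^sup>+\<omega>. ennreal (rate \<omega> u / 2) * indicator {z. \<not> P z} (t, u, scatter \<omega> u) \<partial>\<sigma> \<partial>ker2 t) = (0::ennreal)"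
    proof (cases "t \<in> {0..T}")
      case True
      have "(\<integral>\<^sup>+\<omega>. ennreal (rate \<omega> u / 2) * indicator {z. \<not> P z} (t, u, scatter \<omega> u) \<partial>\<sigma>) = (\<integral>\<^sup>+\<omega>. 0 \<partial>\<sigma>)" for u
        by (rule nn_integral_cong_AE) (use AE_unit in \<open>eventually_elim, auto simp: P[OF True]\<close>)
      then show ?thesis by simp
    qed simp
  qed
  finally have "(\<integral>\<^sup>+z. indicator {z. \<not> P z} z \<partial>K) = 0" by simp
  moreover have "(\<lambda>z. indicator {z. \<not> P z} z :: ennreal) \<in> borel_measurable K" by (intro measurable_K) measurable
  ultimately have "AE z in K. (indicator {z. \<not> P z} z :: ennreal) = 0"
    by (subst (asm) nn_integral_0_iff_AE) auto
  then show ?thesis by eventually_elim (auto simp: indicator_def split: if_splits)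
qed

lemma second_moment: "t \<in> {0..T} \<Longrightarrow> (\<integral>\<^sup>+v. ennreal ((norm v)\<^sup>2) \<partial>ker t) \<le> 2 * ennreal e"
proof -
  assume t: "t \<in> {0..T}"
  have "(\<integral>\<^sup>+v. ennreal ((norm v)\<^sup>2) \<partial>ker t) = (\<integral>\<^sup>+v. 2 * ennreal ((norm v)\<^sup>2 / 2) \<partial>ker t)"
    by (intro nn_integral_cong) (simp add: ennreal_mult[symmetric] flip: ennreal_numeral)
  also have "\<dots> = 2 * (\<integral>\<^sup>+v. ennreal ((norm v)\<^sup>2 / 2) \<partial>ker t)" by (rule nn_integral_cmult) measurable
  also have "\<dots> \<le> 2 * ennreal e" using laws[OF t] t by (intro mult_left_mono) (auto simp: velocity_laws_def ker_def)
  finally show ?thesis .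
qed

lemma lg_ker_integrable: "integrable (ker t) lg"
proof (cases "t \<in> {0..T}")
  case True
  interpret k: prob_space "ker t" by (rule prob_ker)
  have "(\<integral>\<^sup>+v. ennreal ((norm v)\<^sup>2) \<partial>ker t) < \<infinity>"
    using second_moment[OF True] by (rule le_less_trans) (simp add: ennreal_mult_less_top)
  then have i: "integrable (ker t) (\<lambda>v. (norm v)\<^sup>2)" by (intro integrableI_nonneg) auto
  have "lg v \<le> 1 + (norm v)\<^sup>2" for v :: "real^'n"
    using lg_le_norm[of v] sum_power2_ge_zero[of "norm v" "norm v - 1"] by (simp add: power2_eq_square algebra_simps)
  then show ?thesis using lg_nonneg
    by (intro integrable_nonneg_le[OF Bochner_Integration.integrable_add[OF k.integrable_const[of 1] i]]) auto
next
  case False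
  then show ?thesis
    by (intro integrableI_bounded) (auto simp: ker_def nn_integral_return)
qed

text \<open>The rate is itself at most \<open>spread\<close>, so the integrand is of second order in
  the incoming velocities and the energy bound applies.\<close>

lemma nn_integral_spread: "(\<integral>\<^sup>+z. ennreal (spread z) \<partial>K) < \<infinity>"
proof -
  interpret S: finite_measure \<sigma> by (rule finite_\<sigma>)
  define c where "c = emeasure \<sigma> UNIV"
  have c: "c < \<infinity>" using S.emeasure_finite[of UNIV] unfolding c_def by (metis infinity_ennreal_def top.not_eq_extremum)
  define M where "M = (1 + 2 * (2 * ennreal e) + 2 * (2 * ennreal e))"
  have M: "M < \<infinity>" by (simp add: M_def ennreal_mult_less_top)
  note mom = second_moment
  have "(\<integral>\<^sup>+z. ennreal (spread z) \<partial>K) = flux_int (\<lambda>z. ennreal (spread z))" by (rule nn_integral_K) measurable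
  also have "\<dots> \<le> (\<integral>\<^sup>+t. indicator {0..T} t * (3 * M * c) \<partial>lborel)"
    unfolding flux_int_def
  proof (rule nn_integral_mono)
    fix t
    show "indicator {0..T} t * (\<integral>\<^sup>+u. \<integral>\<^sup>+\<omega>. ennreal (rate \<omega> u / 2) * ennreal (spread (t, u, scatter \<omega> u)) \<partial>\<sigma> \<partial>ker2 t) \<le> indicator {0..T} t * (3 * M * c)"
    proof (cases "t \<in> {0..T}")
      case True
      interpret k: prob_space "ker t" by (rule prob_ker)
      have "(\<integral>\<^sup>+\<omega>. ennreal (rate \<omega> u / 2) * ennreal (spread (t, u, scatter \<omega> u)) \<partial>\<sigma>) \<le> ennreal (3 * (1 + (norm (fst u))\<^sup>2 + (norm (snd u))\<^sup>2)) * c" for u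
      proof -
        have "(\<integral>\<^sup>+\<omega>. ennreal (rate \<omega> u / 2) * ennreal (spread (t, u, scatter \<omega> u)) \<partial>\<sigma>) \<le> (\<integral>\<^sup>+\<omega>. ennreal (3 * (1 + (norm (fst u))\<^sup>2 + (norm (snd u))\<^sup>2)) \<partial>\<sigma>)"
        proof (rule nn_integral_mono_AE)
          show "AE \<omega> in \<sigma>. ennreal (rate \<omega> u / 2) * ennreal (spread (t, u, scatter \<omega> u)) \<le> ennreal (3 * (1 + (norm (fst u))\<^sup>2 + (norm (snd u))\<^sup>2))"
            using AE_unit
          proof eventually_elim
            case (elim \<omega>)
            define a b where "a = norm (fst u)" and "b = norm (snd u)"
            have ab: "a \<ge> 0" "b \<ge> 0" by (auto simp: a_def b_def)
            have "rate \<omega> u / 2 * spread (t, u, scatter \<omega> u) \<le> (1 + a + b) * (1 + a + b)"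
              using rate_le[OF elim, of u] rate_nonneg[of \<omega> u] ab by (intro mult_mono) (auto simp: a_def b_def spread_def comp_defs)
            also have "\<dots> \<le> 3 * (1 + a\<^sup>2 + b\<^sup>2)"
              using sum_squares_ge_zero[of "a - 1" "b - 1"] zero_le_square[of "a - b"] by (simp add: power2_eq_square algebra_simps)
            finally have *: "rate \<omega> u / 2 * spread (t, u, scatter \<omega> u) \<le> 3 * (1 + a\<^sup>2 + b\<^sup>2)" .
            have "ennreal (rate \<omega> u / 2) * ennreal (spread (t, u, scatter \<omega> u)) = ennreal (rate \<omega> u / 2 * spread (t, u, scatter \<omega> u))"
              using rate_nonneg[of \<omega> u] spread_ge_1[of "(t, u, scatter \<omega> u)"] by (intro ennreal_mult[symmetric]) auto
            also have "\<dots> \<le> ennreal (3 * (1 + a\<^sup>2 + b\<^sup>2))" by (rule ennreal_leI[OF *])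
            finally show ?case unfolding a_def b_def .
          qed
        qed
        then show ?thesis by (simp add: c_def)
      qed
      then have "(\<integral>\<^sup>+u. \<integral>\<^sup>+\<omega>. ennreal (rate \<omega> u / 2) * ennreal (spread (t, u, scatter \<omega> u)) \<partial>\<sigma> \<partial>ker2 t)
         \<le> (\<integral>\<^sup>+u. ennreal (3 * (1 + (norm (fst u))\<^sup>2 + (norm (snd u))\<^sup>2)) * c \<partial>ker2 t)"
        by (intro nn_integral_mono)
      also have "\<dots> = (\<integral>\<^sup>+v. \<integral>\<^sup>+w. ennreal (3 * (1 + (norm v)\<^sup>2 + (norm w)\<^sup>2)) * c \<partial>ker t \<partial>ker t)"
      proof (rule trans[OF nn_integral_ker2])
        show "(\<lambda>u::(real^'n) \<times> (real^'n). ennreal (3 * (1 + (norm (fst u))\<^sup>2 + (norm (snd u))\<^sup>2)) * c) \<in> borel_measurable borel"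
          unfolding borel_prod[symmetric] by measurable
      qed simp
      also have "\<dots> = (\<integral>\<^sup>+v. \<integral>\<^sup>+w. 3 * c * (1 + ennreal ((norm v)\<^sup>2) + ennreal ((norm w)\<^sup>2)) \<partial>ker t \<partial>ker t)"
        by (intro nn_integral_cong) (simp add: ennreal_mult ennreal_plus mult_ac)
      also have "\<dots> = 3 * c * (1 + (\<integral>\<^sup>+v. ennreal ((norm v)\<^sup>2) \<partial>ker t) + (\<integral>\<^sup>+v. ennreal ((norm v)\<^sup>2) \<partial>ker t))"
        using k.emeasure_space_1 by (simp add: nn_integral_cmult nn_integral_add)
      also have "\<dots> \<le> 3 * c * M" unfolding M_def using mom[OF True]
        by (intro mult_left_mono add_mono order_refl order_trans[OF mom[OF True]]) (auto simp: mult_2)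
      finally show ?thesis using True by (simp add: mult_ac)
    qed simp
  qed
  also have "\<dots> = ennreal T * (3 * M * c)" using T by (simp add: nn_integral_multc)
  also have "\<dots> < \<infinity>" using M c by (simp add: ennreal_mult_less_top)
  finally show ?thesis .
qed

lemma finite_K: "finite_measure K"
proof (rule finite_measureI)
  have "emeasure K (space K) = (\<integral>\<^sup>+z. 1 \<partial>K)" by simp
  also have "\<dots> \<le> (\<integral>\<^sup>+z. ennreal (spread z) \<partial>K)" using spread_ge_1 by (intro nn_integral_mono) (simp add: ennreal_ge_1)
  finally show "emeasure K (space K) \<noteq> \<infinity>" using nn_integral_spread by auto
qed

section \<open>Mollified laws mixed with the weight\<close>

definition dens :: "real \<Rightarrow> real \<Rightarrow> real^'n \<Rightarrow> real" where
  "dens s t x = enn2real (\<integral>\<^sup>+v. ennreal (gauss s (x - v)) \<partial>ker t)"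

lemma nn_integral_ker_measurable [measurable (raw)]:
  assumes "case_prod f \<in> borel_measurable (M \<Otimes>\<^sub>M borel)" "g \<in> borel_measurable M"
  shows "(\<lambda>x. \<integral>\<^sup>+u. f x u \<partial>ker (g x)) \<in> borel_measurable M"
  by (rule nn_integral_measurable_subprob_algebra2[OF assms(1) measurable_compose[OF assms(2) ker_sub]])

lemma dens_measurable [measurable (raw)]:
  assumes [measurable]: "f \<in> borel_measurable M" "g \<in> borel_measurable M"
  shows "(\<lambda>x. dens s (f x) (g x)) \<in> borel_measurable M"
  unfolding dens_def by measurable

lemma ennreal_dens: "ennreal (dens s t x) = (\<integral>\<^sup>+v. ennreal (gauss s (x - v)) \<partial>ker t)"
proof -
  interpret k: prob_space "ker t" by (rule prob_ker)
  have "(\<integral>\<^sup>+v. ennreal (gauss s (x - v)) \<partial>ker t) \<le> (\<integral>\<^sup>+v. ennreal (gauss s (0::real^'n)) \<partial>ker t)"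
    by (intro nn_integral_mono ennreal_leI gauss_le)
  also have "\<dots> < \<infinity>" by (simp add: k.emeasure_space_1[simplified])
  finally show ?thesis by (simp add: dens_def)
qed

lemma dens_nonneg: "dens s t x \<ge> 0" by (simp add: dens_def)

lemma dens_le: "dens s t x \<le> gauss s (0::real^'n)"
proof -
  interpret k: prob_space "ker t" by (rule prob_ker)
  have "ennreal (dens s t x) \<le> (\<integral>\<^sup>+v. ennreal (gauss s (0::real^'n)) \<partial>ker t)"
    unfolding ennreal_dens by (intro nn_integral_mono ennreal_leI gauss_le)
  also have "\<dots> = ennreal (gauss s (0::real^'n))" by (simp add: k.emeasure_space_1[simplified])
  finally show ?thesis by (simp add: gauss_nonneg)
qed

lemma dens_eq: "dens s t x = (\<integral>v. gauss s (x - v) \<partial>ker t)"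
  unfolding dens_def by (intro integral_eq_nn_integral[symmetric]) (auto simp: gauss_nonneg)

lemma nn_integral_dens:
  assumes "s > 0" shows "(\<integral>\<^sup>+x. ennreal (dens s t x) \<partial>lborel) = 1"
proof -
  interpret k: prob_space "ker t" by (rule prob_ker)
  interpret P: pair_sigma_finite lborel "ker t" ..
  have "(\<integral>\<^sup>+x. ennreal (dens s t x) \<partial>lborel) = (\<integral>\<^sup>+v. \<integral>\<^sup>+x. ennreal (gauss s (x - v)) \<partial>lborel \<partial>ker t)"
    unfolding ennreal_dens by (rule P.Fubini'[symmetric]) measurable
  then show ?thesis by (simp add: gauss_shift assms k.emeasure_space_1[simplified])
qed

text \<open>Weak continuity of the path, tested with a Gaussian, which is bounded and
  continuous.\<close>

lemma dens_continuous:
  assumes "s > 0" shows "continuous_on {0..T} (\<lambda>t. dens s t x)"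
proof -
  have "continuous_on {0..T} (\<lambda>t. \<integral>v. gauss s (x - v) \<partial>\<pi> t)"
  proof (rule continuous_integral)
    show "continuous_on UNIV (\<lambda>v. gauss s (x - v))"
      by (intro continuous_on_compose2[OF gauss_continuous[OF assms, of UNIV]] continuous_intros) auto
    show "bounded (range (\<lambda>v. gauss s (x - v)))"
      using gauss_le[of s "x - _"] by (auto simp: bounded_iff gauss_nonneg intro!: exI[of _ "gauss s (0::real^'n)"])
  qed
  then show ?thesis by (rule continuous_on_cong[THEN iffD1, rotated -1]) (auto simp: dens_eq ker_def)
qed

text \<open>Mixing with the weight bounds the mollified law from below, so that \<open>ln (kap \<epsilon> s t x)\<close> grows only
  logarithmically in \<open>x\<close>.\<close>

definition kap :: "real \<Rightarrow> real \<Rightarrow> real \<Rightarrow> real^'n \<Rightarrow> real" where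
  "kap \<epsilon> s t x = (1 - \<epsilon>) * dens s t x + \<epsilon> * weight x"

lemma kap_measurable [measurable (raw)]:
  assumes [measurable]: "f \<in> borel_measurable M" "g \<in> borel_measurable M"
  shows "(\<lambda>x. kap \<epsilon> s (f x) (g x)) \<in> borel_measurable M"
  unfolding kap_def by measurable

definition kap_entropy :: "real \<Rightarrow> real \<Rightarrow> real \<Rightarrow> real" where
  "kap_entropy \<epsilon> s t = (\<integral>x. kap \<epsilon> s t x * ln (kap \<epsilon> s t x) \<partial>lborel)"

text \<open>The kernel moved onto the test function: integrating \<open>Gk\<close> against a measure
  is integrating \<open>ln kap\<close> against the mollified measure.\<close>

definition Gk :: "real \<Rightarrow> real \<Rightarrow> real \<Rightarrow> real^'n \<Rightarrow> real" where
  "Gk \<epsilon> s t v = (\<integral>x. gauss s (x - v) * ln (kap \<epsilon> s t x) \<partial>lborel)"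

lemma Gk_measurable [measurable (raw)]:
  assumes [measurable]: "f \<in> borel_measurable M" "g \<in> borel_measurable M"
  shows "(\<lambda>x. Gk \<epsilon> s (f x) (g x)) \<in> borel_measurable M"
  unfolding Gk_def by measurable

context
  fixes \<epsilon> s :: real
  assumes \<epsilon>: "0 < \<epsilon>" "\<epsilon> < 1" and s: "s > 0"
begin

lemma kap_ge: "kap \<epsilon> s t x \<ge> \<epsilon> * weight x" "kap \<epsilon> s t x \<ge> (1 - \<epsilon>) * dens s t x"
  using \<epsilon> dens_nonneg[of s t x] weight_pos[of x] by (auto simp: kap_def)

lemma kap_pos: "kap \<epsilon> s t x > 0"
  using kap_ge(1)[of x t] \<epsilon> weight_pos[of x] by (auto intro: less_le_trans[OF mult_pos_pos])

lemma kap_mass: "(\<integral>\<^sup>+x. ennreal (kap \<epsilon> s t x) \<partial>lborel) = 1"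
proof -
  have "(\<integral>\<^sup>+x. ennreal (kap \<epsilon> s t x) \<partial>lborel) = (\<integral>\<^sup>+x. ennreal (1 - \<epsilon>) * ennreal (dens s t x) + ennreal \<epsilon> * ennreal (weight x) \<partial>lborel)"
  proof (rule nn_integral_cong)
    fix x
    have "0 \<le> (1 - \<epsilon>) * dens s t x" "0 \<le> \<epsilon> * weight x"
      using \<epsilon> dens_nonneg[of s t x] weight_pos[of x] by (auto intro!: mult_nonneg_nonneg)
    then show "ennreal (kap \<epsilon> s t x) = ennreal (1 - \<epsilon>) * ennreal (dens s t x) + ennreal \<epsilon> * ennreal (weight x)"
      using \<epsilon> dens_nonneg[of s t x] weight_pos[of x] by (simp add: kap_def ennreal_mult)
  qed
  also have "\<dots> = ennreal (1 - \<epsilon>) + ennreal \<epsilon>"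
    using s by (simp add: nn_integral_add nn_integral_cmult nn_integral_dens weight_nn_integral)
  finally show ?thesis using \<epsilon> by (simp add: ennreal_plus[symmetric] del: ennreal_plus)
qed

lemma kap_integral: "integrable lborel (kap \<epsilon> s t)" "(\<integral>x. kap \<epsilon> s t x \<partial>lborel) = 1"
proof -
  show i: "integrable lborel (kap \<epsilon> s t)"
    using kap_mass[of t] kap_pos[of t] by (intro integrableI_nonneg) (auto simp: less_imp_le)
  show "(\<integral>x. kap \<epsilon> s t x \<partial>lborel) = 1"
    using kap_mass[of t] kap_pos[of t] by (subst integral_eq_nn_integral) (auto simp: less_imp_le)
qed

text \<open>From above \<open>kap\<close> is bounded by the peaks of the Gaussian and of the weight,
  from below by \<epsilon> times the weight. The constant is the same for all times, as dominated
  convergence in time requires.\<close>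

lemma ln_kap_bound: "\<exists>C\<ge>0. \<forall>t x. \<bar>ln (kap \<epsilon> s t x)\<bar> \<le> C * (1 + lg x)"
proof -
  obtain C0 where C0: "C0 \<ge> 0" "\<And>x::real^'n. \<bar>lw x\<bar> \<le> C0 * (1 + lg x)" using lw_bound by blast
  define A where "A = gauss s (0::real^'n) + weight (0::real^'n)"
  define C where "C = \<bar>ln A\<bar> + \<bar>ln \<epsilon>\<bar> + C0"
  have "\<bar>ln (kap \<epsilon> s t x)\<bar> \<le> C * (1 + lg x)" for t x
  proof -
    have "kap \<epsilon> s t x \<le> 1 * dens s t x + 1 * weight x"
      unfolding kap_def using \<epsilon> dens_nonneg weight_pos[THEN less_imp_le] by (intro add_mono mult_right_mono) auto
    also have "\<dots> \<le> A" unfolding A_def using dens_le weight_le by (intro add_mono) auto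
    finally have "ln (kap \<epsilon> s t x) \<le> ln A" using kap_pos[of t x] by (intro ln_mono) auto
    moreover have "ln \<epsilon> - lw x \<le> ln (kap \<epsilon> s t x)"
      using ln_mono[OF kap_ge(1)[of x t]] \<epsilon> weight_pos[of x] ln_mult[of \<epsilon> "weight x"] by (simp add: lw_def)
    ultimately have "\<bar>ln (kap \<epsilon> s t x)\<bar> \<le> \<bar>ln A\<bar> + \<bar>ln \<epsilon>\<bar> + \<bar>lw x\<bar>" by linarith
    also have "\<dots> \<le> C * (1 + lg x)"
    proof -
      have "0 \<le> (\<bar>ln A\<bar> + \<bar>ln \<epsilon>\<bar>) * lg x" using lg_nonneg[of x] by (intro mult_nonneg_nonneg) auto
      then show ?thesis using C0(2)[of x] by (simp add: C_def algebra_simps)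
    qed
    finally show ?thesis .
  qed
  moreover have "C \<ge> 0" using C0 by (simp add: C_def)
  ultimately show ?thesis by blast
qed

lemma Gk_bound: "\<exists>C\<ge>0. \<forall>t v. \<bar>Gk \<epsilon> s t v\<bar> \<le> C * (1 + lg v)"
proof -
  obtain C where C: "C \<ge> 0" "\<And>t x. \<bar>ln (kap \<epsilon> s t x)\<bar> \<le> C * (1 + lg x)" using ln_kap_bound by blast
  have "\<bar>Gk \<epsilon> s t v\<bar> \<le> C * (1 + s * gauss_moment TYPE(real^'n)) * (1 + lg v)" for t v
    unfolding Gk_def by (rule gauss_lg_integrable(2)[OF s _ C(2)]) measurable
  then show ?thesis using C s by (intro exI[of _ "C * (1 + s * gauss_moment TYPE(real^'n))"]) (auto simp: gauss_moment_def)
qed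

text \<open>\<open>ln_kap_bound\<close> dominates the integrand uniformly in time. This continuity
  turns sums over a partition of the time interval into an integral in
  \<open>entropy_chain\<close>.\<close>

lemma Gk_continuous: "continuous_on {0..T} (\<lambda>t. Gk \<epsilon> s t v)"
proof -
  obtain C where C: "C \<ge> 0" "\<And>t x. \<bar>ln (kap \<epsilon> s t x)\<bar> \<le> C * (1 + lg x)" using ln_kap_bound by blast
  have "((\<lambda>i. Gk \<epsilon> s (y i) v) \<longlonglongrightarrow> Gk \<epsilon> s t v)" if y: "\<forall>i. y i \<in> {0..T}" and lim: "y \<longlonglongrightarrow> t" and t: "t \<in> {0..T}" for y t
    unfolding Gk_def
  proof (rule integral_dominated_convergence[where w = "\<lambda>x. gauss s (x - v) * (C * (1 + lg x))"])
    show "integrable lborel (\<lambda>x. gauss s (x - v) * (C * (1 + lg x)))"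
      by (rule gauss_lg_integrable(1)[OF s, where C=C]) (use C(1) lg_nonneg in \<open>auto intro!: mult_nonneg_nonneg add_nonneg_nonneg\<close>)
    show "AE x in lborel. (\<lambda>i. gauss s (x - v) * ln (kap \<epsilon> s (y i) x)) \<longlonglongrightarrow> gauss s (x - v) * ln (kap \<epsilon> s t x)"
    proof (rule AE_I2)
      fix x
      have "(\<lambda>i. dens s (y i) x) \<longlonglongrightarrow> dens s t x"
        using continuous_on_tendsto_compose[OF dens_continuous[OF s] lim t] y by auto
      then show "(\<lambda>i. gauss s (x - v) * ln (kap \<epsilon> s (y i) x)) \<longlonglongrightarrow> gauss s (x - v) * ln (kap \<epsilon> s t x)"
        using kap_pos[of t x] unfolding kap_def by (intro tendsto_intros) auto
    qed
    show "AE x in lborel. norm (gauss s (x - v) * ln (kap \<epsilon> s (y i) x)) \<le> gauss s (x - v) * (C * (1 + lg x))" for i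
      using C(2) by (auto simp: abs_mult gauss_nonneg intro!: mult_left_mono)
  qed measurable
  then show ?thesis unfolding continuous_on_sequentially by (auto simp: comp_def)
qed

end

end

section \<open>The entropy inequality for mollified densities\<close>

text \<open>The function \<open>h\<close> is the density of the flux with respect to the typical flux.\<close>

locale flow = vpath e T \<sigma> \<pi>
  for e T :: real and \<sigma> :: "(real^'n) measure" and \<pi> :: "real \<Rightarrow> (real^'n) measure" +
  fixes h :: "'n collision \<Rightarrow> real"
  assumes h_meas [measurable]: "h \<in> borel_measurable borel" and h_nonneg: "\<And>z. h z \<ge> 0"
    and h_ent: "(\<integral>\<^sup>+z. ennreal (h z * ln (h z) - h z + 1) \<partial>typical_flux T \<sigma> \<pi>) < \<infinity>"
    and balance: "\<And>s x a b. s > 0 \<Longrightarrow> 0 \<le> a \<Longrightarrow> a \<le> b \<Longrightarrow> b \<le> T \<Longrightarrow>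
        (\<integral>v. gauss s (x - v) \<partial>\<pi> b) - (\<integral>v. gauss s (x - v) \<partial>\<pi> a) =
        (\<integral>z. indicator {a<..b} (fst z) * (h z * collision_gradient (\<lambda>v. gauss s (x - v)) (snd z)) \<partial>typical_flux T \<sigma> \<pi>)"
begin

section \<open>Moments of the flux controlled by its entropy\<close>

definition ent :: "'n collision \<Rightarrow> real" where "ent z = h z * ln (h z) - h z + 1"

lemma ent_measurable [measurable]: "ent \<in> borel_measurable borel" unfolding ent_def by measurable

lemma ent_nonneg: "ent z \<ge> 0"
  using legendre_exp[OF h_nonneg[of z], of 0] by (simp add: ent_def)

lemma ent_integrable: "integrable K ent"
  using h_ent ent_nonneg by (intro integrableI_nonneg measurable_K) (auto simp: ent_def)

lemma spread_integrable: "integrable K spread"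
proof (rule integrableI_nonneg)
  show "AE z in K. 0 \<le> spread z" by (intro AE_I2 order_trans[OF zero_le_one spread_ge_1])
qed (use nn_integral_spread in \<open>auto intro!: measurable_K\<close>)

definition lspread :: "'n collision \<Rightarrow> real" where "lspread z = 1 + ln (spread z)"

lemma lspread_measurable [measurable]: "lspread \<in> borel_measurable borel" unfolding lspread_def by measurable

lemma lspread_ge_1: "lspread z \<ge> 1" using spread_ge_1[of z] by (simp add: lspread_def)

text \<open>Young's inequality with the exponents 1 and ln (spread), whose exponentials e and
  \<open>spread\<close> are integrable under \<open>K\<close>. The test functions paired with the
  flux below are compared with \<open>lspread\<close>.\<close>

lemma h_lspread_integrable: "integrable K (\<lambda>z. h z * lspread z)"
proof (rule Bochner_Integration.integrable_bound)
  show "integrable K (\<lambda>z. 2 * ent z + spread z + 2)"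
    using ent_integrable spread_integrable finite_measure.integrable_const[OF finite_K, of "2::real"] by auto
  show "(\<lambda>z. h z * lspread z) \<in> borel_measurable K" by (intro measurable_K) measurable
  have "h z * lspread z \<le> 2 * ent z + spread z + 2" for z
  proof -
    have "h z * 1 \<le> h z * ln (h z) - h z + exp 1" by (rule legendre_exp[OF h_nonneg])
    moreover have "h z * ln (spread z) \<le> h z * ln (h z) - h z + exp (ln (spread z))" by (rule legendre_exp[OF h_nonneg])
    moreover have "exp (ln (spread z)) = spread z" using spread_ge_1[of z] by simp
    moreover have "exp 1 \<le> (3::real)" using e_less_272 by simp
    ultimately show ?thesis by (simp add: lspread_def ent_def algebra_simps)
  qed
  then show "AE z in K. norm (h z * lspread z) \<le> norm (2 * ent z + spread z + 2)"
    using h_nonneg lspread_ge_1 ent_nonneg spread_ge_1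
    by (auto simp: abs_of_nonneg mult_nonneg_nonneg order_trans[OF zero_le_one] intro!: order_trans[OF _ abs_ge_self])
qed

lemma h_integrable: "integrable K h"
proof (rule Bochner_Integration.integrable_bound[OF h_lspread_integrable])
  have "norm (h z) \<le> norm (h z * lspread z)" for z
    using h_nonneg[of z] lspread_ge_1[of z] by (simp add: abs_mult mult_le_cancel_left1)
  then show "AE z in K. norm (h z) \<le> norm (h z * lspread z)" by (intro AE_I2)
qed (intro measurable_K, measurable)

text \<open>Covers the four velocity components of a collision, so that the Fubini argument is
  carried out only once.\<close>

definition admissible :: "('n collision \<Rightarrow> real^'n) \<Rightarrow> bool" where
  "admissible c \<longleftrightarrow> c \<in> borel_measurable borel \<and> (AE z in K. 1 + lg (c z) \<le> 3 * lspread z)"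

lemma admissible_comp: "admissible comp1" "admissible comp2" "admissible comp3" "admissible comp4"
  unfolding admissible_def lspread_def by (intro conjI AE_K lg_comp_scatter comp_measurable; measurable)+

text \<open>Averaging over x first turns the growth of \<open>L\<close> into a multiple of 1 + lg (c
  z), which \<open>h\<close> absorbs because \<open>h * lspread\<close> is integrable. The factor
  \<open>g\<close> is a bounded cut-off, in use the indicator of a time interval.\<close>

lemma component_Fubini:
  fixes L :: "real^'n \<Rightarrow> real"
  assumes s: "s > 0" and L[measurable]: "L \<in> borel_measurable borel" and LC: "\<And>x. \<bar>L x\<bar> \<le> C * (1 + lg x)"
    and c: "admissible c" and g[measurable]: "g \<in> borel_measurable borel" and g1: "\<And>z. \<bar>g z\<bar> \<le> 1"
  shows "integrable (lborel \<Otimes>\<^sub>M K) (\<lambda>(x, z). L x * (g z * (h z * gauss s (x - c z))))"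
    "integrable K (\<lambda>z. g z * (h z * (\<integral>x. gauss s (x - c z) * L x \<partial>lborel)))"
    "(\<integral>x. L x * (\<integral>z. g z * (h z * gauss s (x - c z)) \<partial>K) \<partial>lborel) =
      (\<integral>z. g z * (h z * (\<integral>x. gauss s (x - c z) * L x \<partial>lborel)) \<partial>K)"
    "AE x in lborel. integrable K (\<lambda>z. L x * (g z * (h z * gauss s (x - c z))))"
    "integrable lborel (\<lambda>x. L x * (\<integral>z. g z * (h z * gauss s (x - c z)) \<partial>K))"
proof -
  interpret FK: finite_measure K by (rule finite_K)
  interpret P: pair_sigma_finite "lborel :: (real^'n) measure" K ..
  have cm[measurable]: "c \<in> borel_measurable borel" and cA: "AE z in K. 1 + lg (c z) \<le> 3 * lspread z"
    using c by (auto simp: admissible_def)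
  note [measurable] = measurable_K[OF cm] measurable_K[OF g] measurable_K[OF h_meas]
  have C: "C \<ge> 0" using LC[of 0] by (simp add: lg_def)
  have gm: "gauss_moment TYPE(real^'n) \<ge> 0" by (simp add: gauss_moment_def)
  define D where "D = C * (1 + s * gauss_moment TYPE(real^'n))"
  have D: "D \<ge> 0" using C gm s by (simp add: D_def)
  have inner: "(\<integral>\<^sup>+x. ennreal (norm (L x * (g z * (h z * gauss s (x - c z))))) \<partial>lborel) \<le> ennreal (h z * (D * (1 + lg (c z))))" for z
  proof -
    have "(\<integral>\<^sup>+x. ennreal (norm (L x * (g z * (h z * gauss s (x - c z))))) \<partial>lborel)
       \<le> (\<integral>\<^sup>+x. ennreal (C * h z) * ennreal (gauss s (x - c z) * (1 + lg x)) \<partial>lborel)"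
    proof (rule nn_integral_mono)
      fix x
      have "norm (L x * (g z * (h z * gauss s (x - c z)))) = \<bar>L x\<bar> * \<bar>g z\<bar> * (h z * gauss s (x - c z))"
        using h_nonneg[of z] gauss_nonneg[of s "x - c z"] by (simp add: abs_mult)
      also have "\<dots> \<le> (C * (1 + lg x)) * 1 * (h z * gauss s (x - c z))"
        using LC[of x] g1[of z] h_nonneg[of z] gauss_nonneg[of s "x - c z"] C lg_nonneg[of x]
        by (intro mult_right_mono mult_mono mult_nonneg_nonneg) auto
      finally have "norm (L x * (g z * (h z * gauss s (x - c z)))) \<le> (C * h z) * (gauss s (x - c z) * (1 + lg x))" by (simp add: mult_ac)
      then have "ennreal (norm (L x * (g z * (h z * gauss s (x - c z))))) \<le> ennreal ((C * h z) * (gauss s (x - c z) * (1 + lg x)))"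
        by (rule ennreal_leI)
      also have "\<dots> = ennreal (C * h z) * ennreal (gauss s (x - c z) * (1 + lg x))"
        using C h_nonneg[of z] by (intro ennreal_mult') auto
      finally show "ennreal (norm (L x * (g z * (h z * gauss s (x - c z))))) \<le> ennreal (C * h z) * ennreal (gauss s (x - c z) * (1 + lg x))" .
    qed
    also have "\<dots> = ennreal (C * h z) * (\<integral>\<^sup>+x. ennreal (gauss s (x - c z) * (1 + lg x)) \<partial>lborel)"
      by (rule nn_integral_cmult) measurable
    also have "\<dots> \<le> ennreal (C * h z) * ennreal ((1 + s * gauss_moment TYPE(real^'n)) * (1 + lg (c z)))"
      by (intro mult_left_mono nn_integral_gauss_lg s) simp
    also have "\<dots> = ennreal (h z * (D * (1 + lg (c z))))"
      using C h_nonneg[of z] by (subst ennreal_mult'[symmetric]) (auto simp: D_def mult_ac)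
    finally show ?thesis .
  qed
  have fin: "(\<integral>\<^sup>+z. ennreal (h z * (D * (1 + lg (c z)))) \<partial>K) < \<infinity>"
  proof -
    have "(\<integral>\<^sup>+z. ennreal (h z * (D * (1 + lg (c z)))) \<partial>K) \<le> (\<integral>\<^sup>+z. ennreal (3 * D * (h z * lspread z)) \<partial>K)"
    proof (rule nn_integral_mono_AE)
      show "AE z in K. ennreal (h z * (D * (1 + lg (c z)))) \<le> ennreal (3 * D * (h z * lspread z))"
        using cA
      proof eventually_elim
        case (elim z)
        have "(h z * D) * (1 + lg (c z)) \<le> (h z * D) * (3 * lspread z)"
          using elim D h_nonneg[of z] by (intro mult_left_mono mult_nonneg_nonneg) auto
        then show ?case by (intro ennreal_leI) (simp add: mult_ac)
      qed
    qed
    also have "\<dots> < \<infinity>"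
    proof -
      have "integrable K (\<lambda>z. 3 * D * (h z * lspread z))" by (intro integrable_mult_right h_lspread_integrable)
      then show ?thesis
      proof (subst nn_integral_eq_integral)
        show "AE z in K. 0 \<le> 3 * D * (h z * lspread z)"
          by (intro AE_I2 mult_nonneg_nonneg D h_nonneg order_trans[OF zero_le_one lspread_ge_1]) simp
      qed auto
    qed
    finally show ?thesis .
  qed
  show int: "integrable (lborel \<Otimes>\<^sub>M K) (\<lambda>(x, z). L x * (g z * (h z * gauss s (x - c z))))"
  proof (rule integrableI_bounded)
    have "(\<integral>\<^sup>+w. ennreal (norm (case w of (x, z) \<Rightarrow> L x * (g z * (h z * gauss s (x - c z))))) \<partial>(lborel \<Otimes>\<^sub>M K))
        = (\<integral>\<^sup>+z. \<integral>\<^sup>+x. ennreal (norm (L x * (g z * (h z * gauss s (x - c z))))) \<partial>lborel \<partial>K)"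
      by (subst P.nn_integral_snd[symmetric]) (auto simp: split_beta')
    also have "\<dots> \<le> (\<integral>\<^sup>+z. ennreal (h z * (D * (1 + lg (c z)))) \<partial>K)" by (intro nn_integral_mono inner)
    finally show "(\<integral>\<^sup>+w. ennreal (norm (case w of (x, z) \<Rightarrow> L x * (g z * (h z * gauss s (x - c z))))) \<partial>(lborel \<Otimes>\<^sub>M K)) < \<infinity>"
      using fin by (rule le_less_trans)
  qed measurable
  have e1: "(\<integral>x. L x * (g z * (h z * gauss s (x - c z))) \<partial>lborel) = g z * (h z * (\<integral>x. gauss s (x - c z) * L x \<partial>lborel))" for z
  proof -
    have "(\<integral>x. L x * (g z * (h z * gauss s (x - c z))) \<partial>lborel) = (\<integral>x. (g z * h z) * (gauss s (x - c z) * L x) \<partial>lborel)"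
      by (simp add: mult_ac)
    also have "\<dots> = (g z * h z) * (\<integral>x. gauss s (x - c z) * L x \<partial>lborel)" by (rule integral_mult_right_zero)
    finally show ?thesis by (simp only: mult.assoc)
  qed
  have e2: "(\<integral>z. L x * (g z * (h z * gauss s (x - c z))) \<partial>K) = L x * (\<integral>z. g z * (h z * gauss s (x - c z)) \<partial>K)" for x
    by simp
  show "integrable K (\<lambda>z. g z * (h z * (\<integral>x. gauss s (x - c z) * L x \<partial>lborel)))"
    using P.integrable_snd[OF int] unfolding e1 .
  show "integrable lborel (\<lambda>x. L x * (\<integral>z. g z * (h z * gauss s (x - c z)) \<partial>K))"
    using P.integrable_fst'[OF int] unfolding split_beta fst_conv snd_conv e2 .
  show "AE x in lborel. integrable K (\<lambda>z. L x * (g z * (h z * gauss s (x - c z))))"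
    using P.AE_integrable_fst'[OF int] by simp
  show "(\<integral>x. L x * (\<integral>z. g z * (h z * gauss s (x - c z)) \<partial>K) \<partial>lborel) =
      (\<integral>z. g z * (h z * (\<integral>x. gauss s (x - c z) * L x \<partial>lborel)) \<partial>K)"
    using P.Fubini_integral[OF int] unfolding e1 e2 by simp
qed

text \<open>The four components are summed. The effect is to move the Gaussian kernel from the flux
  onto the function \<open>L\<close>.\<close>

lemma gradient_Fubini:
  fixes L :: "real^'n \<Rightarrow> real"
  assumes s: "s > 0" and L[measurable]: "L \<in> borel_measurable borel" and LC: "\<And>x. \<bar>L x\<bar> \<le> C * (1 + lg x)"
    and g[measurable]: "g \<in> borel_measurable borel" and g1: "\<And>z. \<bar>g z\<bar> \<le> 1"
  defines "G v \<equiv> (\<integral>x. gauss s (x - v) * L x \<partial>lborel)"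
  shows "integrable K (\<lambda>z. g z * (h z * collision_gradient G (snd z)))"
    "(\<integral>x. L x * (\<integral>z. g z * (h z * collision_gradient (\<lambda>v. gauss s (x - v)) (snd z)) \<partial>K) \<partial>lborel) =
      (\<integral>z. g z * (h z * collision_gradient G (snd z)) \<partial>K)"
proof -
  note F = component_Fubini[OF s L LC _ g g1, folded G_def]
  note F1 = F[OF admissible_comp(1)] and F2 = F[OF admissible_comp(2)] and F3 = F[OF admissible_comp(3)] and F4 = F[OF admissible_comp(4)]
  have eq: "g z * (h z * collision_gradient G (snd z)) =
     g z * (h z * G (comp3 z)) + g z * (h z * G (comp4 z)) - g z * (h z * G (comp1 z)) - g z * (h z * G (comp2 z))" for z
    by (simp add: collision_gradient_comp algebra_simps)
  show "integrable K (\<lambda>z. g z * (h z * collision_gradient G (snd z)))"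
    unfolding eq using F1(2) F2(2) F3(2) F4(2) by auto
  have gi: "integrable K (\<lambda>z. g z * (h z * gauss s (x - c z)))" if "admissible c" for c x
  proof (rule Bochner_Integration.integrable_bound)
    have [measurable]: "c \<in> borel_measurable borel" using that by (simp add: admissible_def)
    show "integrable K (\<lambda>z. gauss s (0::real^'n) * h z)" using h_integrable by simp
    show "(\<lambda>z. g z * (h z * gauss s (x - c z))) \<in> borel_measurable K" by (intro measurable_K) measurable
    have "\<bar>g z\<bar> * (h z * gauss s (x - c z)) \<le> 1 * (h z * gauss s (0::real^'n))" for z
      by (intro mult_mono mult_left_mono g1 gauss_le mult_nonneg_nonneg h_nonneg gauss_nonneg) auto
    then have "norm (g z * (h z * gauss s (x - c z))) \<le> norm (gauss s (0::real^'n) * h z)" for z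
      using h_nonneg[of z] gauss_nonneg[of s "x - c z"] gauss_nonneg[of s "0::real^'n"] by (simp add: abs_mult mult_ac)
    then show "AE z in K. norm (g z * (h z * gauss s (x - c z))) \<le> norm (gauss s (0::real^'n) * h z)" by (intro AE_I2)
  qed
  have "(\<integral>z. g z * (h z * collision_gradient (\<lambda>v. gauss s (x - v)) (snd z)) \<partial>K) =
     (\<integral>z. g z * (h z * gauss s (x - comp3 z)) \<partial>K) + (\<integral>z. g z * (h z * gauss s (x - comp4 z)) \<partial>K)
     - (\<integral>z. g z * (h z * gauss s (x - comp1 z)) \<partial>K) - (\<integral>z. g z * (h z * gauss s (x - comp2 z)) \<partial>K)" for x
    using gi[OF admissible_comp(1)] gi[OF admissible_comp(2)] gi[OF admissible_comp(3)] gi[OF admissible_comp(4)]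
    by (simp add: collision_gradient_comp right_diff_distrib distrib_left)
  then have "(\<integral>x. L x * (\<integral>z. g z * (h z * collision_gradient (\<lambda>v. gauss s (x - v)) (snd z)) \<partial>K) \<partial>lborel) =
    (\<integral>x. L x * (\<integral>z. g z * (h z * gauss s (x - comp3 z)) \<partial>K) + L x * (\<integral>z. g z * (h z * gauss s (x - comp4 z)) \<partial>K)
     - L x * (\<integral>z. g z * (h z * gauss s (x - comp1 z)) \<partial>K) - L x * (\<integral>z. g z * (h z * gauss s (x - comp2 z)) \<partial>K) \<partial>lborel)"
    by (simp add: right_diff_distrib distrib_left)
  also have "\<dots> = (\<integral>z. g z * (h z * collision_gradient G (snd z)) \<partial>K)"
    unfolding eq using F1(2,3,5) F2(2,3,5) F3(2,3,5) F4(2,3,5) by simp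
  finally show "(\<integral>x. L x * (\<integral>z. g z * (h z * collision_gradient (\<lambda>v. gauss s (x - v)) (snd z)) \<partial>K) \<partial>lborel) =
      (\<integral>z. g z * (h z * collision_gradient G (snd z)) \<partial>K)" .
qed

section \<open>The entropy increment of a mollified density\<close>

context
  fixes \<epsilon> s :: real
  assumes \<epsilon>: "0 < \<epsilon>" "\<epsilon> < 1" and s: "s > 0"
begin

text \<open>The weight does not depend on time and drops out of the difference.\<close>

lemma kap_diff:
  assumes "0 \<le> a" "a \<le> b" "b \<le> T"
  shows "kap \<epsilon> s b x - kap \<epsilon> s a x =
    (1 - \<epsilon>) * (\<integral>z. indicator {a<..b} (fst z) * (h z * collision_gradient (\<lambda>v. gauss s (x - v)) (snd z)) \<partial>K)"
proof -
  have "dens s b x - dens s a x = (\<integral>z. indicator {a<..b} (fst z) * (h z * collision_gradient (\<lambda>v. gauss s (x - v)) (snd z)) \<partial>K)"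
    using balance[OF s assms, of x] assms by (simp add: dens_eq ker_def)
  then show ?thesis by (simp add: kap_def algebra_simps)
qed

lemma dens_lg_integrable: "integrable lborel (\<lambda>x. dens s t x * (1 + lg x))"
proof (rule integrableI_nonneg)
  interpret k: prob_space "ker t" by (rule prob_ker)
  interpret P: pair_sigma_finite lborel "ker t" ..
  show "AE x in lborel. 0 \<le> dens s t x * (1 + lg x)"
    by (intro AE_I2 mult_nonneg_nonneg add_nonneg_nonneg dens_nonneg lg_nonneg) simp
  have i: "integrable (ker t) (\<lambda>v. (1 + s * gauss_moment TYPE(real^'n)) * (1 + lg v))"
    using lg_ker_integrable by simp
  have "(\<integral>\<^sup>+x. ennreal (dens s t x * (1 + lg x)) \<partial>lborel) = (\<integral>\<^sup>+x. \<integral>\<^sup>+v. ennreal (gauss s (x - v) * (1 + lg x)) \<partial>ker t \<partial>lborel)"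
  proof (rule nn_integral_cong)
    fix x :: "real^'n"
    have "ennreal (dens s t x * (1 + lg x)) = (\<integral>\<^sup>+v. ennreal (gauss s (x - v)) \<partial>ker t) * ennreal (1 + lg x)"
      using lg_nonneg[of x] by (simp add: ennreal_mult dens_nonneg ennreal_dens[symmetric])
    also have "\<dots> = (\<integral>\<^sup>+v. ennreal (gauss s (x - v)) * ennreal (1 + lg x) \<partial>ker t)"
      by (rule nn_integral_multc[symmetric]) measurable
    finally show "ennreal (dens s t x * (1 + lg x)) = (\<integral>\<^sup>+v. ennreal (gauss s (x - v) * (1 + lg x)) \<partial>ker t)"
      using lg_nonneg[of x] by (simp add: ennreal_mult gauss_nonneg)
  qed
  also have "\<dots> = (\<integral>\<^sup>+v. \<integral>\<^sup>+x. ennreal (gauss s (x - v) * (1 + lg x)) \<partial>lborel \<partial>ker t)"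
    by (rule P.Fubini'[symmetric]) measurable
  also have "\<dots> \<le> (\<integral>\<^sup>+v. ennreal ((1 + s * gauss_moment TYPE(real^'n)) * (1 + lg v)) \<partial>ker t)"
    by (intro nn_integral_mono nn_integral_gauss_lg s)
  also have "\<dots> < \<infinity>"
  proof (subst nn_integral_eq_integral[OF i])
    show "AE v in ker t. 0 \<le> (1 + s * gauss_moment TYPE(real^'n)) * (1 + lg v)"
      using s by (intro AE_I2 mult_nonneg_nonneg add_nonneg_nonneg lg_nonneg) (auto simp: gauss_moment_def)
  qed auto
  finally show "(\<integral>\<^sup>+x. ennreal (dens s t x * (1 + lg x)) \<partial>lborel) < \<infinity>" .
qed measurable

lemma weight_lg_integrable: "integrable lborel (\<lambda>x::real^'n. weight x * (1 + lg x))"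
proof (rule Bochner_Integration.integrable_bound[OF weight_norm_integrable])
  have "norm (weight x * (1 + lg x)) \<le> norm (weight x * (1 + norm x))" for x :: "real^'n"
    using lg_nonneg[of x] lg_le_norm[of x] weight_pos[of x] by (simp add: abs_mult)
  then show "AE x::real^'n in lborel. norm (weight x * (1 + lg x)) \<le> norm (weight x * (1 + norm x))" by (intro AE_I2)
qed measurable

lemma kap_lg_integrable: "integrable lborel (\<lambda>x. kap \<epsilon> s t x * (1 + lg x))"
  using Bochner_Integration.integrable_add[OF integrable_mult_right[OF dens_lg_integrable, of "1 - \<epsilon>" t] integrable_mult_right[OF weight_lg_integrable, of \<epsilon>]]
  by (simp add: kap_def algebra_simps)

lemma kap_ln_integrable: "integrable lborel (\<lambda>x. kap \<epsilon> s t x * ln (kap \<epsilon> s r x))"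
proof -
  obtain C where C: "C \<ge> 0" "\<And>t x. \<bar>ln (kap \<epsilon> s t x)\<bar> \<le> C * (1 + lg x)" using ln_kap_bound[OF \<epsilon> s] by blast
  show ?thesis
  proof (rule Bochner_Integration.integrable_bound[OF integrable_mult_right[OF kap_lg_integrable, of C]])
    have "kap \<epsilon> s t x * \<bar>ln (kap \<epsilon> s r x)\<bar> \<le> kap \<epsilon> s t x * (C * (1 + lg x))" for x
      using C(2) kap_pos[OF \<epsilon> s, of t x] by (intro mult_left_mono) auto
    then have "norm (kap \<epsilon> s t x * ln (kap \<epsilon> s r x)) \<le> C * (kap \<epsilon> s t x * (1 + lg x))" for x
      using kap_pos[OF \<epsilon> s, of t x] by (simp add: abs_mult mult_ac)
    then have "norm (kap \<epsilon> s t x * ln (kap \<epsilon> s r x)) \<le> norm (C * (kap \<epsilon> s t x * (1 + lg x)))" for x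
      unfolding real_norm_def by (rule order_trans[OF _ abs_ge_self])
    then show "AE x in lborel. norm (kap \<epsilon> s t x * ln (kap \<epsilon> s r x)) \<le> norm (C * (kap \<epsilon> s t x * (1 + lg x)))"
      by (intro AE_I2)
  qed measurable
qed

text \<open>By convexity the tangent of x ln x at the later value bounds the increment from above.
  The constant part of its slope contributes 0 because both densities have mass one; the logarithmic
  part is evaluated by the balance equation.\<close>

lemma entropy_step:
  assumes ab: "0 \<le> a" "a \<le> b" "b \<le> T"
  shows "kap_entropy \<epsilon> s b - kap_entropy \<epsilon> s a
    \<le> (1 - \<epsilon>) * (\<integral>z. indicator {a<..b} (fst z) * (h z * collision_gradient (Gk \<epsilon> s b) (snd z)) \<partial>K)"
proof -
  obtain C where C: "C \<ge> 0" "\<And>t x. \<bar>ln (kap \<epsilon> s t x)\<bar> \<le> C * (1 + lg x)" using ln_kap_bound[OF \<epsilon> s] by blast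
  have conv: "y * ln y - x * ln x \<le> ln y * (y - x) + (y - x)" if "x > 0" "y > 0" for x y :: real
    using legendre_exp[of x "ln y"] that by (simp add: algebra_simps)
  have "kap_entropy \<epsilon> s b - kap_entropy \<epsilon> s a = (\<integral>x. kap \<epsilon> s b x * ln (kap \<epsilon> s b x) - kap \<epsilon> s a x * ln (kap \<epsilon> s a x) \<partial>lborel)"
    unfolding kap_entropy_def using kap_ln_integrable by simp
  also have "\<dots> \<le> (\<integral>x. (kap \<epsilon> s b x * ln (kap \<epsilon> s b x) - kap \<epsilon> s a x * ln (kap \<epsilon> s b x)) + (kap \<epsilon> s b x - kap \<epsilon> s a x) \<partial>lborel)"
    using kap_ln_integrable kap_integral[OF \<epsilon> s] conv[OF kap_pos[OF \<epsilon> s] kap_pos[OF \<epsilon> s]]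
    by (intro integral_mono Bochner_Integration.integrable_add Bochner_Integration.integrable_diff) (auto simp: algebra_simps)
  also have "\<dots> = (\<integral>x. kap \<epsilon> s b x * ln (kap \<epsilon> s b x) - kap \<epsilon> s a x * ln (kap \<epsilon> s b x) \<partial>lborel)"
    using kap_ln_integrable kap_integral[OF \<epsilon> s] by simp
  also have "\<dots> = (\<integral>x. (1 - \<epsilon>) * (ln (kap \<epsilon> s b x) * (\<integral>z. indicator {a<..b} (fst z) * (h z * collision_gradient (\<lambda>v. gauss s (x - v)) (snd z)) \<partial>K)) \<partial>lborel)"
    by (intro Bochner_Integration.integral_cong refl) (simp only: left_diff_distrib[symmetric] kap_diff[OF ab] mult_ac)
  also have "\<dots> = (1 - \<epsilon>) * (\<integral>x. ln (kap \<epsilon> s b x) * (\<integral>z. indicator {a<..b} (fst z) * (h z * collision_gradient (\<lambda>v. gauss s (x - v)) (snd z)) \<partial>K) \<partial>lborel)"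
    by simp
  also have "(\<integral>x. ln (kap \<epsilon> s b x) * (\<integral>z. indicator {a<..b} (fst z) * (h z * collision_gradient (\<lambda>v. gauss s (x - v)) (snd z)) \<partial>K) \<partial>lborel)
      = (\<integral>z. indicator {a<..b} (fst z) * (h z * collision_gradient (Gk \<epsilon> s b) (snd z)) \<partial>K)"
  proof -
    have m: "(\<lambda>x. ln (kap \<epsilon> s b x)) \<in> borel_measurable borel" by measurable
    have m2: "(\<lambda>z. indicator {a<..b} (fst z) :: real) \<in> borel_measurable (borel :: 'n collision measure)"
      unfolding borel_prod[symmetric] by measurable
    from gradient_Fubini(2)[OF s m C(2) m2] show ?thesis
      unfolding Gk_def[abs_def] by (simp add: indicator_def)
  qed
  finally show ?thesis .
qed

text \<open>The exceptional null set is independent of t, so t may depend on the collision. The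
  constant collects four components, each with the factor 3 of \<open>admissible\<close>.\<close>

lemma Gk_gradient_bound:
  "\<exists>C\<ge>0. AE z in K. \<forall>t. \<bar>h z * collision_gradient (Gk \<epsilon> s t) (snd z)\<bar> \<le> C * (h z * lspread z)"
proof -
  obtain C where C: "C \<ge> 0" "\<And>t v. \<bar>Gk \<epsilon> s t v\<bar> \<le> C * (1 + lg v)" using Gk_bound[OF \<epsilon> s] by blast
  have A: "AE z in K. 1 + lg (comp1 z) \<le> 3 * lspread z" "AE z in K. 1 + lg (comp2 z) \<le> 3 * lspread z"
    "AE z in K. 1 + lg (comp3 z) \<le> 3 * lspread z" "AE z in K. 1 + lg (comp4 z) \<le> 3 * lspread z"
    using admissible_comp by (auto simp: admissible_def)
  have "AE z in K. \<forall>t. \<bar>h z * collision_gradient (Gk \<epsilon> s t) (snd z)\<bar> \<le> (12 * C) * (h z * lspread z)"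
    using A
  proof eventually_elim
    case (elim z)
    show ?case
    proof
      fix t
      have b: "\<bar>Gk \<epsilon> s t v\<bar> \<le> 3 * C * lspread z" if "1 + lg v \<le> 3 * lspread z" for v
        using order_trans[OF C(2) mult_left_mono[OF that C(1)], of t] by simp
      have "\<bar>collision_gradient (Gk \<epsilon> s t) (snd z)\<bar> \<le> 12 * C * lspread z"
        unfolding collision_gradient_comp using b[OF elim(1)] b[OF elim(2)] b[OF elim(3)] b[OF elim(4)] by linarith
      then have "h z * \<bar>collision_gradient (Gk \<epsilon> s t) (snd z)\<bar> \<le> h z * (12 * C * lspread z)"
        by (intro mult_left_mono h_nonneg)
      then show "\<bar>h z * collision_gradient (Gk \<epsilon> s t) (snd z)\<bar> \<le> (12 * C) * (h z * lspread z)"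
        using h_nonneg[of z] by (simp add: abs_mult mult_ac)
    qed
  qed
  then show ?thesis using C(1) by (intro exI[of _ "12 * C"]) auto
qed

lemma Gk_gradient_measurable [measurable]:
  "(\<lambda>z. collision_gradient (Gk \<epsilon> s (fst z)) (snd z)) \<in> borel_measurable (borel :: 'n collision measure)"
  "(\<lambda>z. collision_gradient (Gk \<epsilon> s t) (snd z)) \<in> borel_measurable (borel :: 'n collision measure)"
proof -
  have [measurable]: "(fst :: 'n collision \<Rightarrow> real) \<in> borel_measurable borel" by (intro borel_measurable_continuous_onI continuous_intros)
  show "(\<lambda>z. collision_gradient (Gk \<epsilon> s (fst z)) (snd z)) \<in> borel_measurable (borel :: 'n collision measure)"
    "(\<lambda>z. collision_gradient (Gk \<epsilon> s t) (snd z)) \<in> borel_measurable (borel :: 'n collision measure)"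
    unfolding collision_gradient_comp by measurable
qed

text \<open>A single step involves \<open>Gk\<close> only at the right endpoint. Summing over a
  partition and refining it replaces the endpoint by the running time, by dominated
  convergence.\<close>

lemma entropy_chain:
  assumes ab: "0 \<le> a" "a \<le> b" "b \<le> T"
  shows "kap_entropy \<epsilon> s b - kap_entropy \<epsilon> s a
    \<le> (1 - \<epsilon>) * (\<integral>z. indicator {a<..b} (fst z) * (h z * collision_gradient (Gk \<epsilon> s (fst z)) (snd z)) \<partial>K)"
proof (cases "a = b")
  case False
  then have ab': "a < b" using ab by simp
  define p where "p n i = a + (b - a) * real i / real (Suc n)" for n i
  have p0: "p n 0 = a" and pn: "p n (Suc n) = b" for n by (auto simp: p_def)
  have pm: "p n i \<le> p n j" if "i \<le> j" for n i j
    unfolding p_def using that ab' by (intro add_left_mono divide_right_mono mult_left_mono) auto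
  have pr: "0 \<le> p n i" "p n (Suc i) \<le> T" if "i < Suc n" for n i
    using pm[of 0 i n] pm[of "Suc i" "Suc n" n] that ab unfolding p0 pn by auto
  have fstm[measurable]: "(fst :: 'n collision \<Rightarrow> real) \<in> borel_measurable borel" by (intro borel_measurable_continuous_onI continuous_intros)
  define f where "f n z = (\<Sum>i<Suc n. indicator {p n i<..p n (Suc i)} (fst z) * (h z * collision_gradient (Gk \<epsilon> s (p n (Suc i))) (snd z)))" for n z
  obtain C where C: "C \<ge> 0" "AE z in K. \<forall>t. \<bar>h z * collision_gradient (Gk \<epsilon> s t) (snd z)\<bar> \<le> C * (h z * lspread z)"
    using Gk_gradient_bound by blast
  have Cint: "integrable K (\<lambda>z. C * (h z * lspread z))" using h_lspread_integrable by simp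
  have int: "integrable K (\<lambda>z. indicator I (fst z) * (h z * collision_gradient (Gk \<epsilon> s t) (snd z)))" if [measurable]: "I \<in> sets borel" for I t
  proof (rule Bochner_Integration.integrable_bound[OF Cint])
    show "AE z in K. norm (indicator I (fst z) * (h z * collision_gradient (Gk \<epsilon> s t) (snd z))) \<le> norm (C * (h z * lspread z))"
      using C(2)
    proof eventually_elim
      case (elim z)
      then have "\<bar>h z * collision_gradient (Gk \<epsilon> s t) (snd z)\<bar> \<le> C * (h z * lspread z)" by blast
      then show ?case by (auto simp: indicator_def intro: order_trans[OF _ abs_ge_self])
    qed
  qed (intro measurable_K, measurable)
  have le: "kap_entropy \<epsilon> s b - kap_entropy \<epsilon> s a \<le> (1 - \<epsilon>) * (\<integral>z. f n z \<partial>K)" for n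
  proof -
    have "kap_entropy \<epsilon> s b - kap_entropy \<epsilon> s a = (\<Sum>i<Suc n. kap_entropy \<epsilon> s (p n (Suc i)) - kap_entropy \<epsilon> s (p n i))"
      by (subst sum_lessThan_telescope) (simp add: p0 pn)
    also have "\<dots> \<le> (\<Sum>i<Suc n. (1 - \<epsilon>) * (\<integral>z. indicator {p n i<..p n (Suc i)} (fst z) * (h z * collision_gradient (Gk \<epsilon> s (p n (Suc i))) (snd z)) \<partial>K))"
      using pr by (intro sum_mono entropy_step pm) auto
    also have "\<dots> = (1 - \<epsilon>) * (\<integral>z. f n z \<partial>K)"
    proof -
      have "(\<integral>z. f n z \<partial>K) = (\<Sum>i<Suc n. (\<integral>z. indicator {p n i<..p n (Suc i)} (fst z) * (h z * collision_gradient (Gk \<epsilon> s (p n (Suc i))) (snd z)) \<partial>K))"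
        unfolding f_def by (intro Bochner_Integration.integral_sum int) simp
      then show ?thesis by (simp only: sum_distrib_left)
    qed
    finally show ?thesis .
  qed
  \<comment> \<open>The right endpoint of the half-open cell that contains t.\<close>
  define c where "c n t = a + (b - a) * of_int \<lceil>(t - a) / (b - a) * real (Suc n)\<rceil> / real (Suc n)" for n t
  have feq: "f n z = indicator {a<..b} (fst z) * (h z * collision_gradient (Gk \<epsilon> s (c n (fst z))) (snd z))" for n z
  proof -
    have ceq: "c n t = p n (Suc i)" if t: "t \<in> {p n i<..p n (Suc i)}" for t i
    proof -
      have 1: "(b - a) * real i / real (Suc n) < t - a" "t - a \<le> (b - a) * real (Suc i) / real (Suc n)"
        using t by (auto simp: p_def)
      have "real i < (t - a) / (b - a) * real (Suc n)" "(t - a) / (b - a) * real (Suc n) \<le> real (Suc i)"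
        using 1 ab' by (auto simp: field_simps simp del: of_nat_Suc)
      then have "\<lceil>(t - a) / (b - a) * real (Suc n)\<rceil> = int (Suc i)" by (intro ceiling_unique) auto
      then show ?thesis by (simp add: c_def p_def)
    qed
    have "indicator {p n i<..p n (Suc i)} (fst z) * (h z * collision_gradient (Gk \<epsilon> s (p n (Suc i))) (snd z)) =
      indicator {p n i<..p n (Suc i)} (fst z) * (h z * collision_gradient (Gk \<epsilon> s (c n (fst z))) (snd z))" for i
      using ceq[of "fst z" i] by (cases "fst z \<in> {p n i<..p n (Suc i)}") simp_all
    then have "f n z = (\<Sum>i<Suc n. indicator {p n i<..p n (Suc i)} (fst z)) * (h z * collision_gradient (Gk \<epsilon> s (c n (fst z))) (snd z))"
      unfolding f_def by (simp only: sum_distrib_right)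
    also have "(\<Sum>i<N. indicator {p n i<..p n (Suc i)} t) = (indicator {p n 0<..p n N} t :: real)" for N t
    proof (induction N)
      case (Suc N)
      then show ?case using pm[of 0 N n] pm[of N "Suc N" n] by (auto simp: indicator_def)
    qed simp
    finally show ?thesis by (simp only: p0 pn)
  qed
  have cb: "t \<le> c n t" "c n t \<le> t + (b - a) / real (Suc n)" for n t
  proof -
    define y where "y = (t - a) / (b - a) * real (Suc n)"
    have t: "t = a + (b - a) * y / real (Suc n)" using ab' by (simp add: y_def)
    have y: "y \<le> of_int \<lceil>y\<rceil>" "of_int \<lceil>y\<rceil> \<le> y + 1" using ceiling_correct[of y] by linarith+
    have "(b - a) * y / real (Suc n) \<le> (b - a) * of_int \<lceil>y\<rceil> / real (Suc n)"
      using y ab' by (intro divide_right_mono mult_left_mono) auto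
    then show "t \<le> c n t" unfolding c_def y_def[symmetric] by (subst t) simp
    have "(b - a) * of_int \<lceil>y\<rceil> / real (Suc n) \<le> (b - a) * (y + 1) / real (Suc n)"
      using y ab' by (intro divide_right_mono mult_left_mono) auto
    then show "c n t \<le> t + (b - a) / real (Suc n)" unfolding c_def y_def[symmetric]
      by (subst t) (simp add: distrib_left add_divide_distrib)
  qed
  have cT: "c n t \<in> {0..T}" if "t \<in> {a<..b}" for n t
  proof -
    have "(t - a) / (b - a) * real (Suc n) \<le> 1 * real (Suc n)" using that ab' by (intro mult_right_mono) auto
    then have "\<lceil>(t - a) / (b - a) * real (Suc n)\<rceil> \<le> int (Suc n)" by (simp add: ceiling_le_iff)
    then have "c n t \<le> a + (b - a) * real (Suc n) / real (Suc n)"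
      unfolding c_def using ab' by (intro add_left_mono divide_right_mono mult_left_mono) (auto simp: le_of_int_ceiling)
    then show ?thesis using cb(1)[of t n] that ab by auto
  qed
  have "(\<lambda>n. \<integral>z. f n z \<partial>K) \<longlonglongrightarrow> (\<integral>z. indicator {a<..b} (fst z) * (h z * collision_gradient (Gk \<epsilon> s (fst z)) (snd z)) \<partial>K)"
  proof (rule integral_dominated_convergence[OF _ _ Cint])
    show "AE z in K. (\<lambda>n. f n z) \<longlonglongrightarrow> indicator {a<..b} (fst z) * (h z * collision_gradient (Gk \<epsilon> s (fst z)) (snd z))"
    proof (rule AE_I2)
      fix z :: "'n collision"
      show "(\<lambda>n. f n z) \<longlonglongrightarrow> indicator {a<..b} (fst z) * (h z * collision_gradient (Gk \<epsilon> s (fst z)) (snd z))"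
      proof (cases "fst z \<in> {a<..b}")
        case True
        have "(\<lambda>n. c n (fst z)) \<longlonglongrightarrow> fst z"
        proof (rule tendsto_sandwich[where f = "\<lambda>_. fst z" and h = "\<lambda>n. fst z + (b - a) / real (Suc n)"])
          have "(\<lambda>n. fst z + (b - a) * inverse (real (Suc n))) \<longlonglongrightarrow> fst z + (b - a) * 0"
            by (intro tendsto_intros LIMSEQ_inverse_real_of_nat)
          then show "(\<lambda>n. fst z + (b - a) / real (Suc n)) \<longlonglongrightarrow> fst z" by (simp add: divide_inverse)
        qed (use cb in \<open>auto intro!: always_eventually\<close>)
        then have "(\<lambda>n. Gk \<epsilon> s (c n (fst z)) v) \<longlonglongrightarrow> Gk \<epsilon> s (fst z) v" for v
          by (rule continuous_on_tendsto_compose[OF Gk_continuous[OF \<epsilon> s]])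
             (use True ab cT[OF True] in \<open>auto intro!: always_eventually\<close>)
        then show ?thesis unfolding feq collision_gradient_comp by (intro tendsto_intros)
      qed (simp add: feq)
    qed
    show "AE z in K. norm (f n z) \<le> C * (h z * lspread z)" for n
      using C(2)
    proof eventually_elim
      case (elim z)
      then have "\<bar>h z * collision_gradient (Gk \<epsilon> s (c n (fst z))) (snd z)\<bar> \<le> C * (h z * lspread z)" by blast
      then show ?case unfolding feq by (auto simp: indicator_def split: if_splits)
    qed
    show "f n \<in> borel_measurable K" for n unfolding f_def by (intro measurable_K) measurable
  qed (intro measurable_K, measurable)
  then show ?thesis
    by (intro LIMSEQ_le_const[OF tendsto_mult_left]) (use le in auto)
qed simp

end

end

section \<open>An entropy bound uniform in the mollification\<close>

lemma borel_measurable_fst [measurable (raw)]: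
  fixes f :: "'c \<Rightarrow> 'a::second_countable_topology \<times> 'b::second_countable_topology"
  assumes "f \<in> borel_measurable M" shows "(\<lambda>x. fst (f x)) \<in> borel_measurable M"
  by (rule measurable_compose[OF assms]) (intro borel_measurable_continuous_onI continuous_intros)

lemma borel_measurable_snd [measurable (raw)]:
  fixes f :: "'c \<Rightarrow> 'a::second_countable_topology \<times> 'b::second_countable_topology"
  assumes "f \<in> borel_measurable M" shows "(\<lambda>x. snd (f x)) \<in> borel_measurable M"
  by (rule measurable_compose[OF assms]) (intro borel_measurable_continuous_onI continuous_intros)

text \<open>\<open>ennreal\<close> maps negative reals to 0, so the right-hand side integrates the
  positive part.\<close>

lemma ennreal_integral_le_nn_integral:
  fixes f :: "'a \<Rightarrow> real"
  assumes f: "integrable M f"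
  shows "ennreal (\<integral>x. f x \<partial>M) \<le> (\<integral>\<^sup>+x. ennreal (f x) \<partial>M)"
proof -
  have i: "integrable M (\<lambda>x. max 0 (f x))" using f by (intro integrable_max) auto
  have "ennreal (\<integral>x. f x \<partial>M) \<le> ennreal (\<integral>x. max 0 (f x) \<partial>M)"
    using f i by (intro ennreal_leI integral_mono) auto
  also have "\<dots> = (\<integral>\<^sup>+x. ennreal (max 0 (f x)) \<partial>M)" using i by (intro nn_integral_eq_integral[symmetric]) auto
  also have "\<dots> = (\<integral>\<^sup>+x. ennreal (f x) \<partial>M)" by (intro nn_integral_cong) (simp add: max_def ennreal_neg)
  finally show ?thesis .
qed

section \<open>Gaussian averages on pairs of velocities\<close>

lemma gauss_prod_integral:
  fixes L :: "'a::euclidean_space \<Rightarrow> real" and M :: "'b::euclidean_space \<Rightarrow> real" and u :: "'a \<times> 'b"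
  assumes s: "s > 0" and [measurable]: "L \<in> borel_measurable borel" and L: "integrable lborel (\<lambda>x. gauss s (x - fst u) * L x)"
    and [measurable]: "M \<in> borel_measurable borel" and M: "integrable lborel (\<lambda>x. gauss s (x - snd u) * M x)"
  shows "integrable lborel (\<lambda>x. gauss s (x - u) * (L (fst x) * M (snd x)))"
    "(\<integral>x. gauss s (x - u) * (L (fst x) * M (snd x)) \<partial>lborel) =
      (\<integral>x. gauss s (x - fst u) * L x \<partial>lborel) * (\<integral>x. gauss s (x - snd u) * M x \<partial>lborel)"
proof -
  have eq: "gauss s (x - u) * (L (fst x) * M (snd x)) = (gauss s (fst x - fst u) * L (fst x)) * (gauss s (snd x - snd u) * M (snd x))" for x
    using gauss_Pair[of s "fst x - fst u" "snd x - snd u"] by (simp add: prod_eq_iff minus_prod_def mult_ac)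
  have i: "integrable (lborel \<Otimes>\<^sub>M lborel) (\<lambda>x. (gauss s (fst x - fst u) * L (fst x)) * (gauss s (snd x - snd u) * M (snd x)))"
  proof (rule lborel_pair.Fubini_integrable)
    show "integrable lborel (\<lambda>x. LBINT y. norm (gauss s (fst (x, y) - fst u) * L (fst (x, y)) * (gauss s (snd (x, y) - snd u) * M (snd (x, y)))))"
      unfolding fst_conv snd_conv norm_mult[of "gauss s (_ - fst u) * L _"] integral_mult_right_zero
      by (intro integrable_mult_left integrable_norm L)
    show "AE x in lborel. integrable lborel (\<lambda>y. gauss s (fst (x, y) - fst u) * L (fst (x, y)) * (gauss s (snd (x, y) - snd u) * M (snd (x, y))))"
      using M by (intro AE_I2) simp
  qed measurable
  then show "integrable lborel (\<lambda>x. gauss s (x - u) * (L (fst x) * M (snd x)))" unfolding eq lborel_prod .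
  have "(\<integral>x. gauss s (x - u) * (L (fst x) * M (snd x)) \<partial>lborel) = (\<integral>x. \<integral>y. (gauss s (x - fst u) * L x) * (gauss s (y - snd u) * M y) \<partial>lborel \<partial>lborel)"
    unfolding eq lborel_prod[symmetric] using lborel_pair.integral_fst'[OF i] by simp
  then show "(\<integral>x. gauss s (x - u) * (L (fst x) * M (snd x)) \<partial>lborel) =
      (\<integral>x. gauss s (x - fst u) * L x \<partial>lborel) * (\<integral>x. gauss s (x - snd u) * M x \<partial>lborel)" by simp
qed

lemma gauss_fst_integral:
  fixes L :: "real^'n \<Rightarrow> real" and u :: "(real^'n) \<times> (real^'n)"
  assumes s: "s > 0" and m: "L \<in> borel_measurable borel" and L: "\<And>v. integrable lborel (\<lambda>x. gauss s (x - v) * L x)"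
  shows "integrable lborel (\<lambda>x. gauss s (x - u) * L (fst x))"
    "(\<integral>x. gauss s (x - u) * L (fst x) \<partial>lborel) = (\<integral>x. gauss s (x - fst u) * L x \<partial>lborel)"
    "integrable lborel (\<lambda>x. gauss s (x - u) * L (snd x))"
    "(\<integral>x. gauss s (x - u) * L (snd x) \<partial>lborel) = (\<integral>x. gauss s (x - snd u) * L x \<partial>lborel)"
  using gauss_prod_integral[OF s m L, of "\<lambda>_. 1" u] gauss_prod_integral[OF s _ _ m L, of "\<lambda>_. 1" u] integral_gauss[OF s, where 'a="real^'n"]
  by simp_all

text \<open>Substitute x by \<open>scatter \<omega> x\<close>: Lebesgue measure is preserved, and
  the Gaussian depends only on a distance that the substitution keeps.\<close>

lemma gauss_scatter_integrals:
  fixes L :: "real^'n \<Rightarrow> real" and u :: "(real^'n) \<times> (real^'n)"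
  assumes s: "s > 0" and m[measurable]: "L \<in> borel_measurable borel" and L: "\<And>v. integrable lborel (\<lambda>x. gauss s (x - v) * L x)"
    and \<omega>: "norm \<omega> = 1"
  shows "integrable lborel (\<lambda>x. gauss s (x - u) * L (fst (scatter \<omega> x)))"
    "(\<integral>x. gauss s (x - u) * L (fst (scatter \<omega> x)) \<partial>lborel) = (\<integral>x. gauss s (x - fst (scatter \<omega> u)) * L x \<partial>lborel)"
    "integrable lborel (\<lambda>x. gauss s (x - u) * L (snd (scatter \<omega> x)))"
    "(\<integral>x. gauss s (x - u) * L (snd (scatter \<omega> x)) \<partial>lborel) = (\<integral>x. gauss s (x - snd (scatter \<omega> u)) * L x \<partial>lborel)"
proof -
  have F: "integrable lborel (\<lambda>x. gauss s (x - u) * g (scatter \<omega> x))"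
      "(\<integral>x. gauss s (x - u) * g (scatter \<omega> x) \<partial>lborel) = (\<integral>x. gauss s (x - scatter \<omega> u) * g x \<partial>lborel)"
    if [measurable]: "g \<in> borel_measurable borel" and g: "integrable lborel (\<lambda>x. gauss s (x - scatter \<omega> u) * g x)" for g :: "(real^'n) \<times> (real^'n) \<Rightarrow> real"
  proof -
    have sm[measurable]: "scatter \<omega> \<in> borel_measurable borel" by measurable
    have g': "integrable (distr lborel lborel (scatter \<omega>)) (\<lambda>x. gauss s (x - scatter \<omega> u) * g x)"
      using g by (simp add: distr_scatter[OF \<omega>])
    show "integrable lborel (\<lambda>x. gauss s (x - u) * g (scatter \<omega> x))"
      using integrable_distr[OF _ g'] by (simp add: gauss_scatter[OF \<omega>])
    have "(\<integral>x. gauss s (x - scatter \<omega> u) * g x \<partial>lborel) = (\<integral>x. gauss s (x - scatter \<omega> u) * g x \<partial>distr lborel lborel (scatter \<omega>))"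
      by (simp add: distr_scatter[OF \<omega>])
    also have "\<dots> = (\<integral>x. gauss s (x - u) * g (scatter \<omega> x) \<partial>lborel)"
      by (subst integral_distr) (auto simp: gauss_scatter[OF \<omega>])
    finally show "(\<integral>x. gauss s (x - u) * g (scatter \<omega> x) \<partial>lborel) = (\<integral>x. gauss s (x - scatter \<omega> u) * g x \<partial>lborel)" by simp
  qed
  note I = gauss_fst_integral[OF s m L, of "scatter \<omega> u"]
  have "(\<lambda>x::(real^'n) \<times> (real^'n). L (fst x)) \<in> borel_measurable borel" "(\<lambda>x::(real^'n) \<times> (real^'n). L (snd x)) \<in> borel_measurable borel" by measurable
  note F1 = F[OF this(1) I(1)] and F2 = F[OF this(2) I(3)]
  show "integrable lborel (\<lambda>x. gauss s (x - u) * L (fst (scatter \<omega> x)))"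
    "(\<integral>x. gauss s (x - u) * L (fst (scatter \<omega> x)) \<partial>lborel) = (\<integral>x. gauss s (x - fst (scatter \<omega> u)) * L x \<partial>lborel)"
    "integrable lborel (\<lambda>x. gauss s (x - u) * L (snd (scatter \<omega> x)))"
    "(\<integral>x. gauss s (x - u) * L (snd (scatter \<omega> x)) \<partial>lborel) = (\<integral>x. gauss s (x - snd (scatter \<omega> u)) * L x \<partial>lborel)"
    using F1 F2 I by simp_all
qed

lemma gauss_scatter_gradient:
  fixes L :: "real^'n \<Rightarrow> real" and u :: "(real^'n) \<times> (real^'n)"
  assumes s: "s > 0" and m: "L \<in> borel_measurable borel" and L: "\<And>v. integrable lborel (\<lambda>x. gauss s (x - v) * L x)"
    and \<omega>: "norm \<omega> = 1"
  shows "integrable lborel (\<lambda>x. gauss s (x - u) * (L (fst (scatter \<omega> x)) + L (snd (scatter \<omega> x)) - L (fst x) - L (snd x)))"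
    "(\<integral>x. gauss s (x - u) * (L (fst (scatter \<omega> x)) + L (snd (scatter \<omega> x)) - L (fst x) - L (snd x)) \<partial>lborel) =
      collision_gradient (\<lambda>v. \<integral>x. gauss s (x - v) * L x \<partial>lborel) (u, scatter \<omega> u)"
  using gauss_scatter_integrals[OF s m L \<omega>, of u] gauss_fst_integral[OF s m L, of u]
  by (simp_all add: collision_gradient_def split_beta distrib_left right_diff_distrib)

context flow begin

text \<open>The entropy integrand of \<open>h\<close> relative to the value \<open>1 / (1 + speed z)\<close>, which compensates
  the unbounded collision rate.\<close>

definition Psi :: "'n collision \<Rightarrow> real" where
  "Psi z = h z * ln (h z) - h z + h z * ln (1 + speed z) + 1 / (1 + speed z)"

lemma Psi_measurable [measurable]: "Psi \<in> borel_measurable borel" unfolding Psi_def by measurable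

text \<open>\<open>legendre\<close> with the reference value 1 / (1 + speed z), whose logarithm is
  the additional term in \<open>Psi\<close>. Once multiplied by the rate, the exponential carries a
  factor rate / (1 + rate) of at most 1.\<close>

lemma Psi_ge: "h z * a \<le> Psi z + exp a / (1 + speed z)" "h z * a \<le> Psi z + (exp a - 1) / (1 + speed z)"
proof -
  have c: "1 / (1 + speed z) > 0" using speed_nonneg[of z] by simp
  have l: "ln (1 / (1 + speed z)) = - ln (1 + speed z)" using speed_nonneg[of z] by (simp add: ln_div)
  show 2: "h z * a \<le> Psi z + (exp a - 1) / (1 + speed z)"
    using legendre[OF h_nonneg c, of z a] by (simp add: l Psi_def diff_divide_distrib)
  have "(exp a - 1) / (1 + speed z) \<le> exp a / (1 + speed z)" using speed_nonneg[of z] by (intro divide_right_mono) auto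
  then show "h z * a \<le> Psi z + exp a / (1 + speed z)" using 2 by linarith
qed

lemma Psi_nonneg: "Psi z \<ge> 0" using Psi_ge(2)[of z 0] by simp

text \<open>The correction for the rate costs only \<open>h\<close> times a logarithm, which
  \<open>h_lspread_integrable\<close> covers.\<close>

lemma Psi_integrable: "integrable K Psi"
proof (rule Bochner_Integration.integrable_bound)
  show "integrable K (\<lambda>z. ent z + 3 * (h z * lspread z))" using ent_integrable h_lspread_integrable by auto
  have "AE z in K. ln (1 + speed z) \<le> 3 * lspread z"
    unfolding lspread_def by (intro AE_K lg_comp_scatter) measurable
  then show "AE z in K. norm (Psi z) \<le> norm (ent z + 3 * (h z * lspread z))"
  proof eventually_elim
    case (elim z)
    have "h z * ln (1 + speed z) \<le> h z * (3 * lspread z)" using elim by (intro mult_left_mono h_nonneg)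
    moreover have "1 / (1 + speed z) \<le> 1" using speed_nonneg[of z] by simp
    ultimately have "Psi z \<le> ent z + 3 * (h z * lspread z)" by (simp add: Psi_def ent_def)
    then show ?case using Psi_nonneg[of z] by simp
  qed
qed (intro measurable_K, measurable)

definition Lam :: "real \<Rightarrow> real \<Rightarrow> real \<Rightarrow> real^'n \<Rightarrow> (real^'n) \<times> (real^'n) \<Rightarrow> real" where
  "Lam \<epsilon> s t \<omega> x = ln (kap \<epsilon> s t (fst (scatter \<omega> x))) + ln (kap \<epsilon> s t (snd (scatter \<omega> x)))
     - ln (kap \<epsilon> s t (fst x)) - ln (kap \<epsilon> s t (snd x))"

definition smass :: real where "smass = measure \<sigma> UNIV"

definition hF :: "real \<Rightarrow> real \<Rightarrow> 'n collision \<Rightarrow> real" where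
  "hF \<epsilon> s z = h z * collision_gradient (Gk \<epsilon> s (fst z)) (snd z)"

context
  fixes \<epsilon> s :: real
  assumes \<epsilon>: "0 < \<epsilon>" "\<epsilon> < 1" and s: "s > 0"
begin

text \<open>For fixed \<omega> averaging a scattered function around u is averaging the function
  around the scattered u, so the collision gradient of \<open>Gk\<close> is a Gaussian average of
  \<open>Lam\<close>.\<close>

lemma Lam_integral:
  assumes "norm \<omega> = 1"
  shows "integrable lborel (\<lambda>x. gauss s (x - u) * Lam \<epsilon> s t \<omega> x)"
    "(\<integral>x. gauss s (x - u) * Lam \<epsilon> s t \<omega> x \<partial>lborel) = collision_gradient (Gk \<epsilon> s t) (u, scatter \<omega> u)"
proof -
  obtain C where C: "C \<ge> 0" "\<And>t x. \<bar>ln (kap \<epsilon> s t x)\<bar> \<le> C * (1 + lg x)" using ln_kap_bound[OF \<epsilon> s] by blast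
  have m: "(\<lambda>x. ln (kap \<epsilon> s t x)) \<in> borel_measurable borel" by measurable
  have i: "integrable lborel (\<lambda>x. gauss s (x - v) * ln (kap \<epsilon> s t x))" for v
    by (rule gauss_lg_integrable(1)[OF s m C(2)])
  from gauss_scatter_gradient[OF s m i assms, of u] show "integrable lborel (\<lambda>x. gauss s (x - u) * Lam \<epsilon> s t \<omega> x)"
    "(\<integral>x. gauss s (x - u) * Lam \<epsilon> s t \<omega> x \<partial>lborel) = collision_gradient (Gk \<epsilon> s t) (u, scatter \<omega> u)"
    by (simp_all add: Lam_def Gk_def[abs_def])
qed

lemma exp_Lam: "exp (Lam \<epsilon> s t \<omega> x) = kap \<epsilon> s t (fst (scatter \<omega> x)) * kap \<epsilon> s t (snd (scatter \<omega> x)) / (kap \<epsilon> s t (fst x) * kap \<epsilon> s t (snd x))"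
  using kap_pos[OF \<epsilon> s] by (simp add: Lam_def exp_add exp_diff)

text \<open>Both the pair law and the Gaussian on pairs are products.\<close>

lemma nn_integral_ker2_gauss: "(\<integral>\<^sup>+u. ennreal (gauss s (x - u)) \<partial>ker2 t) = ennreal (dens s t (fst x) * dens s t (snd x))"
proof -
  have "(\<integral>\<^sup>+u. ennreal (gauss s (x - u)) \<partial>ker2 t) = (\<integral>\<^sup>+v. \<integral>\<^sup>+w. ennreal (gauss s (fst x - v)) * ennreal (gauss s (snd x - w)) \<partial>ker t \<partial>ker t)"
  proof (subst nn_integral_ker2)
    show "(\<integral>\<^sup>+v. \<integral>\<^sup>+w. ennreal (gauss s (x - (v, w))) \<partial>ker t \<partial>ker t) = (\<integral>\<^sup>+v. \<integral>\<^sup>+w. ennreal (gauss s (fst x - v)) * ennreal (gauss s (snd x - w)) \<partial>ker t \<partial>ker t)"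
      by (intro nn_integral_cong) (simp add: gauss_Pair[symmetric] ennreal_mult[symmetric] gauss_nonneg minus_prod_def)
  qed measurable
  also have "\<dots> = ennreal (dens s t (fst x)) * ennreal (dens s t (snd x))"
    by (simp add: nn_integral_cmult nn_integral_multc ennreal_dens)
  finally show ?thesis by (simp add: ennreal_mult dens_nonneg)
qed

lemma kap_kap_mass: "(\<integral>\<^sup>+x. ennreal (kap \<epsilon> s t (fst x) * kap \<epsilon> s t (snd x)) \<partial>lborel) = 1"
proof -
  have "(\<integral>\<^sup>+x. ennreal (kap \<epsilon> s t (fst x) * kap \<epsilon> s t (snd x)) \<partial>lborel) =
     (\<integral>\<^sup>+x. \<integral>\<^sup>+y. ennreal (kap \<epsilon> s t x) * ennreal (kap \<epsilon> s t y) \<partial>lborel \<partial>lborel)"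
    unfolding lborel_prod[symmetric] using kap_pos[OF \<epsilon> s]
    by (subst lborel.nn_integral_fst[symmetric]) (auto simp: ennreal_mult less_imp_le)
  also have "\<dots> = 1" using kap_mass[OF \<epsilon> s] by (simp add: nn_integral_cmult)
  finally show ?thesis .
qed

lemma kap_kap_mass_scatter:
  assumes "norm \<omega> = 1"
  shows "(\<integral>\<^sup>+x. ennreal (kap \<epsilon> s t (fst (scatter \<omega> x)) * kap \<epsilon> s t (snd (scatter \<omega> x))) \<partial>lborel) = 1"
proof -
  have "(\<lambda>x. ennreal (kap \<epsilon> s t (fst x) * kap \<epsilon> s t (snd x))) \<in> borel_measurable (borel :: ((real^'n) \<times> (real^'n)) measure)"
    unfolding borel_prod[symmetric] by measurable
  from nn_integral_scatter[OF assms this] show ?thesis by (simp add: kap_kap_mass)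
qed

lemma Lam_measurable [measurable (raw)]:
  assumes [measurable]: "f \<in> borel_measurable M" "g \<in> borel_measurable M" "k \<in> borel_measurable M"
  shows "(\<lambda>x. Lam \<epsilon> s (f x) (g x) (k x)) \<in> borel_measurable M"
  unfolding Lam_def by measurable

text \<open>After Fubini the pair law contributes \<open>dens\<close> times \<open>dens\<close>, at
  most \<open>kap\<close> times \<open>kap\<close> over (1 - \<epsilon>)^2. This cancels the
  denominator in \<open>exp_Lam\<close> and leaves the outgoing pair density, of mass one since
  scattering preserves Lebesgue measure.\<close>

lemma exp_Lam_mass:
  assumes \<omega>: "norm \<omega> = 1"
  shows "(\<integral>\<^sup>+u. \<integral>\<^sup>+x. ennreal (gauss s (x - u) * exp (Lam \<epsilon> s t \<omega> x)) \<partial>lborel \<partial>ker2 t) \<le> ennreal (1 / (1 - \<epsilon>)\<^sup>2)"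
proof -
  interpret k: prob_space "ker2 t" by (rule prob_ker2)
  interpret P: pair_sigma_finite lborel "ker2 t" ..
  have "(\<integral>\<^sup>+u. \<integral>\<^sup>+x. ennreal (gauss s (x - u) * exp (Lam \<epsilon> s t \<omega> x)) \<partial>lborel \<partial>ker2 t)
    = (\<integral>\<^sup>+x. \<integral>\<^sup>+u. ennreal (gauss s (x - u) * exp (Lam \<epsilon> s t \<omega> x)) \<partial>ker2 t \<partial>lborel)"
    by (rule P.Fubini') measurable
  also have "\<dots> = (\<integral>\<^sup>+x. ennreal (dens s t (fst x) * dens s t (snd x)) * ennreal (exp (Lam \<epsilon> s t \<omega> x)) \<partial>lborel)"
    unfolding nn_integral_ker2_gauss[symmetric]
    by (intro nn_integral_cong) (simp add: ennreal_mult gauss_nonneg nn_integral_multc)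
  also have "\<dots> \<le> (\<integral>\<^sup>+x. ennreal (1 / (1 - \<epsilon>)\<^sup>2) * ennreal (kap \<epsilon> s t (fst (scatter \<omega> x)) * kap \<epsilon> s t (snd (scatter \<omega> x))) \<partial>lborel)"
  proof (rule nn_integral_mono)
    fix x :: "(real^'n) \<times> (real^'n)"
    have d: "dens s t y \<le> kap \<epsilon> s t y / (1 - \<epsilon>)" for y
      using kap_ge(2)[OF \<epsilon> s, of t y] \<epsilon> by (simp add: field_simps)
    have kp: "kap \<epsilon> s t (fst x) > 0" "kap \<epsilon> s t (snd x) > 0" using kap_pos[OF \<epsilon> s] by auto
    have "dens s t (fst x) * dens s t (snd x) \<le> (kap \<epsilon> s t (fst x) / (1 - \<epsilon>)) * (kap \<epsilon> s t (snd x) / (1 - \<epsilon>))"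
      using d dens_nonneg kp \<epsilon> by (intro mult_mono) (auto simp: less_imp_le)
    also have "\<dots> = 1 / (1 - \<epsilon>)\<^sup>2 * (kap \<epsilon> s t (fst x) * kap \<epsilon> s t (snd x))" by (simp add: power2_eq_square)
    finally have "dens s t (fst x) * dens s t (snd x) * exp (Lam \<epsilon> s t \<omega> x)
      \<le> 1 / (1 - \<epsilon>)\<^sup>2 * (kap \<epsilon> s t (fst x) * kap \<epsilon> s t (snd x)) * exp (Lam \<epsilon> s t \<omega> x)" by (rule mult_right_mono) simp
    also have "\<dots> = 1 / (1 - \<epsilon>)\<^sup>2 * (kap \<epsilon> s t (fst (scatter \<omega> x)) * kap \<epsilon> s t (snd (scatter \<omega> x)))"
      unfolding exp_Lam using kp by simp
    finally have le: "dens s t (fst x) * dens s t (snd x) * exp (Lam \<epsilon> s t \<omega> x)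
      \<le> 1 / (1 - \<epsilon>)\<^sup>2 * (kap \<epsilon> s t (fst (scatter \<omega> x)) * kap \<epsilon> s t (snd (scatter \<omega> x)))" .
    have "ennreal (dens s t (fst x) * dens s t (snd x)) * ennreal (exp (Lam \<epsilon> s t \<omega> x)) = ennreal (dens s t (fst x) * dens s t (snd x) * exp (Lam \<epsilon> s t \<omega> x))"
      by (intro ennreal_mult[symmetric] mult_nonneg_nonneg dens_nonneg) simp
    also have "\<dots> \<le> ennreal (1 / (1 - \<epsilon>)\<^sup>2 * (kap \<epsilon> s t (fst (scatter \<omega> x)) * kap \<epsilon> s t (snd (scatter \<omega> x))))"
      by (rule ennreal_leI[OF le])
    also have "\<dots> = ennreal (1 / (1 - \<epsilon>)\<^sup>2) * ennreal (kap \<epsilon> s t (fst (scatter \<omega> x)) * kap \<epsilon> s t (snd (scatter \<omega> x)))"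
      by (intro ennreal_mult mult_nonneg_nonneg less_imp_le[OF kap_pos[OF \<epsilon> s]]) simp
    finally show "ennreal (dens s t (fst x) * dens s t (snd x)) * ennreal (exp (Lam \<epsilon> s t \<omega> x)) \<le> \<dots>" .
  qed
  also have "\<dots> = ennreal (1 / (1 - \<epsilon>)\<^sup>2) * (\<integral>\<^sup>+x. ennreal (kap \<epsilon> s t (fst (scatter \<omega> x)) * kap \<epsilon> s t (snd (scatter \<omega> x))) \<partial>lborel)"
    by (rule nn_integral_cmult) measurable
  also have "\<dots> = ennreal (1 / (1 - \<epsilon>)\<^sup>2)" by (simp add: kap_kap_mass_scatter[OF \<omega>])
  finally show ?thesis .
qed

lemma hF_measurable [measurable]: "(hF \<epsilon> s) \<in> borel_measurable borel"
  unfolding hF_def using Gk_gradient_measurable(1)[OF \<epsilon> s] by measurable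

lemma hF_integrable: "integrable K (hF \<epsilon> s)"
proof -
  obtain C where C: "C \<ge> 0" "AE z in K. \<forall>t. \<bar>h z * collision_gradient (Gk \<epsilon> s t) (snd z)\<bar> \<le> C * (h z * lspread z)"
    using Gk_gradient_bound[OF \<epsilon> s] by blast
  show ?thesis
  proof (rule Bochner_Integration.integrable_bound[OF integrable_mult_right[OF h_lspread_integrable, of C]])
    show "AE z in K. norm ((hF \<epsilon> s) z) \<le> norm (C * (h z * lspread z))"
      using C(2) by eventually_elim (auto simp: hF_def intro: order_trans[OF _ abs_ge_self])
  qed (intro measurable_K, measurable)
qed

text \<open>The difference is a Gaussian average of h times \<open>Lam\<close> minus
  \<open>Psi\<close>, so \<open>Psi_ge\<close> applies under the integral. The rate is absorbed by
  the factor 1 / (1 + speed).\<close>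

lemma hF_minus_Psi_le:
  assumes \<omega>: "norm \<omega> = 1"
  shows "ennreal (rate \<omega> u / 2) * ennreal ((hF \<epsilon> s) (t, u, scatter \<omega> u) - Psi (t, u, scatter \<omega> u))
    \<le> 1/2 * (\<integral>\<^sup>+x. ennreal (gauss s (x - u) * exp (Lam \<epsilon> s t \<omega> x)) \<partial>lborel)"
proof -
  define z where "z = (t, u, scatter \<omega> u)"
  define \<beta> where "\<beta> = 1 / (1 + speed z)"
  have sp: "speed z = rate \<omega> u" unfolding z_def by (rule speed_scatter[OF \<omega>])
  have \<beta>: "\<beta> \<ge> 0" "rate \<omega> u / 2 * \<beta> \<le> 1/2" using rate_nonneg[of \<omega> u] by (auto simp: \<beta>_def sp divide_le_eq)
  have i: "integrable lborel (\<lambda>x. h z * (gauss s (x - u) * Lam \<epsilon> s t \<omega> x) - Psi z * gauss s (x - u))"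
    by (intro Bochner_Integration.integrable_diff integrable_mult_right Lam_integral(1)[OF \<omega>] integral_gauss s)
  have "(hF \<epsilon> s) z - Psi z = (\<integral>x. h z * (gauss s (x - u) * Lam \<epsilon> s t \<omega> x) - Psi z * gauss s (x - u) \<partial>lborel)"
    using Lam_integral[OF \<omega>, of u t] integral_gauss[OF s, of u]
    by (subst Bochner_Integration.integral_diff) (auto simp: hF_def z_def)
  then have "ennreal ((hF \<epsilon> s) z - Psi z) \<le> (\<integral>\<^sup>+x. ennreal (h z * (gauss s (x - u) * Lam \<epsilon> s t \<omega> x) - Psi z * gauss s (x - u)) \<partial>lborel)"
    using ennreal_integral_le_nn_integral[OF i] by simp
  also have "\<dots> \<le> (\<integral>\<^sup>+x. ennreal \<beta> * ennreal (gauss s (x - u) * exp (Lam \<epsilon> s t \<omega> x)) \<partial>lborel)"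
  proof (rule nn_integral_mono)
    fix x
    have "gauss s (x - u) * (h z * Lam \<epsilon> s t \<omega> x) \<le> gauss s (x - u) * (Psi z + exp (Lam \<epsilon> s t \<omega> x) / (1 + speed z))"
      by (intro mult_left_mono Psi_ge gauss_nonneg)
    then have "h z * (gauss s (x - u) * Lam \<epsilon> s t \<omega> x) - Psi z * gauss s (x - u) \<le> \<beta> * (gauss s (x - u) * exp (Lam \<epsilon> s t \<omega> x))"
      by (simp add: \<beta>_def algebra_simps)
    then show "ennreal (h z * (gauss s (x - u) * Lam \<epsilon> s t \<omega> x) - Psi z * gauss s (x - u)) \<le> ennreal \<beta> * ennreal (gauss s (x - u) * exp (Lam \<epsilon> s t \<omega> x))"
      using \<beta>(1) by (subst ennreal_mult'[symmetric]) (auto intro: ennreal_leI)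
  qed
  also have "\<dots> = ennreal \<beta> * (\<integral>\<^sup>+x. ennreal (gauss s (x - u) * exp (Lam \<epsilon> s t \<omega> x)) \<partial>lborel)"
    by (rule nn_integral_cmult) measurable
  finally have "ennreal (rate \<omega> u / 2) * ennreal ((hF \<epsilon> s) z - Psi z) \<le> ennreal (rate \<omega> u / 2) * (ennreal \<beta> * (\<integral>\<^sup>+x. ennreal (gauss s (x - u) * exp (Lam \<epsilon> s t \<omega> x)) \<partial>lborel))"
    by (rule mult_left_mono) simp
  also have "\<dots> = ennreal (rate \<omega> u / 2 * \<beta>) * (\<integral>\<^sup>+x. ennreal (gauss s (x - u) * exp (Lam \<epsilon> s t \<omega> x)) \<partial>lborel)"
    using rate_nonneg[of \<omega> u] \<beta>(1) by (subst ennreal_mult) (auto simp: mult.assoc)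
  also have "\<dots> \<le> ennreal (1/2) * (\<integral>\<^sup>+x. ennreal (gauss s (x - u) * exp (Lam \<epsilon> s t \<omega> x)) \<partial>lborel)"
    by (intro mult_right_mono ennreal_leI \<beta>) simp
  also have "ennreal (1/2) = 1/2" by (simp add: divide_ennreal_def)
  finally show ?thesis unfolding z_def .
qed

lemma hF_bound:
  assumes I[measurable]: "I \<in> sets borel"
  shows "(\<integral>z. indicator I (fst z) * (hF \<epsilon> s) z \<partial>K) \<le> (\<integral>z. Psi z \<partial>K) + 1 / (2 * (1 - \<epsilon>)\<^sup>2) * T * smass"
proof -
  interpret S: finite_measure \<sigma> by (rule finite_\<sigma>)
  have fstm[measurable]: "(fst :: 'n collision \<Rightarrow> real) \<in> borel_measurable borel" by (intro borel_measurable_continuous_onI continuous_intros)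
  define c where "c = 1 / (1 - \<epsilon>)\<^sup>2"
  have c: "c \<ge> 0" by (simp add: c_def)
  have "(\<integral>\<^sup>+z. ennreal ((hF \<epsilon> s) z - Psi z) \<partial>K) = flux_int (\<lambda>z. ennreal ((hF \<epsilon> s) z - Psi z))"
    by (rule nn_integral_K) measurable
  also have "\<dots> \<le> (\<integral>\<^sup>+t. indicator {0..T} t * (ennreal c * emeasure \<sigma> UNIV / 2) \<partial>lborel)"
    unfolding flux_int_def
  proof (intro nn_integral_mono mult_left_mono)
    fix t
    interpret k: prob_space "ker2 t" by (rule prob_ker2)
    interpret P: pair_sigma_finite \<sigma> "ker2 t" ..
    have "(\<integral>\<^sup>+u. \<integral>\<^sup>+\<omega>. ennreal (rate \<omega> u / 2) * ennreal ((hF \<epsilon> s) (t, u, scatter \<omega> u) - Psi (t, u, scatter \<omega> u)) \<partial>\<sigma> \<partial>ker2 t)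
      \<le> (\<integral>\<^sup>+u. \<integral>\<^sup>+\<omega>. 1/2 * (\<integral>\<^sup>+x. ennreal (gauss s (x - u) * exp (Lam \<epsilon> s t \<omega> x)) \<partial>lborel) \<partial>\<sigma> \<partial>ker2 t)"
    proof (rule nn_integral_mono, rule nn_integral_mono_AE)
      fix u
      show "AE \<omega> in \<sigma>. ennreal (rate \<omega> u / 2) * ennreal ((hF \<epsilon> s) (t, u, scatter \<omega> u) - Psi (t, u, scatter \<omega> u)) \<le> 1/2 * (\<integral>\<^sup>+x. ennreal (gauss s (x - u) * exp (Lam \<epsilon> s t \<omega> x)) \<partial>lborel)"
        using AE_unit by eventually_elim (rule hF_minus_Psi_le)
    qed
    also have "\<dots> = (\<integral>\<^sup>+\<omega>. \<integral>\<^sup>+u. 1/2 * (\<integral>\<^sup>+x. ennreal (gauss s (x - u) * exp (Lam \<epsilon> s t \<omega> x)) \<partial>lborel) \<partial>ker2 t \<partial>\<sigma>)"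
      by (rule P.Fubini') measurable
    also have "\<dots> \<le> (\<integral>\<^sup>+\<omega>. 1/2 * ennreal c \<partial>\<sigma>)"
    proof (intro nn_integral_mono_AE)
      show "AE \<omega> in \<sigma>. (\<integral>\<^sup>+u. 1/2 * (\<integral>\<^sup>+x. ennreal (gauss s (x - u) * exp (Lam \<epsilon> s t \<omega> x)) \<partial>lborel) \<partial>ker2 t) \<le> 1/2 * ennreal c"
        using AE_unit
      proof eventually_elim
        case (elim \<omega>)
        have "(\<integral>\<^sup>+u. 1/2 * (\<integral>\<^sup>+x. ennreal (gauss s (x - u) * exp (Lam \<epsilon> s t \<omega> x)) \<partial>lborel) \<partial>ker2 t) = 1/2 * (\<integral>\<^sup>+u. \<integral>\<^sup>+x. ennreal (gauss s (x - u) * exp (Lam \<epsilon> s t \<omega> x)) \<partial>lborel \<partial>ker2 t)"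
          by (rule nn_integral_cmult) measurable
        also have "\<dots> \<le> 1/2 * ennreal c" unfolding c_def by (intro mult_left_mono exp_Lam_mass elim) simp
        finally show ?case .
      qed
    qed
    also have "\<dots> = ennreal c * emeasure \<sigma> UNIV / 2" by (simp add: ennreal_times_divide mult_ac)
    finally show "(\<integral>\<^sup>+u. \<integral>\<^sup>+\<omega>. ennreal (rate \<omega> u / 2) * ennreal ((hF \<epsilon> s) (t, u, scatter \<omega> u) - Psi (t, u, scatter \<omega> u)) \<partial>\<sigma> \<partial>ker2 t) \<le> ennreal c * emeasure \<sigma> UNIV / 2" .
  qed simp
  also have "\<dots> = ennreal (1 / (2 * (1 - \<epsilon>)\<^sup>2) * T * smass)"
  proof -
    have "ennreal c * emeasure \<sigma> UNIV / 2 = ennreal (c * smass / 2)"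
      using c by (simp add: S.emeasure_eq_measure smass_def ennreal_mult[symmetric] divide_ennreal[symmetric])
    then show ?thesis using T c by (simp add: nn_integral_multc ennreal_mult[symmetric] smass_def c_def mult_ac)
  qed
  finally have 1: "(\<integral>\<^sup>+z. ennreal ((hF \<epsilon> s) z - Psi z) \<partial>K) \<le> ennreal (1 / (2 * (1 - \<epsilon>)\<^sup>2) * T * smass)" .
  have iI: "integrable K (\<lambda>z. indicator I (fst z) * f z)" if "integrable K f" for f :: "'n collision \<Rightarrow> real"
  proof (rule Bochner_Integration.integrable_bound[OF that])
    have [measurable]: "f \<in> borel_measurable K" "(\<lambda>z. fst z) \<in> borel_measurable K" using that by (auto intro: measurable_K fstm)
    show "(\<lambda>z. indicator I (fst z) * f z) \<in> borel_measurable K" by measurable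
  qed (auto simp: indicator_def)
  have i2: "integrable K (\<lambda>z. indicator I (fst z) * ((hF \<epsilon> s) z - Psi z))"
    by (intro iI Bochner_Integration.integrable_diff hF_integrable Psi_integrable)
  have "ennreal (\<integral>z. indicator I (fst z) * ((hF \<epsilon> s) z - Psi z) \<partial>K) \<le> (\<integral>\<^sup>+z. ennreal (indicator I (fst z) * ((hF \<epsilon> s) z - Psi z)) \<partial>K)"
    by (rule ennreal_integral_le_nn_integral[OF i2])
  also have "\<dots> \<le> (\<integral>\<^sup>+z. ennreal ((hF \<epsilon> s) z - Psi z) \<partial>K)" by (intro nn_integral_mono) (auto simp: indicator_def)
  also note 1
  finally have 2: "(\<integral>z. indicator I (fst z) * ((hF \<epsilon> s) z - Psi z) \<partial>K) \<le> 1 / (2 * (1 - \<epsilon>)\<^sup>2) * T * smass"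
    using T by (subst (asm) ennreal_le_iff) (auto simp: smass_def intro!: mult_nonneg_nonneg)
  have "(\<integral>z. indicator I (fst z) * (hF \<epsilon> s) z \<partial>K) = (\<integral>z. indicator I (fst z) * ((hF \<epsilon> s) z - Psi z) \<partial>K) + (\<integral>z. indicator I (fst z) * Psi z \<partial>K)"
    using iI[OF Psi_integrable] i2 by (subst Bochner_Integration.integral_add[symmetric]) (auto simp: algebra_simps)
  also have "(\<integral>z. indicator I (fst z) * Psi z \<partial>K) \<le> (\<integral>z. Psi z \<partial>K)"
    using Psi_nonneg by (intro integral_mono iI Psi_integrable) (auto simp: indicator_def)
  finally show ?thesis using 2 by linarith
qed

lemma kap_entropy_le:
  assumes ab: "0 \<le> a" "a \<le> b" "b \<le> T" and \<epsilon>2: "\<epsilon> \<le> 1/2"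
  shows "kap_entropy \<epsilon> s b \<le> kap_entropy \<epsilon> s a + ((\<integral>z. Psi z \<partial>K) + 2 * T * smass)"
proof -
  have "kap_entropy \<epsilon> s b - kap_entropy \<epsilon> s a \<le> (1 - \<epsilon>) * (\<integral>z. indicator {a<..b} (fst z) * (hF \<epsilon> s) z \<partial>K)"
    using entropy_chain[OF \<epsilon> s ab] by (simp add: hF_def)
  also have "\<dots> \<le> (1 - \<epsilon>) * ((\<integral>z. Psi z \<partial>K) + 1 / (2 * (1 - \<epsilon>)\<^sup>2) * T * smass)"
    using \<epsilon> by (intro mult_left_mono hF_bound) auto
  also have "\<dots> \<le> 1 * ((\<integral>z. Psi z \<partial>K) + 2 * T * smass)"
  proof (intro mult_mono add_left_mono mult_right_mono)
    \<comment> \<open>Since \<epsilon> \<le> 1/2, the factor is at most 1 / (2 / 4), the 2 in the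
      statement.\<close>
    have "(1/2)\<^sup>2 \<le> (1 - \<epsilon>)\<^sup>2" using \<epsilon>2 by (intro power_mono) auto
    then show "1 / (2 * (1 - \<epsilon>)\<^sup>2) \<le> 2" using \<epsilon> by (simp add: power_divide divide_le_eq)
    show "0 \<le> (\<integral>z. Psi z \<partial>K) + 1 / (2 * (1 - \<epsilon>)\<^sup>2) * T * smass"
      using T Psi_nonneg by (intro add_nonneg_nonneg mult_nonneg_nonneg Bochner_Integration.integral_nonneg) (auto simp: smass_def)
  qed (use T \<epsilon> in \<open>auto simp: smass_def\<close>)
  finally show ?thesis by simp
qed

end

end

section \<open>Propagation of absolute continuity\<close>

text \<open>The integrand of the relative entropy of k with respect to m. The terms m - k contribute
  0 between probability densities and make the integrand pointwise nonnegative, as Fatou's lemma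
  requires.\<close>

definition psi :: "real \<Rightarrow> real \<Rightarrow> real" where "psi k m = k * ln k - k * ln m - k + m"

lemma psi_nonneg: "k \<ge> 0 \<Longrightarrow> m > 0 \<Longrightarrow> psi k m \<ge> 0"
  using legendre[of k m 0] by (simp add: psi_def)

lemma psi_measurable [measurable (raw)]:
  assumes [measurable]: "f \<in> borel_measurable M" "g \<in> borel_measurable M"
  shows "(\<lambda>x. psi (f x) (g x)) \<in> borel_measurable M"
  unfolding psi_def by measurable

text \<open>Away from 0 the logarithm is continuous. At 0 the product tends to 0 from both sides; on
  the negative side \<open>ln\<close> takes the same value at x and -x.\<close>

lemma tendsto_mult_ln:
  fixes f :: "'a \<Rightarrow> real"
  assumes f: "(f \<longlongrightarrow> l) F" and l: "l \<ge> 0"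
  shows "((\<lambda>x. f x * ln (f x)) \<longlongrightarrow> l * ln l) F"
proof (cases "l = 0")
  case False
  then show ?thesis using assms by (intro tendsto_intros) auto
next
  case True
  have "isCont (\<lambda>x::real. x * ln x) 0"
  proof -
    have 1: "((\<lambda>x::real. x * ln x) \<longlongrightarrow> 0) (at_right 0)" by real_asymp
    have "((\<lambda>x::real. x * ln (- x)) \<longlongrightarrow> 0) (at_left 0)" by real_asymp
    then have 2: "((\<lambda>x::real. x * ln x) \<longlongrightarrow> 0) (at_left 0)" by (simp add: ln_minus)
    show ?thesis unfolding isCont_def using 1 2 by (simp add: filterlim_split_at)
  qed
  then show ?thesis using isCont_tendsto_compose[of l "\<lambda>x. x * ln x", OF _ f] True by simp
qed

lemma mollify_integral:
  fixes A :: "'a::euclidean_space \<Rightarrow> real"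
  assumes A: "integrable lborel A" and s: "s > 0"
  shows "integrable lborel (mollify s A)" "(\<integral>x. mollify s A x \<partial>lborel) = (\<integral>x. A x \<partial>lborel)"
proof -
  note [measurable] = borel_measurable_integrable[OF A]
  have i: "integrable (lborel \<Otimes>\<^sub>M lborel) (\<lambda>(u, x). gauss s (x - u) * A u)"
  proof (rule lborel_pair.Fubini_integrable)
    have "(\<integral>x. norm (gauss s (x - u) * A u) \<partial>lborel) = \<bar>A u\<bar>" for u
      using integral_gauss(2)[OF s, of u] by (simp add: abs_mult gauss_nonneg)
    then show "integrable lborel (\<lambda>u. LBINT x. norm (case (u, x) of (u, x) \<Rightarrow> gauss s (x - u) * A u))"
      using A by simp
    show "AE u in lborel. integrable lborel (\<lambda>x. case (u, x) of (u, x) \<Rightarrow> gauss s (x - u) * A u)"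
      using integral_gauss(1)[OF s, where 'a='a] by (intro AE_I2) simp
  qed measurable
  show "integrable lborel (mollify s A)"
    using lborel_pair.integrable_snd[OF i] by (simp add: mollify_def[abs_def])
  have "(\<integral>x. mollify s A x \<partial>lborel) = (\<integral>u. \<integral>x. gauss s (x - u) * A u \<partial>lborel \<partial>lborel)"
    using lborel_pair.Fubini_integral[OF i] by (simp add: mollify_def[abs_def])
  also have "\<dots> = (\<integral>u. A u \<partial>lborel)" using integral_gauss(2)[OF s, where 'a='a] by simp
  finally show "(\<integral>x. mollify s A x \<partial>lborel) = (\<integral>x. A x \<partial>lborel)" .
qed

lemma mollify_AE_subseq1:
  fixes A :: "'a::euclidean_space \<Rightarrow> real"
  assumes A: "integrable lborel A" and s: "\<And>n. s n > 0" "s \<longlonglongrightarrow> 0"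
  shows "\<exists>r::nat\<Rightarrow>nat. strict_mono r \<and> (AE x in lborel. (\<lambda>n. mollify (s (r n)) A x) \<longlonglongrightarrow> A x)"
proof -
  have i: "integrable lborel (\<lambda>x. mollify (s n) A x - A x)" for n
    using mollify_integral(1)[OF A s(1)] A by auto
  have "(\<lambda>n. ennreal (\<integral>x. norm (mollify (s n) A x - A x) \<partial>lborel)) \<longlonglongrightarrow> ennreal 0"
    using mollify_L1[OF A s] i by (simp add: nn_integral_eq_integral)
  then have "(\<lambda>n. \<integral>x. norm (mollify (s n) A x - A x) \<partial>lborel) \<longlonglongrightarrow> 0"
    by (rule tendsto_ennrealD) auto
  from tendsto_L1_AE_subseq[OF i this] obtain r where "strict_mono r" "AE x in lborel. (\<lambda>n. mollify (s (r n)) A x - A x) \<longlonglongrightarrow> 0"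
    by blast
  then show ?thesis by (auto dest: LIM_zero_cancel intro!: exI[of _ r] elim!: eventually_mono)
qed

text \<open>The Lipschitz bound of \<open>lw\<close> is integrated against the first moment of the
  Gaussian.\<close>

lemma gauss_lw:
  fixes v :: "'a::euclidean_space"
  assumes s: "s > 0"
  shows "integrable lborel (\<lambda>x. gauss s (x - v) * lw x)"
    "\<bar>(\<integral>x. gauss s (x - v) * lw x \<partial>lborel) - lw v\<bar> \<le> 3 * DIM('a) * (s * gauss_moment TYPE('a))"
proof -
  obtain C0 where C0: "C0 \<ge> 0" "\<And>x::'a. \<bar>lw x\<bar> \<le> C0 * (1 + lg x)" using lw_bound by blast
  show i: "integrable lborel (\<lambda>x. gauss s (x - v) * lw x)"
    by (rule gauss_lg_integrable(1)[OF s _ C0(2)]) simp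
  have i2: "integrable lborel (\<lambda>x. gauss s (x - v) * (lw x - lw v))"
    using i integral_gauss(1)[OF s, of v] by (simp add: right_diff_distrib)
  have "(\<integral>x. gauss s (x - v) * lw x \<partial>lborel) - lw v = (\<integral>x. gauss s (x - v) * (lw x - lw v) \<partial>lborel)"
    using i integral_gauss[OF s, of v] by (simp add: right_diff_distrib)
  then have "ennreal \<bar>(\<integral>x. gauss s (x - v) * lw x \<partial>lborel) - lw v\<bar> \<le> (\<integral>\<^sup>+x. ennreal (norm (gauss s (x - v) * (lw x - lw v))) \<partial>lborel)"
    using integral_norm_bound_ennreal[OF i2] by simp
  also have "\<dots> \<le> (\<integral>\<^sup>+x. ennreal (3 * DIM('a)) * ennreal (norm (x - v) * gauss s (x - v)) \<partial>lborel)"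
  proof (rule nn_integral_mono)
    fix x
    have "norm (gauss s (x - v) * (lw x - lw v)) \<le> gauss s (x - v) * (3 * DIM('a) * norm (x - v))"
      unfolding norm_mult real_norm_def using lw_lipschitz[of x v] gauss_nonneg[of s "x - v"] by (simp add: mult_left_mono abs_mult)
    then have "ennreal (norm (gauss s (x - v) * (lw x - lw v))) \<le> ennreal (3 * DIM('a) * (norm (x - v) * gauss s (x - v)))"
      by (intro ennreal_leI) (simp add: mult_ac)
    then show "ennreal (norm (gauss s (x - v) * (lw x - lw v))) \<le> ennreal (3 * DIM('a)) * ennreal (norm (x - v) * gauss s (x - v))"
      by (subst ennreal_mult'[symmetric]) auto
  qed
  also have "\<dots> = ennreal (3 * DIM('a)) * (\<integral>\<^sup>+(x::'a). ennreal (norm x * gauss s x) \<partial>lborel)"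
    using nn_integral_lborel_shift[of "\<lambda>x. ennreal (norm x * gauss s x)" "- v"] by (subst nn_integral_cmult) auto
  also have "\<dots> \<le> ennreal (3 * DIM('a)) * ennreal (s * gauss_moment TYPE('a))"
    by (intro mult_left_mono gauss_first_moment s) simp
  also have "\<dots> = ennreal (3 * DIM('a) * (s * gauss_moment TYPE('a)))" by (subst ennreal_mult') auto
  finally show "\<bar>(\<integral>x. gauss s (x - v) * lw x \<partial>lborel) - lw v\<bar> \<le> 3 * DIM('a) * (s * gauss_moment TYPE('a))"
    using s by (subst (asm) ennreal_le_iff) (auto simp: gauss_moment_def)
qed

lemma (in vpath) lw_ker_integrable: "integrable (ker t) lw"
proof -
  interpret k: prob_space "ker t" by (rule prob_ker)
  obtain C0 where C0: "C0 \<ge> 0" "\<And>x::real^'n. \<bar>lw x\<bar> \<le> C0 * (1 + lg x)" using lw_bound by blast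
  have "integrable (ker t) (\<lambda>v. C0 * (1 + lg v))" using lg_ker_integrable by simp
  then show ?thesis
  proof (rule Bochner_Integration.integrable_bound)
    show "AE v in ker t. norm (lw v) \<le> norm (C0 * (1 + lg v))"
      unfolding real_norm_def by (intro AE_I2 order_trans[OF C0(2) abs_ge_self])
  qed measurable
qed

context flow begin

lemma nn_integral_dens_mult:
  assumes [measurable]: "\<phi> \<in> borel_measurable borel"
  shows "(\<integral>\<^sup>+x. ennreal (dens s t x) * \<phi> x \<partial>lborel) = (\<integral>\<^sup>+v. \<integral>\<^sup>+x. ennreal (gauss s (x - v)) * \<phi> x \<partial>lborel \<partial>ker t)"
proof -
  interpret k: prob_space "ker t" by (rule prob_ker)
  interpret P: pair_sigma_finite lborel "ker t" ..
  have "(\<integral>\<^sup>+x. ennreal (dens s t x) * \<phi> x \<partial>lborel) = (\<integral>\<^sup>+x. \<integral>\<^sup>+v. ennreal (gauss s (x - v)) * \<phi> x \<partial>ker t \<partial>lborel)"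
    unfolding ennreal_dens by (intro nn_integral_cong nn_integral_multc[symmetric]) measurable
  also have "\<dots> = (\<integral>\<^sup>+v. \<integral>\<^sup>+x. ennreal (gauss s (x - v)) * \<phi> x \<partial>lborel \<partial>ker t)"
    by (rule P.Fubini'[symmetric]) measurable
  finally show ?thesis .
qed

text \<open>Fubini puts the kernel on \<open>lw\<close>, where \<open>gauss_lw\<close> bounds the
  error uniformly in the centre; the law has mass one.\<close>

lemma dens_lw:
  assumes s: "s > 0"
  shows "integrable lborel (\<lambda>x. dens s t x * lw x)"
    "\<bar>(\<integral>x. dens s t x * lw x \<partial>lborel) - (\<integral>v. lw v \<partial>ker t)\<bar> \<le> 3 * CARD('n) * (s * gauss_moment TYPE(real^'n))"
proof -
  interpret k: prob_space "ker t" by (rule prob_ker)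
  interpret P: pair_sigma_finite lborel "ker t" ..
  obtain C0 where C0: "C0 \<ge> 0" "\<And>x::real^'n. \<bar>lw x\<bar> \<le> C0 * (1 + lg x)" using lw_bound by blast
  show i0: "integrable lborel (\<lambda>x. dens s t x * lw x)"
  proof (rule Bochner_Integration.integrable_bound[OF integrable_mult_right[OF dens_lg_integrable[of "1/2", OF _ _ s], of C0 t]])
    have "norm (dens s t x * lw x) \<le> C0 * (dens s t x * (1 + lg x))" for x
      using mult_left_mono[OF C0(2)[of x] dens_nonneg[of s t x]] dens_nonneg[of s t x] by (simp add: abs_mult mult_ac)
    then show "AE x in lborel. norm (dens s t x * lw x) \<le> norm (C0 * (dens s t x * (1 + lg x)))"
      unfolding real_norm_def by (intro AE_I2 order_trans[OF _ abs_ge_self])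
  qed auto
  have i: "integrable (lborel \<Otimes>\<^sub>M ker t) (\<lambda>(x, v). gauss s (x - v) * lw x)"
  proof (rule P.Fubini_integrable)
    have "(\<integral>v. norm (gauss s (x - v) * lw x) \<partial>ker t) = \<bar>dens s t x * lw x\<bar>" for x
      by (simp add: abs_mult gauss_nonneg dens_nonneg dens_eq[symmetric])
    then show "integrable lborel (\<lambda>x. \<integral>v. norm (case (x, v) of (x, v) \<Rightarrow> gauss s (x - v) * lw x) \<partial>ker t)"
      using integrable_norm[OF i0] by simp
    have "integrable (ker t) (\<lambda>v. gauss s (x - v))" for x
      by (rule k.integrable_const_bound[of _ "gauss s (0::real^'n)"]) (auto simp: gauss_nonneg gauss_le)
    then show "AE x in lborel. integrable (ker t) (\<lambda>v. case (x, v) of (x, v) \<Rightarrow> gauss s (x - v) * lw x)"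
      by (intro AE_I2) simp
  qed measurable
  have "(\<integral>x. dens s t x * lw x \<partial>lborel) = (\<integral>x. \<integral>v. gauss s (x - v) * lw x \<partial>ker t \<partial>lborel)"
    by (simp add: dens_eq)
  also have "\<dots> = (\<integral>v. \<integral>x. gauss s (x - v) * lw x \<partial>lborel \<partial>ker t)"
    using P.Fubini_integral[OF i] by simp
  finally have eq: "(\<integral>x. dens s t x * lw x \<partial>lborel) = (\<integral>v. \<integral>x. gauss s (x - v) * lw x \<partial>lborel \<partial>ker t)" .
  have i1: "integrable (ker t) (\<lambda>v. \<integral>x. gauss s (x - v) * lw x \<partial>lborel)"
    using P.integrable_snd[OF i] by simp
  have "\<bar>(\<integral>x. dens s t x * lw x \<partial>lborel) - (\<integral>v. lw v \<partial>ker t)\<bar> = \<bar>\<integral>v. (\<integral>x. gauss s (x - v) * lw x \<partial>lborel) - lw v \<partial>ker t\<bar>"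
    unfolding eq using i1 lw_ker_integrable by simp
  also have "\<dots> \<le> (\<integral>v. \<bar>(\<integral>x. gauss s (x - v) * lw x \<partial>lborel) - lw v\<bar> \<partial>ker t)" by simp
  also have "\<dots> \<le> (\<integral>v. 3 * CARD('n) * (s * gauss_moment TYPE(real^'n)) \<partial>ker t)"
  proof (rule Bochner_Integration.integral_mono)
    show "integrable (ker t) (\<lambda>v. \<bar>(\<integral>x. gauss s (x - v) * lw x \<partial>lborel) - lw v\<bar>)"
      using i1 lw_ker_integrable by auto
  qed (use gauss_lw(2)[OF s, where 'a="real^'n"] in auto)
  finally show "\<bar>(\<integral>x. dens s t x * lw x \<partial>lborel) - (\<integral>v. lw v \<partial>ker t)\<bar> \<le> 3 * CARD('n) * (s * gauss_moment TYPE(real^'n))"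
    by (simp add: k.prob_space[simplified])
qed

lemma weight_lw_integrable: "integrable lborel (\<lambda>x::real^'n. weight x * lw x)"
proof -
  obtain C0 where C0: "C0 \<ge> 0" "\<And>x::real^'n. \<bar>lw x\<bar> \<le> C0 * (1 + lg x)" using lw_bound by blast
  show ?thesis
  proof (rule Bochner_Integration.integrable_bound[OF integrable_mult_right[OF weight_lg_integrable[of "1/2" 1], of C0]])
    have "norm (weight x * lw x) \<le> C0 * (weight x * (1 + lg x))" for x :: "real^'n"
      using mult_left_mono[OF C0(2)[of x] less_imp_le[OF weight_pos[of x]]] weight_pos[of x] by (simp add: abs_mult mult_ac)
    then show "AE x in (lborel :: (real^'n) measure). norm (weight x * lw x) \<le> norm (C0 * (weight x * (1 + lg x)))"
      unfolding real_norm_def by (intro AE_I2 order_trans[OF _ abs_ge_self])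
  qed auto
qed

lemma dens_pos: "s > 0 \<Longrightarrow> dens s t x > 0"
proof -
  assume s: "s > 0"
  interpret k: prob_space "ker t" by (rule prob_ker)
  have "(\<integral>\<^sup>+v. ennreal (gauss s (x - v)) \<partial>ker t) \<noteq> 0"
  proof
    assume "(\<integral>\<^sup>+v. ennreal (gauss s (x - v)) \<partial>ker t) = 0"
    then have "AE v in ker t. ennreal (gauss s (x - v)) = 0" by (subst (asm) nn_integral_0_iff_AE) auto
    then have "AE v in ker t. False" 
    proof eventually_elim
      case (elim v)
      then show ?case using gauss_pos[OF s, of "x - v"] by (simp add: ennreal_eq_0_iff)
    qed
    then show False by simp
  qed
  then have "ennreal (dens s t x) \<noteq> 0" by (simp add: ennreal_dens)
  then show ?thesis using dens_nonneg[of s t x] by (simp add: less_le)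
qed

lemma kap_lw:
  assumes \<epsilon>: "0 < \<epsilon>" "\<epsilon> < 1" and s: "s > 0"
  shows "integrable lborel (\<lambda>x. kap \<epsilon> s t x * lw x)"
    "(\<integral>x. kap \<epsilon> s t x * lw x \<partial>lborel) = (1 - \<epsilon>) * (\<integral>x. dens s t x * lw x \<partial>lborel) + \<epsilon> * (\<integral>(x::real^'n). weight x * lw x \<partial>lborel)"
  using dens_lw(1)[OF s, of t] weight_lw_integrable by (simp_all add: kap_def distrib_right mult.assoc)

text \<open>Both \<open>kap\<close> and \<open>weight\<close> have mass one, so the linear terms of
  \<open>psi\<close> cancel.\<close>

lemma psi_kap:
  assumes \<epsilon>: "0 < \<epsilon>" "\<epsilon> < 1" and s: "s > 0"
  shows "(\<integral>\<^sup>+x. ennreal (psi (kap \<epsilon> s t x) (weight x)) \<partial>lborel) = ennreal (kap_entropy \<epsilon> s t + (\<integral>x. kap \<epsilon> s t x * lw x \<partial>lborel))"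
    "kap_entropy \<epsilon> s t + (\<integral>x. kap \<epsilon> s t x * lw x \<partial>lborel) \<ge> 0"
proof -
  have eq: "psi (kap \<epsilon> s t x) (weight x) = kap \<epsilon> s t x * ln (kap \<epsilon> s t x) + kap \<epsilon> s t x * lw x - kap \<epsilon> s t x + weight x" for x
    by (simp add: psi_def lw_def)
  note i = kap_ln_integrable[OF \<epsilon> s, of t t] kap_lw(1)[OF \<epsilon> s, of t] kap_integral(1)[OF \<epsilon> s, of t] weight_integrable[where 'a="real^'n"]
  have "integrable lborel (\<lambda>x. psi (kap \<epsilon> s t x) (weight x))" unfolding eq using i by auto
  moreover have v: "(\<integral>x. psi (kap \<epsilon> s t x) (weight x) \<partial>lborel) = kap_entropy \<epsilon> s t + (\<integral>x. kap \<epsilon> s t x * lw x \<partial>lborel)"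
    unfolding eq using i kap_integral(2)[OF \<epsilon> s, of t] weight_integral[where 'a="real^'n"] by (simp add: kap_entropy_def)
  moreover have p: "psi (kap \<epsilon> s t x) (weight x) \<ge> 0" for x
    by (intro psi_nonneg less_imp_le[OF kap_pos[OF \<epsilon> s]] weight_pos)
  ultimately show "(\<integral>\<^sup>+x. ennreal (psi (kap \<epsilon> s t x) (weight x)) \<partial>lborel) = ennreal (kap_entropy \<epsilon> s t + (\<integral>x. kap \<epsilon> s t x * lw x \<partial>lborel))"
    by (subst nn_integral_eq_integral) simp_all
  show "kap_entropy \<epsilon> s t + (\<integral>x. kap \<epsilon> s t x * lw x \<partial>lborel) \<ge> 0"
    unfolding v[symmetric] by (rule Bochner_Integration.integral_nonneg) (rule p)
qed

text \<open>As in the portmanteau theorem: around a point of \<open>U\<close> the Gaussian leaves a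
  ball of radius \<rho> inside \<open>U\<close> with mass at most a constant times s / \<rho>, and
  Fatou's lemma integrates this over the law.\<close>

lemma open_le_liminf_dens:
  assumes U: "open U" and s: "\<And>n. s n > 0" "s \<longlonglongrightarrow> 0"
  shows "emeasure (ker t) U \<le> liminf (\<lambda>n. \<integral>\<^sup>+x. ennreal (dens (s n) t x) * indicator U x \<partial>lborel)"
proof -
  have [measurable]: "U \<in> sets borel" using U by simp
  have "emeasure (ker t) U = (\<integral>\<^sup>+v. indicator U v \<partial>ker t)" by simp
  also have "\<dots> \<le> (\<integral>\<^sup>+v. liminf (\<lambda>n. \<integral>\<^sup>+x. ennreal (gauss (s n) (x - v)) * indicator U x \<partial>lborel) \<partial>ker t)"
  proof (rule nn_integral_mono)
    fix v
    show "indicator U v \<le> liminf (\<lambda>n. \<integral>\<^sup>+x. ennreal (gauss (s n) (x - v)) * indicator U x \<partial>lborel)"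
    proof (cases "v \<in> U")
      case True
      then obtain \<rho> where \<rho>: "\<rho> > 0" "ball v \<rho> \<subseteq> U" using U open_contains_ball by blast
      define g where "g = gauss_moment TYPE(real^'n) / \<rho>"
      have g: "g \<ge> 0" using \<rho> by (simp add: g_def gauss_moment_def)
      have ge: "ennreal (1 - s n * g) \<le> (\<integral>\<^sup>+x. ennreal (gauss (s n) (x - v)) * indicator U x \<partial>lborel)" for n
      proof -
        have "1 = (\<integral>\<^sup>+x. ennreal (gauss (s n) (x - v)) \<partial>lborel)" using gauss_shift(1)[OF s(1)] by simp
        also have "\<dots> \<le> (\<integral>\<^sup>+x. ennreal (gauss (s n) (x - v)) * indicator U x + ennreal (1/\<rho>) * ennreal (norm (x - v) * gauss (s n) (x - v)) \<partial>lborel)"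
        proof (rule nn_integral_mono)
          fix x
          show "ennreal (gauss (s n) (x - v)) \<le> ennreal (gauss (s n) (x - v)) * indicator U x + ennreal (1/\<rho>) * ennreal (norm (x - v) * gauss (s n) (x - v))"
          proof (cases "x \<in> U")
            case False
            then have "\<rho> \<le> norm (x - v)" using \<rho>(2) by (force simp: dist_norm norm_minus_commute not_less)
            then have "1 * gauss (s n) (x - v) \<le> (1/\<rho> * norm (x - v)) * gauss (s n) (x - v)"
              using \<rho> by (intro mult_right_mono gauss_nonneg) (simp add: field_simps)
            then have "ennreal (gauss (s n) (x - v)) \<le> ennreal (1/\<rho> * (norm (x - v) * gauss (s n) (x - v)))" by (intro ennreal_leI) simp
            also have "\<dots> = ennreal (1/\<rho>) * ennreal (norm (x - v) * gauss (s n) (x - v))" using \<rho> by (intro ennreal_mult') auto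
            finally show ?thesis using False by simp
          qed simp
        qed
        also have "\<dots> = (\<integral>\<^sup>+x. ennreal (gauss (s n) (x - v)) * indicator U x \<partial>lborel) + ennreal (1/\<rho>) * (\<integral>\<^sup>+(x::real^'n). ennreal (norm x * gauss (s n) x) \<partial>lborel)"
          using nn_integral_lborel_shift[of "\<lambda>x. ennreal (norm x * gauss (s n) x)" "- v"]
          by (subst nn_integral_add) (auto simp: nn_integral_cmult)
        also have "\<dots> \<le> (\<integral>\<^sup>+x. ennreal (gauss (s n) (x - v)) * indicator U x \<partial>lborel) + ennreal (1/\<rho>) * ennreal (s n * gauss_moment TYPE(real^'n))"
          by (intro add_left_mono mult_left_mono gauss_first_moment s) simp
        also have "ennreal (1/\<rho>) * ennreal (s n * gauss_moment TYPE(real^'n)) = ennreal (s n * g)"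
          using \<rho> by (subst ennreal_mult'[symmetric]) (auto simp: g_def)
        finally have "ennreal 1 \<le> (\<integral>\<^sup>+x. ennreal (gauss (s n) (x - v)) * indicator U x \<partial>lborel) + ennreal (s n * g)" by simp
        then show ?thesis
          using s(1)[of n] g by (subst ennreal_minus[symmetric]) (auto simp: ennreal_minus_le_iff add.commute less_imp_le)
      qed
      have "(\<lambda>n. ennreal (1 - s n * g)) \<longlonglongrightarrow> ennreal (1 - 0 * g)" by (intro tendsto_intros s)
      then have "1 = liminf (\<lambda>n. ennreal (1 - s n * g))" using lim_imp_Liminf[of sequentially] by force
      also have "\<dots> \<le> liminf (\<lambda>n. \<integral>\<^sup>+x. ennreal (gauss (s n) (x - v)) * indicator U x \<partial>lborel)"
        by (intro Liminf_mono always_eventually allI ge)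
      finally show ?thesis using True by simp
    qed simp
  qed
  also have "\<dots> \<le> liminf (\<lambda>n. \<integral>\<^sup>+v. \<integral>\<^sup>+x. ennreal (gauss (s n) (x - v)) * indicator U x \<partial>lborel \<partial>ker t)"
    by (rule nn_integral_liminf) measurable
  also have "\<dots> = liminf (\<lambda>n. \<integral>\<^sup>+x. ennreal (dens (s n) t x) * indicator U x \<partial>lborel)"
    by (subst nn_integral_dens_mult) auto
  finally show ?thesis .
qed

text \<open>Bounded entropy excludes concentration. Young's inequality with c times the indicator of
  an open \<open>U\<close> bounds the mass of \<open>U\<close>, up to a factor 2, by (L + (exp c -
  1) w) / c, where w is the weight of \<open>U\<close>; for w \<le> exp (-c) this is of order 1 / c.
  The value 1/2 of \<epsilon> is enough, since \<open>dens\<close> is then at most twice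
  \<open>kap\<close>.\<close>

lemma abs_cont:
  assumes M: "\<And>s. 0 < s \<Longrightarrow> s \<le> 1 \<Longrightarrow> kap_entropy (1/2) s t \<le> M"
  shows "absolutely_continuous lborel (ker t)"
proof -
  have half: "0 < (1/2::real)" "(1/2::real) < 1" by auto
  define L where "L = \<bar>M\<bar> + \<bar>\<integral>v. lw v \<partial>ker t\<bar> + 3 * CARD('n) * gauss_moment TYPE(real^'n) + \<bar>\<integral>(x::real^'n). weight x * lw x \<partial>lborel\<bar>"
  have gm: "gauss_moment TYPE(real^'n) \<ge> 0" by (simp add: gauss_moment_def)
  have L: "kap_entropy (1/2) s t + (\<integral>x. kap (1/2) s t x * lw x \<partial>lborel) \<le> L" if s: "0 < s" "s \<le> 1" for s
  proof -
    define C where "C = 3 * CARD('n) * gauss_moment TYPE(real^'n)"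
    have C: "C \<ge> 0" using gm by (simp add: C_def)
    have "s * C \<le> 1 * C" using s C by (intro mult_right_mono) auto
    moreover have "3 * CARD('n) * (s * gauss_moment TYPE(real^'n)) = s * C" by (simp add: C_def)
    ultimately have "\<bar>(\<integral>x. dens s t x * lw x \<partial>lborel) - (\<integral>v. lw v \<partial>ker t)\<bar> \<le> C"
      using dens_lw(2)[OF s(1), of t] by linarith
    then show ?thesis
      unfolding L_def C_def[symmetric] kap_lw(2)[OF half s(1), of t] using M[OF s] C by (simp add: abs_if split: if_splits)
  qed
  have bnd: "emeasure (ker t) U \<le> ennreal (2 / c * (L + (exp c - 1) * w))"
    if U: "open U" and c: "c > 0" and w: "(\<integral>x. weight x * indicator U x \<partial>lborel) \<le> w" for U c w
  proof -
    have [measurable]: "U \<in> sets borel" using U by simp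
    have w0: "0 \<le> (\<integral>x. weight x * indicator U x \<partial>lborel)" by (intro Bochner_Integration.integral_nonneg mult_nonneg_nonneg less_imp_le[OF weight_pos]) simp
    have "(\<integral>\<^sup>+x. ennreal (dens s t x) * indicator U x \<partial>lborel) \<le> ennreal (2 / c * (L + (exp c - 1) * w))" if s: "0 < s" "s \<le> 1" for s
    proof -
      note i = kap_ln_integrable[OF half s(1), of t t] kap_lw(1)[OF half s(1), of t] kap_integral(1)[OF half s(1), of t] weight_integrable[where 'a="real^'n"]
      have ki: "integrable lborel (\<lambda>x. kap (1/2) s t x * indicator U x)" "integrable lborel (\<lambda>x. weight x * indicator U x)"
        using i by (auto intro!: integrable_real_mult_indicator)
      have "c * (\<integral>x. kap (1/2) s t x * indicator U x \<partial>lborel) = (\<integral>x. c * (kap (1/2) s t x * indicator U x) \<partial>lborel)" by simp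
      also have "\<dots> \<le> (\<integral>x. kap (1/2) s t x * ln (kap (1/2) s t x) + kap (1/2) s t x * lw x - kap (1/2) s t x + (weight x + (exp c - 1) * (weight x * indicator U x)) \<partial>lborel)"
      proof (intro integral_mono)
        fix x
        have "kap (1/2) s t x * (c * indicator U x) \<le> kap (1/2) s t x * ln (kap (1/2) s t x) - kap (1/2) s t x * ln (weight x) - kap (1/2) s t x + weight x * exp (c * indicator U x)"
          using kap_pos[OF half s(1), of t x] weight_pos[of x] by (intro legendre) auto
        also have "weight x * exp (c * indicator U x) = weight x + (exp c - 1) * (weight x * indicator U x)"
          by (simp add: indicator_def algebra_simps)
        finally show "c * (kap (1/2) s t x * indicator U x) \<le> kap (1/2) s t x * ln (kap (1/2) s t x) + kap (1/2) s t x * lw x - kap (1/2) s t x + (weight x + (exp c - 1) * (weight x * indicator U x))"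
          by (simp add: lw_def mult_ac)
      qed (use i ki in auto)
      also have "\<dots> = kap_entropy (1/2) s t + (\<integral>x. kap (1/2) s t x * lw x \<partial>lborel) + (exp c - 1) * (\<integral>x. weight x * indicator U x \<partial>lborel)"
        using i ki kap_integral(2)[OF half s(1), of t] weight_integral[where 'a="real^'n"] by (simp add: kap_entropy_def)
      also have "\<dots> \<le> L + (exp c - 1) * w"
        using c by (intro add_mono L s mult_left_mono w) auto
      finally have 1: "(\<integral>x. kap (1/2) s t x * indicator U x \<partial>lborel) \<le> (L + (exp c - 1) * w) / c" using c by (simp add: field_simps)
      have "(\<integral>\<^sup>+x. ennreal (dens s t x) * indicator U x \<partial>lborel) \<le> (\<integral>\<^sup>+x. 2 * ennreal (kap (1/2) s t x * indicator U x) \<partial>lborel)"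
      proof (rule nn_integral_mono)
        fix x
        have "dens s t x \<le> 2 * kap (1/2) s t x" using kap_ge(2)[OF half s(1), of t x] by simp
        then have "ennreal (dens s t x) \<le> ennreal (2 * kap (1/2) s t x)" by (rule ennreal_leI)
        also have "\<dots> = 2 * ennreal (kap (1/2) s t x)" by (simp add: ennreal_mult')
        finally have "ennreal (dens s t x) \<le> 2 * ennreal (kap (1/2) s t x)" .
        then show "ennreal (dens s t x) * indicator U x \<le> 2 * ennreal (kap (1/2) s t x * indicator U x)" by (simp add: indicator_def)
      qed
      also have "\<dots> = 2 * ennreal (\<integral>x. kap (1/2) s t x * indicator U x \<partial>lborel)"
        using ki kap_pos[OF half s(1), of t] by (subst nn_integral_cmult) (auto simp: nn_integral_eq_integral less_imp_le)
      also have "\<dots> \<le> 2 * ennreal ((L + (exp c - 1) * w) / c)" by (intro mult_left_mono ennreal_leI 1) simp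
      also have "\<dots> = ennreal (2 / c * (L + (exp c - 1) * w))" by (simp add: ennreal_mult'[symmetric] flip: ennreal_numeral)
      finally show ?thesis .
    qed
    then have "\<And>n. (\<integral>\<^sup>+x. ennreal (dens (inverse (real (Suc n))) t x) * indicator U x \<partial>lborel) \<le> ennreal (2 / c * (L + (exp c - 1) * w))"
      by (auto simp: inverse_le_1_iff simp del: of_nat_Suc)
    then have "liminf (\<lambda>n. \<integral>\<^sup>+x. ennreal (dens (inverse (real (Suc n))) t x) * indicator U x \<partial>lborel) \<le> ennreal (2 / c * (L + (exp c - 1) * w))"
      by (intro Liminf_le always_eventually allI) auto
    then show ?thesis
      using open_le_liminf_dens[OF U, of "\<lambda>n. inverse (real (Suc n))" t] LIMSEQ_inverse_real_of_nat by (auto intro: order_trans)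
  qed
  have L0: "L \<ge> 0" using gm by (simp add: L_def)
  show ?thesis
    unfolding absolutely_continuous_def
  proof
    interpret k: prob_space "ker t" by (rule prob_ker)
    fix N :: "(real^'n) set" assume N: "N \<in> null_sets lborel"
    then have Nb: "N \<in> sets borel" "emeasure lborel N = 0" by (auto simp: null_sets_def)
    have le: "measure (ker t) N \<le> 2 / c * (L + 1)" if c: "c > 0" for c
    proof -
      \<comment> \<open>\<open>weight\<close> is largest at 0, so a set of Lebesgue measure below
        \<eta> has weight at most exp (-c).\<close>
      define \<eta> where "\<eta> = 1 / (weight (0::real^'n) * exp c)"
      have \<eta>: "\<eta> > 0" using weight_pos[of "0::real^'n"] by (simp add: \<eta>_def)
      obtain U where U: "open U" "N \<subseteq> U" "emeasure lborel (U - N) < ennreal \<eta>"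
        using outer_regular_lborel[OF Nb(1) \<eta>] by blast
      have [measurable]: "U \<in> sets borel" using U by simp
      have "emeasure lborel U = emeasure lborel (U - N)"
        using N by (intro emeasure_Diff_null_set[symmetric]) auto
      then have lU: "emeasure lborel U < ennreal \<eta>" using U(3) by simp
      have "ennreal (\<integral>x. weight x * indicator U x \<partial>lborel) \<le> (\<integral>\<^sup>+x. ennreal (weight x * indicator U x) \<partial>lborel)"
        by (rule ennreal_integral_le_nn_integral) (intro integrable_real_mult_indicator weight_integrable, simp)
      also have "\<dots> \<le> (\<integral>\<^sup>+x. ennreal (weight (0::real^'n)) * indicator U x \<partial>lborel)"
        by (intro nn_integral_mono) (auto simp: indicator_def intro!: ennreal_leI weight_le)
      also have "\<dots> = ennreal (weight (0::real^'n)) * emeasure lborel U" by (simp add: nn_integral_cmult)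
      also have "\<dots> \<le> ennreal (weight (0::real^'n)) * ennreal \<eta>" using lU by (intro mult_left_mono) auto
      also have "\<dots> = ennreal (exp (- c))"
        using weight_pos[of "0::real^'n"] \<eta> by (subst ennreal_mult[symmetric]) (auto simp: \<eta>_def less_imp_le exp_minus field_simps)
      finally have w: "(\<integral>x. weight x * indicator U x \<partial>lborel) \<le> exp (- c)" by simp
      have "emeasure (ker t) N \<le> emeasure (ker t) U" using U by (intro emeasure_mono) auto
      also have "\<dots> \<le> ennreal (2 / c * (L + (exp c - 1) * exp (- c)))" by (rule bnd[OF U(1) c w])
      also have "\<dots> \<le> ennreal (2 / c * (L + 1))"
        using c by (intro ennreal_leI mult_left_mono add_left_mono) (auto simp: left_diff_distrib exp_minus)
      finally show ?thesis using c L0 by (simp add: k.emeasure_eq_measure)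
    qed
    have "measure (ker t) N \<le> 0"
    proof (rule ccontr)
      assume "\<not> measure (ker t) N \<le> 0"
      define r where "r = measure (ker t) N"
      have r: "r > 0" using \<open>\<not> measure (ker t) N \<le> 0\<close> by (simp add: r_def)
      \<comment> \<open>For this c the bound 2 (L + 1) / c is smaller than r, against
        \<open>le\<close>.\<close>
      define c where "c = 2 * (L + 1) / r + 1"
      have c: "c > 0" using r L0 by (simp add: c_def add_pos_nonneg add_nonneg_pos)
      have "r * c \<le> 2 * (L + 1)" using le[OF c] c by (simp add: r_def[symmetric] field_simps)
      moreover have "r * c = 2 * (L + 1) + r" using r by (simp add: c_def field_simps)
      ultimately show False using r by simp
    qed
    then have "emeasure (ker t) N = 0" using measure_nonneg[of "ker t" N] by (simp add: k.emeasure_eq_measure)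
    then show "N \<in> null_sets (ker t)" using Nb by (auto intro!: null_setsI)
  qed
qed

text \<open>Jensen's inequality for the mixture of a mollified density with the weight.\<close>

lemma kap_entropy_start:
  assumes f: "\<And>v. f v \<ge> 0" "f \<in> borel_measurable borel" "ker t = density lborel (\<lambda>v. ennreal (f v))"
    and fl: "integrable lborel (\<lambda>v. f v * ln (f v))"
    and \<epsilon>: "0 < \<epsilon>" "\<epsilon> < 1" and s: "s > 0"
  shows "kap_entropy \<epsilon> s t \<le> (1 - \<epsilon>) * (\<integral>v. f v * ln (f v) \<partial>lborel) + \<epsilon> * (\<integral>(x::real^'n). weight x * ln (weight x) \<partial>lborel)"
proof -
  note [measurable] = f(2)
  have fi: "integrable lborel f"
  proof (rule integrableI_nonneg)
    interpret k: prob_space "ker t" by (rule prob_ker)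
    have "emeasure (ker t) UNIV = 1" using k.emeasure_space_1 by simp
    then show "(\<integral>\<^sup>+v. ennreal (f v) \<partial>lborel) < \<infinity>" by (simp add: f(3) emeasure_density)
  qed (use f in auto)
  have dm: "dens s t x = mollify s f x" for x
    unfolding dens_eq f(3) mollify_def using f(1) by (subst integral_density) (auto simp: mult_ac)
  have wl: "integrable lborel (\<lambda>x::real^'n. weight x * ln (weight x))"
    using weight_lw_integrable by (simp add: lw_def)
  have pt: "kap \<epsilon> s t x * ln (kap \<epsilon> s t x) \<le> (1 - \<epsilon>) * mollify s (\<lambda>v. f v * ln (f v)) x + \<epsilon> * (weight x * ln (weight x))" for x
  proof -
    define p k where "p = dens s t x" and "k = kap \<epsilon> s t x"
    have k: "k = (1 - \<epsilon>) * p + \<epsilon> * weight x" by (simp add: k_def p_def kap_def)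
    have pos: "p > 0" "k > 0" using dens_pos[OF s] kap_pos[OF \<epsilon> s] by (auto simp: p_def k_def)
    have 1: "p * ln k \<le> p * ln p - p + k" using legendre_exp[of p "ln k"] pos by simp
    have 2: "weight x * ln k \<le> weight x * ln (weight x) - weight x + k"
      using legendre_exp[of "weight x" "ln k"] pos weight_pos[of x] by simp
    have "k * ln k = (1 - \<epsilon>) * (p * ln k) + \<epsilon> * (weight x * ln k)" by (subst k) (simp add: algebra_simps)
    also have "\<dots> \<le> (1 - \<epsilon>) * (p * ln p - p + k) + \<epsilon> * (weight x * ln (weight x) - weight x + k)"
      using 1 2 \<epsilon> by (intro add_mono mult_left_mono) auto
    also have "\<dots> = (1 - \<epsilon>) * (p * ln p) + \<epsilon> * (weight x * ln (weight x)) + (k - ((1 - \<epsilon>) * p + \<epsilon> * weight x))"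
      by (simp add: algebra_simps)
    also have "\<dots> = (1 - \<epsilon>) * (p * ln p) + \<epsilon> * (weight x * ln (weight x))" by (simp add: k)
    also have "p * ln p \<le> mollify s (\<lambda>v. f v * ln (f v)) x"
    proof -
      have i: "integrable lborel (\<lambda>v. gauss s (x - v) * f v)" "integrable lborel (\<lambda>v. gauss s (x - v) * (f v * ln (f v)))"
        "integrable lborel (\<lambda>v. gauss s (x - v))"
        using mollify_integrable[OF fi s] mollify_integrable[OF fl s] integral_gauss(3)[OF s] by auto
      have pf: "(\<integral>v. gauss s (x - v) * f v \<partial>lborel) = p" by (simp add: p_def dm mollify_def)
      have "p * ln p = (\<integral>v. ln p * (gauss s (x - v) * f v) \<partial>lborel)" by (simp add: pf)
      also have "\<dots> \<le> (\<integral>v. gauss s (x - v) * (f v * ln (f v)) - gauss s (x - v) * f v + p * gauss s (x - v) \<partial>lborel)"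
      proof (rule integral_mono)
        fix v
        have "gauss s (x - v) * (f v * ln p) \<le> gauss s (x - v) * (f v * ln (f v) - f v + p)"
          using legendre_exp[OF f(1), of v "ln p"] pos by (intro mult_left_mono gauss_nonneg) auto
        then show "ln p * (gauss s (x - v) * f v) \<le> gauss s (x - v) * (f v * ln (f v)) - gauss s (x - v) * f v + p * gauss s (x - v)"
          by (simp add: algebra_simps)
      qed (use i in auto)
      also have "\<dots> = mollify s (\<lambda>v. f v * ln (f v)) x"
        using i integral_gauss(4)[OF s, of x] by (simp add: pf) (simp add: mollify_def)
      finally show ?thesis .
    qed
    finally show ?thesis using \<epsilon> by (simp add: k_def)
  qed
  have "kap_entropy \<epsilon> s t \<le> (\<integral>x. (1 - \<epsilon>) * mollify s (\<lambda>v. f v * ln (f v)) x + \<epsilon> * (weight x * ln (weight x)) \<partial>lborel)"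
    unfolding kap_entropy_def using kap_ln_integrable[OF \<epsilon> s] mollify_integral(1)[OF fl s] wl pt
    by (intro integral_mono) auto
  also have "\<dots> = (1 - \<epsilon>) * (\<integral>v. f v * ln (f v) \<partial>lborel) + \<epsilon> * (\<integral>(x::real^'n). weight x * ln (weight x) \<partial>lborel)"
    using mollify_integral[OF fl s] wl by simp
  finally show ?thesis .
qed

lemma dens_AE_subseq:
  assumes f: "\<And>v. f v \<ge> 0" "f \<in> borel_measurable borel" "ker t = density lborel (\<lambda>v. ennreal (f v))"
    and s: "\<And>n. s n > 0" "s \<longlonglongrightarrow> 0"
  shows "integrable lborel f" "\<And>\<delta> x. dens \<delta> t x = mollify \<delta> f x"
    "\<exists>r::nat\<Rightarrow>nat. strict_mono r \<and> (AE x in lborel. (\<lambda>n. dens (s (r n)) t x) \<longlonglongrightarrow> f x)"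
proof -
  note [measurable] = f(2)
  show fi: "integrable lborel f"
  proof (rule integrableI_nonneg)
    interpret k: prob_space "ker t" by (rule prob_ker)
    have "emeasure (ker t) UNIV = 1" using k.emeasure_space_1 by simp
    then show "(\<integral>\<^sup>+v. ennreal (f v) \<partial>lborel) < \<infinity>" by (simp add: f(3) emeasure_density)
  qed (use f in auto)
  show dm: "dens \<delta> t x = mollify \<delta> f x" for \<delta> x
    unfolding dens_eq f(3) mollify_def using f(1) by (subst integral_density) (auto simp: mult_ac)
  show "\<exists>r::nat\<Rightarrow>nat. strict_mono r \<and> (AE x in lborel. (\<lambda>n. dens (s (r n)) t x) \<longlonglongrightarrow> f x)"
    unfolding dm by (rule mollify_AE_subseq1[OF fi s])
qed

text \<open>Fatou's lemma. It needs a nonnegative integrand, which x ln x alone is not; this is why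
  the entropy is taken relative to the weight.\<close>

lemma psi_liminf:
  assumes f: "\<And>v. f v \<ge> 0" "f \<in> borel_measurable borel"
    and conv: "AE x in lborel. (\<lambda>n. dens (s n) t x) \<longlonglongrightarrow> f x"
    and \<epsilon>: "\<And>n. 0 < \<epsilon> n" "\<And>n. \<epsilon> n < 1" "\<epsilon> \<longlonglongrightarrow> 0" and s: "\<And>n. s n > 0"
  shows "(\<integral>\<^sup>+x. ennreal (psi (f x) (weight x)) \<partial>lborel)
    \<le> liminf (\<lambda>n. ennreal (kap_entropy (\<epsilon> n) (s n) t + (\<integral>x. kap (\<epsilon> n) (s n) t x * lw x \<partial>lborel)))"
proof -
  note [measurable] = f(2)
  have "AE x in lborel. ennreal (psi (f x) (weight x)) \<le> liminf (\<lambda>n. ennreal (psi (kap (\<epsilon> n) (s n) t x) (weight x)))"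
    using conv
  proof eventually_elim
    case (elim x)
    have "(\<lambda>n. kap (\<epsilon> n) (s n) t x) \<longlonglongrightarrow> (1 - 0) * f x + 0 * weight x"
      unfolding kap_def by (intro tendsto_intros elim \<epsilon>)
    then have k: "(\<lambda>n. kap (\<epsilon> n) (s n) t x) \<longlonglongrightarrow> f x" by simp
    have "(\<lambda>n. psi (kap (\<epsilon> n) (s n) t x) (weight x)) \<longlonglongrightarrow> psi (f x) (weight x)"
      unfolding psi_def by (intro tendsto_intros k tendsto_mult_ln[OF k] f)
    then have "(\<lambda>n. ennreal (psi (kap (\<epsilon> n) (s n) t x) (weight x))) \<longlonglongrightarrow> ennreal (psi (f x) (weight x))" by simp
    from lim_imp_Liminf[OF _ this] show ?case by simp
  qed
  then have "(\<integral>\<^sup>+x. ennreal (psi (f x) (weight x)) \<partial>lborel) \<le> (\<integral>\<^sup>+x. liminf (\<lambda>n. ennreal (psi (kap (\<epsilon> n) (s n) t x) (weight x))) \<partial>lborel)"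
    by (rule nn_integral_mono_AE)
  also have "\<dots> \<le> liminf (\<lambda>n. \<integral>\<^sup>+x. ennreal (psi (kap (\<epsilon> n) (s n) t x) (weight x)) \<partial>lborel)"
    by (rule nn_integral_liminf) measurable
  also have "\<dots> = liminf (\<lambda>n. ennreal (kap_entropy (\<epsilon> n) (s n) t + (\<integral>x. kap (\<epsilon> n) (s n) t x * lw x \<partial>lborel)))"
    using \<epsilon> s by (simp add: psi_kap)
  finally show ?thesis .
qed

text \<open>\<open>dens_lw\<close> bounds the error by a multiple of \<open>s\<close>, and the
  weight enters with the vanishing factor \<epsilon>.\<close>

lemma kap_lw_tendsto:
  assumes \<epsilon>: "\<And>n. 0 < \<epsilon> n" "\<And>n. \<epsilon> n < 1" "\<epsilon> \<longlonglongrightarrow> 0" and s: "\<And>n. s n > 0" "s \<longlonglongrightarrow> 0"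
  shows "(\<lambda>n. \<integral>x. kap (\<epsilon> n) (s n) t x * lw x \<partial>lborel) \<longlonglongrightarrow> (\<integral>v. lw v \<partial>ker t)"
proof -
  have "(\<lambda>n. (\<integral>x. dens (s n) t x * lw x \<partial>lborel) - (\<integral>v. lw v \<partial>ker t)) \<longlonglongrightarrow> 0"
  proof (rule Lim_null_comparison)
    have "(\<lambda>n. 3 * CARD('n) * (s n * gauss_moment TYPE(real^'n))) \<longlonglongrightarrow> 3 * CARD('n) * (0 * gauss_moment TYPE(real^'n))"
      by (intro tendsto_intros s)
    then show "(\<lambda>n. 3 * CARD('n) * (s n * gauss_moment TYPE(real^'n))) \<longlonglongrightarrow> 0" by simp
  qed (use dens_lw(2)[OF s(1), of _ t] in \<open>auto intro!: always_eventually\<close>)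
  then have d: "(\<lambda>n. \<integral>x. dens (s n) t x * lw x \<partial>lborel) \<longlonglongrightarrow> (\<integral>v. lw v \<partial>ker t)" by (rule LIM_zero_cancel)
  have "(\<lambda>n. (1 - \<epsilon> n) * (\<integral>x. dens (s n) t x * lw x \<partial>lborel) + \<epsilon> n * (\<integral>(x::real^'n). weight x * lw x \<partial>lborel))
     \<longlonglongrightarrow> (1 - 0) * (\<integral>v. lw v \<partial>ker t) + 0 * (\<integral>(x::real^'n). weight x * lw x \<partial>lborel)"
    by (intro tendsto_intros d \<epsilon>)
  then show ?thesis using \<epsilon> s by (simp add: kap_lw(2))
qed

text \<open>\<open>lw\<close> grows logarithmically and is integrable for the law, so removing its
  contribution from a finite relative entropy leaves f ln f integrable.\<close>

lemma psi_integrable_imp: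
  assumes f: "\<And>v. f v \<ge> 0" "f \<in> borel_measurable borel" "ker t = density lborel (\<lambda>v. ennreal (f v))"
    and fin: "(\<integral>\<^sup>+x. ennreal (psi (f x) (weight x)) \<partial>lborel) < \<infinity>"
  shows "integrable lborel (\<lambda>v. f v * ln (f v))"
    "(\<integral>\<^sup>+x. ennreal (psi (f x) (weight x)) \<partial>lborel) = ennreal ((\<integral>v. f v * ln (f v) \<partial>lborel) + (\<integral>v. lw v \<partial>ker t))"
proof -
  note [measurable] = f(2)
  have fi: "integrable lborel f" by (rule dens_AE_subseq(1)[OF f _ LIMSEQ_inverse_real_of_nat]) simp
  have flw: "integrable lborel (\<lambda>v. f v * lw v)" "(\<integral>v. f v * lw v \<partial>lborel) = (\<integral>v. lw v \<partial>ker t)"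
    using lw_ker_integrable[of t] f(1) unfolding f(3) by (auto simp: integrable_density integral_density)
  have f1: "(\<integral>v. f v \<partial>lborel) = 1"
  proof -
    interpret k: prob_space "ker t" by (rule prob_ker)
    have "(\<integral>\<^sup>+v. ennreal (f v) \<partial>lborel) = 1" using k.emeasure_space_1 by (simp add: f(3) emeasure_density)
    then show ?thesis using f(1) by (subst integral_eq_nn_integral) auto
  qed
  have ip: "integrable lborel (\<lambda>x. psi (f x) (weight x))"
    using fin f(1) by (intro integrableI_nonneg) (auto intro!: AE_I2 psi_nonneg weight_pos)
  have eq: "f v * ln (f v) = psi (f v) (weight v) - f v * lw v + f v - weight v" for v
    by (simp add: psi_def lw_def)
  note i = ip flw(1) fi weight_integrable[where 'a="real^'n"]
  show fl: "integrable lborel (\<lambda>v. f v * ln (f v))" unfolding eq using i by auto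
  have "(\<integral>v. f v * ln (f v) \<partial>lborel) = (\<integral>x. psi (f x) (weight x) \<partial>lborel) - (\<integral>v. lw v \<partial>ker t)"
    unfolding eq using i f1 weight_integral[where 'a="real^'n"] by (simp add: flw(2))
  then show "(\<integral>\<^sup>+x. ennreal (psi (f x) (weight x)) \<partial>lborel) = ennreal ((\<integral>v. f v * ln (f v) \<partial>lborel) + (\<integral>v. lw v \<partial>ker t))"
    using ip f(1) by (subst nn_integral_eq_integral) (auto intro!: AE_I2 psi_nonneg weight_pos)
qed

text \<open>Jensen's inequality bounds the entropy at the start and \<open>kap_entropy_le\<close>
  its growth, both uniformly in the mollification. The bound excludes singular parts, and lower
  semicontinuity carries it over to the density at the end.\<close>

lemma density_propagates:
  assumes f: "\<And>v. f v \<ge> 0" "f \<in> borel_measurable borel" "ker a = density lborel (\<lambda>v. ennreal (f v))"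
    and fl: "integrable lborel (\<lambda>v. f v * ln (f v))"
    and ab: "0 \<le> a" "a \<le> b" "b \<le> T"
  shows "absolutely_continuous lborel (ker b)"
    and "\<And>g. (\<And>v. g v \<ge> 0) \<Longrightarrow> g \<in> borel_measurable borel \<Longrightarrow> ker b = density lborel (\<lambda>v. ennreal (g v)) \<Longrightarrow> integrable lborel (\<lambda>v. g v * ln (g v))"
proof -
  define M where "M = \<bar>\<integral>v. f v * ln (f v) \<partial>lborel\<bar> + \<bar>\<integral>(x::real^'n). weight x * ln (weight x) \<partial>lborel\<bar> + ((\<integral>z. Psi z \<partial>K) + 2 * T * smass)"
  have M: "kap_entropy \<epsilon> s b \<le> M" if \<epsilon>: "0 < \<epsilon>" "\<epsilon> \<le> 1/2" and s: "s > 0" for \<epsilon> s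
  proof -
    have \<epsilon>1: "\<epsilon> < 1" using \<epsilon> by simp
    have sc: "c * X \<le> \<bar>X\<bar>" if "0 \<le> c" "c \<le> 1" for c X :: real
    proof -
      have "c * X \<le> c * \<bar>X\<bar>" using that by (intro mult_left_mono) auto
      also have "\<dots> \<le> \<bar>X\<bar>" using that by (intro mult_left_le_one_le) auto
      finally show ?thesis .
    qed
    have "(1 - \<epsilon>) * (\<integral>v. f v * ln (f v) \<partial>lborel) \<le> \<bar>\<integral>v. f v * ln (f v) \<partial>lborel\<bar>"
      using \<epsilon> by (intro sc) auto
    moreover have "\<epsilon> * (\<integral>(x::real^'n). weight x * ln (weight x) \<partial>lborel) \<le> \<bar>\<integral>(x::real^'n). weight x * ln (weight x) \<partial>lborel\<bar>"
      using \<epsilon> by (intro sc) auto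
    ultimately show ?thesis
      using kap_entropy_le[OF \<epsilon>(1) \<epsilon>1 s ab \<epsilon>(2)] kap_entropy_start[OF f fl \<epsilon>(1) \<epsilon>1 s] by (simp add: M_def)
  qed
  show "absolutely_continuous lborel (ker b)" by (rule abs_cont[of b M]) (use M in auto)
  fix g :: "real^'n \<Rightarrow> real" assume g: "\<And>v. g v \<ge> 0" "g \<in> borel_measurable borel" "ker b = density lborel (\<lambda>v. ennreal (g v))"
  have s0: "\<And>n. inverse (real (Suc n)) > 0" "(\<lambda>n. inverse (real (Suc n))) \<longlonglongrightarrow> 0" using LIMSEQ_inverse_real_of_nat by auto
  from dens_AE_subseq(3)[OF g s0] obtain r where r: "strict_mono r" "AE x in lborel. (\<lambda>n. dens (inverse (real (Suc (r n)))) b x) \<longlonglongrightarrow> g x" by blast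
  define s where "s n = inverse (real (Suc (r n)))" for n
  \<comment> \<open>A single sequence drives both parameters to 0, with \<epsilon> at most 1/2
    throughout.\<close>
  define \<epsilon> where "\<epsilon> n = s n / 2" for n
  have s: "s n > 0" "s n \<le> 1" for n by (auto simp: s_def inverse_le_1_iff)
  have sl: "s \<longlonglongrightarrow> 0" unfolding s_def using LIMSEQ_subseq_LIMSEQ[OF s0(2) r(1)] by (simp add: o_def)
  have \<epsilon>: "0 < \<epsilon> n" "\<epsilon> n < 1" "\<epsilon> n \<le> 1/2" for n using s[of n] by (auto simp: \<epsilon>_def)
  have \<epsilon>l: "\<epsilon> \<longlonglongrightarrow> 0" unfolding \<epsilon>_def using tendsto_divide[OF sl tendsto_const, of 2] by simp
  have "(\<integral>\<^sup>+x. ennreal (psi (g x) (weight x)) \<partial>lborel)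
    \<le> liminf (\<lambda>n. ennreal (kap_entropy (\<epsilon> n) (s n) b + (\<integral>x. kap (\<epsilon> n) (s n) b x * lw x \<partial>lborel)))"
    by (rule psi_liminf) (use g r(2) \<epsilon> \<epsilon>l s in \<open>auto simp: s_def\<close>)
  also have "\<dots> \<le> liminf (\<lambda>n. ennreal (M + (\<integral>x. kap (\<epsilon> n) (s n) b x * lw x \<partial>lborel)))"
    using M[OF \<epsilon>(1,3) s(1)] by (intro Liminf_mono always_eventually allI ennreal_leI) auto
  also have "\<dots> = ennreal (M + (\<integral>v. lw v \<partial>ker b))"
    by (intro lim_imp_Liminf tendsto_ennrealI tendsto_intros kap_lw_tendsto \<epsilon> \<epsilon>l s sl) simp
  also have "\<dots> < \<infinity>" by simp
  finally show "integrable lborel (\<lambda>v. g v * ln (g v))" by (rule psi_integrable_imp(1)[OF g])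
qed

end

section \<open>Passage to the limit\<close>

text \<open>Joint measurability is part of the data: densities chosen separately for each time need
  not have it.\<close>

locale vpath_dens = vpath e T \<sigma> \<pi>
  for e T :: real and \<sigma> :: "(real^'n) measure" and \<pi> :: "real \<Rightarrow> (real^'n) measure" +
  fixes f :: "real \<Rightarrow> real^'n \<Rightarrow> real"
  assumes f_joint: "(\<lambda>(t, v). f t v) \<in> borel_measurable borel" and f_nonneg: "\<And>t v. f t v \<ge> 0"
    and f_dens: "\<And>t. t \<in> {0..T} \<Longrightarrow> \<pi> t = density lborel (\<lambda>v. ennreal (f t v))"
begin

lemma f_measurable [measurable (raw)]:
  assumes [measurable]: "g \<in> borel_measurable M" "k \<in> borel_measurable M"
  shows "(\<lambda>x. f (g x) (k x)) \<in> borel_measurable M"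
  using measurable_compose[OF _ f_joint, of "\<lambda>x. (g x, k x)" M] by simp

lemma f_ker: "t \<in> {0..T} \<Longrightarrow> ker t = density lborel (\<lambda>v. ennreal (f t v))"
  using f_dens by (simp add: ker_def)

section \<open>The typical flux as a density over time, direction and incoming pair\<close>

definition ff :: "real \<Rightarrow> (real^'n) \<times> (real^'n) \<Rightarrow> real" where "ff t x = f t (fst x) * f t (snd x)"

lemma ff_nonneg: "ff t x \<ge> 0" by (simp add: ff_def f_nonneg)

lemma ff_measurable [measurable (raw)]:
  assumes [measurable]: "g \<in> borel_measurable M" "k \<in> borel_measurable M"
  shows "(\<lambda>x. ff (g x) (k x)) \<in> borel_measurable M"
  unfolding ff_def by measurable

text \<open>A point \<open>((t, \<omega>), x)\<close> of \<open>M0\<close> records the time, the direction and the incoming pair of velocities.\<close>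

abbreviation TS :: "(real \<times> (real^'n)) measure" where "TS \<equiv> lborel \<Otimes>\<^sub>M \<sigma>"
abbreviation M0 :: "((real \<times> (real^'n)) \<times> ((real^'n) \<times> (real^'n))) measure" where "M0 \<equiv> TS \<Otimes>\<^sub>M lborel"

definition tm :: "(real \<times> (real^'n)) \<times> ((real^'n) \<times> (real^'n)) \<Rightarrow> real" where "tm z = fst (fst z)"
definition om :: "(real \<times> (real^'n)) \<times> ((real^'n) \<times> (real^'n)) \<Rightarrow> real^'n" where "om z = snd (fst z)"
definition inc :: "(real \<times> (real^'n)) \<times> ((real^'n) \<times> (real^'n)) \<Rightarrow> (real^'n) \<times> (real^'n)" where "inc z = snd z"
definition out :: "(real \<times> (real^'n)) \<times> ((real^'n) \<times> (real^'n)) \<Rightarrow> (real^'n) \<times> (real^'n)" where "out z = scatter (om z) (inc z)"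
definition coll :: "(real \<times> (real^'n)) \<times> ((real^'n) \<times> (real^'n)) \<Rightarrow> 'n collision" where "coll z = (tm z, inc z, out z)"

lemma M0_measurable [measurable]:
  "tm \<in> borel_measurable M0" "om \<in> borel_measurable M0" "inc \<in> borel_measurable M0" "out \<in> borel_measurable M0" "coll \<in> borel_measurable M0"
proof -
  show 1[measurable]: "tm \<in> borel_measurable M0" "om \<in> borel_measurable M0" "inc \<in> borel_measurable M0"
    unfolding tm_def[abs_def] om_def[abs_def] inc_def[abs_def] by measurable
  show [measurable]: "out \<in> borel_measurable M0" unfolding out_def[abs_def] by measurable
  show "coll \<in> borel_measurable M0" unfolding coll_def[abs_def] by measurable
qed

lemma sigma_finite_TS: "sigma_finite_measure TS"
proof -
  interpret S: finite_measure \<sigma> by (rule finite_\<sigma>)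
  show ?thesis by (rule sigma_finite_pair_measure) unfold_locales
qed

lemma nn_integral_M0:
  assumes [measurable]: "F \<in> borel_measurable M0"
  shows "(\<integral>\<^sup>+z. F z \<partial>M0) = (\<integral>\<^sup>+t. \<integral>\<^sup>+\<omega>. \<integral>\<^sup>+x. F ((t, \<omega>), x) \<partial>lborel \<partial>\<sigma> \<partial>lborel)"
proof -
  interpret S: finite_measure \<sigma> by (rule finite_\<sigma>)
  have "(\<integral>\<^sup>+z. F z \<partial>M0) = (\<integral>\<^sup>+p. \<integral>\<^sup>+x. F (p, x) \<partial>lborel \<partial>TS)"
    by (rule lborel.nn_integral_fst[symmetric]) measurable
  also have "\<dots> = (\<integral>\<^sup>+t. \<integral>\<^sup>+\<omega>. \<integral>\<^sup>+x. F ((t, \<omega>), x) \<partial>lborel \<partial>\<sigma> \<partial>lborel)"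
    by (rule S.nn_integral_fst[symmetric]) measurable
  finally show ?thesis .
qed

lemma AE_TS_M0: "AE p in TS. R p \<Longrightarrow> AE z in M0. R (fst z)"
proof -
  assume "AE p in TS. R p"
  then obtain N where N: "{p \<in> space TS. \<not> R p} \<subseteq> N" "emeasure TS N = 0" "N \<in> sets TS" by (auto elim: AE_E)
  show "AE z in M0. R (fst z)"
  proof (rule AE_I)
    show "{z \<in> space M0. \<not> R (fst z)} \<subseteq> N \<times> UNIV" using N(1) by (auto simp: space_pair_measure)
    show "emeasure M0 (N \<times> UNIV) = 0" using N by (subst lborel.emeasure_pair_measure_Times) auto
    show "N \<times> UNIV \<in> sets M0" using N by auto
  qed
qed

lemma AE_M0_unit: "AE z in M0. norm (om z) = 1"
proof -
  have m: "{z. norm (om z) \<noteq> 1} \<inter> space M0 \<in> sets M0" by measurable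
  have "(\<integral>\<^sup>+z. indicator {z. norm (om z) \<noteq> 1} z \<partial>M0) = (\<integral>\<^sup>+t. \<integral>\<^sup>+\<omega>. \<integral>\<^sup>+x. indicator {z. norm (om z) \<noteq> 1} ((t, \<omega>), x) \<partial>(lborel::((real^'n) \<times> (real^'n)) measure) \<partial>\<sigma> \<partial>(lborel::real measure))"
    by (rule nn_integral_M0) measurable
  also have "\<dots> = (\<integral>\<^sup>+t. \<integral>\<^sup>+\<omega>. 0 \<partial>\<sigma> \<partial>(lborel::real measure))"
  proof (rule nn_integral_cong, rule nn_integral_cong_AE)
    fix t :: real
    show "AE \<omega> in \<sigma>. (\<integral>\<^sup>+x. indicator {z. norm (om z) \<noteq> 1} ((t, \<omega>), x) \<partial>(lborel::((real^'n) \<times> (real^'n)) measure)) = 0"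
      using AE_unit by eventually_elim (simp add: om_def)
  qed
  finally have "(\<integral>\<^sup>+z. indicator {z. norm (om z) \<noteq> 1} z \<partial>M0) = 0" by simp
  then have "AE z in M0. (indicator {z. norm (om z) \<noteq> 1} z :: ennreal) = 0"
    by (subst (asm) nn_integral_0_iff_AE) measurable
  then show ?thesis by eventually_elim (auto simp: indicator_def split: if_splits)
qed

text \<open>The change of variables from incoming to outgoing pairs, carried out at fixed time and
  direction.\<close>

lemma nn_integral_M0_out:
  assumes [measurable]: "F \<in> borel_measurable M0"
  shows "(\<integral>\<^sup>+z. F (fst z, out z) \<partial>M0) = (\<integral>\<^sup>+z. F z \<partial>M0)"
proof -
  have m: "(\<lambda>z. (fst z, out z)) \<in> M0 \<rightarrow>\<^sub>M M0" by measurable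
  have "(\<integral>\<^sup>+z. F (fst z, out z) \<partial>M0) = (\<integral>\<^sup>+t. \<integral>\<^sup>+\<omega>. \<integral>\<^sup>+x. F ((t, \<omega>), scatter \<omega> x) \<partial>lborel \<partial>\<sigma> \<partial>lborel)"
    by (subst nn_integral_M0) (auto intro!: measurable_compose[OF m] simp: out_def om_def inc_def)
  also have "\<dots> = (\<integral>\<^sup>+t. \<integral>\<^sup>+\<omega>. \<integral>\<^sup>+x. F ((t, \<omega>), x) \<partial>lborel \<partial>\<sigma> \<partial>lborel)"
  proof (rule nn_integral_cong, rule nn_integral_cong_AE)
    fix t :: real
    show "AE \<omega> in \<sigma>. (\<integral>\<^sup>+x. F ((t, \<omega>), scatter \<omega> x) \<partial>lborel) = (\<integral>\<^sup>+x. F ((t, \<omega>), x) \<partial>lborel)"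
      using AE_unit
    proof eventually_elim
      case (elim \<omega>)
      have "(\<lambda>x. F ((t, \<omega>), x)) \<in> borel_measurable lborel" by measurable (simp_all add: space_pair_measure)
      then show ?case by (intro nn_integral_scatter[OF elim, of "\<lambda>x. F ((t, \<omega>), x)"]) simp
    qed
  qed
  also have "\<dots> = (\<integral>\<^sup>+z. F z \<partial>M0)" by (rule nn_integral_M0[symmetric]) measurable
  finally show ?thesis .
qed

text \<open>The typical flux \<open>K\<close> is the image under \<open>coll\<close> of the measure
  with this density over \<open>M0\<close>. The direction is kept as a coordinate, as in
  \<open>flux_int\<close>.\<close>

definition wt :: "(real \<times> (real^'n)) \<times> ((real^'n) \<times> (real^'n)) \<Rightarrow> real" where
  "wt z = indicator {0..T} (tm z) * (rate (om z) (inc z) / 2 * ff (tm z) (inc z))"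

lemma wt_measurable [measurable]: "wt \<in> borel_measurable M0" unfolding wt_def by measurable

lemma wt_nonneg: "wt z \<ge> 0" unfolding wt_def by (simp add: rate_nonneg ff_nonneg)

lemma nn_integral_ker2_ff:
  assumes t: "t \<in> {0..T}" and F[measurable]: "F \<in> borel_measurable borel"
  shows "(\<integral>\<^sup>+u. F u \<partial>ker2 t) = (\<integral>\<^sup>+u. ennreal (ff t u) * F u \<partial>lborel)"
proof -
  have "(\<integral>\<^sup>+u. F u \<partial>ker2 t) = (\<integral>\<^sup>+v. \<integral>\<^sup>+w. F (v, w) \<partial>ker t \<partial>ker t)" by (rule nn_integral_ker2[OF F])
  also have "\<dots> = (\<integral>\<^sup>+v. ennreal (f t v) * (\<integral>\<^sup>+w. ennreal (f t w) * F (v, w) \<partial>lborel) \<partial>lborel)"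
    unfolding f_ker[OF t] by (simp add: nn_integral_density)
  also have "\<dots> = (\<integral>\<^sup>+v. \<integral>\<^sup>+w. ennreal (ff t (v, w)) * F (v, w) \<partial>lborel \<partial>lborel)"
    by (simp add: nn_integral_cmult[symmetric] ff_def ennreal_mult f_nonneg mult.assoc)
  also have "\<dots> = (\<integral>\<^sup>+u. ennreal (ff t u) * F u \<partial>lborel)"
    unfolding lborel_prod[symmetric] by (rule lborel.nn_integral_fst) (simp only: lborel_prod, measurable)
  finally show ?thesis .
qed

text \<open>Exchange the incoming pair with the direction in \<open>flux_int\<close>, then replace
  the pair law by its density.\<close>

lemma nn_integral_K_M0:
  assumes [measurable]: "F \<in> borel_measurable (borel :: 'n collision measure)"
  shows "(\<integral>\<^sup>+z. F z \<partial>K) = (\<integral>\<^sup>+z. ennreal (wt z) * F (coll z) \<partial>M0)"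
proof -
  have "(\<integral>\<^sup>+z. F z \<partial>K) = flux_int F" by (rule nn_integral_K) measurable
  also have "\<dots> = (\<integral>\<^sup>+t. \<integral>\<^sup>+\<omega>. \<integral>\<^sup>+x. ennreal (wt ((t, \<omega>), x)) * F (coll ((t, \<omega>), x)) \<partial>lborel \<partial>\<sigma> \<partial>lborel)"
    unfolding flux_int_def
  proof (rule nn_integral_cong)
    fix t
    show "indicator {0..T} t * (\<integral>\<^sup>+u. \<integral>\<^sup>+\<omega>. ennreal (rate \<omega> u / 2) * F (t, u, scatter \<omega> u) \<partial>\<sigma> \<partial>ker2 t) =
      (\<integral>\<^sup>+\<omega>. \<integral>\<^sup>+x. ennreal (wt ((t, \<omega>), x)) * F (coll ((t, \<omega>), x)) \<partial>lborel \<partial>\<sigma>)"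
    proof (cases "t \<in> {0..T}")
      case True
      interpret S: finite_measure \<sigma> by (rule finite_\<sigma>)
      interpret k: prob_space "ker2 t" by (rule prob_ker2)
      interpret P: pair_sigma_finite \<sigma> "ker2 t" ..
      have "(\<integral>\<^sup>+u. \<integral>\<^sup>+\<omega>. ennreal (rate \<omega> u / 2) * F (t, u, scatter \<omega> u) \<partial>\<sigma> \<partial>ker2 t)
        = (\<integral>\<^sup>+\<omega>. \<integral>\<^sup>+u. ennreal (rate \<omega> u / 2) * F (t, u, scatter \<omega> u) \<partial>ker2 t \<partial>\<sigma>)"
        by (rule P.Fubini') measurable
      also have "\<dots> = (\<integral>\<^sup>+\<omega>. \<integral>\<^sup>+u. ennreal (ff t u) * (ennreal (rate \<omega> u / 2) * F (t, u, scatter \<omega> u)) \<partial>lborel \<partial>\<sigma>)"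
        by (intro nn_integral_cong nn_integral_ker2_ff True) measurable
      also have "\<dots> = (\<integral>\<^sup>+\<omega>. \<integral>\<^sup>+x. ennreal (wt ((t, \<omega>), x)) * F (coll ((t, \<omega>), x)) \<partial>lborel \<partial>\<sigma>)"
      proof (intro nn_integral_cong)
        fix \<omega> x
        have "wt ((t, \<omega>), x) = rate \<omega> x / 2 * ff t x" using True by (simp add: wt_def tm_def om_def inc_def)
        moreover have "ennreal (rate \<omega> x / 2 * ff t x) = ennreal (rate \<omega> x / 2) * ennreal (ff t x)"
          by (intro ennreal_mult ff_nonneg) (simp add: rate_nonneg)
        ultimately show "ennreal (ff t x) * (ennreal (rate \<omega> x / 2) * F (t, x, scatter \<omega> x)) = ennreal (wt ((t, \<omega>), x)) * F (coll ((t, \<omega>), x))"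
          by (simp only: coll_def tm_def om_def inc_def out_def fst_conv snd_conv) (simp only: mult_ac)
      qed
      finally show ?thesis using True by simp
    qed (simp add: wt_def tm_def)
  qed
  also have "\<dots> = (\<integral>\<^sup>+z. ennreal (wt z) * F (coll z) \<partial>M0)"
    by (rule nn_integral_M0[symmetric]) measurable
  finally show ?thesis .
qed

lemma integral_K_M0:
  assumes [measurable]: "F \<in> borel_measurable (borel :: 'n collision measure)"
  shows "integrable K F \<longleftrightarrow> integrable M0 (\<lambda>z. wt z * F (coll z))"
    "(\<integral>z. F z \<partial>K) = (\<integral>z. wt z * F (coll z) \<partial>M0)"
proof -
  have e: "ennreal (wt z) * ennreal y = ennreal (wt z * y)" for z y using wt_nonneg[of z] by (simp add: ennreal_mult')
  have [measurable]: "F \<in> borel_measurable K" by (rule measurable_K) measurable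
  have "(\<integral>\<^sup>+z. ennreal (norm (F z)) \<partial>K) = (\<integral>\<^sup>+z. ennreal (norm (wt z * F (coll z))) \<partial>M0)"
    by (subst nn_integral_K_M0) (simp_all add: e abs_mult wt_nonneg)
  then show i: "integrable K F \<longleftrightarrow> integrable M0 (\<lambda>z. wt z * F (coll z))"
    by (simp add: integrable_iff_bounded)
  show "(\<integral>z. F z \<partial>K) = (\<integral>z. wt z * F (coll z) \<partial>M0)"
  proof (cases "integrable K F")
    case True
    then have "integrable M0 (\<lambda>z. wt z * F (coll z))" using i by simp
    moreover have "(\<integral>\<^sup>+z. ennreal (F z) \<partial>K) = (\<integral>\<^sup>+z. ennreal (wt z * F (coll z)) \<partial>M0)"
      "(\<integral>\<^sup>+z. ennreal (- F z) \<partial>K) = (\<integral>\<^sup>+z. ennreal (- (wt z * F (coll z))) \<partial>M0)"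
      using nn_integral_K_M0[of "\<lambda>z. ennreal (- F z)"] by (simp_all add: nn_integral_K_M0 e)
    ultimately show ?thesis using True by (simp add: real_lebesgue_integral_def)
  next
    case False
    then show ?thesis using i by (simp add: not_integrable_integral_eq)
  qed
qed

lemma f_mass: "t \<in> {0..T} \<Longrightarrow> (\<integral>\<^sup>+v. ennreal (f t v) \<partial>lborel) = 1"
proof -
  assume t: "t \<in> {0..T}"
  interpret k: prob_space "ker t" by (rule prob_ker)
  show ?thesis using k.emeasure_space_1 by (simp add: f_ker[OF t] emeasure_density)
qed

lemma ff_mass: "t \<in> {0..T} \<Longrightarrow> (\<integral>\<^sup>+x. ennreal (ff t x) \<partial>lborel) = 1"
proof -
  assume t: "t \<in> {0..T}"
  interpret k: prob_space "ker2 t" by (rule prob_ker2)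
  show ?thesis using nn_integral_ker2_ff[OF t, of "\<lambda>_. 1"] k.emeasure_space_1 by simp
qed

text \<open>For incoming velocities this is Fubini; outgoing ones reduce to them because scattering
  preserves \<open>M0\<close>.\<close>

lemma AE_transfer:
  assumes P: "AE z in lborel \<Otimes>\<^sub>M lborel. P (fst z) (snd z :: real^'n)"
  shows "AE z in M0. P (tm z) (fst (inc z)) \<and> P (tm z) (snd (inc z)) \<and> P (tm z) (fst (out z)) \<and> P (tm z) (snd (out z))"
proof -
  obtain N where N: "{z \<in> space (lborel \<Otimes>\<^sub>M lborel). \<not> P (fst z) (snd z)} \<subseteq> N" "emeasure (lborel \<Otimes>\<^sub>M lborel) N = 0" "N \<in> sets (lborel \<Otimes>\<^sub>M lborel)"
    using P by (auto elim: AE_E)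
  have Nb[measurable]: "N \<in> sets borel" using N(3)[unfolded lborel_prod] by simp
  have NP: "(t, v) \<notin> N \<Longrightarrow> P t v" for t v using N(1) by (force simp: space_pair_measure)
  have "(\<integral>\<^sup>+t. \<integral>\<^sup>+v. indicator N (t, v) \<partial>lborel \<partial>lborel) = (\<integral>\<^sup>+z. indicator N z \<partial>(lborel \<Otimes>\<^sub>M lborel))"
    by (rule lborel.nn_integral_fst) (use N(3) in measurable)
  also have "\<dots> = 0" using N by simp
  finally have "AE t in lborel. (\<integral>\<^sup>+v. indicator N (t, v) \<partial>lborel) = 0"
    by (subst (asm) nn_integral_0_iff_AE) measurable
  \<comment> \<open>The factor c may be infinite, as it is below for the measure of the whole space;
    in \<open>ennreal\<close> infinity times 0 is 0.\<close>
  then have zero: "(\<integral>\<^sup>+t. \<integral>\<^sup>+\<omega>. c * (\<integral>\<^sup>+v. indicator N (t, v) \<partial>lborel) \<partial>\<sigma> \<partial>lborel) = 0" for c :: ennreal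
    by (subst nn_integral_0_iff_AE) (auto elim!: eventually_mono)
  have z1: "(\<integral>\<^sup>+z. indicator N (tm z, fst (inc z)) \<partial>M0) = 0"
  proof -
    have "(\<integral>\<^sup>+z. indicator N (tm z, fst (inc z)) \<partial>M0) = (\<integral>\<^sup>+t. \<integral>\<^sup>+\<omega>. \<integral>\<^sup>+x. indicator N (t, fst x) \<partial>(lborel :: ((real^'n) \<times> (real^'n)) measure) \<partial>\<sigma> \<partial>lborel)"
      by (subst nn_integral_M0) (auto simp: tm_def inc_def)
    also have "\<dots> = (\<integral>\<^sup>+t. \<integral>\<^sup>+\<omega>. emeasure lborel (UNIV :: (real^'n) set) * (\<integral>\<^sup>+v. indicator N (t, v) \<partial>lborel) \<partial>\<sigma> \<partial>lborel)"
      unfolding lborel_prod[symmetric]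
      by (intro nn_integral_cong) (subst lborel.nn_integral_fst[symmetric], auto simp: nn_integral_multc nn_integral_cmult mult.commute)
    finally show ?thesis using zero by simp
  qed
  have z2: "(\<integral>\<^sup>+z. indicator N (tm z, snd (inc z)) \<partial>M0) = 0"
  proof -
    have "(\<integral>\<^sup>+z. indicator N (tm z, snd (inc z)) \<partial>M0) = (\<integral>\<^sup>+t. \<integral>\<^sup>+\<omega>. \<integral>\<^sup>+x. indicator N (t, snd x) \<partial>(lborel :: ((real^'n) \<times> (real^'n)) measure) \<partial>\<sigma> \<partial>lborel)"
      by (subst nn_integral_M0) (auto simp: tm_def inc_def)
    also have "\<dots> = (\<integral>\<^sup>+t. \<integral>\<^sup>+\<omega>. emeasure lborel (UNIV :: (real^'n) set) * (\<integral>\<^sup>+v. indicator N (t, v) \<partial>lborel) \<partial>\<sigma> \<partial>lborel)"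
      unfolding lborel_prod[symmetric]
      by (intro nn_integral_cong) (subst lborel.nn_integral_fst[symmetric], auto simp: nn_integral_multc nn_integral_cmult mult.commute)
    finally show ?thesis using zero by simp
  qed
  have z3: "(\<integral>\<^sup>+z. indicator N (tm z, fst (out z)) \<partial>M0) = 0"
    using nn_integral_M0_out[of "\<lambda>z. indicator N (tm z, fst (inc z))"] z1 by (simp add: tm_def inc_def)
  have z4: "(\<integral>\<^sup>+z. indicator N (tm z, snd (out z)) \<partial>M0) = 0"
    using nn_integral_M0_out[of "\<lambda>z. indicator N (tm z, snd (inc z))"] z2 by (simp add: tm_def inc_def)
  have A: "AE z in M0. (tm z, g z) \<notin> N" if "(\<integral>\<^sup>+z. indicator N (tm z, g z) \<partial>M0) = 0" and [measurable]: "g \<in> borel_measurable M0" for g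
  proof -
    have "AE z in M0. (indicator N (tm z, g z) :: ennreal) = 0" using that(1) by (subst (asm) nn_integral_0_iff_AE) measurable
    then show ?thesis by eventually_elim (auto simp: indicator_def split: if_splits)
  qed
  have "AE z in M0. (tm z, fst (inc z)) \<notin> N" "AE z in M0. (tm z, snd (inc z)) \<notin> N" "AE z in M0. (tm z, fst (out z)) \<notin> N" "AE z in M0. (tm z, snd (out z)) \<notin> N"
    using A z1 z2 z3 z4 by auto
  then show ?thesis by eventually_elim (use NP in auto)
qed

end

lemma ennreal_liminf_ge:
  fixes y w x :: "nat \<Rightarrow> real"
  assumes "\<And>n. y n - w n \<le> D n" "y \<longlonglongrightarrow> l" "w \<longlonglongrightarrow> 0"
  shows "ennreal l \<le> liminf (\<lambda>n. ennreal (D n))"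
proof -
  have "(\<lambda>n. y n - w n) \<longlonglongrightarrow> l - 0" by (intro tendsto_intros assms)
  then have "(\<lambda>n. ennreal (y n - w n)) \<longlonglongrightarrow> ennreal l" by simp
  then have "ennreal l = liminf (\<lambda>n. ennreal (y n - w n))" using lim_imp_Liminf[of sequentially] by force
  also have "\<dots> \<le> liminf (\<lambda>n. ennreal (D n))" using assms by (intro Liminf_mono always_eventually allI ennreal_leI)
  finally show ?thesis .
qed

locale flow_dens = flow e T \<sigma> \<pi> h + vpath_dens e T \<sigma> \<pi> f
  for e T :: real and \<sigma> :: "(real^'n) measure" and \<pi> :: "real \<Rightarrow> (real^'n) measure"
    and h :: "'n collision \<Rightarrow> real" and f :: "real \<Rightarrow> real^'n \<Rightarrow> real"
begin

section \<open>Pairing the mollified flux with the logarithmic ratio\<close>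

definition lam :: "(real \<times> (real^'n)) \<times> ((real^'n) \<times> (real^'n)) \<Rightarrow> real" where
  "lam z = ln (ff (tm z) (out z) / ff (tm z) (inc z))"

lemma lam_measurable [measurable]: "lam \<in> borel_measurable M0" unfolding lam_def by measurable

text \<open>On the times in \<open>{a<..b}\<close>, the densities with respect to \<open>M0\<close> of the flux, of \<open>Psi\<close> and of the gain
  term are \<open>qh\<close>, \<open>ps\<close> and \<open>gn\<close>.\<close>

definition Iab where "Iab a b z = (indicator {a<..b} (tm z) :: real)"
definition qh where "qh a b z = Iab a b z * (wt z * h (coll z))"
definition ps where "ps a b z = Iab a b z * (wt z * Psi (coll z))"
definition gn where "gn a b z = Iab a b z * ff (tm z) (out z)"
definition LA where "LA \<epsilon> s z = Lam \<epsilon> s (tm z) (om z) (inc z)"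
definition kk where "kk \<epsilon> s z = kap \<epsilon> s (tm z) (fst (out z)) * kap \<epsilon> s (tm z) (snd (out z))"

text \<open>Only the pair of velocities is smoothed. Time and direction stay fixed, so the
  scattering map involved is one linear isometry.\<close>

definition mol :: "real \<Rightarrow> ((real \<times> (real^'n)) \<times> ((real^'n) \<times> (real^'n)) \<Rightarrow> real) \<Rightarrow> (real \<times> (real^'n)) \<times> ((real^'n) \<times> (real^'n)) \<Rightarrow> real" where
  "mol s A z = mollify s (\<lambda>u. A (fst z, u)) (snd z)"

context
  fixes a b :: real
  assumes ab: "0 \<le> a" "a \<le> b" "b \<le> T"
begin

lemma Iab_measurable [measurable]: "(Iab a b) \<in> borel_measurable M0" unfolding Iab_def by measurable
lemma qh_measurable [measurable]: "(qh a b) \<in> borel_measurable M0" unfolding qh_def by measurable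
lemma ps_measurable [measurable]: "(ps a b) \<in> borel_measurable M0" unfolding ps_def by measurable
lemma gn_measurable [measurable]: "(gn a b) \<in> borel_measurable M0" unfolding gn_def by measurable

lemma Iab_cases: "Iab a b z = 0 \<or> (Iab a b z = 1 \<and> tm z \<in> {0..T} \<and> tm z \<in> {a<..b})"
  using ab by (auto simp: Iab_def indicator_def)

lemma qh_nonneg: "qh a b z \<ge> 0" and ps_nonneg: "ps a b z \<ge> 0" and gn_nonneg: "gn a b z \<ge> 0"
  by (auto simp: qh_def ps_def gn_def Iab_def intro!: mult_nonneg_nonneg wt_nonneg h_nonneg Psi_nonneg ff_nonneg)

lemma K_indicator_integrable:
  fixes F :: "'n collision \<Rightarrow> real"
  assumes "integrable K F" and [measurable]: "F \<in> borel_measurable borel"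
  shows "integrable K (\<lambda>z. indicator {a<..b} (fst z) * F z)"
proof (rule Bochner_Integration.integrable_bound[OF assms(1)])
  show "(\<lambda>z. indicator {a<..b} (fst z) * F z) \<in> borel_measurable K" by (intro measurable_K) measurable
qed (auto simp: indicator_def)

lemma fst_coll: "fst (coll z) = tm z" by (simp add: coll_def)

lemma integral_K_interval:
  fixes F :: "'n collision \<Rightarrow> real"
  assumes "integrable K F" and [measurable]: "F \<in> borel_measurable borel"
  shows "integrable M0 (\<lambda>z. Iab a b z * (wt z * F (coll z)))"
    "(\<integral>z. Iab a b z * (wt z * F (coll z)) \<partial>M0) = (\<integral>z. indicator {a<..b} (fst z) * F z \<partial>K)"
  using integral_K_M0[of "\<lambda>z. indicator {a<..b} (fst z) * F z"] K_indicator_integrable[OF assms]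
  by (simp_all add: fst_coll Iab_def[symmetric] mult.left_commute)

lemma ps_integrable: "integrable M0 (ps a b)" "(\<integral>z. ps a b z \<partial>M0) = (\<integral>z. indicator {a<..b} (fst z) * Psi z \<partial>K)"
  using integral_K_interval[OF Psi_integrable Psi_measurable] by (simp_all add: ps_def[abs_def])

text \<open>\<open>Psi_ge\<close> multiplied by \<open>wt\<close>; the factor rate / (1 + rate)
  \<le> 1 removes the rate and leaves half the incoming pair density.\<close>

lemma qh_Legendre:
  assumes \<omega>: "norm (om z) = 1" and I: "Iab a b z = 1"
  shows "qh a b z * l \<le> ps a b z + ff (tm z) (inc z) / 2 * exp l"
proof -
  have tT: "tm z \<in> {0..T}" using Iab_cases[of z] I by simp
  have w: "wt z = rate (om z) (inc z) / 2 * ff (tm z) (inc z)" using tT by (simp add: wt_def)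
  have sp: "speed (coll z) = rate (om z) (inc z)" unfolding coll_def out_def by (rule speed_scatter[OF \<omega>])
  have "wt z * (h (coll z) * l) \<le> wt z * (Psi (coll z) + exp l / (1 + rate (om z) (inc z)))"
    using Psi_ge(1)[of "coll z" l] unfolding sp by (intro mult_left_mono wt_nonneg)
  then have 1: "wt z * (h (coll z) * l) \<le> wt z * Psi (coll z) + wt z * (exp l / (1 + rate (om z) (inc z)))"
    by (simp only: distrib_left)
  have "wt z * (exp l / (1 + rate (om z) (inc z))) = (ff (tm z) (inc z) / 2 * exp l) * (rate (om z) (inc z) / (1 + rate (om z) (inc z)))" by (simp add: w)
  also have "\<dots> \<le> (ff (tm z) (inc z) / 2 * exp l) * 1"
    using rate_nonneg[of "om z" "inc z"] ff_nonneg[of "tm z" "inc z"] by (intro mult_left_mono mult_nonneg_nonneg) (auto simp: divide_le_eq)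
  finally have 2: "wt z * (exp l / (1 + rate (om z) (inc z))) \<le> ff (tm z) (inc z) / 2 * exp l" by simp
  have "qh a b z * l = wt z * (h (coll z) * l)" "ps a b z = wt z * Psi (coll z)"
    by (simp_all add: qh_def ps_def I)
  then show ?thesis using 1 2 by linarith
qed

lemma qh_lspread_integrable: "integrable M0 (\<lambda>z. qh a b z * lspread (coll z))"
  using integral_K_interval(1)[OF h_lspread_integrable] by (simp add: qh_def[abs_def] mult.assoc)

lemma qh_integrable: "integrable M0 (qh a b)"
  using integral_K_interval(1)[OF h_integrable] by (simp add: qh_def[abs_def])

text \<open>The scattering map preserves \<open>M0\<close>, so gain terms have the same mass as the pair densities.\<close>

lemma mass_M0:
  fixes F :: "real \<Rightarrow> (real^'n) \<times> (real^'n) \<Rightarrow> real"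
  assumes [measurable]: "(\<lambda>(t, x). F t x) \<in> borel_measurable borel" and F: "\<And>t x. F t x \<ge> 0"
    and m: "\<And>t. t \<in> {0..T} \<Longrightarrow> (\<integral>\<^sup>+x. ennreal (F t x) \<partial>lborel) = 1"
  shows "integrable M0 (\<lambda>z. Iab a b z * F (tm z) (out z))" "(\<integral>z. Iab a b z * F (tm z) (out z) \<partial>M0) = (b - a) * smass"
proof -
  interpret S: finite_measure \<sigma> by (rule finite_\<sigma>)
  have Fm[measurable]: "(\<lambda>x. F (g x) (k x)) \<in> borel_measurable M" if [measurable]: "g \<in> borel_measurable M" "k \<in> borel_measurable M" for g k and M :: "'z measure"
    using measurable_compose[OF _ assms(1), of "\<lambda>x. (g x, k x)" M] by simp
  have "(\<integral>\<^sup>+z. ennreal (Iab a b z * F (tm z) (out z)) \<partial>M0) = (\<integral>\<^sup>+z. ennreal (Iab a b z * F (tm z) (inc z)) \<partial>M0)"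
    using nn_integral_M0_out[of "\<lambda>z. ennreal (Iab a b z * F (tm z) (inc z))"] Fm
    by (simp add: Iab_def tm_def inc_def)
  also have "\<dots> = (\<integral>\<^sup>+t. \<integral>\<^sup>+\<omega>. \<integral>\<^sup>+x. ennreal (indicator {a<..b} t * F t x) \<partial>lborel \<partial>\<sigma> \<partial>lborel)"
    by (subst nn_integral_M0) (use Fm in \<open>auto simp: Iab_def tm_def inc_def\<close>)
  also have "\<dots> = (\<integral>\<^sup>+t. indicator {a<..b} t * emeasure \<sigma> UNIV \<partial>lborel)"
  proof (rule nn_integral_cong)
    fix t show "(\<integral>\<^sup>+\<omega>. \<integral>\<^sup>+x. ennreal (indicator {a<..b} t * F t x) \<partial>lborel \<partial>\<sigma>) = indicator {a<..b} t * emeasure \<sigma> UNIV"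
      using m[of t] ab by (cases "t \<in> {a<..b}") auto
  qed
  also have "\<dots> = ennreal ((b - a) * smass)"
    using ab by (simp add: nn_integral_multc S.emeasure_eq_measure smass_def ennreal_mult)
  finally have e: "(\<integral>\<^sup>+z. ennreal (Iab a b z * F (tm z) (out z)) \<partial>M0) = ennreal ((b - a) * smass)" .
  have nn: "Iab a b z * F (tm z) (out z) \<ge> 0" for z by (simp add: Iab_def F)
  show i: "integrable M0 (\<lambda>z. Iab a b z * F (tm z) (out z))"
    using e nn Fm by (intro integrableI_nonneg) auto
  show "(\<integral>z. Iab a b z * F (tm z) (out z) \<partial>M0) = (b - a) * smass"
    using e nn ab Fm by (subst integral_eq_nn_integral) (auto simp: smass_def)
qed

lemma gn_integrable: "integrable M0 (gn a b)" "(\<integral>z. gn a b z \<partial>M0) = (b - a) * smass"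
proof -
  have "(\<lambda>(t, x). ff t x) \<in> borel_measurable borel" by (simp add: split_beta')
  from mass_M0[OF this ff_nonneg ff_mass] show "integrable M0 (gn a b)" "(\<integral>z. gn a b z \<partial>M0) = (b - a) * smass"
    by (simp_all add: gn_def[abs_def])
qed

context
  fixes \<epsilon> s :: real
  assumes \<epsilon>: "0 < \<epsilon>" "\<epsilon> < 1" and s: "s > 0"
begin

lemma LA_measurable [measurable]: "(LA \<epsilon> s) \<in> borel_measurable M0" unfolding LA_def by (intro Lam_measurable[OF \<epsilon> s] M0_measurable)
lemma kk_measurable [measurable]: "(kk \<epsilon> s) \<in> borel_measurable M0" unfolding kk_def by measurable

lemma kk_integrable: "integrable M0 (\<lambda>z. Iab a b z * kk \<epsilon> s z)" "(\<integral>z. Iab a b z * kk \<epsilon> s z \<partial>M0) = (b - a) * smass"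
proof -
  have "(\<lambda>(t, x). kap \<epsilon> s t (fst x) * kap \<epsilon> s t (snd x)) \<in> borel_measurable borel" by (simp add: split_beta')
  from mass_M0[OF this mult_nonneg_nonneg[OF less_imp_le[OF kap_pos[OF \<epsilon> s]] less_imp_le[OF kap_pos[OF \<epsilon> s]]] kap_kap_mass[OF \<epsilon> s]]
  show "integrable M0 (\<lambda>z. Iab a b z * kk \<epsilon> s z)" "(\<integral>z. Iab a b z * kk \<epsilon> s z \<partial>M0) = (b - a) * smass"
    by (simp_all add: kk_def)
qed

lemma mol_measurable [measurable]:
  assumes A[measurable]: "A \<in> borel_measurable M0" shows "mol s A \<in> borel_measurable M0"
proof -
  have "(\<lambda>(p, u). A (p, u)) \<in> borel_measurable (TS \<Otimes>\<^sub>M lborel)" by simp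
  from mollify_measurable_param[OF this, of s] show ?thesis by (simp add: mol_def[abs_def] split_beta')
qed

lemma mol_integral:
  assumes A: "integrable M0 A" and nn: "\<And>z. A z \<ge> 0"
  shows "integrable M0 (mol s A)" "(\<integral>z. mol s A z \<partial>M0) = (\<integral>z. A z \<partial>M0)"
proof -
  note [measurable] = borel_measurable_integrable[OF A]
  interpret TS: sigma_finite_measure TS by (rule sigma_finite_TS)
  interpret P: pair_sigma_finite TS "lborel :: ((real^'n) \<times> (real^'n)) measure" ..
  have "(\<integral>\<^sup>+z. ennreal (mol s A z) \<partial>M0) = (\<integral>\<^sup>+p. \<integral>\<^sup>+x. ennreal (mol s A (p, x)) \<partial>lborel \<partial>TS)"
    by (rule lborel.nn_integral_fst[symmetric]) measurable
  also have "\<dots> = (\<integral>\<^sup>+p. \<integral>\<^sup>+x. ennreal (A (p, x)) \<partial>lborel \<partial>TS)"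
  proof (rule nn_integral_cong_AE)
    show "AE p in TS. (\<integral>\<^sup>+x. ennreal (mol s A (p, x)) \<partial>lborel) = (\<integral>\<^sup>+x. ennreal (A (p, x)) \<partial>lborel)"
      using P.AE_integrable_fst'[OF A]
    proof eventually_elim
      case (elim p)
      have "(\<integral>\<^sup>+x. ennreal (mol s A (p, x)) \<partial>lborel) = ennreal (\<integral>x. mol s A (p, x) \<partial>lborel)"
        unfolding mol_def fst_conv snd_conv
        by (intro nn_integral_eq_integral mollify_integral(1)[OF elim s] AE_I2 mollify_nonneg nn)
      also have "\<dots> = ennreal (\<integral>x. A (p, x) \<partial>lborel)"
        unfolding mol_def fst_conv snd_conv by (simp add: mollify_integral(2)[OF elim s])
      also have "\<dots> = (\<integral>\<^sup>+x. ennreal (A (p, x)) \<partial>lborel)"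
        by (intro nn_integral_eq_integral[symmetric] elim AE_I2 nn)
      finally show ?case .
    qed
  qed
  also have "\<dots> = (\<integral>\<^sup>+z. ennreal (A z) \<partial>M0)" by (rule lborel.nn_integral_fst) measurable
  finally have e: "(\<integral>\<^sup>+z. ennreal (mol s A z) \<partial>M0) = (\<integral>\<^sup>+z. ennreal (A z) \<partial>M0)" .
  have nm: "mol s A z \<ge> 0" for z unfolding mol_def by (intro mollify_nonneg nn)
  show "integrable M0 (mol s A)" using A nm nn e by (intro integrableI_nonneg) (auto simp: integrable_iff_bounded)
  show "(\<integral>z. mol s A z \<partial>M0) = (\<integral>z. A z \<partial>M0)" using nm nn e by (simp add: integral_eq_nn_integral)
qed

text \<open>Fubini in the point u of the flux and the point x of the mollified flux: integrating u
  first produces \<open>mol\<close>, integrating x first produces the collision gradient of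
  \<open>Gk\<close>.\<close>

lemma LA_mol_integral:
  shows "integrable M0 (\<lambda>z. mol s (qh a b) z * LA \<epsilon> s z)"
    "(\<integral>z. mol s (qh a b) z * LA \<epsilon> s z \<partial>M0) = (\<integral>z. indicator {a<..b} (fst z) * hF \<epsilon> s z \<partial>K)"
proof -
  interpret TS: sigma_finite_measure TS by (rule sigma_finite_TS)
  interpret P: pair_sigma_finite TS "lborel :: ((real^'n) \<times> (real^'n)) measure" ..
  define G where "G p u x = gauss s (x - u) * (qh a b (p, u) * LA \<epsilon> s (p, x))" for p u x
  have Gm[measurable]: "(\<lambda>(u, x). G p u x) \<in> borel_measurable (lborel \<Otimes>\<^sub>M lborel)" for p
    unfolding G_def by measurable (simp_all add: space_pair_measure)
  \<comment> \<open>The L1 norm of \<open>G\<close> on the slice p. It is finite for almost every p,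
    so Fubini can be applied slice by slice.\<close>
  define J where "J p = (\<integral>\<^sup>+u. \<integral>\<^sup>+x. ennreal (norm (G p u x)) \<partial>lborel \<partial>lborel)" for p
  have Gm3[measurable]: "(\<lambda>(z, x). G (fst z) (snd z) x) \<in> borel_measurable (M0 \<Otimes>\<^sub>M lborel)"
    unfolding G_def by measurable
  have Jm[measurable]: "J \<in> borel_measurable TS" unfolding J_def
  proof -
    have 1: "(\<lambda>z. \<integral>\<^sup>+x. ennreal (norm (G (fst z) (snd z) x)) \<partial>lborel) \<in> borel_measurable M0" by measurable
    then have "(\<lambda>(p, u). \<integral>\<^sup>+x. ennreal (norm (G p u x)) \<partial>lborel) \<in> borel_measurable (TS \<Otimes>\<^sub>M lborel)" by (simp add: split_beta')
    then show "(\<lambda>p. \<integral>\<^sup>+u. \<integral>\<^sup>+x. ennreal (norm (G p u x)) \<partial>lborel \<partial>lborel) \<in> borel_measurable TS"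
      by (rule lborel.borel_measurable_nn_integral)
  qed
  obtain C where C: "C \<ge> 0" "\<And>t x. \<bar>ln (kap \<epsilon> s t x)\<bar> \<le> C * (1 + lg x)" using ln_kap_bound[OF \<epsilon> s] by blast
  define D where "D = C * (1 + s * gauss_moment TYPE(real^'n))"
  have D: "D \<ge> 0" using C s by (simp add: D_def gauss_moment_def)
  have inner: "(\<integral>\<^sup>+x. ennreal (norm (G (fst z) (snd z) x)) \<partial>lborel) \<le> ennreal (12 * D * (qh a b z * lspread (coll z)))" if \<omega>: "norm (om z) = 1" for z
  proof -
    \<comment> \<open>Absolute values, so that the four terms of \<open>H\<close> dominate
      \<open>LA\<close> without relying on cancellation.\<close>
    define L where "L x = \<bar>ln (kap \<epsilon> s (tm z) x)\<bar>" for x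
    have Lm[measurable]: "L \<in> borel_measurable borel" unfolding L_def by measurable
    have LC: "\<bar>L x\<bar> \<le> C * (1 + lg x)" for x using C(2) by (simp add: L_def)
    have Li: "integrable lborel (\<lambda>x. gauss s (x - v) * L x)" "\<bar>\<integral>x. gauss s (x - v) * L x \<partial>lborel\<bar> \<le> D * (1 + lg v)" for v
      using gauss_lg_integrable[OF s Lm LC, of v] by (simp_all add: D_def)
    note I = gauss_scatter_integrals[OF s Lm Li(1) \<omega>, of "snd z"] gauss_fst_integral[OF s Lm Li(1), of "snd z"]
    define H where "H x = gauss s (x - snd z) * L (fst (scatter (om z) x)) + gauss s (x - snd z) * L (snd (scatter (om z) x))
       + gauss s (x - snd z) * L (fst x) + gauss s (x - snd z) * L (snd x)" for x
    have Hi: "integrable lborel H" unfolding H_def using I by auto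
    have H0: "H x \<ge> 0" for x unfolding H_def L_def by (intro add_nonneg_nonneg mult_nonneg_nonneg gauss_nonneg) auto
    have lgs: "1 + lg (fst (snd z)) \<le> 3 * lspread (coll z)" "1 + lg (snd (snd z)) \<le> 3 * lspread (coll z)"
      "1 + lg (fst (scatter (om z) (snd z))) \<le> 3 * lspread (coll z)" "1 + lg (snd (scatter (om z) (snd z))) \<le> 3 * lspread (coll z)"
      using lg_comp_scatter[OF \<omega>, of "tm z" "snd z"] by (simp_all add: comp_defs coll_def inc_def out_def lspread_def)
    have "(\<integral>x. H x \<partial>lborel) \<le> D * (1 + lg (fst (scatter (om z) (snd z)))) + D * (1 + lg (snd (scatter (om z) (snd z)))) + D * (1 + lg (fst (snd z))) + D * (1 + lg (snd (snd z)))"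
      unfolding H_def using I Li(2)[THEN order_trans[OF abs_ge_self]] by (simp add: add_mono)
    also have "\<dots> \<le> D * (3 * lspread (coll z)) + D * (3 * lspread (coll z)) + D * (3 * lspread (coll z)) + D * (3 * lspread (coll z))"
      by (intro add_mono mult_left_mono lgs D)
    finally have HI: "(\<integral>x. H x \<partial>lborel) \<le> 12 * D * lspread (coll z)" by simp
    have "norm (G (fst z) (snd z) x) \<le> qh a b z * H x" for x
    proof -
      have "\<bar>LA \<epsilon> s (fst z, x)\<bar> \<le> L (fst (scatter (om z) x)) + L (snd (scatter (om z) x)) + L (fst x) + L (snd x)"
        unfolding LA_def Lam_def L_def tm_def om_def inc_def fst_conv snd_conv by linarith
      then have "gauss s (x - snd z) * \<bar>LA \<epsilon> s (fst z, x)\<bar> \<le> gauss s (x - snd z) * (L (fst (scatter (om z) x)) + L (snd (scatter (om z) x)) + L (fst x) + L (snd x))"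
        by (intro mult_left_mono gauss_nonneg)
      also have "\<dots> = H x" by (simp add: H_def distrib_left)
      finally have "qh a b z * (gauss s (x - snd z) * \<bar>LA \<epsilon> s (fst z, x)\<bar>) \<le> qh a b z * H x" by (intro mult_left_mono qh_nonneg)
      then show ?thesis using qh_nonneg[of z] gauss_nonneg[of s "x - snd z"] by (simp add: G_def abs_mult mult_ac)
    qed
    then have "(\<integral>\<^sup>+x. ennreal (norm (G (fst z) (snd z) x)) \<partial>lborel) \<le> (\<integral>\<^sup>+x. ennreal (qh a b z * H x) \<partial>lborel)"
      by (intro nn_integral_mono ennreal_leI)
    also have "\<dots> = ennreal (\<integral>x. qh a b z * H x \<partial>lborel)"
      using Hi H0 qh_nonneg[of z] by (intro nn_integral_eq_integral) (auto intro!: AE_I2 mult_nonneg_nonneg)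
    also have "(\<integral>x. qh a b z * H x \<partial>lborel) = qh a b z * (\<integral>x. H x \<partial>lborel)" by simp
    also have "ennreal (qh a b z * (\<integral>x. H x \<partial>lborel)) \<le> ennreal (qh a b z * (12 * D * lspread (coll z)))"
      by (intro ennreal_leI mult_left_mono HI qh_nonneg)
    finally show ?thesis by (simp add: mult_ac)
  qed
  have fin: "(\<integral>\<^sup>+z. \<integral>\<^sup>+x. ennreal (norm (G (fst z) (snd z) x)) \<partial>lborel \<partial>M0) < \<infinity>"
  proof -
    have i: "integrable M0 (\<lambda>z. 12 * D * (qh a b z * lspread (coll z)))" using qh_lspread_integrable by simp
    have "(\<integral>\<^sup>+z. \<integral>\<^sup>+x. ennreal (norm (G (fst z) (snd z) x)) \<partial>lborel \<partial>M0) \<le> (\<integral>\<^sup>+z. ennreal (12 * D * (qh a b z * lspread (coll z))) \<partial>M0)"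
    proof (rule nn_integral_mono_AE)
      show "AE z in M0. (\<integral>\<^sup>+x. ennreal (norm (G (fst z) (snd z) x)) \<partial>lborel) \<le> ennreal (12 * D * (qh a b z * lspread (coll z)))"
        using AE_M0_unit
      proof eventually_elim
        case (elim z) then show ?case by (rule inner)
      qed
    qed
    also have "\<dots> = ennreal (\<integral>z. 12 * D * (qh a b z * lspread (coll z)) \<partial>M0)"
      by (intro nn_integral_eq_integral[OF i] AE_I2 mult_nonneg_nonneg D qh_nonneg order_trans[OF zero_le_one lspread_ge_1]) simp
    finally show ?thesis by (simp add: le_less_trans)
  qed
  have JM: "(\<integral>\<^sup>+p. J p \<partial>TS) = (\<integral>\<^sup>+z. \<integral>\<^sup>+x. ennreal (norm (G (fst z) (snd z) x)) \<partial>lborel \<partial>M0)"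
  proof -
    have "(\<lambda>z. \<integral>\<^sup>+x. ennreal (norm (G (fst z) (snd z) x)) \<partial>lborel) \<in> borel_measurable M0" by measurable
    from lborel.nn_integral_fst[OF this] show ?thesis by (simp add: J_def)
  qed
  then have "(\<integral>\<^sup>+p. J p \<partial>TS) < \<infinity>" using fin by simp
  then have AJ: "AE p in TS. J p < \<infinity>" using nn_integral_PInf_AE[OF Jm] by (auto simp: less_top)
  have pi: "integrable (lborel \<Otimes>\<^sub>M lborel) (\<lambda>(u, x). G p u x)" if "J p < \<infinity>" for p
  proof (rule integrableI_bounded)
    have "(\<integral>\<^sup>+z. ennreal (norm (case z of (u, x) \<Rightarrow> G p u x)) \<partial>(lborel \<Otimes>\<^sub>M lborel)) = J p"
      unfolding J_def by (subst lborel.nn_integral_fst[symmetric]) (auto simp: split_beta')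
    then show "(\<integral>\<^sup>+z. ennreal (norm (case z of (u, x) \<Rightarrow> G p u x)) \<partial>(lborel \<Otimes>\<^sub>M lborel)) < \<infinity>" using that by simp
  qed measurable
  have Gu: "(\<integral>u. G p u x \<partial>lborel) = mol s (qh a b) (p, x) * LA \<epsilon> s (p, x)" for p x
  proof -
    have "(\<integral>u. G p u x \<partial>lborel) = (\<integral>u. (gauss s (x - u) * qh a b (p, u)) * LA \<epsilon> s (p, x) \<partial>lborel)" by (simp add: G_def mult.assoc)
    also have "\<dots> = (\<integral>u. gauss s (x - u) * qh a b (p, u) \<partial>lborel) * LA \<epsilon> s (p, x)" by (rule integral_mult_left_zero)
    finally show ?thesis by (simp add: mol_def mollify_def)
  qed
  have Gx: "(\<integral>x. G p u x \<partial>lborel) = qh a b (p, u) * collision_gradient (Gk \<epsilon> s (fst p)) (u, scatter (snd p) u)" if "norm (snd p) = 1" for p u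
  proof -
    have "(\<integral>x. G p u x \<partial>lborel) = (\<integral>x. qh a b (p, u) * (gauss s (x - u) * Lam \<epsilon> s (fst p) (snd p) x) \<partial>lborel)"
      by (simp add: G_def LA_def tm_def om_def inc_def mult_ac)
    also have "\<dots> = qh a b (p, u) * (\<integral>x. gauss s (x - u) * Lam \<epsilon> s (fst p) (snd p) x \<partial>lborel)" by (rule integral_mult_right_zero)
    finally show ?thesis using Lam_integral(2)[OF \<epsilon> s that] by simp
  qed
  show i1: "integrable M0 (\<lambda>z. mol s (qh a b) z * LA \<epsilon> s z)"
  proof (rule integrableI_bounded)
    have "(\<integral>\<^sup>+z. ennreal (norm (mol s (qh a b) z * LA \<epsilon> s z)) \<partial>M0) = (\<integral>\<^sup>+p. \<integral>\<^sup>+x. ennreal (norm (mol s (qh a b) (p, x) * LA \<epsilon> s (p, x))) \<partial>lborel \<partial>TS)"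
      by (rule lborel.nn_integral_fst[symmetric]) measurable
    also have "\<dots> \<le> (\<integral>\<^sup>+p. J p \<partial>TS)"
    proof (rule nn_integral_mono_AE)
      show "AE p in TS. (\<integral>\<^sup>+x. ennreal (norm (mol s (qh a b) (p, x) * LA \<epsilon> s (p, x))) \<partial>lborel) \<le> J p"
        using AJ
      proof eventually_elim
        case (elim p)
        have "(\<integral>\<^sup>+x. ennreal (norm (mol s (qh a b) (p, x) * LA \<epsilon> s (p, x))) \<partial>lborel) \<le> (\<integral>\<^sup>+x. \<integral>\<^sup>+u. ennreal (norm (G p u x)) \<partial>lborel \<partial>lborel)"
        proof (rule nn_integral_mono_AE)
          show "AE x in lborel. ennreal (norm (mol s (qh a b) (p, x) * LA \<epsilon> s (p, x))) \<le> (\<integral>\<^sup>+u. ennreal (norm (G p u x)) \<partial>lborel)"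
            using lborel_pair.AE_integrable_snd[OF pi[OF elim]]
            by eventually_elim (use integral_norm_bound_ennreal in \<open>force simp: Gu[symmetric]\<close>)
        qed
        also have "\<dots> = J p" unfolding J_def by (rule lborel_pair.Fubini') measurable
        finally show ?case .
      qed
    qed
    finally show "(\<integral>\<^sup>+z. ennreal (norm (mol s (qh a b) z * LA \<epsilon> s z)) \<partial>M0) < \<infinity>" using \<open>(\<integral>\<^sup>+p. J p \<partial>TS) < \<infinity>\<close> by (rule le_less_trans)
  qed measurable
  have Au: "AE p in TS. norm (snd p) = 1"
  proof -
    have "AE z in M0. norm (snd (fst z)) = 1" using AE_M0_unit by (simp add: om_def)
    from P.AE_pair[OF this] have "AE p in TS. AE x in (lborel :: ((real^'n) \<times> (real^'n)) measure). norm (snd p) = 1" by simp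
    then show ?thesis by eventually_elim (simp add: ae_filter_eq_bot_iff trivial_limit_def[symmetric] eventually_const)
  qed
  note hi = integral_K_interval[OF hF_integrable[OF \<epsilon> s] hF_measurable[OF \<epsilon> s]]
  have hq: "Iab a b z * (wt z * hF \<epsilon> s (coll z)) = qh a b z * collision_gradient (Gk \<epsilon> s (tm z)) (inc z, out z)" for z
    by (simp add: hF_def qh_def coll_def)
  have "(\<integral>z. indicator {a<..b} (fst z) * hF \<epsilon> s z \<partial>K) = (\<integral>z. qh a b z * collision_gradient (Gk \<epsilon> s (tm z)) (inc z, out z) \<partial>M0)"
    using hi(2) unfolding hq by simp
  also have "\<dots> = (\<integral>p. \<integral>u. qh a b (p, u) * collision_gradient (Gk \<epsilon> s (fst p)) (u, scatter (snd p) u) \<partial>lborel \<partial>TS)"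
    using P.integral_fst'[OF hi(1)[unfolded hq]] by (simp add: tm_def inc_def out_def om_def)
  also have "\<dots> = (\<integral>p. \<integral>x. mol s (qh a b) (p, x) * LA \<epsilon> s (p, x) \<partial>lborel \<partial>TS)"
  proof (rule integral_cong_AE)
    show "AE p in TS. (\<integral>u. qh a b (p, u) * collision_gradient (Gk \<epsilon> s (fst p)) (u, scatter (snd p) u) \<partial>lborel) = (\<integral>x. mol s (qh a b) (p, x) * LA \<epsilon> s (p, x) \<partial>lborel)"
      using Au AJ
    proof eventually_elim
      case (elim p)
      show ?case unfolding Gu[symmetric] Gx[OF elim(1), symmetric] using lborel_pair.Fubini_integral[OF pi[OF elim(2)]] by simp
    qed
    show "(\<lambda>p. \<integral>x. mol s (qh a b) (p, x) * LA \<epsilon> s (p, x) \<partial>lborel) \<in> borel_measurable TS" by measurable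
    have "(\<lambda>z. qh a b z * collision_gradient (Gk \<epsilon> s (tm z)) (inc z, out z)) \<in> borel_measurable M0"
      using borel_measurable_integrable[OF hi(1)] unfolding hq .
    then have "(\<lambda>(p, u). qh a b (p, u) * collision_gradient (Gk \<epsilon> s (fst p)) (u, scatter (snd p) u)) \<in> borel_measurable (TS \<Otimes>\<^sub>M lborel)"
      by (simp add: split_beta' tm_def inc_def out_def om_def)
    then show "(\<lambda>p. \<integral>u. qh a b (p, u) * collision_gradient (Gk \<epsilon> s (fst p)) (u, scatter (snd p) u) \<partial>lborel) \<in> borel_measurable TS"
      by (rule lborel.borel_measurable_lebesgue_integral)
  qed
  also have "\<dots> = (\<integral>z. mol s (qh a b) z * LA \<epsilon> s z \<partial>M0)" using P.integral_fst'[OF i1] by simp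
  finally show "(\<integral>z. mol s (qh a b) z * LA \<epsilon> s z \<partial>M0) = (\<integral>z. indicator {a<..b} (fst z) * hF \<epsilon> s z \<partial>K)" by simp
qed

text \<open>\<open>qh_Legendre\<close> averaged over u, with the exponent fixed at the point x; the
  pair density averages to \<open>dens\<close> times \<open>dens\<close>. One null set serves all c,
  of which 1 and 1/2 are used later.\<close>

lemma mol_Legendre:
  "AE z in M0. \<forall>c>0. mol s (qh a b) z * (c * LA \<epsilon> s z) \<le> mol s (ps a b) z + Iab a b z / 2 * (dens s (tm z) (fst (inc z)) * dens s (tm z) (snd (inc z))) * exp (c * LA \<epsilon> s z)"
proof -
  interpret TS: sigma_finite_measure TS by (rule sigma_finite_TS)
  interpret P: pair_sigma_finite TS "lborel :: ((real^'n) \<times> (real^'n)) measure" ..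
  have "AE p in TS. integrable lborel (\<lambda>u. qh a b (p, u)) \<and> integrable lborel (\<lambda>u. ps a b (p, u)) \<and> norm (snd p) = 1"
  proof -
    have "AE p in TS. norm (snd p) = 1"
    proof -
      have "AE z in M0. norm (snd (fst z)) = 1" using AE_M0_unit by (simp add: om_def)
      from P.AE_pair[OF this] have "AE p in TS. AE x in (lborel :: ((real^'n) \<times> (real^'n)) measure). norm (snd p) = 1" by simp
      then show ?thesis by eventually_elim (simp add: ae_filter_eq_bot_iff trivial_limit_def[symmetric] eventually_const)
    qed
    then show ?thesis using P.AE_integrable_fst'[OF qh_integrable] P.AE_integrable_fst'[OF ps_integrable(1)]
      by eventually_elim simp
  qed
  then have "AE z in M0. integrable lborel (\<lambda>u. qh a b (fst z, u)) \<and> integrable lborel (\<lambda>u. ps a b (fst z, u)) \<and> norm (snd (fst z)) = 1"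
    by (rule AE_TS_M0)
  then show ?thesis
  proof eventually_elim
    case (elim z)
    obtain t \<omega> x where z: "z = ((t, \<omega>), x)" by (metis prod.collapse)
    have \<omega>: "norm \<omega> = 1" using elim by (simp add: z)
    have iq: "integrable lborel (\<lambda>u. gauss s (x - u) * qh a b ((t, \<omega>), u))" and ip: "integrable lborel (\<lambda>u. gauss s (x - u) * ps a b ((t, \<omega>), u))"
      using elim mollify_integrable[OF _ s] by (auto simp: z)
    show ?case
    proof (intro allI impI)
      fix c :: real assume c: "c > 0"
      define l where "l = c * LA \<epsilon> s z"
      show "mol s (qh a b) z * (c * LA \<epsilon> s z) \<le> mol s (ps a b) z + Iab a b z / 2 * (dens s (tm z) (fst (inc z)) * dens s (tm z) (snd (inc z))) * exp (c * LA \<epsilon> s z)"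
      proof (cases "t \<in> {a<..b}")
        case False
        then have "qh a b ((t, \<omega>), u) = 0" "ps a b ((t, \<omega>), u) = 0" for u by (auto simp: qh_def ps_def Iab_def tm_def)
        then show ?thesis using False by (simp add: mol_def mollify_def z Iab_def tm_def)
      next
        case True
        then have tT: "t \<in> {0..T}" using ab by auto
        have I: "Iab a b ((t, \<omega>), u) = 1" for u using True by (simp add: Iab_def tm_def)
        have dd: "(\<integral>\<^sup>+u. ennreal (gauss s (x - u) * ff t u) \<partial>lborel) = ennreal (dens s t (fst x) * dens s t (snd x))"
          unfolding nn_integral_ker2_gauss[OF \<epsilon> s, symmetric]
          by (subst nn_integral_ker2_ff[OF tT]) (auto intro!: nn_integral_cong simp: ennreal_mult[symmetric] gauss_nonneg ff_nonneg mult.commute)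
        have iff: "integrable lborel (\<lambda>u. gauss s (x - u) * ff t u)"
          using dd by (intro integrableI_nonneg) (auto intro!: AE_I2 mult_nonneg_nonneg gauss_nonneg ff_nonneg)
        have vff: "(\<integral>u. gauss s (x - u) * ff t u \<partial>lborel) = dens s t (fst x) * dens s t (snd x)"
        proof (subst integral_eq_nn_integral)
          show "AE u in lborel. 0 \<le> gauss s (x - u) * ff t u" by (intro AE_I2 mult_nonneg_nonneg gauss_nonneg ff_nonneg)
          show "enn2real (\<integral>\<^sup>+u. ennreal (gauss s (x - u) * ff t u) \<partial>lborel) = dens s t (fst x) * dens s t (snd x)"
            unfolding dd by (intro enn2real_ennreal mult_nonneg_nonneg dens_nonneg)
        qed measurable
        have pt: "qh a b ((t, \<omega>), u) * l \<le> ps a b ((t, \<omega>), u) + ff t u / 2 * exp l" for u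
          using qh_Legendre[of "((t, \<omega>), u)" l] \<omega> I[of u] by (simp add: tm_def om_def inc_def)
        have "mol s (qh a b) z * l = (\<integral>u. gauss s (x - u) * qh a b ((t, \<omega>), u) * l \<partial>lborel)" by (simp add: mol_def mollify_def z)
        also have "\<dots> \<le> (\<integral>u. gauss s (x - u) * ps a b ((t, \<omega>), u) + exp l / 2 * (gauss s (x - u) * ff t u) \<partial>lborel)"
        proof (rule integral_mono)
          fix u
          show "gauss s (x - u) * qh a b ((t, \<omega>), u) * l \<le> gauss s (x - u) * ps a b ((t, \<omega>), u) + exp l / 2 * (gauss s (x - u) * ff t u)"
            using mult_left_mono[OF pt[of u] gauss_nonneg[of s "x - u"]] by (simp add: algebra_simps)
        qed (use iq ip iff in auto)
        also have "\<dots> = mol s (ps a b) z + exp l / 2 * (dens s t (fst x) * dens s t (snd x))"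
          using ip iff by (simp add: vff mol_def mollify_def z)
        finally show ?thesis by (simp add: l_def z tm_def inc_def I mult_ac)
      qed
    qed
  qed
qed

end

end

end

context flow_dens begin

lemma kap_scatter_exp:
  assumes \<epsilon>: "0 < \<epsilon>" "\<epsilon> < 1" and s: "s > 0"
  shows "exp (c * LA \<epsilon> s z) = (kk \<epsilon> s z / (kap \<epsilon> s (tm z) (fst (inc z)) * kap \<epsilon> s (tm z) (snd (inc z)))) powr c"
    "LA \<epsilon> s z = ln (kk \<epsilon> s z / (kap \<epsilon> s (tm z) (fst (inc z)) * kap \<epsilon> s (tm z) (snd (inc z))))"
proof -
  have "exp (LA \<epsilon> s z) = kk \<epsilon> s z / (kap \<epsilon> s (tm z) (fst (inc z)) * kap \<epsilon> s (tm z) (snd (inc z)))"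
    unfolding LA_def kk_def out_def by (rule exp_Lam[OF \<epsilon> s])
  then show "LA \<epsilon> s z = ln (kk \<epsilon> s z / (kap \<epsilon> s (tm z) (fst (inc z)) * kap \<epsilon> s (tm z) (snd (inc z))))"
    by (metis ln_exp)
  then show "exp (c * LA \<epsilon> s z) = (kk \<epsilon> s z / (kap \<epsilon> s (tm z) (fst (inc z)) * kap \<epsilon> s (tm z) (snd (inc z)))) powr c"
    using kap_pos[OF \<epsilon> s, of "tm z" "fst (inc z)"] kap_pos[OF \<epsilon> s, of "tm z" "snd (inc z)"]
      kap_pos[OF \<epsilon> s, of "tm z" "fst (out z)"] kap_pos[OF \<epsilon> s, of "tm z" "snd (out z)"] by (simp add: powr_def kk_def)
qed

text \<open>The pointwise limit of the nonnegative integrands; where the flux is positive but the gain density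
  vanishes, they diverge.\<close>

definition Dinf :: "real \<Rightarrow> real \<Rightarrow> (real \<times> (real^'n)) \<times> ((real^'n) \<times> (real^'n)) \<Rightarrow> ennreal" where
  "Dinf a b z = (if qh a b z > 0 \<and> ff (tm z) (out z) = 0 then \<infinity> else ennreal (ps a b z - qh a b z * lam z + gn a b z / 2))"

text \<open>The factor 1 / (1 - \<epsilon>)^2 makes up for bounding \<open>dens\<close> by kap / (1
  - \<epsilon>). It secures nonnegativity and tends to 1.\<close>

definition Dn :: "real \<Rightarrow> real \<Rightarrow> real \<Rightarrow> real \<Rightarrow> (real \<times> (real^'n)) \<times> ((real^'n) \<times> (real^'n)) \<Rightarrow> real" where
  "Dn a b \<epsilon> s z = mol s (ps a b) z - mol s (qh a b) z * LA \<epsilon> s z + 1 / (2 * (1 - \<epsilon>)\<^sup>2) * (Iab a b z * kk \<epsilon> s z)"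

context
  fixes a b :: real
  assumes ab: "0 \<le> a" "a \<le> b" "b \<le> T"
begin

lemma dens_kap_le:
  assumes \<epsilon>: "0 < \<epsilon>" "\<epsilon> < 1" and s: "s > 0"
  shows "dens s t x * dens s t y \<le> 1 / (1 - \<epsilon>)\<^sup>2 * (kap \<epsilon> s t x * kap \<epsilon> s t y)"
proof -
  have d: "dens s t y \<le> kap \<epsilon> s t y / (1 - \<epsilon>)" for y
    using kap_ge(2)[OF \<epsilon> s, of t y] \<epsilon> by (simp add: field_simps)
  have "dens s t x * dens s t y \<le> (kap \<epsilon> s t x / (1 - \<epsilon>)) * (kap \<epsilon> s t y / (1 - \<epsilon>))"
    using \<epsilon> kap_pos[OF \<epsilon> s, of t] by (intro mult_mono d dens_nonneg) (auto simp: less_imp_le)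
  then show ?thesis by (simp add: power2_eq_square)
qed

lemma Legendre_kap:
  assumes \<epsilon>: "0 < \<epsilon>" "\<epsilon> < 1" and s: "s > 0"
  shows "AE z in M0. \<forall>c>0. mol s (qh a b) z * (c * LA \<epsilon> s z) \<le> mol s (ps a b) z +
    1 / (2 * (1 - \<epsilon>)\<^sup>2) * (Iab a b z * (kap \<epsilon> s (tm z) (fst (inc z)) * kap \<epsilon> s (tm z) (snd (inc z)) * exp (c * LA \<epsilon> s z)))"
  using mol_Legendre[OF ab \<epsilon> s]
proof eventually_elim
  case (elim z)
  show ?case
  proof (intro allI impI)
    fix c :: real assume c: "c > 0"
    have "Iab a b z / 2 * (dens s (tm z) (fst (inc z)) * dens s (tm z) (snd (inc z))) * exp (c * LA \<epsilon> s z)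
      \<le> Iab a b z / 2 * (1 / (1 - \<epsilon>)\<^sup>2 * (kap \<epsilon> s (tm z) (fst (inc z)) * kap \<epsilon> s (tm z) (snd (inc z)))) * exp (c * LA \<epsilon> s z)"
      by (intro mult_right_mono mult_left_mono dens_kap_le[OF \<epsilon> s]) (auto simp: Iab_def)
    also have "\<dots> = 1 / (2 * (1 - \<epsilon>)\<^sup>2) * (Iab a b z * (kap \<epsilon> s (tm z) (fst (inc z)) * kap \<epsilon> s (tm z) (snd (inc z)) * exp (c * LA \<epsilon> s z)))"
      by simp
    finally show "mol s (qh a b) z * (c * LA \<epsilon> s z) \<le> mol s (ps a b) z +
      1 / (2 * (1 - \<epsilon>)\<^sup>2) * (Iab a b z * (kap \<epsilon> s (tm z) (fst (inc z)) * kap \<epsilon> s (tm z) (snd (inc z)) * exp (c * LA \<epsilon> s z)))"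
      using elim[rule_format, OF c] by linarith
  qed
qed

text \<open>At c = 1 the exponential turns the incoming pair density of \<open>kap\<close> into the
  outgoing one, \<open>kk\<close>.\<close>

lemma Dn_nonneg:
  assumes \<epsilon>: "0 < \<epsilon>" "\<epsilon> < 1" and s: "s > 0"
  shows "AE z in M0. Dn a b \<epsilon> s z \<ge> 0"
  using Legendre_kap[OF \<epsilon> s]
proof eventually_elim
  case (elim z)
  have "kap \<epsilon> s (tm z) (fst (inc z)) * kap \<epsilon> s (tm z) (snd (inc z)) > 0" "kk \<epsilon> s z > 0"
    unfolding kk_def by (intro mult_pos_pos kap_pos[OF \<epsilon> s])+
  then have "kap \<epsilon> s (tm z) (fst (inc z)) * kap \<epsilon> s (tm z) (snd (inc z)) * exp (1 * LA \<epsilon> s z) = kk \<epsilon> s z"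
    unfolding kap_scatter_exp(1)[OF \<epsilon> s] by (subst powr_one) (auto simp: less_imp_le)
  then show ?case using elim[rule_format, of 1] unfolding Dn_def by simp
qed

lemma Dn_integral:
  assumes \<epsilon>: "0 < \<epsilon>" "\<epsilon> < 1" and s: "s > 0"
  shows "integrable M0 (Dn a b \<epsilon> s)"
    "(\<integral>z. Dn a b \<epsilon> s z \<partial>M0) = (\<integral>z. ps a b z \<partial>M0) - (\<integral>z. indicator {a<..b} (fst z) * hF \<epsilon> s z \<partial>K) + 1 / (2 * (1 - \<epsilon>)\<^sup>2) * ((b - a) * smass)"
proof -
  note i = mol_integral[OF ab \<epsilon> s ps_integrable(1)[OF ab] ps_nonneg[OF ab]] LA_mol_integral[OF ab \<epsilon> s] kk_integrable[OF ab \<epsilon> s]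
  show "integrable M0 (Dn a b \<epsilon> s)" unfolding Dn_def[abs_def] using i
    by (intro Bochner_Integration.integrable_add Bochner_Integration.integrable_diff integrable_mult_right)
  show "(\<integral>z. Dn a b \<epsilon> s z \<partial>M0) = (\<integral>z. ps a b z \<partial>M0) - (\<integral>z. indicator {a<..b} (fst z) * hF \<epsilon> s z \<partial>K) + 1 / (2 * (1 - \<epsilon>)\<^sup>2) * ((b - a) * smass)"
    unfolding Dn_def using i by simp
qed

text \<open>The delicate term is the flux times \<open>LA\<close> where a density vanishes. If the
  limit flux is positive, so is the incoming pair density, and only the outgoing one may vanish. If
  it is 0, the product may be of the form 0 times infinity, and it has to be shown that it cannot
  lower the limit.\<close>

lemma Dinf_le_liminf:
  fixes \<epsilon> s :: "nat \<Rightarrow> real"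
  assumes \<epsilon>: "\<And>n. 0 < \<epsilon> n" "\<And>n. \<epsilon> n < 1" "\<epsilon> \<longlonglongrightarrow> 0" and s: "\<And>n. s n > 0"
    and Leg: "\<And>n c. c > 0 \<Longrightarrow> mol (s n) (qh a b) z * (c * LA (\<epsilon> n) (s n) z) \<le> mol (s n) (ps a b) z +
      1 / (2 * (1 - \<epsilon> n)\<^sup>2) * (Iab a b z * (kap (\<epsilon> n) (s n) (tm z) (fst (inc z)) * kap (\<epsilon> n) (s n) (tm z) (snd (inc z)) * exp (c * LA (\<epsilon> n) (s n) z)))"
    and q: "(\<lambda>n. mol (s n) (qh a b) z) \<longlonglongrightarrow> qh a b z" and p: "(\<lambda>n. mol (s n) (ps a b) z) \<longlonglongrightarrow> ps a b z"
    and d: "\<And>v. tm z \<in> {0..T} \<Longrightarrow> v \<in> {fst (inc z), snd (inc z), fst (out z), snd (out z)} \<Longrightarrow> (\<lambda>n. dens (s n) (tm z) v) \<longlonglongrightarrow> f (tm z) v"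
  shows "Dinf a b z \<le> liminf (\<lambda>n. ennreal (Dn a b (\<epsilon> n) (s n) z))"
proof (cases "Iab a b z = 0")
  case True
  then have "Dinf a b z = 0" by (simp add: Dinf_def qh_def ps_def gn_def)
  then show ?thesis by simp
next
  case False
  then have I: "Iab a b z = 1" "tm z \<in> {0..T}" using Iab_cases[OF ab, of z] by auto
  define t where "t = tm z"
  define g where "g = ff t (inc z)"
  define g' where "g' = ff t (out z)"
  have g0: "g \<ge> 0" "g' \<ge> 0" by (simp_all add: g_def g'_def ff_nonneg)
  define ki where "ki n = kap (\<epsilon> n) (s n) t (fst (inc z)) * kap (\<epsilon> n) (s n) t (snd (inc z))" for n
  define ko where "ko n = kk (\<epsilon> n) (s n) z" for n
  define Q where "Q n = mol (s n) (qh a b) z" for n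
  define P where "P n = mol (s n) (ps a b) z" for n
  define L where "L n = LA (\<epsilon> n) (s n) z" for n
  define c where "c n = 1 / (2 * (1 - \<epsilon> n)\<^sup>2)" for n
  have kl: "(\<lambda>n. kap (\<epsilon> n) (s n) t v) \<longlonglongrightarrow> f t v" if "v \<in> {fst (inc z), snd (inc z), fst (out z), snd (out z)}" for v
  proof -
    have "(\<lambda>n. kap (\<epsilon> n) (s n) t v) \<longlonglongrightarrow> (1 - 0) * f t v + 0 * weight v"
      unfolding kap_def t_def by (intro tendsto_intros \<epsilon> d I that)
    then show ?thesis by simp
  qed
  have kil: "ki \<longlonglongrightarrow> g" unfolding ki_def g_def ff_def by (intro tendsto_intros kl) auto
  have kol: "ko \<longlonglongrightarrow> g'" unfolding ko_def kk_def t_def[symmetric] g'_def ff_def by (intro tendsto_intros kl) auto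
  have kp: "ki n > 0" "ko n > 0" for n
    using kap_pos[OF \<epsilon>(1,2) s] by (auto simp: ki_def ko_def kk_def)
  have Ll: "L n = ln (ko n / ki n)" for n
    unfolding L_def ko_def ki_def t_def by (rule kap_scatter_exp(2)[OF \<epsilon>(1,2) s])
  have cl: "c \<longlonglongrightarrow> 1/2"
  proof -
    have "c \<longlonglongrightarrow> 1 / (2 * (1 - 0)\<^sup>2)" unfolding c_def by (intro tendsto_intros \<epsilon>) auto
    then show ?thesis by simp
  qed
  have c0: "c n \<ge> 0" for n by (simp add: c_def)
  have Ql: "Q \<longlonglongrightarrow> qh a b z" and Pl: "P \<longlonglongrightarrow> ps a b z" using p q by (simp_all add: Q_def[abs_def] P_def[abs_def])
  have Q0: "Q n \<ge> 0" and P0: "P n \<ge> 0" for n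
    unfolding Q_def P_def mol_def by (intro mollify_nonneg qh_nonneg[OF ab] ps_nonneg[OF ab])+
  have D: "Dn a b (\<epsilon> n) (s n) z = P n - Q n * L n + c n * ko n" for n
    by (simp add: Dn_def P_def Q_def L_def c_def ko_def I)
  have gz: "gn a b z = g'" by (simp add: gn_def I g'_def t_def)
  have yl: "(\<lambda>n. P n + c n * ko n) \<longlonglongrightarrow> ps a b z + 1/2 * g'" by (intro tendsto_intros Pl cl kol)
  consider "qh a b z > 0" | "qh a b z = 0" using qh_nonneg[OF ab, of z] by linarith
  then show ?thesis
  proof cases
    case 1
    \<comment> \<open>\<open>qh\<close> contains the incoming pair density through
      \<open>wt\<close>.\<close>
    then have "g \<noteq> 0" by (auto simp: qh_def wt_def g_def t_def)
    then have g: "g > 0" using g0 by simp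
    have rl: "(\<lambda>n. ko n / ki n) \<longlonglongrightarrow> g' / g" by (intro tendsto_intros kil kol) (use g in auto)
    show ?thesis
    proof (cases "g' = 0")
      case False
      then have g'p: "g' > 0" using g0 by simp
      have "L \<longlonglongrightarrow> ln (g' / g)" unfolding Ll by (intro tendsto_ln rl) (use g g'p in auto)
      then have "L \<longlonglongrightarrow> lam z" by (simp add: lam_def g_def g'_def t_def)
      then have "(\<lambda>n. P n - Q n * L n + c n * ko n) \<longlonglongrightarrow> ps a b z - qh a b z * lam z + 1/2 * g'"
        by (intro tendsto_intros Pl Ql cl kol)
      then have "(\<lambda>n. ennreal (P n - Q n * L n + c n * ko n)) \<longlonglongrightarrow> ennreal (ps a b z - qh a b z * lam z + 1/2 * g')" by simp
      from lim_imp_Liminf[OF _ this] have "liminf (\<lambda>n. ennreal (Dn a b (\<epsilon> n) (s n) z)) = ennreal (ps a b z - qh a b z * lam z + 1/2 * g')"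
        unfolding D by simp
      moreover have "Dinf a b z = ennreal (ps a b z - qh a b z * lam z + 1/2 * g')"
        using False by (simp add: Dinf_def g'_def t_def[symmetric] gz)
      ultimately show ?thesis by simp
    next
      case True
      \<comment> \<open>The flux stays positive while its logarithmic factor tends to minus
        infinity, so the integrands diverge and match the infinite branch of
        \<open>Dinf\<close>.\<close>
      have "filterlim (\<lambda>n. ko n / ki n) (at_right 0) sequentially"
        unfolding filterlim_at using rl True kp[THEN less_imp_neq, THEN not_sym] kp by (auto intro!: always_eventually)
      then have "filterlim L at_bot sequentially"
        unfolding Ll by (rule filterlim_compose[OF ln_at_0])
      then have "filterlim (\<lambda>n. - L n) at_top sequentially" by (simp add: filterlim_uminus_at_bot)
      then have top: "filterlim (\<lambda>n. Q n * (- L n)) at_top sequentially"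
        by (rule filterlim_tendsto_pos_mult_at_top[OF Ql 1])
      have "of_nat N \<le> liminf (\<lambda>n. ennreal (Dn a b (\<epsilon> n) (s n) z))" for N
      proof (rule Liminf_bounded)
        have "\<forall>\<^sub>F n in sequentially. real N \<le> Q n * (- L n)" using top by (simp add: filterlim_at_top)
        then show "\<forall>\<^sub>F n in sequentially. of_nat N \<le> ennreal (Dn a b (\<epsilon> n) (s n) z)"
        proof eventually_elim
          case (elim n)
          have "real N \<le> Dn a b (\<epsilon> n) (s n) z" unfolding D using elim P0[of n] mult_nonneg_nonneg[OF c0[of n] less_imp_le[OF kp(2)[of n]]] by simp
          then show ?case by (metis ennreal_leI ennreal_of_nat_eq_real_of_nat)
        qed
      qed
      then have "liminf (\<lambda>n. ennreal (Dn a b (\<epsilon> n) (s n) z)) = \<infinity>"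
        by (metis ennreal_Ex_less_of_nat infinity_ennreal_def leD top.not_eq_extremum)
      then show ?thesis by simp
    qed
  next
    case 2
    have Di: "Dinf a b z = ennreal (ps a b z + 1/2 * g')" using 2 by (simp add: Dinf_def gz)
    show ?thesis
    proof (cases "g = 0")
      case False
      then have g: "g > 0" using g0 by simp
      show ?thesis unfolding Di
      proof (rule ennreal_liminf_ge[OF _ yl])
        \<comment> \<open>The quotient converges since g > 0, so this upper bound for Q L vanishes
          together with Q. A very negative L only enlarges the integrand.\<close>
        show "(P n + c n * ko n) - Q n * (ko n / ki n) \<le> Dn a b (\<epsilon> n) (s n) z" for n
        proof -
          have "L n \<le> ko n / ki n" unfolding Ll using kp[of n] ln_le_minus_one[of "ko n / ki n"] by simp
          then have "Q n * L n \<le> Q n * (ko n / ki n)" by (intro mult_left_mono Q0)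
          then show ?thesis unfolding D by simp
        qed
        have "(\<lambda>n. Q n * (ko n / ki n)) \<longlonglongrightarrow> 0 * (g' / g)"
          using Ql 2 by (intro tendsto_intros kil kol) (use g in auto)
        then show "(\<lambda>n. Q n * (ko n / ki n)) \<longlonglongrightarrow> 0" by simp
      qed
    next
      case True
      then have ps0: "ps a b z = 0" by (simp add: ps_def wt_def g_def t_def)
      show ?thesis unfolding Di
      proof (rule ennreal_liminf_ge[OF _ yl])
        \<comment> \<open>With g = 0 the quotient ko / ki is uncontrolled. The Legendre inequality
          at half the logarithm bounds Q L by 2 (P + c sqrt (ki ko)), which tends to 0; at the full
          logarithm the bound would keep the outgoing density.\<close>
        show "(P n + c n * ko n) - 2 * (P n + c n * sqrt (ki n * ko n)) \<le> Dn a b (\<epsilon> n) (s n) z" for n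
        proof -
          have e: "exp (1/2 * L n) = sqrt (ko n / ki n)"
            unfolding L_def kap_scatter_exp(1)[OF \<epsilon>(1,2) s] ko_def[symmetric] ki_def[symmetric] t_def[symmetric]
            using kp[of n] by (simp add: powr_half_sqrt)
          have "ki n * sqrt (ko n / ki n) = sqrt (ki n * ko n)"
            using kp[of n] by (simp add: real_sqrt_divide real_sqrt_mult real_div_sqrt field_simps)
          then have "Q n * (1/2 * L n) \<le> P n + c n * sqrt (ki n * ko n)"
            using Leg[of "1/2" n] e by (simp add: Q_def P_def L_def c_def I ki_def t_def)
          then show ?thesis unfolding D by simp
        qed
        have "(\<lambda>n. 2 * (P n + c n * sqrt (ki n * ko n))) \<longlonglongrightarrow> 2 * (0 + 1/2 * sqrt (0 * g'))"
          using Pl ps0 kil True by (intro tendsto_intros cl kol) auto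
        then show "(\<lambda>n. 2 * (P n + c n * sqrt (ki n * ko n))) \<longlonglongrightarrow> 0" by simp
      qed
    qed
  qed
qed

text \<open>Four successive subsequences of 1 / (n + 1): for \<open>qh\<close>, for
  \<open>ps\<close>, for the densities at almost all times, and for the density at \<open>b\<close>,
  a single time that the third one need not reach.\<close>

lemma approximating_sequence:
  "\<exists>s::nat \<Rightarrow> real. (\<forall>n. 0 < s n \<and> s n \<le> 1) \<and> s \<longlonglongrightarrow> 0 \<and>
    (AE z in M0. (\<lambda>n. mol (s n) (qh a b) z) \<longlonglongrightarrow> qh a b z) \<and>
    (AE z in M0. (\<lambda>n. mol (s n) (ps a b) z) \<longlonglongrightarrow> ps a b z) \<and>
    (AE z in M0. tm z \<in> {0..T} \<longrightarrow> (\<forall>v\<in>{fst (inc z), snd (inc z), fst (out z), snd (out z)}. (\<lambda>n. dens (s n) (tm z) v) \<longlonglongrightarrow> f (tm z) v)) \<and>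
    (AE x in lborel. (\<lambda>n. dens (s n) b x) \<longlonglongrightarrow> f b x)"
proof -
  have bT: "b \<in> {0..T}" using ab by simp
  define s0 :: "nat \<Rightarrow> real" where "s0 n = inverse (real (Suc n))" for n
  have s0: "\<And>n. s0 n > 0" "\<And>n. s0 n \<le> 1" "s0 \<longlonglongrightarrow> 0"
    using LIMSEQ_inverse_real_of_nat by (auto simp: s0_def[abs_def] inverse_le_1_iff)
  have sub: "(\<lambda>n. X (r n)) \<longlonglongrightarrow> l" if "strict_mono r" "X \<longlonglongrightarrow> l" for r :: "nat \<Rightarrow> nat" and X :: "nat \<Rightarrow> real" and l
    using LIMSEQ_subseq_LIMSEQ[OF that(2,1)] by (simp add: o_def)
  obtain r1 where r1: "strict_mono r1" "AE z in M0. (\<lambda>n. mollify (s0 (r1 n)) (\<lambda>u. qh a b (fst z, u)) (snd z)) \<longlonglongrightarrow> qh a b z"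
    using mollify_AE_subseq[OF sigma_finite_TS qh_integrable[OF ab] s0(1,3)] by blast
  define s1 where "s1 n = s0 (r1 n)" for n
  have s1: "\<And>n. s1 n > 0" "\<And>n. s1 n \<le> 1" "s1 \<longlonglongrightarrow> 0" using s0 sub[OF r1(1) s0(3)] by (auto simp: s1_def[abs_def])
  obtain r2 where r2: "strict_mono r2" "AE z in M0. (\<lambda>n. mollify (s1 (r2 n)) (\<lambda>u. ps a b (fst z, u)) (snd z)) \<longlonglongrightarrow> ps a b z"
    using mollify_AE_subseq[OF sigma_finite_TS ps_integrable(1)[OF ab] s1(1,3)] by blast
  define s2 where "s2 n = s1 (r2 n)" for n
  have s2: "\<And>n. s2 n > 0" "\<And>n. s2 n \<le> 1" "s2 \<longlonglongrightarrow> 0" using s1 sub[OF r2(1) s1(3)] by (auto simp: s2_def[abs_def])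
  define A where "A z = indicator {0..T} (fst z) * f (fst z) (snd z)" for z :: "real \<times> (real^'n)"
  have Am[measurable]: "A \<in> borel_measurable (lborel \<Otimes>\<^sub>M lborel)" unfolding A_def by measurable
  have A: "integrable (lborel \<Otimes>\<^sub>M lborel) A"
  proof (rule integrableI_nonneg)
    have "(\<integral>\<^sup>+z. ennreal (A z) \<partial>(lborel \<Otimes>\<^sub>M lborel)) = (\<integral>\<^sup>+t. \<integral>\<^sup>+v. ennreal (A (t, v)) \<partial>lborel \<partial>lborel)"
      by (rule lborel.nn_integral_fst[symmetric]) measurable
    also have "\<dots> = (\<integral>\<^sup>+t. indicator {0..T} t \<partial>lborel)"
    proof (rule nn_integral_cong)
      fix t show "(\<integral>\<^sup>+v. ennreal (A (t, v)) \<partial>lborel) = indicator {0..T} t"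
        using f_mass[of t] by (cases "t \<in> {0..T}") (simp_all add: A_def)
    qed
    also have "\<dots> < \<infinity>" using T by simp
    finally show "(\<integral>\<^sup>+z. ennreal (A z) \<partial>(lborel \<Otimes>\<^sub>M lborel)) < \<infinity>" .
  qed (auto simp: A_def f_nonneg)
  obtain r3 where r3: "strict_mono r3" "AE z in lborel \<Otimes>\<^sub>M lborel. (\<lambda>n. mollify (s2 (r3 n)) (\<lambda>u. A (fst z, u)) (snd z)) \<longlonglongrightarrow> A z"
    using mollify_AE_subseq[OF sigma_finite_lborel A s2(1,3)] by blast
  define s3 where "s3 n = s2 (r3 n)" for n
  have s3: "\<And>n. s3 n > 0" "\<And>n. s3 n \<le> 1" "s3 \<longlonglongrightarrow> 0" using s2 sub[OF r3(1) s2(3)] by (auto simp: s3_def[abs_def])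
  have fb: "f b \<in> borel_measurable borel" by measurable
  obtain r4 where r4: "strict_mono r4" "AE x in lborel. (\<lambda>n. dens (s3 (r4 n)) b x) \<longlonglongrightarrow> f b x"
    using dens_AE_subseq(3)[OF f_nonneg fb f_ker[OF bT] s3(1,3)] by blast
  define s where "s n = s3 (r4 n)" for n
  have s: "\<And>n. s n > 0" "\<And>n. s n \<le> 1" "s \<longlonglongrightarrow> 0" using s3 sub[OF r4(1) s3(3)] by (auto simp: s_def[abs_def])
  note mol_def[simp]
  have 1: "AE z in M0. (\<lambda>n. mol (s n) (qh a b) z) \<longlonglongrightarrow> qh a b z"
    using r1(2)
  proof eventually_elim
    case (elim z)
    have "(\<lambda>n. mollify (s0 (r1 (r2 (r3 (r4 n))))) (\<lambda>u. qh a b (fst z, u)) (snd z)) \<longlonglongrightarrow> qh a b z"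
      by (rule sub[OF r4(1) sub[OF r3(1) sub[OF r2(1) elim]]])
    then show ?case by (simp add: s_def s3_def s2_def s1_def)
  qed
  have 2: "AE z in M0. (\<lambda>n. mol (s n) (ps a b) z) \<longlonglongrightarrow> ps a b z"
    using r2(2)
  proof eventually_elim
    case (elim z)
    have "(\<lambda>n. mollify (s1 (r2 (r3 (r4 n)))) (\<lambda>u. ps a b (fst z, u)) (snd z)) \<longlonglongrightarrow> ps a b z"
      by (rule sub[OF r4(1) sub[OF r3(1) elim]])
    then show ?case by (simp add: s_def s3_def s2_def)
  qed
  have "AE z in lborel \<Otimes>\<^sub>M lborel. fst z \<in> {0..T} \<longrightarrow> (\<lambda>n. dens (s n) (fst z) (snd z)) \<longlonglongrightarrow> f (fst z) (snd z)"
    using r3(2)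
  proof eventually_elim
    case (elim z)
    show ?case
    proof
      assume t: "fst z \<in> {0..T}"
      have fm: "f (fst z) \<in> borel_measurable borel" by measurable
      have "(\<lambda>n. mollify (s2 (r3 (r4 n))) (\<lambda>u. A (fst z, u)) (snd z)) \<longlonglongrightarrow> A z"
        by (rule sub[OF r4(1) elim])
      moreover have "(\<lambda>u. A (fst z, u)) = f (fst z)" "A z = f (fst z) (snd z)" using t by (auto simp: A_def)
      moreover have "dens \<delta> (fst z) x = mollify \<delta> (f (fst z)) x" for \<delta> x
        by (rule dens_AE_subseq(2)[OF f_nonneg fm f_ker[OF t] s0(1,3)])
      ultimately show "(\<lambda>n. dens (s n) (fst z) (snd z)) \<longlonglongrightarrow> f (fst z) (snd z)" by (simp add: s_def s3_def)
    qed
  qed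
  from AE_transfer[OF this]
  have 3: "AE z in M0. tm z \<in> {0..T} \<longrightarrow> (\<forall>v\<in>{fst (inc z), snd (inc z), fst (out z), snd (out z)}. (\<lambda>n. dens (s n) (tm z) v) \<longlonglongrightarrow> f (tm z) v)"
    by eventually_elim auto
  have 4: "AE x in lborel. (\<lambda>n. dens (s n) b x) \<longlonglongrightarrow> f b x" using r4(2) by (simp add: s_def)
  show ?thesis using s 1 2 3 4 by blast
qed

end

end

text \<open>The infima over tails increase, so the supremum of their sums is the sum of the
  suprema.\<close>

lemma ennreal_liminf_add_le:
  fixes u v :: "nat \<Rightarrow> ennreal"
  shows "liminf u + liminf v \<le> liminf (\<lambda>n. u n + v n)"
proof -
  have inc: "incseq (\<lambda>n. INF m\<in>{n..}. w m)" for w :: "nat \<Rightarrow> ennreal"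
    by (intro incseq_SucI INF_superset_mono) auto
  have "liminf u + liminf v = (SUP n. (INF m\<in>{n..}. u m) + (INF m\<in>{n..}. v m))"
    unfolding liminf_SUP_INF by (rule ennreal_SUP_add[symmetric, OF inc inc])
  also have "\<dots> \<le> (SUP n. INF m\<in>{n..}. u m + v m)"
    by (intro SUP_mono' INF_greatest add_mono INF_lower)
  finally show ?thesis by (simp only: liminf_SUP_INF)
qed

context flow_dens begin

lemma Dinf_measurable [measurable]: "Dinf a b \<in> borel_measurable M0"
proof -
  have [measurable]: "qh a b \<in> borel_measurable M0" "ps a b \<in> borel_measurable M0" "gn a b \<in> borel_measurable M0"
    unfolding qh_def ps_def gn_def Iab_def by measurable
  show ?thesis unfolding Dinf_def by measurable
qed

text \<open>The integral of \<open>Dn\<close> and the relative entropy at \<open>b\<close> are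
  nonnegative, and their sum is at most the convergent sequence \<open>B\<close>. Fatou's lemma for
  both yields finite entropy at \<open>b\<close>, integrability of the logarithmic term and the
  inequality together.\<close>

lemma entropy_inequality:
  assumes ab: "0 \<le> a" "a \<le> b" "b \<le> T" and fl: "integrable lborel (\<lambda>v. f a v * ln (f a v))"
  shows "integrable lborel (\<lambda>v. f b v * ln (f b v))"
    and "AE z in M0. qh a b z > 0 \<longrightarrow> ff (tm z) (out z) > 0"
    and "integrable M0 (\<lambda>z. qh a b z * lam z)"
    and "(\<integral>v. f b v * ln (f b v) \<partial>lborel) - (\<integral>v. f a v * ln (f a v) \<partial>lborel) \<le> (\<integral>z. qh a b z * lam z \<partial>M0)"
proof -
  note [measurable] = qh_measurable[OF ab] ps_measurable[OF ab] gn_measurable[OF ab]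
  have aT: "a \<in> {0..T}" and bT: "b \<in> {0..T}" using ab by auto
  have fm: "f t \<in> borel_measurable borel" for t by measurable
  obtain s :: "nat \<Rightarrow> real" where s: "\<And>n. 0 < s n" "\<And>n. s n \<le> 1" "s \<longlonglongrightarrow> 0"
    and q: "AE z in M0. (\<lambda>n. mol (s n) (qh a b) z) \<longlonglongrightarrow> qh a b z"
    and p: "AE z in M0. (\<lambda>n. mol (s n) (ps a b) z) \<longlonglongrightarrow> ps a b z"
    and d: "AE z in M0. tm z \<in> {0..T} \<longrightarrow> (\<forall>v\<in>{fst (inc z), snd (inc z), fst (out z), snd (out z)}. (\<lambda>n. dens (s n) (tm z) v) \<longlonglongrightarrow> f (tm z) v)"
    and db: "AE x in lborel. (\<lambda>n. dens (s n) b x) \<longlonglongrightarrow> f b x"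
    using approximating_sequence[OF ab] by blast
  define \<epsilon> where "\<epsilon> n = s n / 2" for n
  have \<epsilon>: "0 < \<epsilon> n" "\<epsilon> n < 1" for n using s(1,2)[of n] by (auto simp: \<epsilon>_def)
  have \<epsilon>0: "\<epsilon> \<longlonglongrightarrow> 0" using tendsto_divide[OF s(3) tendsto_const, of 2] by (simp add: \<epsilon>_def[abs_def])
  define Ha where "Ha = (\<integral>v. f a v * ln (f a v) \<partial>lborel)"
  define Hb where "Hb = (\<integral>v. f b v * ln (f b v) \<partial>lborel)"
  define W where "W = (\<integral>(x::real^'n). weight x * ln (weight x) \<partial>lborel)"
  define E where "E n = kap_entropy (\<epsilon> n) (s n) b" for n
  define L where "L n = (\<integral>x. kap (\<epsilon> n) (s n) b x * lw x \<partial>lborel)" for n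
  define X where "X n = (\<integral>z. indicator {a<..b} (fst z) * hF (\<epsilon> n) (s n) z \<partial>K)" for n
  define P where "P = (\<integral>z. ps a b z \<partial>M0)"
  define m where "m = (b - a) * smass"
  define c where "c n = 1 / (2 * (1 - \<epsilon> n)\<^sup>2)" for n
  \<comment> \<open>Division by 1 - \<epsilon> frees \<open>X\<close> from its factor in
    \<open>entropy_chain\<close>.\<close>
  define \<theta> where "\<theta> n = 1 / (1 - \<epsilon> n)" for n
  define Lb where "Lb = (\<integral>v. lw v \<partial>ker b)"
  define B where "B n = P + c n * m + Ha + \<theta> n * (\<epsilon> n * W) + \<theta> n * L n" for n
  have \<theta>1: "\<theta> n \<ge> 1" for n using \<epsilon>[of n] by (simp add: \<theta>_def)
  have y0: "E n + L n \<ge> 0" for n using psi_kap(2)[OF \<epsilon> s(1)] by (simp add: E_def L_def)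
  have Dn: "(\<integral>\<^sup>+z. ennreal (Dn a b (\<epsilon> n) (s n) z) \<partial>M0) = ennreal (P - X n + c n * m)" "P - X n + c n * m \<ge> 0" for n
  proof -
    have v: "P - X n + c n * m = (\<integral>z. Dn a b (\<epsilon> n) (s n) z \<partial>M0)"
      using Dn_integral(2)[OF ab \<epsilon>[of n] s(1)[of n]] by (simp add: P_def X_def c_def m_def)
    show "(\<integral>\<^sup>+z. ennreal (Dn a b (\<epsilon> n) (s n) z) \<partial>M0) = ennreal (P - X n + c n * m)"
      unfolding v by (rule nn_integral_eq_integral[OF Dn_integral(1)[OF ab \<epsilon> s(1)] Dn_nonneg[OF ab \<epsilon> s(1)]])
    show "P - X n + c n * m \<ge> 0" unfolding v by (rule integral_nonneg_AE[OF Dn_nonneg[OF ab \<epsilon> s(1)]])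
  qed
  have le: "(P - X n + c n * m) + (E n + L n) \<le> B n" for n
  proof -
    have 1: "E n - kap_entropy (\<epsilon> n) (s n) a \<le> (1 - \<epsilon> n) * X n"
      using entropy_chain[OF \<epsilon>[of n] s(1)[of n] ab] by (simp add: E_def X_def hF_def)
    have 2: "kap_entropy (\<epsilon> n) (s n) a \<le> (1 - \<epsilon> n) * Ha + \<epsilon> n * W"
      using kap_entropy_start[OF f_nonneg fm f_ker[OF aT] fl \<epsilon>[of n] s(1)[of n]] by (simp add: Ha_def W_def)
    have "E n \<le> (1 - \<epsilon> n) * (X n + Ha) + \<epsilon> n * W" using 1 2 by (simp add: algebra_simps)
    then have "\<theta> n * E n \<le> \<theta> n * ((1 - \<epsilon> n) * (X n + Ha) + \<epsilon> n * W)"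
      using \<theta>1[of n] by (intro mult_left_mono) auto
    also have "\<dots> = X n + Ha + \<theta> n * (\<epsilon> n * W)"
      using \<epsilon>[of n] by (simp add: \<theta>_def distrib_left)
    finally have 3: "\<theta> n * E n \<le> X n + Ha + \<theta> n * (\<epsilon> n * W)" .
    \<comment> \<open>Relative entropy is nonnegative and may be enlarged by the factor \<theta>;
      the entropy alone has no sign.\<close>
    have "1 * (E n + L n) \<le> \<theta> n * (E n + L n)" by (intro mult_right_mono \<theta>1 y0)
    then show ?thesis using 3 by (simp add: B_def algebra_simps)
  qed
  have lim: "B \<longlonglongrightarrow> P + m / 2 + Ha + Lb"
  proof -
    have "(\<lambda>n. 1 - \<epsilon> n) \<longlonglongrightarrow> 1 - 0" by (intro tendsto_intros \<epsilon>0)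
    then have e1: "(\<lambda>n. 1 - \<epsilon> n) \<longlonglongrightarrow> 1" by simp
    have "c \<longlonglongrightarrow> 1 / (2 * 1\<^sup>2)" unfolding c_def by (intro tendsto_intros e1) auto
    moreover have "\<theta> \<longlonglongrightarrow> 1 / 1" unfolding \<theta>_def by (intro tendsto_intros e1) auto
    moreover have "L \<longlonglongrightarrow> Lb" unfolding L_def Lb_def by (rule kap_lw_tendsto[OF \<epsilon> \<epsilon>0 s(1,3)])
    ultimately have "(\<lambda>n. P + c n * m + Ha + \<theta> n * (\<epsilon> n * W) + \<theta> n * L n) \<longlonglongrightarrow> P + 1 / (2 * 1\<^sup>2) * m + Ha + 1 / 1 * (0 * W) + 1 / 1 * Lb"
      by (intro tendsto_intros \<epsilon>0)
    then show ?thesis by (simp add: B_def[abs_def])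
  qed
  \<comment> \<open>Needed at the end to read an inequality between \<open>ennreal\<close> values as
    one between reals.\<close>
  have B0: "P + m / 2 + Ha + Lb \<ge> 0"
    by (rule LIMSEQ_le_const[OF lim]) (use le Dn(2) y0 in \<open>meson add_nonneg_nonneg order_trans\<close>)
  have "(\<integral>\<^sup>+z. Dinf a b z \<partial>M0) \<le> (\<integral>\<^sup>+z. liminf (\<lambda>n. ennreal (Dn a b (\<epsilon> n) (s n) z)) \<partial>M0)"
  proof (rule nn_integral_mono_AE)
    have "AE z in M0. \<forall>n. \<forall>c>0. mol (s n) (qh a b) z * (c * LA (\<epsilon> n) (s n) z) \<le> mol (s n) (ps a b) z +
      1 / (2 * (1 - \<epsilon> n)\<^sup>2) * (Iab a b z * (kap (\<epsilon> n) (s n) (tm z) (fst (inc z)) * kap (\<epsilon> n) (s n) (tm z) (snd (inc z)) * exp (c * LA (\<epsilon> n) (s n) z)))"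
      unfolding AE_all_countable by (intro allI Legendre_kap[OF ab \<epsilon> s(1)])
    then show "AE z in M0. Dinf a b z \<le> liminf (\<lambda>n. ennreal (Dn a b (\<epsilon> n) (s n) z))"
      using q p d by eventually_elim (rule Dinf_le_liminf[OF ab \<epsilon> \<epsilon>0 s(1)], blast+)
  qed
  also have "\<dots> \<le> liminf (\<lambda>n. \<integral>\<^sup>+z. ennreal (Dn a b (\<epsilon> n) (s n) z) \<partial>M0)"
    using borel_measurable_integrable[OF Dn_integral(1)[OF ab \<epsilon> s(1)]] by (intro nn_integral_liminf) auto
  finally have D: "(\<integral>\<^sup>+z. Dinf a b z \<partial>M0) \<le> liminf (\<lambda>n. ennreal (P - X n + c n * m))" by (simp only: Dn(1))
  have "(\<integral>\<^sup>+x. ennreal (psi (f b x) (weight x)) \<partial>lborel) \<le> liminf (\<lambda>n. ennreal (E n + L n))"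
    unfolding E_def L_def by (rule psi_liminf[OF f_nonneg fm db \<epsilon> \<epsilon>0 s(1)])
  with D have "(\<integral>\<^sup>+z. Dinf a b z \<partial>M0) + (\<integral>\<^sup>+x. ennreal (psi (f b x) (weight x)) \<partial>lborel)
    \<le> liminf (\<lambda>n. ennreal (P - X n + c n * m)) + liminf (\<lambda>n. ennreal (E n + L n))" by (rule add_mono)
  also have "\<dots> \<le> liminf (\<lambda>n. ennreal (P - X n + c n * m) + ennreal (E n + L n))" by (rule ennreal_liminf_add_le)
  also have "\<dots> \<le> liminf (\<lambda>n. ennreal (B n))"
    using Dn(2) y0 le by (intro Liminf_mono always_eventually allI) (simp add: ennreal_plus[symmetric] ennreal_leI del: ennreal_plus)
  also have "\<dots> = ennreal (P + m / 2 + Ha + Lb)"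
    by (rule lim_imp_Liminf) (use lim in auto)
  finally have main: "(\<integral>\<^sup>+z. Dinf a b z \<partial>M0) + (\<integral>\<^sup>+x. ennreal (psi (f b x) (weight x)) \<partial>lborel) \<le> ennreal (P + m / 2 + Ha + Lb)" .
  then have fin: "(\<integral>\<^sup>+z. Dinf a b z \<partial>M0) < \<infinity>" "(\<integral>\<^sup>+x. ennreal (psi (f b x) (weight x)) \<partial>lborel) < \<infinity>"
    by (auto simp: less_top[symmetric] top_unique)
  note ps = psi_integrable_imp[OF f_nonneg fm f_ker[OF bT] fin(2)]
  show "integrable lborel (\<lambda>v. f b v * ln (f b v))" by (rule ps(1))
  have "AE z in M0. Dinf a b z \<noteq> \<infinity>" using fin(1) by (intro nn_integral_noteq_infinite) auto
  then show pos: "AE z in M0. qh a b z > 0 \<longrightarrow> ff (tm z) (out z) > 0"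
    by eventually_elim (use ff_nonneg in \<open>auto simp: Dinf_def less_le split: if_splits\<close>)
  \<comment> \<open>\<open>Dinf\<close> without its infinite branch, which has measure 0 by now. Its
    nonnegativity is the Legendre inequality at the limit logarithm \<open>lam\<close>.\<close>
  define D0 where "D0 z = ps a b z - qh a b z * lam z + gn a b z / 2" for z
  have D0: "AE z in M0. D0 z \<ge> 0"
    using pos AE_M0_unit
  proof eventually_elim
    case (elim z)
    show ?case
    proof (cases "qh a b z = 0")
      case True
      then show ?thesis using ps_nonneg[OF ab, of z] gn_nonneg[OF ab, of z] by (simp add: D0_def)
    next
      case False
      then have I: "Iab a b z = 1" and i: "ff (tm z) (inc z) > 0"
        using Iab_cases[OF ab, of z] ff_nonneg[of "tm z" "inc z"] by (auto simp: qh_def wt_def less_le)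
      have o: "ff (tm z) (out z) > 0" using elim(1) False qh_nonneg[OF ab, of z] by simp
      have "ff (tm z) (inc z) / 2 * exp (lam z) = gn a b z / 2" using i o by (simp add: lam_def gn_def I)
      then show ?thesis using qh_Legendre[OF ab elim(2) I, of "lam z"] by (simp add: D0_def)
    qed
  qed
  have "(\<integral>\<^sup>+z. ennreal (D0 z) \<partial>M0) \<le> (\<integral>\<^sup>+z. Dinf a b z \<partial>M0)"
    by (intro nn_integral_mono) (simp add: Dinf_def D0_def)
  moreover have D0i: "integrable M0 D0"
    using D0 calculation fin(1) by (intro integrableI_nonneg) (auto simp: D0_def[abs_def])
  ultimately have D0v: "ennreal (\<integral>z. D0 z \<partial>M0) \<le> (\<integral>\<^sup>+z. Dinf a b z \<partial>M0)"
    using D0 by (simp add: nn_integral_eq_integral)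
  \<comment> \<open>The logarithmic term is recovered from three integrable functions; no sign of
    \<open>lam\<close> is used.\<close>
  have eq: "qh a b z * lam z = ps a b z + gn a b z / 2 - D0 z" for z by (simp add: D0_def)
  note i = ps_integrable(1)[OF ab] gn_integrable[OF ab] D0i
  show "integrable M0 (\<lambda>z. qh a b z * lam z)" unfolding eq using i by auto
  have v: "(\<integral>z. qh a b z * lam z \<partial>M0) = P + m / 2 - (\<integral>z. D0 z \<partial>M0)" unfolding eq using i by (simp add: P_def m_def)
  have "ennreal ((\<integral>z. D0 z \<partial>M0) + (Hb + Lb)) \<le> ennreal (\<integral>z. D0 z \<partial>M0) + ennreal (Hb + Lb)"
    using integral_nonneg_AE[OF D0] by (cases "Hb + Lb \<ge> 0") (auto simp: ennreal_plus[symmetric] ennreal_neg intro!: ennreal_leI simp del: ennreal_plus)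
  also have "\<dots> \<le> ennreal (P + m / 2 + Ha + Lb)"
    using main by (intro order_trans[OF add_right_mono[OF D0v]]) (simp add: ps(2) Hb_def Lb_def)
  finally have "(\<integral>z. D0 z \<partial>M0) + (Hb + Lb) \<le> P + m / 2 + Ha + Lb" using B0 by (simp add: ennreal_le_iff)
  then show "(\<integral>v. f b v * ln (f b v) \<partial>lborel) - (\<integral>v. f a v * ln (f a v) \<partial>lborel) \<le> (\<integral>z. qh a b z * lam z \<partial>M0)"
    unfolding v by (simp add: Ha_def Hb_def)
qed

end

section \<open>Jointly measurable densities\<close>

lemma real_density_exists:
  assumes M: "sigma_finite_measure M" and N: "finite_measure N" and ac: "absolutely_continuous M N" "sets N = sets M"
  shows "\<exists>g. g \<in> borel_measurable M \<and> (\<forall>x. 0 \<le> g x) \<and> N = density M (\<lambda>x. ennreal (g x))"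
proof -
  obtain g where g: "g \<in> borel_measurable M" "AE x in M. RN_deriv M N x = ennreal (g x)" "\<And>x. 0 \<le> g x"
    using sigma_finite_measure.real_RN_deriv[OF M N ac] by blast
  have "N = density M (RN_deriv M N)" by (rule sigma_finite_measure.density_RN_deriv[OF M ac, symmetric])
  also have "\<dots> = density M (\<lambda>x. ennreal (g x))" using g by (intro density_cong) auto
  finally show ?thesis using g by (auto intro!: exI[of _ g])
qed

context flow begin

text \<open>The index of the mollification used at time \<open>t\<close> is a measurable function of \<open>t\<close>, chosen so that the
  errors in \<open>L\<^sup>1\<close> are summable.\<close>

lemma joint_density_exists:
  assumes ac: "\<And>t. t \<in> {0..T} \<Longrightarrow> absolutely_continuous lborel (ker t)"
  shows "\<exists>f. vpath_dens e T \<sigma> \<pi> f"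
proof -
  define s :: "nat \<Rightarrow> real" where "s n = inverse (real (Suc n))" for n
  have s: "s n > 0" "s \<longlonglongrightarrow> 0" for n using LIMSEQ_inverse_real_of_nat by (auto simp: s_def[abs_def])
  define A where "A t m n = (\<integral>\<^sup>+x. ennreal \<bar>dens (s m) t x - dens (s n) t x\<bar> \<partial>lborel)" for t m n
  have Am[measurable]: "(\<lambda>t. A t m n) \<in> borel_measurable borel" for m n unfolding A_def by measurable
  \<comment> \<open>A Cauchy condition between mollified densities only. The distance to the limit
    would involve a density chosen separately at each time, with unknown measurability in t.\<close>
  define N where "N k t = (LEAST n. \<forall>m\<ge>n. A t m n \<le> ennreal ((1/2) ^ k))" for k t
  have Nm[measurable]: "N k \<in> borel \<rightarrow>\<^sub>M count_space UNIV" for k unfolding N_def by measurable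
  define f where "f t x = enn2real (liminf (\<lambda>k. ennreal (dens (s (N k t)) t x)))" for t x
  have dm: "(\<lambda>p. dens (s (N k (fst p))) (fst p) (snd p)) \<in> borel_measurable (borel :: (real \<times> (real^'n)) measure)" for k
    by (rule measurable_compose_countable[where f = "\<lambda>n p. dens (s n) (fst p) (snd p)" and g = "\<lambda>p. N k (fst p)"]) measurable
  have fj: "(\<lambda>(t, x). f t x) \<in> borel_measurable borel"
    unfolding f_def split_beta' using dm by measurable
  have "\<pi> t = density lborel (\<lambda>x. ennreal (f t x))" if t: "t \<in> {0..T}" for t
  proof -
    obtain g where gm[measurable]: "g \<in> borel_measurable borel" and g0: "\<And>x. 0 \<le> g x" and g: "ker t = density lborel (\<lambda>x. ennreal (g x))"
      using real_density_exists[OF sigma_finite_lborel _ ac[OF t]] prob_ker[of t] by (auto simp: prob_space_def)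
    note G = dens_AE_subseq[OF g0 gm g s]
    define d where "d n = (\<integral>\<^sup>+x. ennreal \<bar>dens (s n) t x - g x\<bar> \<partial>lborel)" for n
    have d0: "d \<longlonglongrightarrow> 0" using mollify_L1[OF G(1) s] by (simp add: d_def[abs_def] G(2))
    have tri: "A t m n \<le> d m + d n" and tri2: "d n \<le> d m + A t m n" for m n
    proof -
      have "A t m n \<le> (\<integral>\<^sup>+x. ennreal \<bar>dens (s m) t x - g x\<bar> + ennreal \<bar>dens (s n) t x - g x\<bar> \<partial>lborel)"
        unfolding A_def by (intro nn_integral_mono) (simp add: ennreal_plus[symmetric] ennreal_leI del: ennreal_plus)
      then show "A t m n \<le> d m + d n" unfolding d_def by (subst (asm) nn_integral_add) auto
      have "d n \<le> (\<integral>\<^sup>+x. ennreal \<bar>dens (s m) t x - g x\<bar> + ennreal \<bar>dens (s m) t x - dens (s n) t x\<bar> \<partial>lborel)"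
        unfolding d_def by (intro nn_integral_mono) (simp add: ennreal_plus[symmetric] ennreal_leI del: ennreal_plus)
      then show "d n \<le> d m + A t m n" unfolding d_def A_def by (subst (asm) nn_integral_add) auto
    qed
    have dN: "d (N k t) \<le> ennreal ((1/2) ^ k)" for k
    proof -
      have "\<forall>\<^sub>F n in sequentially. d n < ennreal ((1/2) ^ Suc k)" using d0 by (rule order_tendstoD) auto
      then obtain n where n: "\<And>m. m \<ge> n \<Longrightarrow> d m < ennreal ((1/2) ^ Suc k)" by (auto simp: eventually_sequentially)
      have "\<forall>m\<ge>n. A t m n \<le> ennreal ((1/2) ^ k)"
      proof (intro allI impI)
        fix m assume "n \<le> m"
        have "A t m n \<le> d m + d n" by (rule tri)
        also have "\<dots> \<le> ennreal ((1/2) ^ Suc k) + ennreal ((1/2) ^ Suc k)"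
          using n[OF \<open>n \<le> m\<close>] n[of n] by (intro add_mono) auto
        also have "\<dots> = ennreal ((1/2) ^ k)" by (simp add: ennreal_plus[symmetric] del: ennreal_plus)
        finally show "A t m n \<le> ennreal ((1/2) ^ k)" .
      qed
      then have "\<forall>m\<ge>N k t. A t m (N k t) \<le> ennreal ((1/2) ^ k)" unfolding N_def by (rule LeastI)
      \<comment> \<open>Letting m tend to infinity turns the Cauchy estimate into an estimate of the
        distance to \<open>g\<close>.\<close>
      then have "\<forall>\<^sub>F m in sequentially. d (N k t) \<le> d m + ennreal ((1/2) ^ k)"
        unfolding eventually_sequentially using tri2 by (meson add_left_mono order_trans)
      moreover have "(\<lambda>m. d m + ennreal ((1/2) ^ k)) \<longlonglongrightarrow> 0 + ennreal ((1/2) ^ k)" by (intro tendsto_intros d0)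
      ultimately have "d (N k t) \<le> 0 + ennreal ((1/2) ^ k)"
        by (intro tendsto_lowerbound[where F = sequentially]) auto
      then show ?thesis by simp
    qed
    \<comment> \<open>Summable errors give almost everywhere convergence without a further
      subsequence, which could not be chosen measurably in t for free.\<close>
    define D where "D k x = \<bar>dens (s (N k t)) t x - g x\<bar>" for k x
    have "(\<integral>\<^sup>+x. (\<Sum>k. ennreal (D k x)) \<partial>lborel) = (\<Sum>k. \<integral>\<^sup>+x. ennreal (D k x) \<partial>lborel)"
      by (rule nn_integral_suminf) (simp add: D_def)
    also have "\<dots> \<le> (\<Sum>k. ennreal ((1/2) ^ k))"
      using dN by (intro suminf_le) (auto simp: D_def d_def)
    also have "\<dots> = ennreal (\<Sum>k. (1/2) ^ k)" by (rule suminf_ennreal2) auto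
    also have "\<dots> < \<infinity>" by simp
    finally have "AE x in lborel. (\<Sum>k. ennreal (D k x)) \<noteq> \<infinity>"
      by (intro nn_integral_noteq_infinite) (auto simp: D_def)
    then have "AE x in lborel. ennreal (g x) = ennreal (f t x)"
    proof eventually_elim
      case (elim x)
      have "summable (\<lambda>k. D k x)" using elim by (intro summable_suminf_not_top) (auto simp: D_def)
      then have "(\<lambda>k. \<bar>dens (s (N k t)) t x - g x\<bar>) \<longlonglongrightarrow> 0" unfolding D_def by (rule summable_LIMSEQ_zero)
      then have "(\<lambda>k. dens (s (N k t)) t x) \<longlonglongrightarrow> g x" by (simp only: tendsto_rabs_zero_iff LIM_zero_iff)
      then have "(\<lambda>k. ennreal (dens (s (N k t)) t x)) \<longlonglongrightarrow> ennreal (g x)" by simp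
      from lim_imp_Liminf[OF _ this] show ?case using g0 by (simp add: f_def)
    qed
    then have "density lborel (\<lambda>x. ennreal (g x)) = density lborel (\<lambda>x. ennreal (f t x))"
      using measurable_compose[OF _ fj, of "\<lambda>x. (t, x)" borel] by (intro density_cong) auto
    then show ?thesis using g t by (simp add: ker_def)
  qed
  then have "vpath_dens e T \<sigma> \<pi> f" by unfold_locales (use fj in \<open>auto simp: f_def\<close>)
  then show ?thesis by blast
qed

lemma flow_dens_exists:
  assumes f: "\<And>v. f v \<ge> 0" "f \<in> borel_measurable borel" "ker 0 = density lborel (\<lambda>v. ennreal (f v))"
    and fl: "integrable lborel (\<lambda>v. f v * ln (f v))"
  shows "\<exists>g. flow_dens e T \<sigma> \<pi> h g"
proof -
  obtain g where g: "vpath_dens e T \<sigma> \<pi> g"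
    using joint_density_exists density_propagates(1)[OF f fl] by force
  have "flow_dens e T \<sigma> \<pi> h g" by (intro flow_dens.intro flow_axioms g)
  then show ?thesis by blast
qed

end

section \<open>Reversal of the flow and the chain rule\<close>

text \<open>Agreement of nonnegative integrals is equality of image measures, and so it extends to
  Bochner integrals.\<close>

lemma integral_transport:
  fixes g :: "'a \<Rightarrow> 'b::second_countable_topology" and F :: "'b \<Rightarrow> real"
  assumes nn: "\<And>G::'b \<Rightarrow> ennreal. G \<in> borel_measurable borel \<Longrightarrow> (\<integral>\<^sup>+x. G x \<partial>N) = (\<integral>\<^sup>+x. G (g x) \<partial>M)"
    and id: "(\<lambda>x. x) \<in> borel_measurable N" and g: "g \<in> borel_measurable M" and F: "F \<in> borel_measurable borel"
  shows "integrable N F \<longleftrightarrow> integrable M (\<lambda>x. F (g x))" "(\<integral>x. F x \<partial>N) = (\<integral>x. F (g x) \<partial>M)"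
proof -
  have "distr N borel (\<lambda>x. x) = distr M borel g"
  proof (rule measure_eqI)
    fix A assume "A \<in> sets (distr N borel (\<lambda>x. x))"
    then have A[measurable]: "A \<in> sets borel" by simp
    have "emeasure (distr N borel (\<lambda>x. x)) A = (\<integral>\<^sup>+x. indicator A x \<partial>distr N borel (\<lambda>x. x))" by simp
    also have "\<dots> = (\<integral>\<^sup>+x. indicator A x \<partial>N)" by (rule nn_integral_distr[OF id]) measurable
    also have "\<dots> = (\<integral>\<^sup>+x. indicator A (g x) \<partial>M)" by (rule nn) measurable
    also have "\<dots> = (\<integral>\<^sup>+x. indicator A x \<partial>distr M borel g)" by (rule nn_integral_distr[OF g, symmetric]) measurable
    also have "\<dots> = emeasure (distr M borel g) A" by simp
    finally show "emeasure (distr N borel (\<lambda>x. x)) A = emeasure (distr M borel g) A" .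
  qed simp
  with integrable_distr_eq[OF id F] integrable_distr_eq[OF g F] integral_distr[OF id F] integral_distr[OF g F]
  show "integrable N F \<longleftrightarrow> integrable M (\<lambda>x. F (g x))" "(\<integral>x. F x \<partial>N) = (\<integral>x. F (g x) \<partial>M)" by auto
qed

lemma (in vpath) id_K: "(\<lambda>z. z) \<in> borel_measurable K"
  by (simp add: measurable_cong_sets[OF sets_K refl] measurable_restrict_space1)

text \<open>The time marginal of the typical flux has a density, so half-open and closed time
  intervals are interchangeable.\<close>

lemma (in vpath) AE_K_time: "AE z in K. fst z \<noteq> c"
proof -
  have "(\<integral>\<^sup>+z. indicator {c} (fst z) \<partial>K) = flux_int (\<lambda>z. indicator {c} (fst z))"
    by (rule nn_integral_K) measurable
  also have "\<dots> = (\<integral>\<^sup>+t. 0 \<partial>(lborel :: real measure))"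
    unfolding flux_int_def using AE_lborel_singleton[of c]
    by (intro nn_integral_cong_AE) (auto elim!: eventually_mono)
  finally have "(\<integral>\<^sup>+z. indicator {c} (fst z) \<partial>K) = 0" by simp
  then have "AE z in K. indicator {c} (fst z) = (0::ennreal)"
    by (subst (asm) nn_integral_0_iff_AE) (auto intro!: measurable_K)
  then show ?thesis by eventually_elim (auto simp: indicator_def split: if_splits)
qed

lemma (in vpath) vpath_flip: "vpath e T \<sigma> (\<lambda>t. \<pi> (T - t))"
proof
  have "continuous_map (top_of_set {0..T}) (top_of_set {0..T}) (\<lambda>t. T - t)"
    by (auto simp: continuous_map_in_subtopology intro!: continuous_intros)
  from continuous_map_compose[OF this] cont show "(\<lambda>t. \<pi> (T - t)) \<in> continuous_paths e T"
    by (auto simp: continuous_paths_def o_def)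
qed (rule T haar)+

section \<open>Time flip and exchange of incoming and outgoing pairs\<close>

definition flip :: "real \<Rightarrow> 'n collision \<Rightarrow> 'n collision" where "flip T z = (T - fst z, snd z)"

lemma flip_measurable [measurable]: "flip T \<in> borel_measurable borel"
  unfolding flip_def[abs_def] by measurable

lemma flip_flip [simp]: "flip T (flip T z) = z" "fst (flip T z) = T - fst z" "snd (flip T z) = snd z"
  by (simp_all add: flip_def)

lemma (in vpath) nn_integral_flip:
  assumes [measurable]: "F \<in> borel_measurable borel"
  shows "(\<integral>\<^sup>+z. F z \<partial>typical_flux T \<sigma> (\<lambda>t. \<pi> (T - t))) = (\<integral>\<^sup>+z. F (flip T z) \<partial>K)"
proof -
  interpret F: vpath e T \<sigma> "\<lambda>t. \<pi> (T - t)" by (rule vpath_flip)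
  have k: "F.ker2 t = ker2 (T - t)" for t by (simp add: F.ker2_def ker2_def F.ker_def ker_def)
  define G where "G t = indicator {0..T} t * (\<integral>\<^sup>+u. \<integral>\<^sup>+\<omega>. ennreal (rate \<omega> u / 2) * F (T - t, u, scatter \<omega> u) \<partial>\<sigma> \<partial>ker2 t)" for t
  have [measurable]: "G \<in> borel_measurable borel" unfolding G_def by measurable
  have "(\<integral>\<^sup>+z. F z \<partial>F.K) = F.flux_int F" by (rule F.nn_integral_K) measurable
  also have "\<dots> = (\<integral>\<^sup>+t. G (T - t) \<partial>lborel)"
    unfolding F.flux_int_def k G_def by (intro nn_integral_cong) (auto simp: indicator_def)
  also have "\<dots> = (\<integral>\<^sup>+t. G t \<partial>lborel)" by (rule nn_integral_lborel_reflect) measurable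
  also have "\<dots> = flux_int (\<lambda>z. F (flip T z))" by (simp add: flux_int_def G_def flip_def)
  also have "\<dots> = (\<integral>\<^sup>+z. F (flip T z) \<partial>K)" by (rule nn_integral_K[symmetric]) measurable
  finally show ?thesis .
qed

lemma (in vpath) integral_flip:
  fixes F :: "'n collision \<Rightarrow> real"
  assumes "F \<in> borel_measurable borel"
  shows "(\<integral>z. F z \<partial>typical_flux T \<sigma> (\<lambda>t. \<pi> (T - t))) = (\<integral>z. F (flip T z) \<partial>K)"
proof -
  interpret F: vpath e T \<sigma> "\<lambda>t. \<pi> (T - t)" by (rule vpath_flip)
  show ?thesis by (rule integral_transport(2)[OF nn_integral_flip F.id_K measurable_K[OF flip_measurable] assms])
qed

definition exchange :: "'n collision \<Rightarrow> 'n collision" where "exchange z = (fst z, snd (snd z), fst (snd z))"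

lemma exchange_measurable [measurable]: "exchange \<in> borel_measurable borel"
  unfolding exchange_def[abs_def] by measurable

lemma exchange_exchange [simp]: "exchange (exchange z) = z" "fst (exchange z) = fst z"
  "fst (snd (exchange z)) = snd (snd z)" "snd (snd (exchange z)) = fst (snd z)"
  by (simp_all add: exchange_def)

context vpath_dens begin

text \<open>\<open>K\<close> is the image under \<open>coll\<close> of the measure with density
  \<open>wt\<close> over \<open>M0\<close>.\<close>

lemma AE_K_iff:
  assumes [measurable]: "Measurable.pred borel P"
  shows "(AE z in K. P z) \<longleftrightarrow> (AE z in M0. wt z > 0 \<longrightarrow> P (coll z))"
proof -
  have "(AE z in K. P z) \<longleftrightarrow> (AE z in K. indicator {z. \<not> P z} z = (0::ennreal))" by (simp add: indicator_def)
  also have "\<dots> \<longleftrightarrow> (\<integral>\<^sup>+z. indicator {z. \<not> P z} z \<partial>K) = 0"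
    by (subst nn_integral_0_iff_AE) (auto intro!: measurable_K)
  also have "(\<integral>\<^sup>+z. indicator {z. \<not> P z} z \<partial>K) = (\<integral>\<^sup>+z. ennreal (wt z) * indicator {z. \<not> P z} (coll z) \<partial>M0)"
    by (rule nn_integral_K_M0) measurable
  also have "\<dots> = 0 \<longleftrightarrow> (AE z in M0. ennreal (wt z) * indicator {z. \<not> P z} (coll z) = 0)"
    by (rule nn_integral_0_iff_AE) measurable
  also have "\<dots> \<longleftrightarrow> (AE z in M0. wt z > 0 \<longrightarrow> P (coll z))"
    by (intro AE_cong) (auto simp: indicator_def ennreal_eq_0_iff)
  finally show ?thesis .
qed

lemma log_ratio_eq: "log_ratio f z = ln (ff (fst z) (snd (snd z)) / ff (fst z) (fst (snd z)))"
  by (simp add: log_ratio_def ff_def split_beta)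

lemma log_ratio_measurable [measurable]: "log_ratio f \<in> borel_measurable borel"
  unfolding log_ratio_eq[abs_def] by measurable

text \<open>At incoming pairs of vanishing density division by zero makes the value 0; such points
  carry no typical flux.\<close>

definition ratio :: "('n collision \<Rightarrow> real) \<Rightarrow> 'n collision \<Rightarrow> real" where
  "ratio h z = h (exchange z) * (ff (fst z) (snd (snd z)) / ff (fst z) (fst (snd z)))"

lemma ratio_measurable [measurable]:
  assumes [measurable]: "h \<in> borel_measurable borel"
  shows "ratio h \<in> borel_measurable borel" unfolding ratio_def[abs_def] by measurable

lemma ratio_nonneg: "(\<And>z. h z \<ge> 0) \<Longrightarrow> ratio h z \<ge> 0"
  unfolding ratio_def by (simp add: ff_nonneg)

abbreviation scat where "scat z \<equiv> (fst z, out z)"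

lemma scat:
  assumes "norm (om z) = 1"
  shows "coll (scat z) = exchange (coll z)" "wt (scat z) = indicator {0..T} (tm z) * (rate (om z) (inc z) / 2 * ff (tm z) (out z))"
  using scatter_involution[OF assms] rate_scatter[OF assms]
  by (simp_all add: coll_def exchange_def out_def wt_def tm_def om_def inc_def)

context
  fixes h :: "'n collision \<Rightarrow> real"
  assumes h[measurable]: "h \<in> borel_measurable borel" "\<And>z. h z \<ge> 0"
    and pos: "AE z in K. h z > 0 \<longrightarrow> ff (fst z) (snd (snd z)) > 0"
begin

lemma pos_M0: "AE z in M0. wt z > 0 \<longrightarrow> h (coll z) > 0 \<longrightarrow> ff (tm z) (out z) > 0"
proof -
  have "AE z in M0. wt z > 0 \<longrightarrow> (h (coll z) > 0 \<longrightarrow> ff (fst (coll z)) (snd (snd (coll z))) > 0)"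
    by (subst AE_K_iff[symmetric]) (use pos in measurable)
  then show ?thesis by (simp add: coll_def)
qed

text \<open>The rate is invariant under scattering, so the quotient of pair densities compensates
  exactly for the change of \<open>wt\<close>. Where the outgoing density is 0, the right-hand side
  vanishes by the positivity assumption.\<close>

lemma ratio_scat: "AE z in M0. wt (scat z) * ratio h (coll (scat z)) = wt z * h (coll z)"
  using pos_M0 AE_M0_unit
proof eventually_elim
  case (elim z)
  have r: "ratio h (coll (scat z)) = h (coll z) * (ff (tm z) (inc z) / ff (tm z) (out z))"
    unfolding scat(1)[OF elim(2)] ratio_def by (simp add: coll_def)
  show ?case
  proof (cases "ff (tm z) (out z) = 0")
    case True
    then have "\<not> (wt z > 0 \<and> h (coll z) > 0)" using elim(1) by auto
    then have "wt z * h (coll z) = 0" using wt_nonneg[of z] h(2)[of "coll z"] by (auto simp: not_less)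
    then show ?thesis using True by (simp add: r)
  next
    case False
    then show ?thesis unfolding r scat(2)[OF elim(2)] by (simp add: wt_def)
  qed
qed

text \<open>Scattering preserves \<open>M0\<close> and turns \<open>coll\<close> into its exchange;
  \<open>ratio_scat\<close> matches the weights.\<close>

lemma nn_integral_ratio:
  assumes [measurable]: "F \<in> borel_measurable borel"
  shows "(\<integral>\<^sup>+z. ennreal (ratio h z) * F z \<partial>K) = (\<integral>\<^sup>+z. ennreal (h z) * F (exchange z) \<partial>K)"
proof -
  have "(\<integral>\<^sup>+z. ennreal (ratio h z) * F z \<partial>K) = (\<integral>\<^sup>+z. ennreal (wt z) * (ennreal (ratio h (coll z)) * F (coll z)) \<partial>M0)"
    by (rule nn_integral_K_M0) measurable
  also have "\<dots> = (\<integral>\<^sup>+z. ennreal (wt (scat z)) * (ennreal (ratio h (coll (scat z))) * F (coll (scat z))) \<partial>M0)"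
    by (rule nn_integral_M0_out[symmetric]) measurable
  also have "\<dots> = (\<integral>\<^sup>+z. ennreal (wt z) * (ennreal (h (coll z)) * F (exchange (coll z))) \<partial>M0)"
  proof (rule nn_integral_cong_AE)
    show "AE z in M0. ennreal (wt (scat z)) * (ennreal (ratio h (coll (scat z))) * F (coll (scat z))) = ennreal (wt z) * (ennreal (h (coll z)) * F (exchange (coll z)))"
      using ratio_scat AE_M0_unit
    proof eventually_elim
      case (elim z)
      have "ennreal (wt (scat z)) * ennreal (ratio h (coll (scat z))) = ennreal (wt z) * ennreal (h (coll z))"
        using elim(1) by (simp add: ennreal_mult[symmetric] wt_nonneg h(2) ratio_nonneg)
      then show ?case by (simp add: scat(1)[OF elim(2)] mult.assoc[symmetric])
    qed
  qed
  also have "\<dots> = (\<integral>\<^sup>+z. ennreal (h z) * F (exchange z) \<partial>K)"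
    by (rule nn_integral_K_M0[symmetric]) measurable
  finally show ?thesis .
qed

lemma integral_ratio:
  fixes F :: "'n collision \<Rightarrow> real"
  assumes [measurable]: "F \<in> borel_measurable borel"
  shows "(\<integral>z. ratio h z * F z \<partial>K) = (\<integral>z. h z * F (exchange z) \<partial>K)"
proof -
  have mk: "h \<in> borel_measurable K" "ratio h \<in> borel_measurable K" "F \<in> borel_measurable K" "(\<lambda>z. F (exchange z)) \<in> borel_measurable K"
    by (intro measurable_K; measurable)+
  have "(\<integral>z. F z \<partial>density K (\<lambda>z. ennreal (ratio h z))) = (\<integral>z. F (exchange z) \<partial>density K (\<lambda>z. ennreal (h z)))"
  proof (rule integral_transport(2))
    show "(\<integral>\<^sup>+z. G z \<partial>density K (\<lambda>z. ennreal (ratio h z))) = (\<integral>\<^sup>+z. G (exchange z) \<partial>density K (\<lambda>z. ennreal (h z)))"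
      if [measurable]: "G \<in> borel_measurable borel" for G :: "'n collision \<Rightarrow> ennreal"
      using nn_integral_ratio[OF that] mk by (simp add: nn_integral_density measurable_K)
  qed (use id_K measurable_K[OF exchange_measurable] in \<open>simp_all add: measurable_density_eq1\<close>)
  then show ?thesis using mk by (simp add: integral_density h(2) ratio_nonneg)
qed

lemma time_reversal_density:
  "time_reversal (density K (\<lambda>z. ennreal (h z))) = density K (\<lambda>z. ennreal (ratio h z))"
proof (rule measure_eqI)
  show "sets (time_reversal (density K (\<lambda>z. ennreal (h z)))) = sets (density K (\<lambda>z. ennreal (ratio h z)))"
    by (simp add: time_reversal_def)
  fix A assume "A \<in> sets (time_reversal (density K (\<lambda>z. ennreal (h z))))"
  then have AK: "A \<in> sets K" by (simp add: time_reversal_def)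
  then have A[measurable]: "A \<in> sets borel" using slab_borel by (simp add: sets_restrict_space_iff)
  have ex: "exchange \<in> K \<rightarrow>\<^sub>M K"
    using measurable_K[OF exchange_measurable] by (simp add: measurable_cong_sets[OF refl sets_K] measurable_restrict_space2_iff exchange_def mem_Times_iff)
  have eq: "(\<lambda>(t, x, y). (t, y, x)) = exchange" by (auto simp: exchange_def)
  have mk: "h \<in> borel_measurable K" "ratio h \<in> borel_measurable K" by (intro measurable_K; measurable)+
  have "emeasure (time_reversal (density K (\<lambda>z. ennreal (h z)))) A = (\<integral>\<^sup>+z. indicator A z \<partial>time_reversal (density K (\<lambda>z. ennreal (h z))))"
    using AK by (simp add: time_reversal_def)
  also have "\<dots> = (\<integral>\<^sup>+z. indicator A (exchange z) \<partial>density K (\<lambda>z. ennreal (h z)))"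
    unfolding time_reversal_def eq using AK ex by (intro nn_integral_distr) (auto simp: measurable_density_eq1 measurable_density_eq2)
  also have "\<dots> = (\<integral>\<^sup>+z. ennreal (h z) * indicator A (exchange z) \<partial>K)"
    using mk by (intro nn_integral_density measurable_K) auto
  also have "\<dots> = (\<integral>\<^sup>+z. ennreal (ratio h z) * indicator A z \<partial>K)" by (rule nn_integral_ratio[symmetric]) measurable
  also have "\<dots> = emeasure (density K (\<lambda>z. ennreal (ratio h z))) A"
    using mk AK by (intro emeasure_density[symmetric]) auto
  finally show "emeasure (time_reversal (density K (\<lambda>z. ennreal (h z)))) A = emeasure (density K (\<lambda>z. ennreal (ratio h z))) A" .
qed

end

end

lemma (in vpath_dens) distr_scat: "distr M0 M0 scat = M0"
proof (rule measure_eqI)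
  fix A assume "A \<in> sets (distr M0 M0 scat)"
  then have A[measurable]: "A \<in> sets M0" by simp
  have m: "scat \<in> M0 \<rightarrow>\<^sub>M M0" by measurable
  have "emeasure (distr M0 M0 scat) A = (\<integral>\<^sup>+z. indicator A z \<partial>distr M0 M0 scat)"
    by (rule nn_integral_indicator[symmetric]) (unfold sets_distr, rule A)
  also have "\<dots> = (\<integral>\<^sup>+z. indicator A (scat z) \<partial>M0)" by (rule nn_integral_distr[OF m]) simp
  also have "\<dots> = (\<integral>\<^sup>+z. indicator A z \<partial>M0)" by (rule nn_integral_M0_out) simp
  also have "\<dots> = emeasure M0 A" by (rule nn_integral_indicator[OF A])
  finally show "emeasure (distr M0 M0 scat) A = emeasure M0 A" .
qed simp

lemma (in vpath_dens) integral_M0_scat: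
  fixes G :: "_ \<Rightarrow> real"
  assumes [measurable]: "G \<in> borel_measurable M0"
  shows "integrable M0 (\<lambda>z. G (scat z)) \<longleftrightarrow> integrable M0 G" "(\<integral>z. G (scat z) \<partial>M0) = (\<integral>z. G z \<partial>M0)"
proof -
  have m: "scat \<in> M0 \<rightarrow>\<^sub>M M0" by measurable
  show "integrable M0 (\<lambda>z. G (scat z)) \<longleftrightarrow> integrable M0 G"
    using integrable_distr_eq[OF m assms] by (simp add: distr_scat)
  show "(\<integral>z. G (scat z) \<partial>M0) = (\<integral>z. G z \<partial>M0)"
    using integral_distr[OF m assms] by (simp add: distr_scat)
qed

text \<open>The quotient is inverted. Where one of the products vanishes, both sides are 0, by
  division by zero and \<open>ln 0 = 0\<close>.\<close>

lemma (in vpath_dens) log_ratio_exchange: "log_ratio f (exchange z) = - log_ratio f z"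
proof (cases "ff (fst z) (snd (snd z)) = 0 \<or> ff (fst z) (fst (snd z)) = 0")
  case False
  then have "ff (fst z) (snd (snd z)) > 0" "ff (fst z) (fst (snd z)) > 0"
    using ff_nonneg by (auto simp: less_le)
  then show ?thesis by (simp add: log_ratio_eq ln_div)
qed (auto simp: log_ratio_eq)

text \<open>The flip moves the open end of the interval to the other side; endpoints carry no
  mass.\<close>

lemma (in vpath) indicator_flip: "AE z in K. indicator {a<..b} (T - fst z) = (indicator {T - b<..T - a} (fst z) :: real)"
  using AE_K_time[of "T - a"] AE_K_time[of "T - b"] by eventually_elim (auto simp: indicator_def)

context flow_dens begin

lemma lam_eq: "lam z = log_ratio f (coll z)"
  by (simp add: lam_def log_ratio_eq coll_def)

lemma entropy_inequality_flux:
  assumes ab: "0 \<le> a" "a \<le> b" "b \<le> T" and fl: "integrable lborel (\<lambda>v. f a v * ln (f a v))"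
  shows "AE z in K. fst z \<in> {a<..b} \<longrightarrow> h z > 0 \<longrightarrow> ff (fst z) (snd (snd z)) > 0"
    and "integrable K (\<lambda>z. indicator {a<..b} (fst z) * (h z * log_ratio f z))"
    and "(\<integral>v. f b v * ln (f b v) \<partial>lborel) - (\<integral>v. f a v * ln (f a v) \<partial>lborel)
      \<le> (\<integral>z. indicator {a<..b} (fst z) * (h z * log_ratio f z) \<partial>K)"
proof -
  note C = entropy_inequality[OF ab fl]
  define F :: "'n collision \<Rightarrow> real" where "F z = indicator {a<..b} (fst z) * (h z * log_ratio f z)" for z
  have Fm[measurable]: "F \<in> borel_measurable borel" unfolding F_def by measurable
  have eq: "qh a b z * lam z = wt z * F (coll z)" for z by (simp add: qh_def Iab_def lam_eq F_def coll_def)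
  show "integrable K (\<lambda>z. indicator {a<..b} (fst z) * (h z * log_ratio f z))"
    using C(3) integral_K_M0(1)[OF Fm] unfolding eq by (simp add: F_def[abs_def])
  show "(\<integral>v. f b v * ln (f b v) \<partial>lborel) - (\<integral>v. f a v * ln (f a v) \<partial>lborel)
      \<le> (\<integral>z. indicator {a<..b} (fst z) * (h z * log_ratio f z) \<partial>K)"
    using C(4) integral_K_M0(2)[OF Fm] unfolding eq by (simp add: F_def[abs_def])
  have "AE z in M0. wt z > 0 \<longrightarrow> (fst (coll z) \<in> {a<..b} \<longrightarrow> h (coll z) > 0 \<longrightarrow> ff (fst (coll z)) (snd (snd (coll z))) > 0)"
    using C(2) by eventually_elim (auto simp: qh_def Iab_def coll_def)
  then show "AE z in K. fst z \<in> {a<..b} \<longrightarrow> h z > 0 \<longrightarrow> ff (fst z) (snd (snd z)) > 0"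
    by (subst AE_K_iff) measurable
qed

context
  assumes fl: "integrable lborel (\<lambda>v. f 0 v * ln (f 0 v))"
begin

lemma entropy_integrable: "t \<in> {0..T} \<Longrightarrow> integrable lborel (\<lambda>v. f t v * ln (f t v))"
  using entropy_inequality(1)[OF _ _ _ fl] by simp

lemma AE_interior: "AE z in K. fst z \<in> {0<..T}"
  using AE_K_time[of 0] AE_space by eventually_elim auto

lemma pos_out: "AE z in K. h z > 0 \<longrightarrow> ff (fst z) (snd (snd z)) > 0"
  using entropy_inequality_flux(1)[OF order_refl less_imp_le[OF T] order_refl fl] AE_interior by eventually_elim auto

text \<open>\<open>K\<close> charges only points of positive \<open>wt\<close>, which has the
  incoming pair density as a factor.\<close>

lemma pos_inc: "AE z in K. ff (fst z) (fst (snd z)) > 0"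
proof (subst AE_K_iff)
  have "wt z > 0 \<Longrightarrow> ff (fst (coll z)) (fst (snd (coll z))) > 0" for z
    using ff_nonneg[of "tm z" "inc z"] by (cases "ff (tm z) (inc z) = 0") (auto simp: wt_def coll_def)
  then show "AE z in M0. wt z > 0 \<longrightarrow> ff (fst (coll z)) (fst (snd (coll z))) > 0" by (intro AE_I2) simp
qed measurable

lemma h_log_ratio_integrable: "integrable K (\<lambda>z. h z * log_ratio f z)"
proof -
  have "AE z in K. h z * log_ratio f z = indicator {0<..T} (fst z) * (h z * log_ratio f z)"
    using AE_interior by eventually_elim simp
  moreover have "(\<lambda>z. h z * log_ratio f z) \<in> borel_measurable K" by (rule measurable_K) measurable
  moreover have "(\<lambda>z. indicator {0<..T} (fst z) * (h z * log_ratio f z)) \<in> borel_measurable K" by (rule measurable_K) measurable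
  ultimately show ?thesis
    using entropy_inequality_flux(2)[OF order_refl less_imp_le[OF T] order_refl fl] integrable_cong_AE by blast
qed

text \<open>Change variables by scattering. With weight c and density q at a point, and c', r for
  the exchanged flux at the scattered point, c' r = c q gives c' r ln r = c q (ln q - log_ratio).
  The terms c and c' have equal integrals because scattering preserves \<open>M0\<close>.\<close>

lemma ratio_ent:
  "integrable K (\<lambda>z. ratio h z * ln (ratio h z) - ratio h z + 1)"
  "(\<integral>z. ratio h z * ln (ratio h z) - ratio h z + 1 \<partial>K) = (\<integral>z. ent z \<partial>K) - (\<integral>z. h z * log_ratio f z \<partial>K)"
proof -
  define \<theta> :: "real \<Rightarrow> real" where "\<theta> x = x * ln x - x + 1" for x
  have [measurable]: "\<theta> \<in> borel_measurable borel" unfolding \<theta>_def by measurable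
  have rm: "(\<lambda>z. \<theta> (ratio h z)) \<in> borel_measurable borel" by measurable
  define G where "G z = wt z * \<theta> (ratio h (coll z))" for z
  have Gm[measurable]: "G \<in> borel_measurable M0" unfolding G_def by measurable
  define S where "S z = wt z * ent (coll z) - wt z * (h (coll z) * log_ratio f (coll z)) - wt z * 1 + wt (scat z)" for z
  have AE: "AE z in M0. G (scat z) = S z"
    using ratio_scat[OF h_meas h_nonneg pos_out] pos_M0[OF h_meas h_nonneg pos_out] AE_M0_unit
  proof eventually_elim
    case (elim z)
    define c where "c = wt z" define c' where "c' = wt (scat z)"
    define q where "q = h (coll z)" define r where "r = ratio h (coll (scat z))"
    have c: "c \<ge> 0" "c' \<ge> 0" "q \<ge> 0" by (simp_all add: c_def c'_def q_def wt_nonneg h_nonneg)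
    have cr: "c' * r = c * q" using elim(1) by (simp add: c_def c'_def q_def r_def)
    have Ge: "G (scat z) = c' * (r * ln r) - c' * r + c'"
      by (simp add: G_def \<theta>_def c'_def r_def algebra_simps)
    have Se: "S z = c * (q * ln q) - c * q + c - c * (q * log_ratio f (coll z)) - c + c'"
      by (simp add: S_def ent_def c_def c'_def q_def algebra_simps)
    have "c' * (r * ln r) = c * (q * ln q) - c * (q * log_ratio f (coll z))"
    proof (cases "c * q = 0")
      case True
      show ?thesis unfolding mult.assoc[symmetric] cr True by simp
    next
      case False
      then have p: "c > 0" "q > 0" using c by (auto simp: less_le)
      then have o: "ff (tm z) (out z) > 0" using elim(2) by (simp add: c_def q_def)
      have i: "ff (tm z) (inc z) > 0" using p ff_nonneg[of "tm z" "inc z"] by (auto simp: c_def wt_def less_le)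
      have "r = q * (ff (tm z) (inc z) / ff (tm z) (out z))"
        unfolding r_def scat(1)[OF elim(3)] ratio_def q_def by (simp add: coll_def)
      then have "ln r = ln q - log_ratio f (coll z)"
        using p i o by (simp add: ln_mult ln_div log_ratio_eq coll_def)
      then have "c' * (r * ln r) = c * (q * (ln q - log_ratio f (coll z)))" using cr by (metis mult.assoc)
      then show ?thesis by (simp add: right_diff_distrib)
    qed
    then show ?case unfolding Ge Se cr by simp
  qed
  have lm: "(\<lambda>z. h z * log_ratio f z) \<in> borel_measurable borel" by measurable
  have one: "integrable K (\<lambda>z. 1::real)" using finite_measure.integrable_const[OF finite_K] .
  note e = ent_integrable[unfolded integral_K_M0(1)[OF ent_measurable]]
  note l = h_log_ratio_integrable[unfolded integral_K_M0(1)[OF lm]]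
  note o = one[unfolded integral_K_M0(1)[OF borel_measurable_const]]
  have w: "integrable M0 (\<lambda>z. wt (scat z))" "(\<integral>z. wt (scat z) \<partial>M0) = (\<integral>z. wt z * 1 \<partial>M0)"
    using o integral_M0_scat[OF wt_measurable] by simp_all
  have S: "integrable M0 S" unfolding S_def[abs_def]
    by (intro Bochner_Integration.integrable_add Bochner_Integration.integrable_diff e l o w(1))
  have Sm: "S \<in> borel_measurable M0" "(\<lambda>z. G (scat z)) \<in> borel_measurable M0"
    using S by (auto simp: measurable_compose[OF _ Gm])
  have "integrable M0 (\<lambda>z. G (scat z))" using S integrable_cong_AE[OF Sm(2,1) AE] by simp
  then have "integrable M0 G" using integral_M0_scat(1)[OF Gm] by simp
  then show "integrable K (\<lambda>z. ratio h z * ln (ratio h z) - ratio h z + 1)"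
    using integral_K_M0(1)[OF rm] by (simp add: G_def[abs_def] \<theta>_def)
  have "(\<integral>z. \<theta> (ratio h z) \<partial>K) = (\<integral>z. G z \<partial>M0)" using integral_K_M0(2)[OF rm] by (simp add: G_def)
  also have "\<dots> = (\<integral>z. G (scat z) \<partial>M0)" by (rule integral_M0_scat(2)[OF Gm, symmetric])
  also have "\<dots> = (\<integral>z. S z \<partial>M0)" by (rule integral_cong_AE[OF Sm(2,1) AE])
  also have "\<dots> = (\<integral>z. wt z * ent (coll z) \<partial>M0) - (\<integral>z. wt z * (h (coll z) * log_ratio f (coll z)) \<partial>M0) - (\<integral>z. wt z * 1 \<partial>M0) + (\<integral>z. wt (scat z) \<partial>M0)"
    unfolding S_def[abs_def] using e l o w(1) by simp
  also have "\<dots> = (\<integral>z. ent z \<partial>K) - (\<integral>z. h z * log_ratio f z \<partial>K)"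
    unfolding w(2) integral_K_M0(2)[OF ent_measurable] integral_K_M0(2)[OF lm] by simp
  finally show "(\<integral>z. ratio h z * ln (ratio h z) - ratio h z + 1 \<partial>K) = (\<integral>z. ent z \<partial>K) - (\<integral>z. h z * log_ratio f z \<partial>K)"
    by (simp add: \<theta>_def)
qed

lemma integral_flip_ratio:
  assumes F[measurable]: "F \<in> borel_measurable borel"
  shows "(\<integral>z. indicator {a<..b} (fst z) * (ratio h (flip T z) * F (flip T z)) \<partial>typical_flux T \<sigma> (\<lambda>t. \<pi> (T - t)))
    = (\<integral>z. indicator {T - b<..T - a} (fst z) * (h z * F (exchange z)) \<partial>K)"
proof -
  define A :: "'n collision \<Rightarrow> real" where "A z = indicator {a<..b} (fst z) * (ratio h (flip T z) * F (flip T z))" for z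
  define B :: "'n collision \<Rightarrow> real" where "B z = indicator {T - b<..T - a} (fst z) * F z" for z
  have [measurable]: "A \<in> borel_measurable borel" "B \<in> borel_measurable borel" unfolding A_def B_def by measurable
  have mK: "(\<lambda>z. A (flip T z)) \<in> borel_measurable K" by (rule measurable_K) measurable
  have mK': "(\<lambda>z. ratio h z * B z) \<in> borel_measurable K" by (rule measurable_K) measurable
  have "(\<integral>z. A z \<partial>typical_flux T \<sigma> (\<lambda>t. \<pi> (T - t))) = (\<integral>z. A (flip T z) \<partial>K)"
    by (rule integral_flip) measurable
  also have "\<dots> = (\<integral>z. ratio h z * B z \<partial>K)"
  proof (rule integral_cong_AE[OF mK mK'])
    show "AE z in K. A (flip T z) = ratio h z * B z"
      using indicator_flip[of a b] by eventually_elim (simp add: A_def B_def)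
  qed
  also have "\<dots> = (\<integral>z. h z * B (exchange z) \<partial>K)"
    by (rule integral_ratio[OF h_meas h_nonneg pos_out]) measurable
  finally show ?thesis by (simp add: A_def B_def mult.left_commute)
qed

text \<open>Running time backwards negates the increments of the path, and exchanging velocities
  negates the collision gradient, so the balance is kept. That the new density has finite cost is
  \<open>ratio_ent\<close>, which already rests on the forward inequality.\<close>

lemma reverse_flow: "flow_dens e T \<sigma> (\<lambda>t. \<pi> (T - t)) (\<lambda>z. ratio h (flip T z)) (\<lambda>t. f (T - t))"
proof -
  interpret F: vpath e T \<sigma> "\<lambda>t. \<pi> (T - t)" by (rule vpath_flip)
  show ?thesis
  proof unfold_locales
    show "(\<lambda>z. ratio h (flip T z)) \<in> borel_measurable borel" by measurable
    show "ratio h (flip T z) \<ge> 0" for z by (intro ratio_nonneg h_nonneg)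
    show "(\<lambda>(t, v). f (T - t) v) \<in> borel_measurable borel" unfolding split_beta' by measurable
    show "f (T - t) v \<ge> 0" for t v by (rule f_nonneg)
    show "\<pi> (T - t) = density lborel (\<lambda>v. ennreal (f (T - t) v))" if "t \<in> {0..T}" for t
      using f_dens[of "T - t"] that by simp
    have "(\<integral>\<^sup>+z. ennreal (ratio h (flip T z) * ln (ratio h (flip T z)) - ratio h (flip T z) + 1) \<partial>typical_flux T \<sigma> (\<lambda>t. \<pi> (T - t)))
      = (\<integral>\<^sup>+z. ennreal (ratio h z * ln (ratio h z) - ratio h z + 1) \<partial>K)"
      using nn_integral_flip[of "\<lambda>z. ennreal (ratio h (flip T z) * ln (ratio h (flip T z)) - ratio h (flip T z) + 1)"] by simp
    also have "\<dots> \<le> (\<integral>\<^sup>+z. ennreal (norm (ratio h z * ln (ratio h z) - ratio h z + 1)) \<partial>K)"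
      by (intro nn_integral_mono ennreal_leI) simp
    also have "\<dots> < \<infinity>" using ratio_ent(1) by (simp only: integrable_iff_bounded)
    finally show "(\<integral>\<^sup>+z. ennreal (ratio h (flip T z) * ln (ratio h (flip T z)) - ratio h (flip T z) + 1) \<partial>typical_flux T \<sigma> (\<lambda>t. \<pi> (T - t))) < \<infinity>" .
    fix s a b :: real and x :: "real^'n"
    assume s: "s > 0" and ab: "0 \<le> a" "a \<le> b" "b \<le> T"
    define g where "g z = collision_gradient (\<lambda>v. gauss s (x - v)) (snd z)" for z :: "'n collision"
    have [measurable]: "g \<in> borel_measurable borel" unfolding g_def collision_gradient_def split_beta by measurable
    have ge: "g (exchange z) = - g z" for z by (simp add: g_def collision_gradient_def split_beta exchange_def)
    have "(\<integral>z. indicator {a<..b} (fst z) * (ratio h (flip T z) * g (flip T z)) \<partial>typical_flux T \<sigma> (\<lambda>t. \<pi> (T - t)))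
      = - (\<integral>z. indicator {T - b<..T - a} (fst z) * (h z * g z) \<partial>K)"
      using integral_flip_ratio[of g a b] by (simp add: ge)
    also have "\<dots> = (\<integral>v. gauss s (x - v) \<partial>\<pi> (T - b)) - (\<integral>v. gauss s (x - v) \<partial>\<pi> (T - a))"
      using balance[OF s, of "T - b" "T - a" x] ab by (simp add: g_def)
    finally show "(\<integral>v. gauss s (x - v) \<partial>\<pi> (T - b)) - (\<integral>v. gauss s (x - v) \<partial>\<pi> (T - a)) =
       (\<integral>z. indicator {a<..b} (fst z) * (ratio h (flip T z) * collision_gradient (\<lambda>v. gauss s (x - v)) (snd z)) \<partial>typical_flux T \<sigma> (\<lambda>t. \<pi> (T - t)))"
      by (simp add: g_def)
  qed
qed

lemma chain_rule:
  assumes rs: "0 \<le> r" "r \<le> s" "s \<le> T"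
  shows "(\<integral>v. f s v * ln (f s v) \<partial>lborel) - (\<integral>v. f r v * ln (f r v) \<partial>lborel)
    = (\<integral>z. indicator {r<..s} (fst z) * (h z * log_ratio f z) \<partial>K)"
proof (rule antisym)
  show "(\<integral>v. f s v * ln (f s v) \<partial>lborel) - (\<integral>v. f r v * ln (f r v) \<partial>lborel)
    \<le> (\<integral>z. indicator {r<..s} (fst z) * (h z * log_ratio f z) \<partial>K)"
    using entropy_inequality_flux(3)[OF rs entropy_integrable] rs by simp
  interpret R: flow_dens e T \<sigma> "\<lambda>t. \<pi> (T - t)" "\<lambda>z. ratio h (flip T z)" "\<lambda>t. f (T - t)" by (rule reverse_flow)
  have lr: "log_ratio (\<lambda>t. f (T - t)) z = log_ratio f (flip T z)" for z
    by (simp add: log_ratio_def flip_def split_beta)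
  have "(\<integral>v. f r v * ln (f r v) \<partial>lborel) - (\<integral>v. f s v * ln (f s v) \<partial>lborel)
    \<le> (\<integral>z. indicator {T - s<..T - r} (fst z) * (ratio h (flip T z) * log_ratio f (flip T z)) \<partial>typical_flux T \<sigma> (\<lambda>t. \<pi> (T - t)))"
    using R.entropy_inequality_flux(3)[of "T - s" "T - r"] rs entropy_integrable[of s] by (simp add: lr)
  also have "\<dots> = - (\<integral>z. indicator {r<..s} (fst z) * (h z * log_ratio f z) \<partial>K)"
    using integral_flip_ratio[OF log_ratio_measurable, of "T - s" "T - r"] by (simp add: log_ratio_exchange)
  finally show "(\<integral>z. indicator {r<..s} (fst z) * (h z * log_ratio f z) \<partial>K)
    \<le> (\<integral>v. f s v * ln (f s v) \<partial>lborel) - (\<integral>v. f r v * ln (f r v) \<partial>lborel)" by simp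
qed

end

end

section \<open>The balance equation on time intervals\<close>

text \<open>The indicator of {..t} is continuous in t except at t = p z, and no value of
  \<open>p\<close> has positive mass.\<close>

lemma continuous_on_integral_atMost:
  fixes p q :: "'a \<Rightarrow> real"
  assumes q: "integrable M q" and p[measurable]: "p \<in> borel_measurable M" and na: "\<And>c. AE z in M. p z \<noteq> c"
  shows "continuous_on A (\<lambda>t. \<integral>z. indicator {..t} (p z) * q z \<partial>M)"
proof (rule continuous_on_sequentiallyI)
  note [measurable] = borel_measurable_integrable[OF q]
  fix u :: "nat \<Rightarrow> real" and a assume u: "u \<longlonglongrightarrow> a"
  show "(\<lambda>n. \<integral>z. indicator {..u n} (p z) * q z \<partial>M) \<longlonglongrightarrow> (\<integral>z. indicator {..a} (p z) * q z \<partial>M)"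
  proof (rule integral_dominated_convergence[where w = "\<lambda>z. norm (q z)"])
    show "AE z in M. (\<lambda>n. indicator {..u n} (p z) * q z) \<longlonglongrightarrow> indicator {..a} (p z) * q z"
      using na[of a]
    proof eventually_elim
      case (elim z)
      consider "p z < a" | "p z > a" using elim by linarith
      then have "\<forall>\<^sub>F n in sequentially. (indicator {..u n} (p z) * q z :: real) = indicator {..a} (p z) * q z"
      proof cases
        case 1
        from order_tendstoD(1)[OF u 1] show ?thesis by eventually_elim (use 1 in auto)
      next
        case 2
        from order_tendstoD(2)[OF u 2] show ?thesis by eventually_elim (use 2 in auto)
      qed
      then show ?case by (rule tendsto_eventually)
    qed
  qed (use q in \<open>auto simp: indicator_def\<close>)
qed

lemma has_derivative_gauss:
  fixes x v :: "'a::euclidean_space"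
  shows "((\<lambda>v. gauss s (x - v)) has_derivative (\<lambda>w. gauss s (x - v) / s\<^sup>2 * ((x - v) \<bullet> w))) (at v within S)"
proof -
  define c where "c = 1 / (2 * s\<^sup>2)"
  define C where "C = (1 / sqrt (2 * pi * s\<^sup>2)) ^ DIM('a)"
  have g: "gauss s y = C * exp (- (c * (y \<bullet> y)))" for y :: 'a
    by (simp add: gauss_def C_def c_def power2_norm_eq_inner)
  have "((\<lambda>v. C * exp (- (c * ((x - v) \<bullet> (x - v))))) has_derivative
      (\<lambda>w. C * (exp (- (c * ((x - v) \<bullet> (x - v)))) * (2 * c * ((x - v) \<bullet> w))))) (at v within S)"
    by (auto intro!: derivative_eq_intros simp: fun_eq_iff inner_commute algebra_simps)
  moreover have "2 * c = 1 / s\<^sup>2" by (simp add: c_def)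
  ultimately show ?thesis unfolding g by (simp add: mult.assoc)
qed

text \<open>The velocity gradient is a multiple of y times the Gaussian of y, and
  \<open>norm_mult_gauss_le\<close> bounds it.\<close>

lemma C1b_mult_gauss:
  fixes x :: "real^'n"
  assumes s: "s > 0" and u: "continuous_on {0..T} u"
    and \<eta>: "\<And>t. t \<in> {0..T} \<Longrightarrow> (\<eta> has_real_derivative u t) (at t within {0..T})"
  shows "C1b_with_derivative T (\<lambda>z. \<eta> (fst z) * gauss s (x - snd z))
    (\<lambda>z. blinfun_inner_right (u (fst z) * gauss s (x - snd z), (\<eta> (fst z) * (gauss s (x - snd z) / s\<^sup>2)) *\<^sub>R (x - snd z)))"
proof -
  let ?S = "{0..T} \<times> (UNIV :: (real^'n) set)"
  have \<eta>c: "continuous_on {0..T} \<eta>" unfolding continuous_on_eq_continuous_within using DERIV_continuous[OF \<eta>] by blast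
  have cf: "continuous_on ?S (\<lambda>z. w (fst z))" if "continuous_on {0..T} w" for w :: "real \<Rightarrow> real"
    by (rule continuous_on_compose2[OF that]) (auto intro: continuous_intros)
  have cg: "continuous_on ?S (\<lambda>z. gauss s (x - snd z))"
    by (rule continuous_on_compose2[OF gauss_continuous[OF s, of UNIV]]) (auto intro!: continuous_intros)
  obtain A where A: "A > 0" "\<And>t. t \<in> {0..T} \<Longrightarrow> \<bar>\<eta> t\<bar> \<le> A"
    using compact_imp_bounded[OF compact_continuous_image[OF \<eta>c compact_Icc]] by (auto simp: bounded_pos)
  obtain B where B: "B > 0" "\<And>t. t \<in> {0..T} \<Longrightarrow> \<bar>u t\<bar> \<le> B"
    using compact_imp_bounded[OF compact_continuous_image[OF u compact_Icc]] by (auto simp: bounded_pos)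
  define m where "m = s * gauss_moment TYPE(real^'n) * gauss (2 * s) (0 :: real^'n)"
  have gm: "gauss s y * norm y \<le> m" for y :: "real^'n"
  proof -
    have "norm y * gauss s y \<le> s * gauss_moment TYPE(real^'n) * gauss (2 * s) y" by (rule norm_mult_gauss_le[OF s])
    also have "\<dots> \<le> m" unfolding m_def using s by (intro mult_left_mono gauss_le) (auto simp: gauss_moment_def)
    finally show ?thesis by (simp add: mult.commute)
  qed
  show ?thesis
    unfolding C1b_with_derivative_def
  proof (intro conjI ballI)
    fix z :: "real \<times> (real^'n)" assume z: "z \<in> ?S"
    have im: "fst ` ?S = {0..T}" by force
    have "((\<lambda>z. \<eta> (fst z)) has_derivative (\<lambda>w. u (fst z) * fst w)) (at z within ?S)"
    proof (rule has_derivative_in_compose[where f = fst and f' = fst and g = \<eta> and g' = "(*) (u (fst z))"])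
      show "(\<eta> has_derivative (*) (u (fst z))) (at (fst z) within fst ` ?S)"
        unfolding im using \<eta>[of "fst z"] z by (auto simp: has_field_derivative_def)
    qed (intro derivative_intros)
    moreover have "((\<lambda>z. gauss s (x - snd z)) has_derivative (\<lambda>w. gauss s (x - snd z) / s\<^sup>2 * ((x - snd z) \<bullet> snd w))) (at z within ?S)"
      by (rule has_derivative_in_compose[where f = snd and f' = snd, OF _ has_derivative_gauss]) (intro derivative_intros)
    ultimately show "((\<lambda>z. \<eta> (fst z) * gauss s (x - snd z)) has_derivative
      blinfun_apply (blinfun_inner_right (u (fst z) * gauss s (x - snd z), (\<eta> (fst z) * (gauss s (x - snd z) / s\<^sup>2)) *\<^sub>R (x - snd z)))) (at z within ?S)"
      by (rule has_derivative_eq_rhs[OF has_derivative_mult]) (auto simp: fun_eq_iff inner_prod_def algebra_simps diff_divide_distrib)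
  next
    show "continuous_on ?S (\<lambda>z. blinfun_inner_right (u (fst z) * gauss s (x - snd z), (\<eta> (fst z) * (gauss s (x - snd z) / s\<^sup>2)) *\<^sub>R (x - snd z)))"
      using s by (intro bounded_linear.continuous_on[OF bounded_linear_blinfun_inner_right] continuous_intros cf u \<eta>c cg) auto
    show "bounded ((\<lambda>z. \<eta> (fst z) * gauss s (x - snd z)) ` ?S)"
    proof (rule boundedI)
      fix y assume "y \<in> (\<lambda>z. \<eta> (fst z) * gauss s (x - snd z)) ` ?S"
      then obtain t v where t: "t \<in> {0..T}" and y: "y = \<eta> t * gauss s (x - v)" by force
      show "norm y \<le> A * gauss s (0 :: real^'n)"
        unfolding y real_norm_def abs_mult using A(2)[OF t] A(1) gauss_nonneg[of s "x - v"] gauss_le[of s "x - v"]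
        by (intro mult_mono) auto
    qed
    have "norm (u t * gauss s (x - v), (\<eta> t * (gauss s (x - v) / s\<^sup>2)) *\<^sub>R (x - v)) \<le> B * gauss s (0 :: real^'n) + A * (m / s\<^sup>2)"
      if t: "t \<in> {0..T}" for t v
    proof -
      have "norm (u t * gauss s (x - v), (\<eta> t * (gauss s (x - v) / s\<^sup>2)) *\<^sub>R (x - v))
        \<le> norm (u t * gauss s (x - v)) + norm ((\<eta> t * (gauss s (x - v) / s\<^sup>2)) *\<^sub>R (x - v))" by (rule norm_Pair_le)
      also have "\<dots> = \<bar>u t\<bar> * gauss s (x - v) + \<bar>\<eta> t\<bar> * (gauss s (x - v) * norm (x - v) / s\<^sup>2)"
        by (simp add: abs_mult gauss_nonneg)
      also have "\<dots> \<le> B * gauss s (0 :: real^'n) + A * (m / s\<^sup>2)"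
        using A(1) B(1) gauss_nonneg[of s "x - v"] by (intro add_mono mult_mono divide_right_mono A(2)[OF t] B(2)[OF t] gauss_le gm) auto
      finally show ?thesis .
    qed
    then have "bounded ((\<lambda>z. (u (fst z) * gauss s (x - snd z), (\<eta> (fst z) * (gauss s (x - snd z) / s\<^sup>2)) *\<^sub>R (x - snd z))) ` ?S)"
      by (intro boundedI[of _ "B * gauss s (0 :: real^'n) + A * (m / s\<^sup>2)"]) auto
    from bounded_linear_image[OF this bounded_linear_blinfun_inner_right]
    show "bounded ((\<lambda>z. blinfun_inner_right (u (fst z) * gauss s (x - snd z), (\<eta> (fst z) * (gauss s (x - snd z) / s\<^sup>2)) *\<^sub>R (x - snd z))) ` ?S)"
      by (simp add: image_image)
  qed
qed

text \<open>Testing with \<open>\<eta>(t) g(v)\<close>, where \<open>\<eta>\<close> is a primitive of the defect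
  \<open>u(t) = \<pi>\<^sub>t(g) - \<pi>\<^sub>0(g) - Q(1\<^bsub>[0,t]\<^esub> \<nabla>g)\<close> of the balance equation, gives \<open>\<integral> u\<^sup>2 = 0\<close>.\<close>

lemma (in vpath) balance_interval:
  assumes Q: "sets Q = sets (collision_space T :: 'n collision measure)" "finite_measure Q" and na: "\<And>c. AE z in Q. fst z \<noteq> c"
    and bal: "\<And>\<phi> D. C1b_with_derivative T \<phi> D \<Longrightarrow>
        (\<integral>v. \<phi> (T, v) \<partial>\<pi> T) - (\<integral>v. \<phi> (0, v) \<partial>\<pi> 0)
        - (LINT t:{0..T}|lborel. (\<integral>v. D (t, v) (1, 0) \<partial>\<pi> t))
        - (\<integral>(t, z). collision_gradient (\<lambda>v. \<phi> (t, v)) z \<partial>Q) = 0"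
    and s: "s > 0" and ab: "0 \<le> a" "a \<le> b" "b \<le> T"
  shows "(\<integral>v. gauss s (x - v) \<partial>\<pi> b) - (\<integral>v. gauss s (x - v) \<partial>\<pi> a) =
    (\<integral>z. indicator {a<..b} (fst z) * collision_gradient (\<lambda>v. gauss s (x - v)) (snd z) \<partial>Q)"
proof -
  interpret Q: finite_measure Q by (rule Q(2))
  have mQ: "F \<in> borel_measurable Q" if "F \<in> borel_measurable borel" for F :: "'n collision \<Rightarrow> 'z::topological_space"
    using that by (simp add: measurable_cong_sets[OF Q(1) refl] collision_space_def measurable_restrict_space1)
  have spQ: "space Q = {0..T} \<times> UNIV" using sets_eq_imp_space_eq[OF Q(1)] by (simp add: space_collision_space)
  define g where "g v = gauss s (x - v)" for v
  define G where "G t = (\<integral>v. g v \<partial>\<pi> t)" for t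
  define q where "q z = collision_gradient g (snd z)" for z :: "'n collision"
  define F where "F t = (\<integral>z. indicator {..t} (fst z) * q z \<partial>Q)" for t
  define u where "u t = G t - G 0 - F t" for t
  \<comment> \<open>The primitive is normalised to vanish at T, so the boundary term there drops
    out.\<close>
  define \<eta> where "\<eta> t = integral {0..t} u - integral {0..T} u" for t
  define U where "U t = indicator {0..T} t * u t" for t
  have gc: "continuous_on UNIV g" unfolding g_def
    by (rule continuous_on_compose2[OF gauss_continuous[OF s, of UNIV]]) (auto intro!: continuous_intros)
  have [measurable]: "g \<in> borel_measurable borel" using gc by (rule borel_measurable_continuous_onI)
  have gb: "0 \<le> g v" "g v \<le> gauss s (0 :: real^'n)" for v by (simp_all add: g_def gauss_nonneg gauss_le)
  have Gc: "continuous_on {0..T} G" unfolding G_def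
    using gb by (intro continuous_integral gc) (auto simp: bounded_iff intro!: exI[of _ "gauss s (0 :: real^'n)"])
  have qm[measurable]: "q \<in> borel_measurable borel" unfolding q_def collision_gradient_def split_beta by measurable
  have qb: "\<bar>q z\<bar> \<le> 4 * gauss s (0 :: real^'n)" for z
    using gb[of "fst (fst (snd z))"] gb[of "snd (fst (snd z))"] gb[of "fst (snd (snd z))"] gb[of "snd (snd (snd z))"]
    by (simp add: q_def collision_gradient_def split_beta)
  have qi: "integrable Q q" using qb by (intro Q.integrable_const_bound[where B = "4 * gauss s (0 :: real^'n)"] mQ) auto
  have fm: "fst \<in> borel_measurable Q" by (rule mQ) measurable
  have Fc: "continuous_on A F" for A unfolding F_def by (rule continuous_on_integral_atMost[OF qi fm na])
  have uc: "continuous_on {0..T} u" unfolding u_def by (intro continuous_intros Gc Fc)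
  have ui: "set_integrable lborel {t..t'} u" if "0 \<le> t" "t' \<le> T" for t t'
    using that by (intro borel_integrable_atLeastAtMost' continuous_on_subset[OF uc]) auto
  have Ui: "integrable lborel U" using ui[of 0 T] by (simp add: set_integrable_def U_def[abs_def])
  note [measurable] = borel_measurable_integrable[OF Ui]
  have IU: "integral {0..T} u = (\<integral>t. U t \<partial>lborel)"
    using set_borel_integral_eq_integral(2)[OF ui[of 0 T]] by (simp add: set_lebesgue_integral_def U_def)
  have \<eta>': "(\<eta> has_real_derivative u t) (at t within {0..T})" if "t \<in> {0..T}" for t
    unfolding \<eta>_def[abs_def] using integral_has_real_derivative[OF uc that] by (auto intro!: derivative_eq_intros)
  \<comment> \<open>Written as an integral over later times \<tau>, so that Fubini produces
    \<open>F\<close> \<tau> from the flux term.\<close>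
  have \<eta>: "\<eta> t = - (\<integral>\<tau>. U \<tau> * indicator {..\<tau>} t \<partial>lborel)" if t: "t \<in> {0..T}" for t
  proof -
    have "integral {0..t} u + integral {t..T} u = integral {0..T} u"
      using t integrable_continuous_interval[OF uc] by (intro Henstock_Kurzweil_Integration.integral_combine) auto
    then have "\<eta> t = - integral {t..T} u" by (simp add: \<eta>_def)
    also have "integral {t..T} u = (\<integral>\<tau>. indicator {t..T} \<tau> * u \<tau> \<partial>lborel)"
      using set_borel_integral_eq_integral(2)[OF ui[of t T]] t by (simp add: set_lebesgue_integral_def)
    also have "\<dots> = (\<integral>\<tau>. U \<tau> * indicator {..\<tau>} t \<partial>lborel)"
      by (rule Bochner_Integration.integral_cong) (use t in \<open>auto simp: U_def indicator_def\<close>)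
    finally show ?thesis .
  qed
  have "\<eta> T = 0" by (simp add: \<eta>_def)
  have \<eta>0: "\<eta> 0 = - integral {0..T} u" by (simp add: \<eta>_def)
  have test: "0 - \<eta> 0 * G 0 - (\<integral>t. U t * G t \<partial>lborel) - (\<integral>z. \<eta> (fst z) * q z \<partial>Q) = 0"
  proof -
    have 1: "(LINT t:{0..T}|lborel. (\<integral>v. blinfun_inner_right (u (fst (t, v)) * gauss s (x - snd (t, v)), (\<eta> (fst (t, v)) * (gauss s (x - snd (t, v)) / s\<^sup>2)) *\<^sub>R (x - snd (t, v))) (1, 0) \<partial>\<pi> t))
      = (\<integral>t. U t * G t \<partial>lborel)"
      by (simp add: set_lebesgue_integral_def U_def G_def g_def inner_prod_def mult.assoc)
    have 2: "(\<integral>(t, z). collision_gradient (\<lambda>v. \<eta> (fst (t, v)) * gauss s (x - snd (t, v))) z \<partial>Q) = (\<integral>z. \<eta> (fst z) * q z \<partial>Q)"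
      by (rule Bochner_Integration.integral_cong) (auto simp: q_def collision_gradient_def g_def algebra_simps)
    show ?thesis
      using bal[OF C1b_mult_gauss[OF s uc \<eta>', of x]] \<open>\<eta> T = 0\<close> unfolding 1 2 by (simp add: G_def g_def)
  qed
  have "(\<integral>z. \<eta> (fst z) * q z \<partial>Q) = - (\<integral>t. U t * F t \<partial>lborel)"
  proof -
    interpret P: pair_sigma_finite Q "lborel :: real measure" ..
    define R where "R z \<tau> = U \<tau> * (indicator {..\<tau>} (fst z) * q z)" for z :: "'n collision" and \<tau> :: real
    have qQ[measurable]: "q \<in> borel_measurable Q" by (rule mQ) measurable
    note fm[measurable]
    have Rm: "case_prod R \<in> borel_measurable (Q \<Otimes>\<^sub>M lborel)"
    proof -
      have "(\<lambda>(z, \<tau>). (indicator {p :: real \<times> real. fst p \<le> snd p} (fst z, \<tau>) :: real)) \<in> borel_measurable (Q \<Otimes>\<^sub>M lborel)" by measurable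
      moreover have "indicator {p :: real \<times> real. fst p \<le> snd p} (fst z, \<tau>) = (indicator {..\<tau>} (fst z) :: real)" for z :: "'n collision" and \<tau>
        by (simp add: indicator_def)
      ultimately have [measurable]: "(\<lambda>p. (indicator {..snd p} (fst (fst p)) :: real)) \<in> borel_measurable (Q \<Otimes>\<^sub>M lborel)" by (simp add: split_beta')
      show ?thesis unfolding R_def split_beta' by measurable
    qed
    have Ri: "integrable (Q \<Otimes>\<^sub>M lborel) (case_prod R)"
    proof (rule P.Fubini_integrable[OF Rm])
      have b: "norm (R z \<tau>) \<le> norm (4 * gauss s (0 :: real^'n) * U \<tau>)" for z \<tau>
        using qb[of z] gauss_nonneg[of s "0 :: real^'n"] mult_mono[OF qb[of z] order_refl[of "\<bar>U \<tau>\<bar>"]]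
        by (auto simp: R_def abs_mult indicator_def mult.commute)
      have Rz: "integrable lborel (R z)" if z: "z \<in> space Q" for z
        using Ui b measurable_compose[OF measurable_Pair1'[OF z] Rm]
        by (intro Bochner_Integration.integrable_bound[OF integrable_mult_right[OF Ui, of "4 * gauss s (0 :: real^'n)"]] AE_I2) auto
      show "AE z in Q. integrable lborel (\<lambda>\<tau>. case (z, \<tau>) of (z, \<tau>) \<Rightarrow> R z \<tau>)" using Rz by (intro AE_I2) simp
      have "(\<integral>\<tau>. norm (R z \<tau>) \<partial>lborel) \<le> (\<integral>\<tau>. norm (4 * gauss s (0 :: real^'n) * U \<tau>) \<partial>lborel)" if "z \<in> space Q" for z
        using Rz[OF that] Ui by (intro integral_mono b) auto
      moreover have "(\<lambda>z. \<integral>\<tau>. norm (R z \<tau>) \<partial>lborel) \<in> borel_measurable Q"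
        by (rule lborel.borel_measurable_lebesgue_integral) (use Rm in \<open>simp add: split_beta'\<close>)
      ultimately show "integrable Q (\<lambda>z. \<integral>\<tau>. norm (case (z, \<tau>) of (z, \<tau>) \<Rightarrow> R z \<tau>) \<partial>lborel)"
        by (intro Q.integrable_const_bound[where B = "\<integral>\<tau>. norm (4 * gauss s (0 :: real^'n) * U \<tau>) \<partial>lborel"] AE_I2)
           (auto simp: abs_of_nonneg)
    qed
    have "(\<integral>z. \<eta> (fst z) * q z \<partial>Q) = (\<integral>z. - (\<integral>\<tau>. R z \<tau> \<partial>lborel) \<partial>Q)"
    proof (rule Bochner_Integration.integral_cong[OF refl])
      fix z assume "z \<in> space Q"
      then have "fst z \<in> {0..T}" using spQ by auto
      from \<eta>[OF this] show "\<eta> (fst z) * q z = - (\<integral>\<tau>. R z \<tau> \<partial>lborel)"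
        by (simp add: R_def mult.assoc[symmetric])
    qed
    also have "\<dots> = - (\<integral>\<tau>. \<integral>z. R z \<tau> \<partial>Q \<partial>lborel)" using P.Fubini_integral[OF Ri] by simp
    also have "(\<integral>\<tau>. \<integral>z. R z \<tau> \<partial>Q \<partial>lborel) = (\<integral>\<tau>. U \<tau> * F \<tau> \<partial>lborel)" by (simp add: R_def F_def)
    finally show ?thesis .
  qed
  with test have "integral {0..T} u * G 0 - (\<integral>t. U t * G t \<partial>lborel) + (\<integral>t. U t * F t \<partial>lborel) = 0" by (simp add: \<eta>0)
  moreover have UH: "integrable lborel (\<lambda>t. U t * H t)" if "continuous_on {0..T} H" for H :: "real \<Rightarrow> real"
    using borel_integrable_atLeastAtMost'[OF continuous_on_mult[OF uc that]] by (simp add: set_integrable_def U_def[abs_def] mult.assoc)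
  ultimately have "(\<integral>t. U t * u t \<partial>lborel) = 0"
    using Ui UH[OF Gc] UH[OF Fc] by (simp add: u_def right_diff_distrib IU)
  then have "(LINT t:{0..T}|lborel. u t * u t) = 0" by (simp add: set_lebesgue_integral_def U_def mult.assoc)
  then have "integral {0..T} (\<lambda>t. u t * u t) = 0"
    using set_borel_integral_eq_integral(2)[OF borel_integrable_atLeastAtMost'[OF continuous_on_mult[OF uc uc]]] by simp
  \<comment> \<open>The defect is continuous on the closed interval, so the vanishing integral of
    its square leaves no exceptional times.\<close>
  then have u0: "u t = 0" if "t \<in> {0..T}" for t
    using integral_eq_0_iff[OF continuous_on_mult[OF uc uc] T] that by auto
  have "G b - G a = F b - F a" using u0[of a] u0[of b] ab by (simp add: u_def)
  also have "\<dots> = (\<integral>z. indicator {..b} (fst z) * q z - indicator {..a} (fst z) * q z \<partial>Q)"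
    unfolding F_def using qi
    by (intro Bochner_Integration.integral_diff[symmetric] Bochner_Integration.integrable_bound[OF qi] mQ) (auto simp: indicator_def)
  also have "\<dots> = (\<integral>z. indicator {a<..b} (fst z) * q z \<partial>Q)"
    by (rule Bochner_Integration.integral_cong) (use ab in \<open>auto simp: indicator_def\<close>)
  finally show ?thesis by (simp add: G_def g_def[abs_def] q_def)
qed

section \<open>Entropy and action\<close>

context vpath begin

text \<open>Nonnegativity of \<open>psi\<close> bounds the negative part of g ln g by |g lw| +
  weight, which is integrable. The additive constant depends on neither time nor density and is left
  unnamed, as it cancels in differences.\<close>

lemma entropy_rel_eq:
  "\<exists>c. \<forall>t\<in>{0..T}. \<forall>g. (\<forall>v. 0 \<le> g v) \<longrightarrow> g \<in> borel_measurable borel \<longrightarrow> \<pi> t = density lborel (\<lambda>v. ennreal (g v)) \<longrightarrow>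
     entropy_rel e (\<pi> t) = (if integrable lborel (\<lambda>v. g v * ln (g v)) then ereal ((\<integral>v. g v * ln (g v) \<partial>lborel) + c) else \<infinity>)"
proof (intro exI ballI allI impI)
  fix t and g :: "real^'n \<Rightarrow> real"
  define c where "c = real CARD('n) / 2 * (ln (4 * pi * e / real CARD('n)) + 1)"
  assume t: "t \<in> {0..T}" and g0: "\<forall>v. 0 \<le> g v" and g[measurable]: "g \<in> borel_measurable borel"
    and \<pi>: "\<pi> t = density lborel (\<lambda>v. ennreal (g v))"
  define l where "l v = g v * ln (g v)" for v
  have [measurable]: "l \<in> borel_measurable borel" unfolding l_def by measurable
  have ex: "\<exists>g\<in>borel_measurable lborel. density lborel g = \<pi> t" using \<pi> by (intro bexI[of _ "\<lambda>v. ennreal (g v)"]) auto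
  have AE: "AE v in lborel. enn2real (RN_deriv lborel (\<pi> t) v) = g v"
    using sigma_finite_measure.RN_deriv_unique[OF sigma_finite_lborel _ \<pi>[symmetric]]
    by (auto elim!: eventually_mono simp: g0) (metis enn2real_ennreal g0)
  have p: "(\<integral>\<^sup>+v. ennreal (enn2real (RN_deriv lborel (\<pi> t) v) * ln (enn2real (RN_deriv lborel (\<pi> t) v))) \<partial>lborel) = (\<integral>\<^sup>+v. ennreal (l v) \<partial>lborel)"
    using AE by (intro nn_integral_cong_AE) (auto simp: l_def elim!: eventually_mono)
  have n: "(\<integral>\<^sup>+v. ennreal (- (enn2real (RN_deriv lborel (\<pi> t) v) * ln (enn2real (RN_deriv lborel (\<pi> t) v)))) \<partial>lborel) = (\<integral>\<^sup>+v. ennreal (- l v) \<partial>lborel)"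
    using AE by (intro nn_integral_cong_AE) (auto simp: l_def elim!: eventually_mono)
  have "integrable (density lborel (\<lambda>v. ennreal (g v))) lw" using lw_ker_integrable[of t] t \<pi> by (simp add: ker_def)
  then have lwi: "integrable lborel (\<lambda>v. g v * lw v)" using g0 by (subst (asm) integrable_density) auto
  have "(\<integral>\<^sup>+v. ennreal (- l v) \<partial>lborel) \<le> (\<integral>\<^sup>+v. ennreal (norm (\<bar>g v * lw v\<bar> + weight v)) \<partial>lborel)"
  proof (intro nn_integral_mono ennreal_leI)
    fix v :: "real^'n"
    have "0 \<le> l v + g v * lw v - g v + weight v" using psi_nonneg[of "g v" "weight v"] g0 weight_pos[of v] by (simp add: psi_def lw_def l_def)
    then show "- l v \<le> norm (\<bar>g v * lw v\<bar> + weight v)" using spec[OF g0, of v] weight_pos[of v] by simp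
  qed
  also have "\<dots> < \<infinity>"
  proof -
    have "integrable lborel (\<lambda>v. \<bar>g v * lw v\<bar> + weight v)" using lwi weight_integrable[where 'a="real^'n"] by auto
    then show ?thesis by (simp only: integrable_iff_bounded)
  qed
  finally have nf: "(\<integral>\<^sup>+v. ennreal (- l v) \<partial>lborel) < \<infinity>" .
  then obtain n where nn: "(\<integral>\<^sup>+v. ennreal (- l v) \<partial>lborel) = ennreal n" "n \<ge> 0" by (cases "\<integral>\<^sup>+v. ennreal (- l v) \<partial>lborel") auto
  have E: "entropy_rel e (\<pi> t) = enn2ereal (\<integral>\<^sup>+v. ennreal (l v) \<partial>lborel) - ereal n + ereal c"
    unfolding entropy_rel_def Let_def p n using ex nn by (simp add: c_def enn2ereal_ennreal)
  have "entropy_rel e (\<pi> t) = (if integrable lborel l then ereal ((\<integral>v. l v \<partial>lborel) + c) else \<infinity>)"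
  proof (cases "(\<integral>\<^sup>+v. ennreal (l v) \<partial>lborel) = \<infinity>")
    case True
    then have "\<not> integrable lborel l" by (simp add: real_integrable_def)
    then show ?thesis using E True by simp
  next
    case False
    then obtain p where p: "(\<integral>\<^sup>+v. ennreal (l v) \<partial>lborel) = ennreal p" "p \<ge> 0" by (cases "\<integral>\<^sup>+v. ennreal (l v) \<partial>lborel") auto
    have i: "integrable lborel l" using p nn by (simp add: real_integrable_def)
    have "(\<integral>v. l v \<partial>lborel) = p - n" using real_lebesgue_integral_def[OF i] p nn by simp
    then show ?thesis using E i p by (simp add: enn2ereal_ennreal)
  qed
  then show "entropy_rel e (\<pi> t) = (if integrable lborel (\<lambda>v. g v * ln (g v)) then ereal ((\<integral>v. g v * ln (g v) \<partial>lborel) + c) else \<infinity>)"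
    by (simp add: l_def[abs_def])
qed

lemma density_if_exists:
  assumes t: "t \<in> {0..T}" and "\<exists>g\<in>borel_measurable lborel. density lborel g = \<pi> t"
  shows "\<exists>g. g \<in> borel_measurable borel \<and> (\<forall>v. 0 \<le> g v) \<and> \<pi> t = density lborel (\<lambda>v. ennreal (g v))"
proof -
  have "absolutely_continuous lborel (\<pi> t)" using assms(2) by (metis absolutely_continuousI_density)
  then show ?thesis
    using real_density_exists[OF sigma_finite_lborel, of "\<pi> t"] prob[OF t] sets_\<pi>[OF t] by (auto simp: prob_space_def)
qed

lemma entropy_rel_not_MInf: "t \<in> {0..T} \<Longrightarrow> entropy_rel e (\<pi> t) \<noteq> -\<infinity>"
proof (cases "\<exists>g\<in>borel_measurable lborel. density lborel g = \<pi> t")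
  case True
  assume t: "t \<in> {0..T}"
  obtain g where g: "g \<in> borel_measurable borel" "\<forall>v. 0 \<le> g v" "\<pi> t = density lborel (\<lambda>v. ennreal (g v))"
    using density_if_exists[OF t True] by blast
  obtain c where "entropy_rel e (\<pi> t) = (if integrable lborel (\<lambda>v. g v * ln (g v)) then ereal ((\<integral>v. g v * ln (g v) \<partial>lborel) + c) else \<infinity>)"
    using entropy_rel_eq t g by blast
  then show ?thesis by simp
next
  case False
  then show ?thesis unfolding entropy_rel_def by simp
qed

lemma entropy_rel_finite:
  assumes t: "t \<in> {0..T}" and "\<bar>entropy_rel e (\<pi> t)\<bar> \<noteq> \<infinity>"
  shows "\<exists>g. g \<in> borel_measurable borel \<and> (\<forall>v. 0 \<le> g v) \<and> \<pi> t = density lborel (\<lambda>v. ennreal (g v)) \<and> integrable lborel (\<lambda>v. g v * ln (g v))"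
proof -
  have "\<exists>g\<in>borel_measurable lborel. density lborel g = \<pi> t"
  proof (rule ccontr)
    assume "\<not> ?thesis"
    then have "entropy_rel e (\<pi> t) = \<infinity>" unfolding entropy_rel_def by simp
    then show False using assms by simp
  qed
  from density_if_exists[OF t this] obtain g where g: "g \<in> borel_measurable borel" "\<forall>v. 0 \<le> g v" "\<pi> t = density lborel (\<lambda>v. ennreal (g v))" by blast
  obtain c where "entropy_rel e (\<pi> t) = (if integrable lborel (\<lambda>v. g v * ln (g v)) then ereal ((\<integral>v. g v * ln (g v) \<partial>lborel) + c) else \<infinity>)"
    using entropy_rel_eq t g by blast
  with assms(2) have "integrable lborel (\<lambda>v. g v * ln (g v))" by (simp split: if_splits)
  then show ?thesis using g by blast
qed

text \<open>Uniqueness of the Radon-Nikodym derivative identifies the version in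
  \<open>action\<close> with \<open>h\<close> almost everywhere.\<close>

lemma action_density:
  assumes [measurable]: "h \<in> borel_measurable borel" and h: "\<And>z. h z \<ge> 0"
  shows "action e T \<sigma> \<pi> (density K (\<lambda>z. ennreal (h z))) = enn2ereal (\<integral>\<^sup>+z. ennreal (h z * ln (h z) - h z + 1) \<partial>K)"
proof -
  interpret Kf: finite_measure K by (rule finite_K)
  have hK: "(\<lambda>z. ennreal (h z)) \<in> borel_measurable K" by (rule measurable_K) measurable
  have "AE z in K. ennreal (h z) = RN_deriv K (density K (\<lambda>z. ennreal (h z))) z"
    by (rule Kf.RN_deriv_unique[OF hK refl])
  then have AE: "AE z in K. enn2real (RN_deriv K (density K (\<lambda>z. ennreal (h z))) z) = h z"
    by eventually_elim (metis enn2real_ennreal h)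
  have "(\<integral>\<^sup>+z. (let k = enn2real (RN_deriv K (density K (\<lambda>z. ennreal (h z))) z) in ennreal (k * ln k - (k - 1))) \<partial>K)
     = (\<integral>\<^sup>+z. ennreal (h z * ln (h z) - h z + 1) \<partial>K)"
    using AE by (intro nn_integral_cong_AE) (auto simp: Let_def algebra_simps elim!: eventually_mono)
  then show ?thesis using cont absolutely_continuousI_density[OF hK] by (simp add: action_def)
qed

lemma action_finite:
  assumes fin: "\<bar>action e T \<sigma> \<pi> R\<bar> \<noteq> \<infinity>" and R: "finite_measure R" "sets R = sets K"
  shows "\<exists>h. h \<in> borel_measurable borel \<and> (\<forall>z. h z \<ge> 0) \<and> R = density K (\<lambda>z. ennreal (h z)) \<and>
    (\<integral>\<^sup>+z. ennreal (h z * ln (h z) - h z + 1) \<partial>K) < \<infinity>"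
proof -
  interpret Kf: finite_measure K by (rule finite_K)
  have "absolutely_continuous K R" using fin unfolding action_def by (auto split: if_splits)
  from real_density_exists[OF Kf.sigma_finite_measure_axioms R(1) this R(2)]
  obtain g where g: "g \<in> borel_measurable K" "\<forall>z. 0 \<le> g z" "R = density K (\<lambda>z. ennreal (g z))" by blast
  \<comment> \<open>Extended by 0 beyond the slab, to be Borel on the whole space.\<close>
  define h where "h z = (if z \<in> {0..T} \<times> UNIV then g z else 0)" for z
  have hm: "h \<in> borel_measurable borel"
    unfolding h_def using g(1) slab_borel by (subst measurable_restrict_space_iff[symmetric]) (auto simp: measurable_cong_sets[OF sets_K refl])
  have h0: "h z \<ge> 0" for z by (metis h_def g(2) order_refl)
  have R': "R = density K (\<lambda>z. ennreal (h z))"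
    unfolding g(3)
  proof (rule density_cong)
    show "(\<lambda>z. ennreal (g z)) \<in> borel_measurable K" using g(1) by measurable
    show "(\<lambda>z. ennreal (h z)) \<in> borel_measurable K" using measurable_K[OF hm] by measurable
    show "AE z in K. ennreal (g z) = ennreal (h z)" using AE_space by eventually_elim (simp add: h_def)
  qed
  moreover have "(\<integral>\<^sup>+z. ennreal (h z * ln (h z) - h z + 1) \<partial>K) < \<infinity>"
    using fin unfolding R' action_density[OF hm h0] by (auto simp: less_top)
  ultimately show ?thesis using hm h0 by blast
qed

lemma action_nonneg: "action e T \<sigma> \<pi> R \<ge> 0"
  unfolding action_def by simp

text \<open>Neither summand can be minus infinity, so a finite sum has finite terms.\<close>

lemma entropy_plus_action_finite_iff:
  assumes "t \<in> {0..T}"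
  shows "\<bar>entropy_rel e (\<pi> t) + action e T \<sigma> \<pi> R\<bar> \<noteq> \<infinity> \<longleftrightarrow> \<bar>entropy_rel e (\<pi> t)\<bar> \<noteq> \<infinity> \<and> \<bar>action e T \<sigma> \<pi> R\<bar> \<noteq> \<infinity>"
  using entropy_rel_not_MInf[OF assms] action_nonneg[of R]
  by (cases "entropy_rel e (\<pi> t)"; cases "action e T \<sigma> \<pi> R") auto

lemma AE_flip:
  assumes [measurable]: "Measurable.pred borel P"
  shows "(AE z in typical_flux T \<sigma> (\<lambda>t. \<pi> (T - t)). P z) \<longleftrightarrow> (AE z in K. P (flip T z))"
proof -
  interpret F: vpath e T \<sigma> "\<lambda>t. \<pi> (T - t)" by (rule vpath_flip)
  have "(AE z in F.K. P z) \<longleftrightarrow> (AE z in F.K. indicator {z. \<not> P z} z = (0::ennreal))" by (simp add: indicator_def)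
  also have "\<dots> \<longleftrightarrow> (\<integral>\<^sup>+z. indicator {z. \<not> P z} z \<partial>F.K) = 0"
    by (subst nn_integral_0_iff_AE) (auto intro!: F.measurable_K)
  also have "(\<integral>\<^sup>+z. indicator {z. \<not> P z} z \<partial>F.K) = (\<integral>\<^sup>+z. indicator {z. \<not> P z} (flip T z) \<partial>K)"
    by (rule nn_integral_flip) measurable
  also have "\<dots> = 0 \<longleftrightarrow> (AE z in K. indicator {z. \<not> P z} (flip T z) = (0::ennreal))"
    by (rule nn_integral_0_iff_AE) (rule measurable_K, measurable)
  also have "\<dots> \<longleftrightarrow> (AE z in K. P (flip T z))" by (simp add: indicator_def)
  finally show ?thesis .
qed

end

text \<open>The second part serves the case where only the reversed action is known to be finite. It
  is then the reversed flux that has a density, and the path run backwards that forms a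
  flow.\<close>

lemma (in vpath) flow_of_balance:
  assumes Q: "sets Q = sets K" "finite_measure Q" and na: "\<And>c. AE z in Q. fst z \<noteq> c"
    and bal: "\<And>\<phi> D. C1b_with_derivative T \<phi> D \<Longrightarrow>
        (\<integral>v. \<phi> (T, v) \<partial>\<pi> T) - (\<integral>v. \<phi> (0, v) \<partial>\<pi> 0)
        - (LINT t:{0..T}|lborel. (\<integral>v. D (t, v) (1, 0) \<partial>\<pi> t))
        - (\<integral>(t, z). collision_gradient (\<lambda>v. \<phi> (t, v)) z \<partial>Q) = 0"
    and h[measurable]: "h \<in> borel_measurable borel" and h0: "\<And>z. h z \<ge> 0"
    and fin: "(\<integral>\<^sup>+z. ennreal (h z * ln (h z) - h z + 1) \<partial>K) < \<infinity>"
  shows "Q = density K (\<lambda>z. ennreal (h z)) \<Longrightarrow> flow e T \<sigma> \<pi> h"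
    and "time_reversal Q = density K (\<lambda>z. ennreal (h z)) \<Longrightarrow> flow e T \<sigma> (\<lambda>t. \<pi> (T - t)) (\<lambda>z. h (flip T z))"
proof -
  have Q': "sets Q = sets (collision_space T :: 'n collision measure)" using Q(1) by (simp add: collision_space_def)
  have I: "(\<integral>v. gauss s (x - v) \<partial>\<pi> b) - (\<integral>v. gauss s (x - v) \<partial>\<pi> a) =
    (\<integral>z. indicator {a<..b} (fst z) * collision_gradient (\<lambda>v. gauss s (x - v)) (snd z) \<partial>Q)"
    if "s > 0" "0 \<le> a" "a \<le> b" "b \<le> T" for s a b x
    by (rule balance_interval[OF Q' Q(2) na _ that]) (rule bal)
  have hK: "h \<in> borel_measurable K" by (rule measurable_K) measurable
  have gm[measurable]: "(\<lambda>z :: 'n collision. collision_gradient (\<lambda>v. gauss s (x - v)) (snd z)) \<in> borel_measurable borel" for s and x :: "real^'n"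
    unfolding collision_gradient_def split_beta by measurable
  have dens: "(\<integral>z. indicator {a<..b} (fst z) * collision_gradient (\<lambda>v. gauss s (x - v)) (snd z) \<partial>density K (\<lambda>z. ennreal (h z)))
    = (\<integral>z. indicator {a<..b} (fst z) * (h z * collision_gradient (\<lambda>v. gauss s (x - v)) (snd z)) \<partial>K)" for a b s and x :: "real^'n"
  proof (subst integral_density)
    show "(\<lambda>z. indicator {a<..b} (fst z) * collision_gradient (\<lambda>v. gauss s (x - v)) (snd z) :: real) \<in> borel_measurable K"
      by (rule measurable_K) measurable
  qed (use hK h0 in \<open>auto simp: mult.left_commute\<close>)
  {
    assume Qh: "Q = density K (\<lambda>z. ennreal (h z))"
    show "flow e T \<sigma> \<pi> h"
    proof unfold_locales
      fix s x a b assume "s > (0::real)" "0 \<le> a" "a \<le> b" "b \<le> T"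
      from I[OF this, of x] show "(\<integral>v. gauss s (x - v) \<partial>\<pi> b) - (\<integral>v. gauss s (x - v) \<partial>\<pi> a) =
        (\<integral>z. indicator {a<..b} (fst z) * (h z * collision_gradient (\<lambda>v. gauss s (x - v)) (snd z)) \<partial>K)"
        unfolding Qh dens by simp
    qed (use h h0 fin in auto)
  }
  {
    assume Qh: "time_reversal Q = density K (\<lambda>z. ennreal (h z))"
    interpret F: vpath e T \<sigma> "\<lambda>t. \<pi> (T - t)" by (rule vpath_flip)
    have ex: "exchange \<in> Q \<rightarrow>\<^sub>M Q"
      using measurable_K[OF exchange_measurable] by (simp add: measurable_cong_sets[OF Q(1) Q(1)] measurable_cong_sets[OF refl sets_K] measurable_restrict_space2_iff exchange_def mem_Times_iff)
    have tr: "time_reversal Q = distr Q Q exchange" by (simp add: time_reversal_def exchange_def[abs_def] split_beta')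
    show "flow e T \<sigma> (\<lambda>t. \<pi> (T - t)) (\<lambda>z. h (flip T z))"
    proof unfold_locales
      show "(\<lambda>z. h (flip T z)) \<in> borel_measurable borel" by measurable
      have "(\<integral>\<^sup>+z. ennreal (h (flip T z) * ln (h (flip T z)) - h (flip T z) + 1) \<partial>F.K) = (\<integral>\<^sup>+z. ennreal (h z * ln (h z) - h z + 1) \<partial>K)"
        using nn_integral_flip[of "\<lambda>z. ennreal (h (flip T z) * ln (h (flip T z)) - h (flip T z) + 1)"] by simp
      then show "(\<integral>\<^sup>+z. ennreal (h (flip T z) * ln (h (flip T z)) - h (flip T z) + 1) \<partial>F.K) < \<infinity>" using fin by simp
      fix s a b :: real and x :: "real^'n" assume s: "s > 0" and ab: "0 \<le> a" "a \<le> b" "b \<le> T"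
      define q where "q z = collision_gradient (\<lambda>v. gauss s (x - v)) (snd z)" for z :: "'n collision"
      have [measurable]: "q \<in> borel_measurable borel" unfolding q_def by measurable
      have qe: "q (exchange z) = - q z" for z by (simp add: q_def collision_gradient_def split_beta exchange_def)
      define A :: "'n collision \<Rightarrow> real" where "A z = indicator {a<..b} (fst z) * (h (flip T z) * q z)" for z
      define B :: "'n collision \<Rightarrow> real" where "B z = indicator {T - b<..T - a} (fst z) * q z" for z
      have [measurable]: "A \<in> borel_measurable borel" "B \<in> borel_measurable borel" unfolding A_def B_def by measurable
      have m1: "(\<lambda>z. A (flip T z)) \<in> borel_measurable K" by (rule measurable_K) measurable
      have m2: "(\<lambda>z. indicator {T - b<..T - a} (fst z) * (h z * q z)) \<in> borel_measurable K" by (rule measurable_K) measurable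
      have BQ: "B \<in> borel_measurable Q" using measurable_K[of B] by (simp add: measurable_cong_sets[OF Q(1) refl])
      have "(\<integral>z. A z \<partial>F.K) = (\<integral>z. A (flip T z) \<partial>K)" by (rule integral_flip) measurable
      also have "\<dots> = (\<integral>z. indicator {T - b<..T - a} (fst z) * (h z * q z) \<partial>K)"
      proof (rule integral_cong_AE[OF m1 m2])
        show "AE z in K. A (flip T z) = indicator {T - b<..T - a} (fst z) * (h z * q z)"
          using indicator_flip[of a b] by eventually_elim (simp add: A_def q_def)
      qed
      also have "\<dots> = (\<integral>z. B z \<partial>time_reversal Q)" unfolding Qh B_def q_def dens ..
      also have "\<dots> = (\<integral>z. B (exchange z) \<partial>Q)" unfolding tr by (rule integral_distr[OF ex BQ])
      also have "\<dots> = - (\<integral>z. B z \<partial>Q)" by (simp add: B_def qe)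
      also have "\<dots> = (\<integral>v. gauss s (x - v) \<partial>\<pi> (T - b)) - (\<integral>v. gauss s (x - v) \<partial>\<pi> (T - a))"
        using I[OF s, of "T - b" "T - a" x] ab by (simp add: B_def q_def)
      finally show "(\<integral>v. gauss s (x - v) \<partial>\<pi> (T - b)) - (\<integral>v. gauss s (x - v) \<partial>\<pi> (T - a)) =
        (\<integral>z. indicator {a<..b} (fst z) * (h (flip T z) * collision_gradient (\<lambda>v. gauss s (x - v)) (snd z)) \<partial>F.K)"
        by (simp add: A_def q_def)
    qed (use h0 in auto)
  }
qed

lemma (in vpath) AE_density_K_time: "Q = density K (\<lambda>z. ennreal (h z)) \<Longrightarrow> h \<in> borel_measurable borel \<Longrightarrow> AE z in Q. fst z \<noteq> c"
  using AE_K_time[of c] by (auto simp: AE_density measurable_K elim!: eventually_mono)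

text \<open>Densities of a path are measurable only on {0..T}; extension by 0 makes them Borel on
  the whole space.\<close>

lemma (in vpath) extend_densities:
  assumes "densities_of_path T \<pi> f"
  shows "vpath_dens e T \<sigma> \<pi> (\<lambda>t v. if t \<in> {0..T} then f t v else 0)"
proof unfold_locales
  have S: "{0..T} \<times> (UNIV :: (real^'n) set) \<in> sets borel" by (intro borel_closed closed_Times) auto
  have "(\<lambda>p. if p \<in> {0..T} \<times> UNIV then f (fst p) (snd p) else 0) \<in> borel_measurable borel"
    using assms S by (subst measurable_restrict_space_iff[symmetric]) (auto simp: densities_of_path_def split_beta')
  then show "(\<lambda>(t, v). if t \<in> {0..T} then f t v else 0) \<in> borel_measurable borel"
    by (simp add: split_beta' mem_Times_iff)
qed (use assms in \<open>auto simp: densities_of_path_def\<close>)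

lemma (in vpath_dens) densities: "densities_of_path T \<pi> f"
  using f_dens f_nonneg measurable_restrict_space1[OF f_joint] by (auto simp: densities_of_path_def)

text \<open>If the reversed action and the final entropy are finite, run the flow backwards in time and reverse it
  once more.\<close>

lemma (in vpath) forward_finite:
  assumes Q: "sets Q = sets K" "finite_measure Q"
    and bal: "\<And>\<phi> D. C1b_with_derivative T \<phi> D \<Longrightarrow>
        (\<integral>v. \<phi> (T, v) \<partial>\<pi> T) - (\<integral>v. \<phi> (0, v) \<partial>\<pi> 0)
        - (LINT t:{0..T}|lborel. (\<integral>v. D (t, v) (1, 0) \<partial>\<pi> t))
        - (\<integral>(t, z). collision_gradient (\<lambda>v. \<phi> (t, v)) z \<partial>Q) = 0"
    and H: "\<bar>entropy_rel e (\<pi> T)\<bar> \<noteq> \<infinity>" and J: "\<bar>action e T \<sigma> \<pi> (time_reversal Q)\<bar> \<noteq> \<infinity>"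
  shows "\<bar>entropy_rel e (\<pi> 0)\<bar> \<noteq> \<infinity>" "\<bar>action e T \<sigma> \<pi> Q\<bar> \<noteq> \<infinity>"
proof -
  interpret Q: finite_measure Q by (rule Q(2))
  have T0: "0 \<in> {0..T}" "T \<in> {0..T}" using T by auto
  have ex: "exchange \<in> Q \<rightarrow>\<^sub>M Q"
    using measurable_K[OF exchange_measurable] by (simp add: measurable_cong_sets[OF Q(1) Q(1)] measurable_cong_sets[OF refl sets_K] measurable_restrict_space2_iff exchange_def mem_Times_iff)
  have tr: "time_reversal Q = distr Q Q exchange" by (simp add: time_reversal_def exchange_def[abs_def] split_beta')
  have "finite_measure (time_reversal Q)" "sets (time_reversal Q) = sets K"
    unfolding tr using Q.finite_measure_distr[OF ex] Q(1) by auto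
  from action_finite[OF J this] obtain h where h[measurable]: "h \<in> borel_measurable borel" and h0: "\<And>z. h z \<ge> 0"
    and tQ: "time_reversal Q = density K (\<lambda>z. ennreal (h z))" and fin: "(\<integral>\<^sup>+z. ennreal (h z * ln (h z) - h z + 1) \<partial>K) < \<infinity>" by blast
  have na: "AE z in Q. fst z \<noteq> c" for c
    using AE_distrD[OF ex, of "\<lambda>z. fst z \<noteq> c"] AE_density_K_time[OF tQ h, of c, unfolded tr] by simp
  obtain g where g: "g \<in> borel_measurable borel" "\<And>v. 0 \<le> g v" "\<pi> T = density lborel (\<lambda>v. ennreal (g v))" "integrable lborel (\<lambda>v. g v * ln (g v))"
    using entropy_rel_finite[OF T0(2) H] by blast
  interpret F: flow e T \<sigma> "\<lambda>t. \<pi> (T - t)" "\<lambda>z. h (flip T z)" by (rule flow_of_balance(2)[OF Q na _ h h0 fin tQ]) (rule bal)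
  have "F.ker 0 = density lborel (\<lambda>v. ennreal (g v))" using g(3) T0 by (simp add: F.ker_def)
  from F.flow_dens_exists[OF g(2,1) this g(4)] obtain k where k: "flow_dens e T \<sigma> (\<lambda>t. \<pi> (T - t)) (\<lambda>z. h (flip T z)) k" by blast
  interpret R: flow_dens e T \<sigma> "\<lambda>t. \<pi> (T - t)" "\<lambda>z. h (flip T z)" k by (rule k)
  obtain c where c: "\<And>t g. t \<in> {0..T} \<Longrightarrow> (\<forall>v. 0 \<le> g v) \<Longrightarrow> g \<in> borel_measurable borel \<Longrightarrow> \<pi> t = density lborel (\<lambda>v. ennreal (g v)) \<Longrightarrow>
     entropy_rel e (\<pi> t) = (if integrable lborel (\<lambda>v. g v * ln (g v)) then ereal ((\<integral>v. g v * ln (g v) \<partial>lborel) + c) else \<infinity>)"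
    using entropy_rel_eq by blast
  have km: "k t \<in> borel_measurable borel" for t by measurable
  have k0: "integrable lborel (\<lambda>v. k 0 v * ln (k 0 v))"
    using c[of T "k 0"] R.f_dens[of 0] R.f_nonneg km[of 0] T0 H by (simp split: if_splits)
  have kd: "\<pi> t = density lborel (\<lambda>v. ennreal (k (T - t) v))" if "t \<in> {0..T}" for t
    using R.f_dens[of "T - t"] that by simp
  show "\<bar>entropy_rel e (\<pi> 0)\<bar> \<noteq> \<infinity>"
    using c[of 0 "k T"] kd[of 0] R.f_nonneg km[of T] T0 R.entropy_integrable[OF k0, of T] by simp
  \<comment> \<open>A flow along the original path, obtained by reversing the backward flow. That
    its density belongs to \<open>Q\<close> is shown below from the involutivity of
    \<open>time_reversal\<close>.\<close>
  interpret V: flow_dens e T \<sigma> \<pi> "\<lambda>z. R.ratio (\<lambda>z. h (flip T z)) (flip T z)" "\<lambda>t. k (T - t)"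
    using R.reverse_flow[OF k0] by simp
  have "Measurable.pred borel (\<lambda>z. h (flip T z) > 0 \<longrightarrow> R.ff (fst z) (snd (snd z)) > 0)" by measurable
  from R.pos_out[OF k0, unfolded AE_flip[OF this]]
  have "AE z in K. h z > 0 \<longrightarrow> V.ff (fst z) (snd (snd z)) > 0" by (simp add: V.ff_def R.ff_def)
  from V.time_reversal_density[OF h h0 this]
  have "time_reversal (time_reversal Q) = density K (\<lambda>z. ennreal (V.ratio h z))" unfolding tQ .
  moreover have "time_reversal (time_reversal Q) = Q"
  proof -
    have "time_reversal (time_reversal Q) = distr (distr Q Q exchange) (distr Q Q exchange) exchange"
      by (simp add: time_reversal_def exchange_def[abs_def] split_beta')
    also have "\<dots> = distr (distr Q Q exchange) Q exchange" by (rule distr_cong) simp_all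
    also have "\<dots> = distr Q Q (exchange \<circ> exchange)" by (rule distr_distr[OF ex ex])
    also have "\<dots> = Q" by (simp add: o_def distr_id2)
    finally show ?thesis .
  qed
  moreover have "V.ratio h = (\<lambda>z. R.ratio (\<lambda>z. h (flip T z)) (flip T z))"
    by (simp add: V.ratio_def R.ratio_def V.ff_def R.ff_def flip_def exchange_def fun_eq_iff)
  ultimately have Qd: "Q = density K (\<lambda>z. ennreal (R.ratio (\<lambda>z. h (flip T z)) (flip T z)))" by simp
  have "action e T \<sigma> \<pi> Q \<noteq> \<infinity>"
    unfolding Qd action_density[OF V.h_meas V.h_nonneg] using V.h_ent by (auto simp: less_top)
  then show "\<bar>action e T \<sigma> \<pi> Q\<bar> \<noteq> \<infinity>" using action_nonneg[of Q] by (cases "action e T \<sigma> \<pi> Q") auto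
qed

lemma theta_nonneg: "x \<ge> 0 \<Longrightarrow> x * ln x - x + 1 \<ge> (0::real)"
  using legendre_exp[of x 0] by simp

lemma enn2ereal_nn_integral:
  assumes "integrable M F" "\<And>x. F x \<ge> 0"
  shows "enn2ereal (\<integral>\<^sup>+x. ennreal (F x) \<partial>M) = ereal (\<integral>x. F x \<partial>M)"
  using assms by (simp add: nn_integral_eq_integral enn2ereal_ennreal)

context flow_dens begin

context
  assumes fl: "integrable lborel (\<lambda>v. f 0 v * ln (f 0 v))"
begin

lemma log_ratio_integrable_density: "log_ratio_integrable f (density K (\<lambda>z. ennreal (h z)))"
  unfolding log_ratio_integrable_def
proof
  have hK: "h \<in> borel_measurable K" "log_ratio f \<in> borel_measurable K"
    by (rule measurable_K, rule h_meas) (rule measurable_K, rule log_ratio_measurable)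
  show "AE (t, (v, w), (v', w')) in density K (\<lambda>z. ennreal (h z)). 0 < f t v * f t w \<and> 0 < f t v' * f t w'"
    unfolding AE_density[OF measurable_compose[OF hK(1) measurable_ennreal]]
    using pos_out[OF fl] pos_inc[OF fl] by eventually_elim (auto simp: ff_def)
  show "integrable (density K (\<lambda>z. ennreal (h z))) (log_ratio f)"
    using h_log_ratio_integrable[OF fl] hK h_nonneg by (subst integrable_density) auto
qed

lemma integral_log_ratio:
  assumes rs: "0 \<le> r" "r \<le> s" "s \<le> T"
  shows "(\<integral>v. f s v * ln (f s v) \<partial>lborel) - (\<integral>v. f r v * ln (f r v) \<partial>lborel)
    = (\<integral>z. indicator {r..s} (fst z) * log_ratio f z \<partial>density K (\<lambda>z. ennreal (h z)))"
proof -
  have m0: "h \<in> borel_measurable K" by (rule measurable_K) measurable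
  have m1: "(\<lambda>z. indicator {r..s} (fst z) * log_ratio f z) \<in> borel_measurable K" by (rule measurable_K) measurable
  have m2: "(\<lambda>z. h z * (indicator {r..s} (fst z) * log_ratio f z)) \<in> borel_measurable K" by (rule measurable_K) measurable
  have m3: "(\<lambda>z. indicator {r<..s} (fst z) * (h z * log_ratio f z)) \<in> borel_measurable K" by (rule measurable_K) measurable
  have "(\<integral>z. indicator {r..s} (fst z) * log_ratio f z \<partial>density K (\<lambda>z. ennreal (h z)))
    = (\<integral>z. h z * (indicator {r..s} (fst z) * log_ratio f z) \<partial>K)"
    using m0 m1 h_nonneg by (subst integral_density) auto
  also have "\<dots> = (\<integral>z. indicator {r<..s} (fst z) * (h z * log_ratio f z) \<partial>K)"
  proof (rule integral_cong_AE[OF m2 m3])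
    \<comment> \<open>The two intervals differ only at the time r.\<close>
    show "AE z in K. h z * (indicator {r..s} (fst z) * log_ratio f z) = indicator {r<..s} (fst z) * (h z * log_ratio f z)"
      using AE_K_time[of r] by eventually_elim (auto simp: indicator_def)
  qed
  finally show ?thesis using chain_rule[OF fl rs] by simp
qed

text \<open>By \<open>ratio_ent\<close> the two costs differ by the integral of h times the
  logarithmic ratio, which the chain rule over the whole interval identifies with the entropy
  increment.\<close>

lemma action_balance:
  "action e T \<sigma> \<pi> (density K (\<lambda>z. ennreal (h z))) = ereal (\<integral>z. ent z \<partial>K)"
  "action e T \<sigma> \<pi> (time_reversal (density K (\<lambda>z. ennreal (h z)))) = ereal ((\<integral>z. ent z \<partial>K)
     - ((\<integral>v. f T v * ln (f T v) \<partial>lborel) - (\<integral>v. f 0 v * ln (f 0 v) \<partial>lborel)))"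
proof -
  show "action e T \<sigma> \<pi> (density K (\<lambda>z. ennreal (h z))) = ereal (\<integral>z. ent z \<partial>K)"
    unfolding action_density[OF h_meas h_nonneg] ent_def[symmetric] by (rule enn2ereal_nn_integral[OF ent_integrable ent_nonneg])
  have m: "(\<lambda>z. indicator {0<..T} (fst z) * (h z * log_ratio f z)) \<in> borel_measurable K" by (rule measurable_K) measurable
  have m': "(\<lambda>z. h z * log_ratio f z) \<in> borel_measurable K" by (rule measurable_K) measurable
  have "(\<integral>v. f T v * ln (f T v) \<partial>lborel) - (\<integral>v. f 0 v * ln (f 0 v) \<partial>lborel) = (\<integral>z. h z * log_ratio f z \<partial>K)"
    unfolding chain_rule[OF fl order_refl less_imp_le[OF T] order_refl]
  proof (rule integral_cong_AE[OF m m'])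
    show "AE z in K. indicator {0<..T} (fst z) * (h z * log_ratio f z) = h z * log_ratio f z"
      using AE_interior[OF fl] by eventually_elim simp
  qed
  moreover have "action e T \<sigma> \<pi> (density K (\<lambda>z. ennreal (ratio h z))) = ereal (\<integral>z. ratio h z * ln (ratio h z) - ratio h z + 1 \<partial>K)"
    unfolding action_density[OF ratio_measurable[OF h_meas] ratio_nonneg[OF h_nonneg]]
    by (rule enn2ereal_nn_integral[OF ratio_ent(1)[OF fl] theta_nonneg[OF ratio_nonneg[OF h_nonneg]]])
  ultimately show "action e T \<sigma> \<pi> (time_reversal (density K (\<lambda>z. ennreal (h z)))) = ereal ((\<integral>z. ent z \<partial>K)
     - ((\<integral>v. f T v * ln (f T v) \<partial>lborel) - (\<integral>v. f 0 v * ln (f 0 v) \<partial>lborel)))"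
    unfolding time_reversal_density[OF h_meas h_nonneg pos_out[OF fl]] ratio_ent(2)[OF fl] by simp
qed

text \<open>By the chain rule the entropy is a constant plus the integral over {..t} of a fixed
  integrable function, and single times carry no mass.\<close>

lemma entropy_continuous: "continuous_on {0..T} (\<lambda>t. \<integral>v. f t v * ln (f t v) \<partial>lborel)"
proof -
  have m: "(\<lambda>z. indicator A (fst z) * (h z * log_ratio f z)) \<in> borel_measurable K" if [measurable]: "A \<in> sets borel" for A :: "real set"
    by (rule measurable_K) measurable
  have "(\<integral>v. f t v * ln (f t v) \<partial>lborel) = (\<integral>v. f 0 v * ln (f 0 v) \<partial>lborel) + (\<integral>z. indicator {..t} (fst z) * (h z * log_ratio f z) \<partial>K)"
    if t: "t \<in> {0..T}" for t
  proof -
    have "(\<integral>z. indicator {0<..t} (fst z) * (h z * log_ratio f z) \<partial>K) = (\<integral>z. indicator {..t} (fst z) * (h z * log_ratio f z) \<partial>K)"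
    proof (rule integral_cong_AE[OF m m])
      show "AE z in K. indicator {0<..t} (fst z) * (h z * log_ratio f z) = indicator {..t} (fst z) * (h z * log_ratio f z)"
        using AE_interior[OF fl] by eventually_elim (simp add: indicator_def)
    qed auto
    then show ?thesis using chain_rule[OF fl, of 0 t] t by simp
  qed
  note eq = this
  have "continuous_on {0..T} (\<lambda>t. (\<integral>v. f 0 v * ln (f 0 v) \<partial>lborel) + (\<integral>z. indicator {..t} (fst z) * (h z * log_ratio f z) \<partial>K))"
    by (intro continuous_intros continuous_on_integral_atMost h_log_ratio_integrable[OF fl] AE_K_time measurable_K) measurable
  then show ?thesis by (rule continuous_on_eq) (rule eq[symmetric])
qed

end

end

theorem proposition3p1:
  fixes e T :: real
    and \<sigma> :: "(real^'n) measure"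
    and \<pi> :: "real \<Rightarrow> (real^'n) measure"
    and Q :: "'n collision measure"
  assumes "CARD('n) \<ge> 2" and "e > 0" and "T > 0"
    and "haar_sphere \<sigma>"
    and "(\<pi>, Q) \<in> balance_pairs e T"
  shows
    "let L = entropy_rel e (\<pi> 0) + action e T \<sigma> \<pi> Q;
         R = entropy_rel e (\<pi> T) + action e T \<sigma> \<pi> (time_reversal Q)
     in \<bar>L\<bar> \<noteq> \<infinity> \<or> \<bar>R\<bar> \<noteq> \<infinity> \<longrightarrow>
        \<bar>L\<bar> \<noteq> \<infinity> \<and> \<bar>R\<bar> \<noteq> \<infinity> \<and> L = R \<and>
        (\<forall>t\<in>{0..T}. \<exists>g\<in>borel_measurable lborel. density lborel g = \<pi> t) \<and>
        (\<exists>f. densities_of_path T \<pi> f) \<and>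
        (\<forall>f. densities_of_path T \<pi> f \<longrightarrow>
           log_ratio_integrable f Q \<and>
           (\<forall>r s. 0 \<le> r \<and> r \<le> s \<and> s \<le> T \<longrightarrow>
              entropy_rel e (density lborel (\<lambda>v. ennreal (f s v)))
              - entropy_rel e (density lborel (\<lambda>v. ennreal (f r v)))
              = ereal (\<integral>z. indicator {r..s} (fst z) * log_ratio f z \<partial>Q))) \<and>
        (\<forall>t\<in>{0..T}. \<bar>entropy_rel e (\<pi> t)\<bar> \<noteq> \<infinity>) \<and>
        continuous_on {0..T} (\<lambda>t. entropy_rel e (\<pi> t))"
proof (unfold Let_def, rule impI, goal_cases)
  case LR: 1
  let ?L = "entropy_rel e (\<pi> 0) + action e T \<sigma> \<pi> Q"
  let ?R = "entropy_rel e (\<pi> T) + action e T \<sigma> \<pi> (time_reversal Q)"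
  have Q: "sets Q = sets (collision_space T :: 'n collision measure)" "finite_measure Q"
    and bal: "\<And>\<phi> D. C1b_with_derivative T \<phi> D \<Longrightarrow>
        (\<integral>v. \<phi> (T, v) \<partial>\<pi> T) - (\<integral>v. \<phi> (0, v) \<partial>\<pi> 0)
        - (LINT t:{0..T}|lborel. (\<integral>v. D (t, v) (1, 0) \<partial>\<pi> t))
        - (\<integral>(t, z). collision_gradient (\<lambda>v. \<phi> (t, v)) z \<partial>Q) = 0"
    using assms(5) by (auto simp: balance_pairs_def flux_measures_def)
  \<comment> \<open>For a discontinuous path both actions are infinite by definition, so neither
    side would be finite.\<close>
  have "\<pi> \<in> continuous_paths e T"
  proof (rule ccontr)
    assume "\<not> ?thesis"
    then have "?L = \<infinity>" "?R = \<infinity>" by (simp_all add: action_def)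
    then have "\<bar>?L\<bar> = \<infinity>" "\<bar>?R\<bar> = \<infinity>" by (metis abs_ereal.simps(3))+
    then show False using LR by metis
  qed
  then interpret vpath e T \<sigma> \<pi> by unfold_locales (use assms in auto)
  have T0: "0 \<in> {0..T}" "T \<in> {0..T}" using T by auto
  have QK: "sets Q = sets K" using Q(1) by (simp add: collision_space_def)
  \<comment> \<open>Everything is reduced to finiteness on the left; a finite right-hand side is
    carried over by \<open>forward_finite\<close>.\<close>
  have HJ: "\<bar>entropy_rel e (\<pi> 0)\<bar> \<noteq> \<infinity>" "\<bar>action e T \<sigma> \<pi> Q\<bar> \<noteq> \<infinity>"
  proof -
    have "\<bar>entropy_rel e (\<pi> 0)\<bar> \<noteq> \<infinity> \<and> \<bar>action e T \<sigma> \<pi> Q\<bar> \<noteq> \<infinity>"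
    proof (cases "\<bar>?L\<bar> = \<infinity>")
      case False
      then show ?thesis using entropy_plus_action_finite_iff[OF T0(1)] by simp
    next
      case True
      then have "\<bar>?R\<bar> \<noteq> \<infinity>" using LR by metis
      then have RT: "\<bar>entropy_rel e (\<pi> T)\<bar> \<noteq> \<infinity>" "\<bar>action e T \<sigma> \<pi> (time_reversal Q)\<bar> \<noteq> \<infinity>"
        using entropy_plus_action_finite_iff[OF T0(2)] by simp_all
      have "\<bar>entropy_rel e (\<pi> 0)\<bar> \<noteq> \<infinity>" by (rule forward_finite(1)[OF QK Q(2) _ RT]) (rule bal)
      moreover have "\<bar>action e T \<sigma> \<pi> Q\<bar> \<noteq> \<infinity>" by (rule forward_finite(2)[OF QK Q(2) _ RT]) (rule bal)
      ultimately show ?thesis ..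
    qed
    then show "\<bar>entropy_rel e (\<pi> 0)\<bar> \<noteq> \<infinity>" "\<bar>action e T \<sigma> \<pi> Q\<bar> \<noteq> \<infinity>" by auto
  qed
  obtain h where h: "h \<in> borel_measurable borel" "\<And>z. h z \<ge> 0" and Qh: "Q = density K (\<lambda>z. ennreal (h z))"
    and fin: "(\<integral>\<^sup>+z. ennreal (h z * ln (h z) - h z + 1) \<partial>K) < \<infinity>"
    using action_finite[OF HJ(2) Q(2) QK] by blast
  interpret flow e T \<sigma> \<pi> h
    by (rule flow_of_balance(1)[OF QK Q(2) AE_density_K_time[OF Qh h(1)] _ h fin Qh]) (rule bal)
  obtain g where g: "g \<in> borel_measurable borel" "\<And>v. 0 \<le> g v" "\<pi> 0 = density lborel (\<lambda>v. ennreal (g v))" "integrable lborel (\<lambda>v. g v * ln (g v))"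
    using entropy_rel_finite[OF T0(1) HJ(1)] by blast
  have "ker 0 = density lborel (\<lambda>v. ennreal (g v))" using g(3) T0 by (simp add: ker_def)
  from flow_dens_exists[OF g(2,1) this g(4)] obtain k where k: "flow_dens e T \<sigma> \<pi> h k" by blast
  obtain c where c: "\<And>t g. t \<in> {0..T} \<Longrightarrow> (\<forall>v. 0 \<le> g v) \<Longrightarrow> g \<in> borel_measurable borel \<Longrightarrow> \<pi> t = density lborel (\<lambda>v. ennreal (g v)) \<Longrightarrow>
     entropy_rel e (\<pi> t) = (if integrable lborel (\<lambda>v. g v * ln (g v)) then ereal ((\<integral>v. g v * ln (g v) \<partial>lborel) + c) else \<infinity>)"
    using entropy_rel_eq by blast
  have fl: "integrable lborel (\<lambda>v. f 0 v * ln (f 0 v))" and ent: "\<And>t. t \<in> {0..T} \<Longrightarrow> entropy_rel e (\<pi> t) = ereal ((\<integral>v. f t v * ln (f t v) \<partial>lborel) + c)"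
    if "flow_dens e T \<sigma> \<pi> h f" for f
  proof -
    interpret F: flow_dens e T \<sigma> \<pi> h f by (rule that)
    have fm: "f t \<in> borel_measurable borel" for t by measurable
    show f0: "integrable lborel (\<lambda>v. f 0 v * ln (f 0 v))"
      using c[of 0 "f 0"] F.f_dens[of 0] F.f_nonneg fm[of 0] T0 HJ(1) by (simp split: if_splits)
    show "entropy_rel e (\<pi> t) = ereal ((\<integral>v. f t v * ln (f t v) \<partial>lborel) + c)" if "t \<in> {0..T}" for t
      using c[OF that _ fm F.f_dens[OF that]] F.f_nonneg F.entropy_integrable[OF f0 that] by simp
  qed
  interpret D: flow_dens e T \<sigma> \<pi> h k by (rule k)
  note kl = fl[OF k] and ke = ent[OF k]
  have eq: "?L = ?R" "\<bar>?R\<bar> \<noteq> \<infinity>"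
    using D.action_balance[OF kl] ke[OF T0(1)] ke[OF T0(2)] by (simp_all add: Qh)
  have dens: "\<exists>g\<in>borel_measurable lborel. density lborel g = \<pi> t" if "t \<in> {0..T}" for t
  proof -
    have "k t \<in> borel_measurable borel" by measurable
    then show ?thesis using D.f_dens[OF that] by (intro bexI[of _ "\<lambda>v. ennreal (k t v)"]) auto
  qed
  have chain: "log_ratio_integrable f Q"
    "\<And>r s. 0 \<le> r \<Longrightarrow> r \<le> s \<Longrightarrow> s \<le> T \<Longrightarrow> entropy_rel e (density lborel (\<lambda>v. ennreal (f s v)))
            - entropy_rel e (density lborel (\<lambda>v. ennreal (f r v)))
            = ereal (\<integral>z. indicator {r..s} (fst z) * log_ratio f z \<partial>Q)"
    if f: "densities_of_path T \<pi> f" for f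
  proof -
    \<comment> \<open>The given densities are arbitrary outside {0..T}. They are cut off to fit the
      locale and are unchanged at all times that \<open>Q\<close> charges.\<close>
    define f' where "f' t v = (if t \<in> {0..T} then f t v else 0)" for t v
    interpret V: vpath_dens e T \<sigma> \<pi> f' unfolding f'_def using extend_densities[OF f] .
    have fd: "flow_dens e T \<sigma> \<pi> h f'" by (intro flow_dens.intro flow_axioms V.vpath_dens_axioms)
    interpret F: flow_dens e T \<sigma> \<pi> h f' by (rule fd)
    have lr: "log_ratio f z = log_ratio f' z" if "z \<in> space Q" for z
      using that by (auto simp: Qh log_ratio_def f'_def)
    have sp: "AE z in Q. fst z \<in> {0..T}" using AE_space by eventually_elim (auto simp: Qh)
    have a: "AE (t, (v, w), (v', w')) in Q. 0 < f' t v * f' t w \<and> 0 < f' t v' * f' t w'" and i: "integrable Q (log_ratio f')"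
      using F.log_ratio_integrable_density[OF fl[OF fd]] unfolding log_ratio_integrable_def Qh[symmetric] by blast+
    from sp a have "AE (t, (v, w), (v', w')) in Q. 0 < f t v * f t w \<and> 0 < f t v' * f t w'"
      by eventually_elim (auto simp: f'_def)
    moreover have "integrable Q (log_ratio f)" using i Bochner_Integration.integrable_cong[where M = Q and N = Q and f = "log_ratio f" and g = "log_ratio f'"] lr by simp
    ultimately show "log_ratio_integrable f Q" by (simp add: log_ratio_integrable_def)
    fix r s assume rs: "0 \<le> r" "r \<le> s" "s \<le> T"
    have d: "density lborel (\<lambda>v. ennreal (f t v)) = \<pi> t" if "t \<in> {0..T}" for t
      using f that by (simp add: densities_of_path_def)
    have "(\<integral>z. indicator {r..s} (fst z) * log_ratio f z \<partial>Q) = (\<integral>z. indicator {r..s} (fst z) * log_ratio f' z \<partial>Q)"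
      by (intro Bochner_Integration.integral_cong refl) (simp add: lr)
    also have "\<dots> = (\<integral>v. f' s v * ln (f' s v) \<partial>lborel) - (\<integral>v. f' r v * ln (f' r v) \<partial>lborel)"
      using F.integral_log_ratio[OF fl[OF fd] rs] by (simp add: Qh)
    finally show "entropy_rel e (density lborel (\<lambda>v. ennreal (f s v))) - entropy_rel e (density lborel (\<lambda>v. ennreal (f r v)))
            = ereal (\<integral>z. indicator {r..s} (fst z) * log_ratio f z \<partial>Q)"
      using rs d[of r] d[of s] ent[OF fd, of r] ent[OF fd, of s] by simp
  qed
  have "continuous_on {0..T} (\<lambda>t. ereal ((\<integral>v. k t v * ln (k t v) \<partial>lborel) + c))"
    by (intro continuous_on_ereal continuous_intros D.entropy_continuous[OF kl])
  then have "continuous_on {0..T} (\<lambda>t. entropy_rel e (\<pi> t))"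
    by (rule continuous_on_eq) (simp add: ke)
  moreover have "\<forall>t\<in>{0..T}. \<bar>entropy_rel e (\<pi> t)\<bar> \<noteq> \<infinity>" using ke by simp
  moreover have "\<bar>?L\<bar> \<noteq> \<infinity>" using eq by simp
  ultimately show ?case using eq dens chain D.densities by blast
qed

end
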